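(* Let $\alpha,\beta\in\mathbb{R}$. Suppose there exists a function $v\colon [0,T]\times \mathbb{R}^n\to \mathbb{R}$ that is continuously differentiable in $t$ and twice continuously differentiable in $x$, satisfying $$\begin{cases}\mathcal{L}v(t,x)\leq \alpha v(t,x)+\beta, & \forall x\in \mathcal{X}\setminus \mathcal{X}_s,\ \forall t \in [0,T],\\ \frac{\partial v(t,x)}{\partial t}\leq \alpha v(t,x)+\beta, & \forall x\in \partial \mathcal{X}\cup \partial \mathcal{X}_s,\ \forall t\in [0,T],\\ v(T,x)\geq 1_{\partial \mathcal{X}_s}(x), & \forall x\in \overline{\mathcal{X}\setminus \mathcal{X}_s}.\end{cases}$$ Then, for every $x_0\in \mathcal{X}\setminus \mathcal{X}_s$, $$\mathbb{P}_{x_0}^{[0,T]}\leq \begin{cases} v(0,x_0)+\beta T, & \text{if } \alpha=0,\\ e^{\alpha T}v(0,x_0)+\frac{\beta}{\alpha}(e^{\alpha T}-1), & \text{if } \alpha\neq 0.\end{cases}$$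
   Context: Let $b\colon\mathbb{R}^n\to\mathbb{R}^n$ and $\sigma\colon\mathbb{R}^n\to\mathbb{R}^{n\times k}$ be locally Lipschitz continuous, and let $W$ be a standard $k$-dimensional Wiener process on a probability space $(\Omega,\mathbb{P})$. For $x_0\in\mathbb{R}^n$, the SDE $dX=b(X)\,dt+\sigma(X)\,dW$ with initial state $x_0$ has a unique maximal local strong solution $X_{x_0}^{w}(t)$, $t\in[0,T^{x_0}(w))$, with continuous sample paths, where $T^{x_0}(w)\in(0,\infty]$. Let $\mathcal{X}\subseteq\mathbb{R}^n$ be open and bounded, $\mathcal{X}_s\subseteq\mathcal{X}$ a closed set, and $0<T<\infty$. An overline denotes closure, $\partial$ denotes topological boundary, and $1_A$ is the indicator function of $A$. For $x_0\in\mathcal{X}\setminus\mathcal{X}_s$ define $$\mathbb{P}_{x_0}^{[0,T]}:=\mathbb{P}\big(\{w\in\Omega \mid \exists t\in[0,T].\ X_{x_0}^{w}(t)\in\mathcal{X}_s\ \wedge\ \forall\tau\in[0,t).\ X_{x_0}^{w}(\tau)\in\mathcal{X}\}\big),$$ where the path is required to be defined at the times involved. For a function $v(t,x)$ that is continuously differentiable in $t$ and twice continuously differentiable in $x$ (class $C^{1,2}$), $$\mathcal{L}v(t,x)=\frac{\partial v(t,x)}{\partial t}+\frac{\partial v(t,x)}{\partial x}b(x)+\frac12\mathrm{tr}\Big(\sigma(x)^{\top}\frac{\partial^2 v(t,x)}{\partial x^2}\sigma(x)\Big).$$ *)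

theory Defs
  imports "HOL-Probability.Probability"
begin

section \<open>Wiener processes\<close>

definition natural_filtration ::
    "'a measure \<Rightarrow> (real \<Rightarrow> 'a \<Rightarrow> 'b::topological_space) \<Rightarrow> real \<Rightarrow> 'a measure" where
  "natural_filtration M W t =
     sigma (space M) {W s -` B \<inter> space M | s B. 0 \<le> s \<and> s \<le> t \<and> B \<in> sets borel}"

text \<open>
  The filtration to which strong solutions are adapted. The measure space need not be complete;
  only the null sets that are events are adjoined.
\<close>

definition augmented_filtration ::
    "'a measure \<Rightarrow> (real \<Rightarrow> 'a \<Rightarrow> 'b::topological_space) \<Rightarrow> real \<Rightarrow> 'a measure" where
  "augmented_filtration M W t =
     sigma (space M) (sets (natural_filtration M W t) \<union> null_sets M)"

text \<open>
  The product density below is that of the centred normal law with covariance matrix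
  \<open>(t - s)\<close> times the identity.
\<close>

definition wiener_process :: "'a measure \<Rightarrow> (real \<Rightarrow> 'a \<Rightarrow> real ^ 'k) \<Rightarrow> bool" where
  "wiener_process M W \<longleftrightarrow>
     prob_space M \<and>
     (\<forall>t\<ge>0. W t \<in> borel_measurable M) \<and>
     (AE w in M. W 0 w = 0) \<and>
     (AE w in M. continuous_on {0..} (\<lambda>t. W t w)) \<and>
     (\<forall>s t. 0 \<le> s \<longrightarrow> s < t \<longrightarrow>
        distributed M lborel (\<lambda>w. W t w - W s w)
          (\<lambda>x. ennreal (\<Prod>i\<in>UNIV. normal_density 0 (sqrt (t - s)) (x $ i))) \<and>
        prob_space.indep_set M
          (sets (natural_filtration M W s))
          {(\<lambda>w. W t w - W s w) -` B \<inter> space M | B. B \<in> sets borel})"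


section \<open>The Ito integral\<close>

text \<open>
  Convergence to 0 in probability. The value \<open>measure\<close> of a set that is not an event is 0, so this
  is meant for measurable \<open>Z n\<close> only.
\<close>

definition null_in_prob :: "'a measure \<Rightarrow> (nat \<Rightarrow> 'a \<Rightarrow> ennreal) \<Rightarrow> bool" where
  "null_in_prob M Z \<longleftrightarrow>
     (\<forall>\<epsilon>>0. (\<lambda>n. measure M {w \<in> space M. \<epsilon> < Z n w}) \<longlonglongrightarrow> 0)"

definition progressively_measurable ::
    "(real \<Rightarrow> 'a measure) \<Rightarrow> (real \<Rightarrow> 'a \<Rightarrow> 'b::topological_space) \<Rightarrow> bool" where
  "progressively_measurable F H \<longleftrightarrow>
     (\<forall>t\<ge>0. (\<lambda>(s, w). H s w) \<in> borel_measurable (restrict_space borel {0..t} \<Otimes>\<^sub>M F t))"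

text \<open>
  A simple process with value \<open>\<xi> i\<close> on the time interval from \<open>p i\<close> (excluded) to \<open>p (Suc i)\<close>
  (included), for \<open>i < m\<close>.
\<close>

definition simple_process ::
    "(real \<Rightarrow> 'a measure) \<Rightarrow> nat \<Rightarrow> (nat \<Rightarrow> real) \<Rightarrow> (nat \<Rightarrow> 'a \<Rightarrow> 'b::real_normed_vector) \<Rightarrow> bool" where
  "simple_process F m p \<xi> \<longleftrightarrow>
     0 \<le> p 0 \<and> (\<forall>i<m. p i < p (Suc i)) \<and>
     (\<forall>i<m. \<xi> i \<in> borel_measurable (F (p i)) \<and> bounded (\<xi> i ` space (F (p i))))"

definition simple_value ::
    "nat \<Rightarrow> (nat \<Rightarrow> real) \<Rightarrow> (nat \<Rightarrow> 'a \<Rightarrow> 'b::real_vector) \<Rightarrow> real \<Rightarrow> 'a \<Rightarrow> 'b" where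
  "simple_value m p \<xi> s w = (\<Sum>i<m. indicator {p i<..p (Suc i)} s *\<^sub>R \<xi> i w)"

definition simple_integral ::
    "(real \<Rightarrow> 'a \<Rightarrow> real ^ 'k) \<Rightarrow> nat \<Rightarrow> (nat \<Rightarrow> real) \<Rightarrow> (nat \<Rightarrow> 'a \<Rightarrow> real ^ 'k ^ 'n) \<Rightarrow>
     real \<Rightarrow> 'a \<Rightarrow> real ^ 'n" where
  "simple_integral W m p \<xi> t w =
     (\<Sum>i<m. \<xi> i w *v (W (min t (p (Suc i))) w - W (min t (p i)) w))"

text \<open>
  \<open>I\<close> is a version, with almost surely continuous paths, of the Ito integral process
  \<open>t \<mapsto> \<integral>\<^sub>0\<^sup>t H dW\<close>, for a progressively measurable and almost surely locally
  square integrable integrand \<open>H\<close>; this integrability is implied by the approximation property.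
\<close>

definition has_ito_integral ::
    "'a measure \<Rightarrow> (real \<Rightarrow> 'a measure) \<Rightarrow> (real \<Rightarrow> 'a \<Rightarrow> real ^ 'k) \<Rightarrow>
     (real \<Rightarrow> 'a \<Rightarrow> real ^ 'k ^ 'n) \<Rightarrow> (real \<Rightarrow> 'a \<Rightarrow> real ^ 'n) \<Rightarrow> bool" where
  "has_ito_integral M F W H I \<longleftrightarrow>
     progressively_measurable F H \<and>
     (\<forall>t\<ge>0. I t \<in> borel_measurable (F t)) \<and>
     (AE w in M. continuous_on {0..} (\<lambda>t. I t w)) \<and>
     (\<exists>m p \<xi>.
        (\<forall>n. simple_process F (m n) (p n) (\<xi> n)) \<and>
        (\<forall>t\<ge>0.
           null_in_prob M (\<lambda>n w. \<integral>\<^sup>+ s\<in>{0..t}.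
             ennreal ((norm (simple_value (m n) (p n) (\<xi> n) s w - H s w))\<^sup>2) \<partial>lborel) \<and>
           null_in_prob M (\<lambda>n w.
             ennreal (norm (simple_integral W (m n) (p n) (\<xi> n) t w - I t w)))))"


section \<open>Stochastic differential equations\<close>

text \<open>
  A local strong solution \<open>X\<close> of \<open>dX = b(X) dt + \<sigma>(X) dW\<close> with initial state \<open>x0\<close> and lifetime
  \<open>\<zeta>\<close>. The values of \<open>X\<close> from time \<open>\<zeta>\<close> on are irrelevant. The lifetime is announced by the finite
  stopping times \<open>\<theta> k\<close>, and the equation is required up to each of them; at time 0 it says that
  \<open>X\<close> starts in \<open>x0\<close>.
\<close>

definition local_strong_solution ::
    "'a measure \<Rightarrow> (real \<Rightarrow> 'a \<Rightarrow> real ^ 'k) \<Rightarrow> (real ^ 'n \<Rightarrow> real ^ 'n) \<Rightarrow> (real ^ 'n \<Rightarrow> real ^ 'k ^ 'n) \<Rightarrow>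
     real ^ 'n \<Rightarrow> (real \<Rightarrow> 'a \<Rightarrow> real ^ 'n) \<Rightarrow> ('a \<Rightarrow> ereal) \<Rightarrow> bool" where
  "local_strong_solution M W b \<sigma> x0 X \<zeta> \<longleftrightarrow>
     (\<forall>w\<in>space M. 0 < \<zeta> w \<and> continuous_on {t. 0 \<le> t \<and> ereal t < \<zeta> w} (\<lambda>t. X t w)) \<and>
     (\<forall>t\<ge>0. X t \<in> borel_measurable
        (restrict_space (augmented_filtration M W t) {w. ereal t < \<zeta> w})) \<and>
     (\<exists>\<theta> :: nat \<Rightarrow> 'a \<Rightarrow> real.
        (\<forall>k. stopping_time (augmented_filtration M W) (\<theta> k)) \<and>
        (\<forall>w\<in>space M. incseq (\<lambda>k. \<theta> k w) \<and> (\<forall>k. 0 \<le> \<theta> k w \<and> ereal (\<theta> k w) < \<zeta> w) \<and>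
           (\<lambda>k. ereal (\<theta> k w)) \<longlonglongrightarrow> \<zeta> w) \<and>
        (\<forall>k. \<exists>I.
           has_ito_integral M (augmented_filtration M W) W
             (\<lambda>s w. if s \<le> \<theta> k w then \<sigma> (X s w) else 0) I \<and>
           (AE w in M. \<forall>t\<ge>0.
              X (min t (\<theta> k w)) w =
                x0 + integral {0..min t (\<theta> k w)} (\<lambda>s. b (X s w)) + I t w)))"

text \<open>
  Maximal local solutions in the sense of Mao, Stochastic Differential Equations and
  Applications, Definition 2.3.14: the lifetime is the explosion time.
\<close>

definition maximal_local_strong_solution ::
    "'a measure \<Rightarrow> (real \<Rightarrow> 'a \<Rightarrow> real ^ 'k) \<Rightarrow> (real ^ 'n \<Rightarrow> real ^ 'n) \<Rightarrow> (real ^ 'n \<Rightarrow> real ^ 'k ^ 'n) \<Rightarrow>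
     real ^ 'n \<Rightarrow> (real \<Rightarrow> 'a \<Rightarrow> real ^ 'n) \<Rightarrow> ('a \<Rightarrow> ereal) \<Rightarrow> bool" where
  "maximal_local_strong_solution M W b \<sigma> x0 X \<zeta> \<longleftrightarrow>
     local_strong_solution M W b \<sigma> x0 X \<zeta> \<and>
     (AE w in M. \<zeta> w < \<infinity> \<longrightarrow>
        Limsup (at_left (real_of_ereal (\<zeta> w))) (\<lambda>t. ereal (norm (X t w))) = \<infinity>)"

definition reach_avoid_prob ::
    "'a measure \<Rightarrow> (real \<Rightarrow> 'a \<Rightarrow> real ^ 'n) \<Rightarrow> ('a \<Rightarrow> ereal) \<Rightarrow>
     (real ^ 'n) set \<Rightarrow> (real ^ 'n) set \<Rightarrow> real \<Rightarrow> real" where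
  "reach_avoid_prob M X \<zeta> D D\<^sub>s T =
     measure M {w \<in> space M.
       \<exists>t\<in>{0..T}. ereal t < \<zeta> w \<and> X t w \<in> D\<^sub>s \<and> (\<forall>\<tau>\<in>{0..<t}. X \<tau> w \<in> D)}"


section \<open>The generator\<close>

text \<open>
  \<open>v\<close> is of class \<open>C\<^sup>1\<^sup>,\<^sup>2\<close> on \<open>{0..T} \<times> UNIV\<close> with time derivative \<open>vt\<close> (one-sided at the end
  points), spatial gradient \<open>vx\<close> and spatial Hessian \<open>vxx\<close>; these are uniquely determined there
  when \<open>0 < T\<close>.
\<close>

definition C12_on ::
    "real \<Rightarrow> (real \<Rightarrow> real ^ 'n \<Rightarrow> real) \<Rightarrow> (real \<Rightarrow> real ^ 'n \<Rightarrow> real) \<Rightarrow>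
     (real \<Rightarrow> real ^ 'n \<Rightarrow> real ^ 'n) \<Rightarrow> (real \<Rightarrow> real ^ 'n \<Rightarrow> real ^ 'n ^ 'n) \<Rightarrow> bool" where
  "C12_on T v vt vx vxx \<longleftrightarrow>
     (\<forall>t\<in>{0..T}. \<forall>x.
        ((\<lambda>s. v s x) has_real_derivative vt t x) (at t within {0..T}) \<and>
        (v t has_derivative (\<lambda>h. vx t x \<bullet> h)) (at x) \<and>
        (vx t has_derivative (\<lambda>h. vxx t x *v h)) (at x)) \<and>
     continuous_on ({0..T} \<times> UNIV) (\<lambda>(t, x). v t x) \<and>
     continuous_on ({0..T} \<times> UNIV) (\<lambda>(t, x). vt t x) \<and>
     continuous_on ({0..T} \<times> UNIV) (\<lambda>(t, x). vx t x) \<and>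
     continuous_on ({0..T} \<times> UNIV) (\<lambda>(t, x). vxx t x)"

definition generator ::
    "(real ^ 'n \<Rightarrow> real ^ 'n) \<Rightarrow> (real ^ 'n \<Rightarrow> real ^ 'k ^ 'n) \<Rightarrow> (real \<Rightarrow> real ^ 'n \<Rightarrow> real) \<Rightarrow>
     (real \<Rightarrow> real ^ 'n \<Rightarrow> real ^ 'n) \<Rightarrow> (real \<Rightarrow> real ^ 'n \<Rightarrow> real ^ 'n ^ 'n) \<Rightarrow>
     real \<Rightarrow> real ^ 'n \<Rightarrow> real" where
  "generator b \<sigma> vt vx vxx t x =
     vt t x + vx t x \<bullet> b x + 1 / 2 * trace (transpose (\<sigma> x) ** vxx t x ** \<sigma> x)"

end

(*
  With phi(s) the integral of exp(alpha r) over r from 0 to s, the function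
  V(t,x) = exp(alpha (T - t)) v(t,x) + beta phi(T - t) reduces the hypotheses to alpha = beta = 0.
  Let U = D - Ds and let Z be the solution stopped at its exit from U (or at T, or at an announcing
  time theta_k of the lifetime). Off U the stopped process only moves in time, and there dV/dt <= 0;
  in U the generator of V is nonpositive. Dynkin's formula therefore gives E V(T,Z_T) <= V(0,x0), up to
  a multiple of the probability that theta_k comes before T and before the exit. Since V(T,.) dominates
  the indicator of the boundary of Ds, through which every path that reaches Ds inside D must pass,
  this bounds the reach-avoid probability. The error vanishes as k tends to infinity: a path that
  stays in the bounded set U cannot explode.

  Dynkin's formula needs only second order Taylor expansions over short time steps and three moment
  identities for increments of the bounded stopped stochastic integral Y, namely E[a . dY] = 0,
  E[dY . Q dY] = E int (H . Q H) du and E |dY|^4 = O(dt^2) for a, Q known at the start of the step.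
  These hold for bounded simple integrands, which approximate the stopped one in probability; the
  fourth moment bound turns this into convergence of second moments.
*)

theory Submission
  imports Defs
begin

section \<open>Increments of the Wiener process\<close>

text \<open>The definition of the Ito integral offers only simple processes that converge in
  probability: they need not respect the bound of the stopped integrand, nor the stopping time, and
  their integrals come without moments. Hence three repairs in \<open>approximation\<close>: the
  stopping time is rounded up to a grid, which keeps it non-anticipating; the values are projected
  onto the ball of radius K; and the integral of what the projection cuts off is handled by
  Lenglart's inequality, because only its square integral is small, and only in probability.

  Dynkin's formula is not summed over a partition. For every \<epsilon> a step of length h costs at
  most C \<epsilon> h + C(\<epsilon>) h^2, so the defect of the formula, as a function of time, has
  derivative zero.

  The error term arises because an announcing time may stop a path inside U, where the generator has
  a sign but the time derivative alone has none. Null sets are dealt with before the estimates: the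
  stopped process is redefined there, so that its bounds and its increment identity hold on every
  path.\<close>

lemma borel_measurable_vec_nth' [measurable (raw)]:
  fixes f :: "'a \<Rightarrow> 'b :: topological_space ^ 'n"
  assumes "f \<in> borel_measurable M"
  shows "(\<lambda>x. f x $ i) \<in> borel_measurable M"
  by (rule measurable_compose[OF assms borel_measurable_continuous_onI]) (intro continuous_intros)

section \<open>Natural and augmented filtrations\<close>

lemma space_natural_filtration [simp]: "space (natural_filtration M W t) = space M"
  unfolding natural_filtration_def by (rule space_measure_of) auto

lemma space_augmented_filtration [simp]: "space (augmented_filtration M W t) = space M"
  unfolding augmented_filtration_def
  by (rule space_measure_of)
     (use sets.sets_into_space[of _ M] sets.sets_into_space[of _ "natural_filtration M W t"] in auto)

lemma sets_natural_filtration: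
  "sets (natural_filtration M W t) =
     sigma_sets (space M) {W s -` B \<inter> space M | s B. 0 \<le> s \<and> s \<le> t \<and> B \<in> sets borel}"
  unfolding natural_filtration_def by (rule sets_measure_of) auto

lemma sets_augmented_filtration:
  "sets (augmented_filtration M W t) =
     sigma_sets (space M) (sets (natural_filtration M W t) \<union> null_sets M)"
  unfolding augmented_filtration_def
  by (rule sets_measure_of)
     (use sets.sets_into_space[of _ M] sets.sets_into_space[of _ "natural_filtration M W t"] in auto)

lemma sets_augmented_filtration_mono:
  assumes "s \<le> t"
  shows "sets (augmented_filtration M W s) \<subseteq> sets (augmented_filtration M W t)"
proof -
  have "sets (natural_filtration M W s) \<subseteq> sets (natural_filtration M W t)"
    unfolding sets_natural_filtration using assms by (intro sigma_sets_mono') force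
  then show ?thesis
    unfolding sets_augmented_filtration by (intro sigma_sets_mono') auto
qed

locale brownian =
  fixes M :: "'a measure" and W :: "real \<Rightarrow> 'a \<Rightarrow> real ^ 'k"
  assumes wiener: "wiener_process M W"

sublocale brownian \<subseteq> prob_space M
  using wiener by (simp add: wiener_process_def)

context brownian
begin

abbreviation "F \<equiv> augmented_filtration M W"

lemma W_measurable [measurable]: "0 \<le> t \<Longrightarrow> W t \<in> borel_measurable M"
  using wiener by (simp add: wiener_process_def)

lemma sets_natural_le: "sets (natural_filtration M W t) \<subseteq> sets M"
  unfolding sets_natural_filtration
  by (rule sets.sigma_sets_subset) (auto intro!: measurable_sets[OF W_measurable])

lemma sets_F_le: "sets (F t) \<subseteq> sets M"
  unfolding sets_augmented_filtration
  by (rule sets.sigma_sets_subset) (use sets_natural_le in auto)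

lemma F_measurable_M: "f \<in> measurable (F t) N \<Longrightarrow> f \<in> measurable M N"
  using sets_F_le[of t] by (auto simp: measurable_def)

lemma F_measurable_mono: "f \<in> measurable (F s) N \<Longrightarrow> s \<le> t \<Longrightarrow> f \<in> measurable (F t) N"
  using sets_augmented_filtration_mono[of s t M W] by (auto simp: measurable_def)

lemma W_measurable_F:
  assumes "0 \<le> s" "s \<le> t"
  shows "W s \<in> borel_measurable (F t)"
proof (rule measurableI)
  fix B :: "(real ^ 'k) set" assume "B \<in> sets borel"
  then have "W s -` B \<inter> space M \<in> sets (natural_filtration M W t)"
    unfolding sets_natural_filtration using assms by (intro sigma_sets.Basic) auto
  then show "W s -` B \<inter> space (F t) \<in> sets (F t)"
    unfolding sets_augmented_filtration by (auto intro: sigma_sets.Basic)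
qed auto

text \<open>The sets that agree almost surely with an event of the natural filtration form a
  sigma-algebra containing the null sets. The Wiener hypothesis gives independence from the natural
  filtration only; this carries it over to the augmented one, to which the solution is
  adapted.\<close>

lemma F_event_natural:
  assumes "A \<in> sets (F t)"
  shows "\<exists>A' \<in> sets (natural_filtration M W t). AE w in M. w \<in> A \<longleftrightarrow> w \<in> A'"
  using assms unfolding sets_augmented_filtration
proof (induction rule: sigma_sets.induct)
  case (Basic a)
  then show ?case
  proof
    assume "a \<in> null_sets M"
    then have "AE w in M. w \<in> a \<longleftrightarrow> w \<in> {}"
      using AE_not_in by auto
    then show ?thesis by (metis sets.empty_sets)
  qed auto
next
  case Empty
  then show ?case by (intro bexI[of _ "{}"]) auto
next
  case (Compl a)
  then obtain A' where A': "A' \<in> sets (natural_filtration M W t)" "AE w in M. w \<in> a \<longleftrightarrow> w \<in> A'"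
    by auto
  have "space M - A' \<in> sets (natural_filtration M W t)"
    using sets.compl_sets[OF A'(1)] by simp
  moreover have "AE w in M. w \<in> space M - a \<longleftrightarrow> w \<in> space M - A'"
    using A'(2) by auto
  ultimately show ?case by blast
next
  case (Union a)
  then obtain A' where A': "\<And>i. A' i \<in> sets (natural_filtration M W t)"
      "\<And>i. AE w in M. w \<in> a i \<longleftrightarrow> w \<in> A' i"
    by metis
  have "AE w in M. \<forall>i::nat. w \<in> a i \<longleftrightarrow> w \<in> A' i"
    using A'(2) by (simp add: AE_all_countable)
  then have "AE w in M. w \<in> (\<Union>i. a i) \<longleftrightarrow> w \<in> (\<Union>i. A' i)" by auto
  then show ?case using A'(1) by (intro bexI[of _ "\<Union>i. A' i"]) auto
qed

section \<open>Independence of increments from the past\<close>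

lemma increment_indep_set:
  assumes "0 \<le> s" "s < t"
  shows "indep_set (sets (F s)) {(\<lambda>w. W t w - W s w) -` B \<inter> space M | B. B \<in> sets borel}"
proof (rule indep_setI)
  have ind: "indep_set (sets (natural_filtration M W s))
      {(\<lambda>w. W t w - W s w) -` B \<inter> space M | B. B \<in> sets borel}"
    using wiener assms by (simp add: wiener_process_def)
  show "sets (F s) \<subseteq> events" by (rule sets_F_le)
  show ev2: "{(\<lambda>w. W t w - W s w) -` B \<inter> space M |B. B \<in> sets borel} \<subseteq> events"
    by (rule indep_setD_ev2[OF ind])
  fix A C assume A: "A \<in> sets (F s)"
    and C: "C \<in> {(\<lambda>w. W t w - W s w) -` B \<inter> space M |B. B \<in> sets borel}"
  obtain A' where A': "A' \<in> sets (natural_filtration M W s)" "AE w in M. w \<in> A \<longleftrightarrow> w \<in> A'"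
    using F_event_natural[OF A] by auto
  have [measurable]: "A \<in> events" "A' \<in> events" "C \<in> events"
    using A A' C sets_F_le sets_natural_le ev2 by blast+
  have "prob (A \<inter> C) = prob (A' \<inter> C)"
    by (rule finite_measure_eq_AE) (use A'(2) in auto)
  moreover have "prob A = prob A'"
    by (rule finite_measure_eq_AE) (use A'(2) in auto)
  ultimately show "prob (A \<inter> C) = prob A * prob C"
    using indep_setD[OF ind A'(1) C] by simp
qed

lemma increment_indep_var:
  fixes f :: "'a \<Rightarrow> real" and g :: "real ^ 'k \<Rightarrow> real"
  assumes "0 \<le> s" "s < t" and f: "f \<in> borel_measurable (F s)" and g: "g \<in> borel_measurable borel"
  shows "indep_var borel f borel (\<lambda>w. g (W t w - W s w))"
proof -
  let ?Y = "\<lambda>w. W t w - W s w"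
  let ?B = "{?Y -` B \<inter> space M | B. B \<in> sets borel}"
  have [measurable]: "W t \<in> borel_measurable M" "W s \<in> borel_measurable M" using assms by auto
  \<comment> \<open>Independence extends from generating families to the generated sigma-algebras
    when the families are stable under intersection.\<close>
  have st: "Int_stable ?B"
    unfolding Int_stable_def
  proof safe
    fix B B' :: "(real ^ 'k) set" assume "B \<in> sets borel" "B' \<in> sets borel"
    then show "\<exists>C. ?Y -` B \<inter> space M \<inter> (?Y -` B' \<inter> space M) = ?Y -` C \<inter> space M \<and> C \<in> sets borel"
      by (intro exI[of _ "B \<inter> B'"]) auto
  qed
  have 0: "indep_set (sigma_sets (space M) (sets (F s))) (sigma_sets (space M) ?B)"
    by (rule indep_set_sigma_sets[OF increment_indep_set[OF assms(1,2)] sets.Int_stable st])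
  have 1: "sigma_sets (space M) {f -` A \<inter> space M |A. A \<in> sets borel} \<subseteq> sigma_sets (space M) (sets (F s))"
    using measurable_sets[OF f] by (intro sigma_sets_mono') auto
  have 2: "sigma_sets (space M) {(\<lambda>w. g (?Y w)) -` A \<inter> space M |A. A \<in> sets borel} \<subseteq> sigma_sets (space M) ?B"
  proof (intro sigma_sets_mono' subsetI)
    fix x assume "x \<in> {(\<lambda>w. g (?Y w)) -` A \<inter> space M |A. A \<in> sets borel}"
    then obtain A where A: "A \<in> sets borel" "x = (\<lambda>w. g (?Y w)) -` A \<inter> space M" by auto
    have "g -` A \<in> sets borel" using measurable_sets[OF g A(1)] by simp
    then show "x \<in> ?B" using A(2) by (intro CollectI exI[of _ "g -` A"]) auto
  qed
  have "indep_set (sigma_sets (space M) {f -` A \<inter> space M |A. A \<in> sets borel})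
     (sigma_sets (space M) {(\<lambda>w. g (?Y w)) -` A \<inter> space M |A. A \<in> sets borel})"
    using 0 1 2 unfolding indep_sets2_eq by blast
  then show ?thesis
    unfolding indep_var_eq using F_measurable_M[OF f] g by auto
qed

section \<open>Law and moments of the increments\<close>

text \<open>Tonelli over the coordinates: the standard basis consists of the axis vectors and the
  density is a product. An indicator in one coordinate yields the law of that coordinate, indicators
  in two coordinates their independence, with the factor 1 elsewhere.\<close>

lemma increment_nn_integral_prod:
  fixes g :: "'k \<Rightarrow> real \<Rightarrow> ennreal"
  assumes "0 \<le> s" "s < t" and g[measurable]: "\<And>i. g i \<in> borel_measurable borel"
  shows "(\<integral>\<^sup>+ w. (\<Prod>i\<in>UNIV. g i ((W t w - W s w) $ i)) \<partial>M) =
    (\<Prod>i\<in>UNIV. \<integral>\<^sup>+ x. ennreal (normal_density 0 (sqrt (t - s)) x) * g i x \<partial>lborel)"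
proof -
  let ?d = "normal_density 0 (sqrt (t - s))"
  let ?Y = "\<lambda>w. W t w - W s w"
  have D: "distributed M lborel ?Y (\<lambda>x. ennreal (\<Prod>i\<in>UNIV. ?d (x $ i)))"
    using wiener assms by (simp add: wiener_process_def)
  have Basis: "(Basis :: (real^'k) set) = (\<lambda>i. axis i 1) ` UNIV"
    by (auto simp: Basis_vec_def)
  have inj: "inj (\<lambda>i::'k. axis i (1::real))"
    by (auto simp: inj_on_def axis_eq_axis)
  define h where "h b x = ennreal (?d x) * g (axis_index b) x" for b :: "real ^ 'k" and x
  have "(\<integral>\<^sup>+ w. (\<Prod>i\<in>UNIV. g i (?Y w $ i)) \<partial>M) =
      (\<integral>\<^sup>+ x. ennreal (\<Prod>i\<in>UNIV. ?d (x $ i)) * (\<Prod>i\<in>UNIV. g i (x $ i)) \<partial>lborel)"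
    by (rule distributed_nn_integral[OF D, symmetric]) measurable
  also have "\<dots> = (\<integral>\<^sup>+ x. (\<Prod>b\<in>Basis. h b (x \<bullet> b)) \<partial>lborel)"
    unfolding Basis prod.reindex[OF inj] o_def h_def axis_index_axis
    by (simp add: prod_ennreal[symmetric] prod.distrib inner_axis)
  also have "\<dots> = (\<Prod>b\<in>Basis. (\<integral>\<^sup>+ x. h b x \<partial>lborel))"
    by (rule nn_integral_lborel_prod) (auto simp: h_def)
  also have "\<dots> = (\<Prod>i\<in>UNIV. \<integral>\<^sup>+ x. ennreal (?d x) * g i x \<partial>lborel)"
    unfolding Basis prod.reindex[OF inj] o_def h_def axis_index_axis by simp
  finally show ?thesis .
qed

lemma increment_joint_prob:
  assumes "0 \<le> s" "s < t" "A \<in> sets borel" "B \<in> sets borel" "a \<noteq> b"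
  defines "N \<equiv> density lborel (\<lambda>x. ennreal (normal_density 0 (sqrt (t - s)) x))"
  shows "emeasure M {w\<in>space M. (W t w - W s w) $ a \<in> A \<and> (W t w - W s w) $ b \<in> B} =
    emeasure N A * emeasure N B"
proof -
  let ?d = "normal_density 0 (sqrt (t - s))"
  let ?Y = "\<lambda>w. W t w - W s w"
  interpret N: prob_space "density lborel (\<lambda>x. ennreal (?d x))"
    by (rule prob_space_normal_density) (use assms in simp)
  have [measurable]: "W t \<in> borel_measurable M" "W s \<in> borel_measurable M" "A \<in> sets borel" "B \<in> sets borel" using assms by auto
  define g where "g i = (if i = a then indicator A else if i = b then indicator B else (\<lambda>_. 1) :: real \<Rightarrow> ennreal)" for i
  have g[measurable]: "g i \<in> borel_measurable borel" for i
    unfolding g_def by auto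
  have pg: "(\<Prod>i\<in>UNIV. f i) = f a * f b" if "\<And>i. i \<noteq> a \<Longrightarrow> i \<noteq> b \<Longrightarrow> f i = 1" for f :: "'k \<Rightarrow> ennreal"
  proof -
    have "(\<Prod>i\<in>UNIV. f i) = (\<Prod>i\<in>{a,b}. f i)"
      by (rule prod.mono_neutral_right) (use that in auto)
    then show ?thesis using assms by simp
  qed
  have N: "emeasure N S = (\<integral>\<^sup>+ x. ennreal (?d x) * indicator S x \<partial>lborel)" if "S \<in> sets borel" for S
    unfolding N_def by (rule emeasure_density) (use that in auto)
  have one: "(\<integral>\<^sup>+ x. ennreal (?d x) * 1 \<partial>lborel) = 1"
    using N.emeasure_space_1 unfolding N_def[symmetric] using N[of UNIV] by (simp add: N_def)
  have "emeasure M {w\<in>space M. ?Y w $ a \<in> A \<and> ?Y w $ b \<in> B} =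
     (\<integral>\<^sup>+ w. indicator {w\<in>space M. ?Y w $ a \<in> A \<and> ?Y w $ b \<in> B} w \<partial>M)"
    by (rule nn_integral_indicator[symmetric]) measurable
  also have "\<dots> = (\<integral>\<^sup>+ w. (\<Prod>i\<in>UNIV. g i (?Y w $ i)) \<partial>M)"
    by (rule nn_integral_cong, subst pg) (use assms(5) in \<open>auto simp: g_def split: split_indicator\<close>)
  also have "\<dots> = (\<Prod>i\<in>UNIV. \<integral>\<^sup>+ x. ennreal (?d x) * g i x \<partial>lborel)"
    by (rule increment_nn_integral_prod) (use assms in auto)
  also have "\<dots> = emeasure N A * emeasure N B"
    by (subst pg) (use assms(5) one in \<open>auto simp: g_def N[OF assms(3)] N[OF assms(4)]\<close>)
  finally show ?thesis .
qed

lemma increment_component_distributed: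
  assumes "0 \<le> s" "s < t"
  shows "distributed M lborel (\<lambda>w. (W t w - W s w) $ a) (\<lambda>x. ennreal (normal_density 0 (sqrt (t - s)) x))"
proof -
  let ?d = "normal_density 0 (sqrt (t - s))"
  let ?N = "density lborel (\<lambda>x. ennreal (?d x))"
  let ?Y = "\<lambda>w. W t w - W s w"
  interpret N: prob_space ?N
    by (rule prob_space_normal_density) (use assms in simp)
  have [measurable]: "W t \<in> borel_measurable M" "W s \<in> borel_measurable M" using assms by auto
  have one: "(\<integral>\<^sup>+ x. ennreal (?d x) * 1 \<partial>lborel) = 1"
    using N.emeasure_space_1 by (subst (asm) emeasure_density) auto
  have "distr M lborel (\<lambda>w. ?Y w $ a) = ?N"
  proof (rule measure_eqI)
    fix A assume "A \<in> sets (distr M lborel (\<lambda>w. ?Y w $ a))"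
    then have A[measurable]: "A \<in> sets borel" by simp
    define g where "g i = (if i = a then indicator A else (\<lambda>_. 1) :: real \<Rightarrow> ennreal)" for i
    have pg: "(\<Prod>i\<in>UNIV. f i) = f a" if "\<And>i. i \<noteq> a \<Longrightarrow> f i = 1" for f :: "'k \<Rightarrow> ennreal"
    proof -
      have "(\<Prod>i\<in>UNIV. f i) = (\<Prod>i\<in>{a}. f i)"
        by (rule prod.mono_neutral_right) (use that in auto)
      then show ?thesis using assms by simp
    qed
    have "emeasure (distr M lborel (\<lambda>w. ?Y w $ a)) A = emeasure M ((\<lambda>w. ?Y w $ a) -` A \<inter> space M)"
      by (rule emeasure_distr) auto
    also have "\<dots> = (\<integral>\<^sup>+ w. indicator ((\<lambda>w. ?Y w $ a) -` A \<inter> space M) w \<partial>M)"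
      by (rule nn_integral_indicator[symmetric]) measurable
    also have "\<dots> = (\<integral>\<^sup>+ w. (\<Prod>i\<in>UNIV. g i (?Y w $ i)) \<partial>M)"
      by (rule nn_integral_cong, subst pg) (auto simp: g_def split: split_indicator)
    also have "\<dots> = (\<Prod>i\<in>UNIV. \<integral>\<^sup>+ x. ennreal (?d x) * g i x \<partial>lborel)"
      by (rule increment_nn_integral_prod) (use assms in \<open>auto simp: g_def\<close>)
    also have "\<dots> = emeasure ?N A"
      by (subst pg) (use assms one in \<open>auto simp: g_def emeasure_density\<close>)
    finally show "emeasure (distr M lborel (\<lambda>w. ?Y w $ a)) A = emeasure ?N A" .
  qed simp
  then show ?thesis unfolding distributed_def by auto
qed

lemma increment_component_indep:
  assumes "0 \<le> s" "s < t" "a \<noteq> b"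
  shows "indep_var borel (\<lambda>w. (W t w - W s w) $ a) borel (\<lambda>w. (W t w - W s w) $ b)"
proof -
  let ?d = "normal_density 0 (sqrt (t - s))"
  let ?N = "density lborel (\<lambda>x. ennreal (?d x))"
  let ?Y = "\<lambda>w. W t w - W s w"
  have [measurable]: "W t \<in> borel_measurable M" "W s \<in> borel_measurable M" using assms by auto
  have distr_Y: "distr M borel (\<lambda>w. ?Y w $ c) = ?N" for c
  proof -
    have "distr M borel (\<lambda>w. ?Y w $ c) = distr M lborel (\<lambda>w. ?Y w $ c)"
      by (rule distr_cong) auto
    then show ?thesis using increment_component_distributed[OF assms(1,2), of c]
      unfolding distributed_def by simp
  qed
  interpret N: prob_space ?N
    by (rule prob_space_normal_density) (use assms in simp)
  have st: "Int_stable {(\<lambda>w. ?Y w $ c) -` A \<inter> space M |A. A \<in> sets borel}" for c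
    unfolding Int_stable_def
  proof safe
    fix B B' :: "real set" assume "B \<in> sets borel" "B' \<in> sets borel"
    then show "\<exists>C. (\<lambda>w. ?Y w $ c) -` B \<inter> space M \<inter> ((\<lambda>w. ?Y w $ c) -` B' \<inter> space M) = (\<lambda>w. ?Y w $ c) -` C \<inter> space M \<and> C \<in> sets borel"
      by (intro exI[of _ "B \<inter> B'"]) auto
  qed
  have pr: "prob ((\<lambda>w. ?Y w $ c) -` A \<inter> space M) = measure ?N A" if "A \<in> sets borel" for A c
  proof -
    have "measure ?N A = measure (distr M borel (\<lambda>w. ?Y w $ c)) A"
      by (subst distr_Y) simp
    also have "\<dots> = prob ((\<lambda>w. ?Y w $ c) -` A \<inter> space M)"
      by (rule measure_distr) (use that in auto)
    finally show ?thesis by simp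
  qed
  have "indep_set {(\<lambda>w. ?Y w $ a) -` A \<inter> space M |A. A \<in> sets borel} {(\<lambda>w. ?Y w $ b) -` A \<inter> space M |A. A \<in> sets borel}"
  proof (rule indep_setI)
    show "{(\<lambda>w. ?Y w $ a) -` A \<inter> space M |A. A \<in> sets borel} \<subseteq> events"
      "{(\<lambda>w. ?Y w $ b) -` A \<inter> space M |A. A \<in> sets borel} \<subseteq> events" by auto
    fix S R assume "S \<in> {(\<lambda>w. ?Y w $ a) -` A \<inter> space M |A. A \<in> sets borel}"
      and "R \<in> {(\<lambda>w. ?Y w $ b) -` A \<inter> space M |A. A \<in> sets borel}"
    then obtain A B where AB: "A \<in> sets borel" "S = (\<lambda>w. ?Y w $ a) -` A \<inter> space M"
       "B \<in> sets borel" "R = (\<lambda>w. ?Y w $ b) -` B \<inter> space M" by auto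
    have "S \<inter> R = {w\<in>space M. ?Y w $ a \<in> A \<and> ?Y w $ b \<in> B}" using AB by auto
    then have "emeasure M (S \<inter> R) = emeasure ?N A * emeasure ?N B"
      using increment_joint_prob[OF assms(1,2) AB(1,3) assms(3)] by simp
    then have "prob (S \<inter> R) = measure ?N A * measure ?N B"
      unfolding emeasure_eq_measure N.emeasure_eq_measure
      by (simp add: ennreal_mult'[symmetric])
    then show "prob (S \<inter> R) = prob S * prob R" using AB pr by simp
  qed
  then show ?thesis
    unfolding indep_var_eq by (intro conjI indep_set_sigma_sets st) auto
qed

lemma increment_component_even_moment:
  assumes "0 \<le> s" "s < t"
  shows "integrable M (\<lambda>w. ((W t w - W s w) $ a) ^ (2 * n))"
    "expectation (\<lambda>w. ((W t w - W s w) $ a) ^ (2 * n)) = fact (2 * n) / (2 ^ n * fact n) * (t - s) ^ n"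
proof -
  let ?Y = "\<lambda>w. (W t w - W s w) $ a"
  have D: "distributed M lborel ?Y (\<lambda>x. ennreal (normal_density 0 (sqrt (t - s)) x))"
    by (rule increment_component_distributed[OF assms])
  have pos: "0 < sqrt (t - s)" using assms by simp
  note E = normal_moment_even[OF pos, of 0 n]
  have "integrable lborel (\<lambda>x. normal_density 0 (sqrt (t - s)) x * x ^ (2 * n))"
    using E by (auto simp: has_bochner_integral_iff)
  then show "integrable M (\<lambda>w. ?Y w ^ (2 * n))"
    using distributed_integrable[OF D, of "\<lambda>x. x ^ (2 * n)"] by simp
  have "expectation (\<lambda>w. ?Y w ^ (2 * n)) = (\<integral>x. normal_density 0 (sqrt (t - s)) x * x ^ (2 * n) \<partial>lborel)"
    by (rule distributed_integral[OF D, symmetric]) auto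
  also have "\<dots> = fact (2 * n) / ((2 / (sqrt (t - s))\<^sup>2) ^ n * fact n)"
    using E by (auto simp: has_bochner_integral_iff)
  also have "\<dots> = fact (2 * n) / (2 ^ n * fact n) * (t - s) ^ n"
    using assms by (simp add: field_simps)
  finally show "expectation (\<lambda>w. ?Y w ^ (2 * n)) = fact (2 * n) / (2 ^ n * fact n) * (t - s) ^ n" .
qed

lemma increment_component_mean:
  assumes "0 \<le> s" "s < t"
  shows "integrable M (\<lambda>w. (W t w - W s w) $ a)" "expectation (\<lambda>w. (W t w - W s w) $ a) = 0"
proof -
  let ?Y = "\<lambda>w. (W t w - W s w) $ a"
  have D: "distributed M lborel ?Y (\<lambda>x. ennreal (normal_density 0 (sqrt (t - s)) x))"
    by (rule increment_component_distributed[OF assms])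
  have pos: "0 < sqrt (t - s)" using assms by simp
  note E = normal_moment_odd[OF pos, of 0 0]
  show "integrable M ?Y"
    using distributed_integrable[OF D, of "\<lambda>x. x"] E by (auto simp: has_bochner_integral_iff)
  have "expectation ?Y = (\<integral>x. normal_density 0 (sqrt (t - s)) x * x \<partial>lborel)"
    by (rule distributed_integral[OF D, symmetric]) auto
  then show "expectation ?Y = 0"
    using E by (auto simp: has_bochner_integral_iff)
qed

lemma increment_component_product:
  assumes "0 \<le> s" "s < t"
  shows "integrable M (\<lambda>w. (W t w - W s w) $ a * (W t w - W s w) $ b)"
    "expectation (\<lambda>w. (W t w - W s w) $ a * (W t w - W s w) $ b) = (if a = b then t - s else 0)"
proof -
  let ?Y = "\<lambda>w c. (W t w - W s w) $ c"
  have "integrable M (\<lambda>w. ?Y w a * ?Y w b) \<and>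
      expectation (\<lambda>w. ?Y w a * ?Y w b) = (if a = b then t - s else 0)"
  proof (cases "a = b")
    case True
    then show ?thesis
      using increment_component_even_moment[OF assms, of a 1] by (simp add: power2_eq_square)
  next
    case False
    note ind = increment_component_indep[OF assms False]
    show ?thesis
      using indep_var_integrable[OF ind] indep_var_lebesgue_integral[OF ind]
        increment_component_mean[OF assms] False by simp
  qed
  then show "integrable M (\<lambda>w. ?Y w a * ?Y w b)"
     "expectation (\<lambda>w. ?Y w a * ?Y w b) = (if a = b then t - s else 0)" by auto
qed

text \<open>Cauchy-Schwarz against the constant vector gives |x|^4 \<le> k times the sum of the
  x_i^4, with k the dimension, and each coordinate has fourth moment 3 (t - s)^2.\<close>

lemma increment_norm_fourth_moment:
  fixes s t :: real
  assumes "0 \<le> s" "s < t"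
  shows "integrable M (\<lambda>w. norm (W t w - W s w) ^ 4)"
    "expectation (\<lambda>w. norm (W t w - W s w) ^ 4) \<le> 3 * (real CARD('k))\<^sup>2 * (t - s)\<^sup>2"
proof -
  let ?Y = "\<lambda>w. W t w - W s w"
  have [measurable]: "W t \<in> borel_measurable M" "W s \<in> borel_measurable M" using assms by auto
  have le: "norm x ^ 4 \<le> real CARD('k) * (\<Sum>i\<in>UNIV. (x $ i) ^ 4)" for x :: "real ^ 'k"
  proof -
    have "norm x ^ 4 = ((norm x)\<^sup>2)\<^sup>2" by (simp flip: power_mult)
    also have "\<dots> = (\<Sum>i\<in>UNIV. 1 * (x $ i)\<^sup>2)\<^sup>2"
      by (simp add: norm_vec_def L2_set_def sum_nonneg)
    also have "\<dots> \<le> (\<Sum>i\<in>(UNIV::'k set). 1\<^sup>2) * (\<Sum>i\<in>UNIV. ((x $ i)\<^sup>2)\<^sup>2)"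
      by (rule Cauchy_Schwarz_ineq_sum)
    also have "\<dots> = real CARD('k) * (\<Sum>i\<in>UNIV. (x $ i) ^ 4)"
      by (simp flip: power_mult)
    finally show ?thesis .
  qed
  have m4: "integrable M (\<lambda>w. (?Y w $ a) ^ 4)" "expectation (\<lambda>w. (?Y w $ a) ^ 4) = 3 * (t - s)\<^sup>2" for a
    using increment_component_even_moment[OF assms, of a 2] by (simp_all add: fact_numeral)
  have i: "integrable M (\<lambda>w. real CARD('k) * (\<Sum>i\<in>UNIV. (?Y w $ i) ^ 4))"
    using m4(1) by auto
  show 1: "integrable M (\<lambda>w. norm (?Y w) ^ 4)"
    by (rule Bochner_Integration.integrable_bound[OF i]) (use le[of "?Y _"] in \<open>auto simp: sum_nonneg\<close>)
  have "expectation (\<lambda>w. norm (?Y w) ^ 4) \<le> expectation (\<lambda>w. real CARD('k) * (\<Sum>i\<in>UNIV. (?Y w $ i) ^ 4))"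
    by (rule integral_mono[OF 1 i]) (rule le)
  also have "\<dots> = 3 * (real CARD('k))\<^sup>2 * (t - s)\<^sup>2"
    using m4 by (simp add: power2_eq_square)
  finally show "expectation (\<lambda>w. norm (?Y w) ^ 4) \<le> 3 * (real CARD('k))\<^sup>2 * (t - s)\<^sup>2" .
qed

lemma increment_norm_second_moment:
  fixes s t :: real
  assumes "0 \<le> s" "s < t"
  shows "integrable M (\<lambda>w. (norm (W t w - W s w))\<^sup>2)"
    "expectation (\<lambda>w. (norm (W t w - W s w))\<^sup>2) = real CARD('k) * (t - s)"
proof -
  have "(norm x)\<^sup>2 = (\<Sum>i\<in>UNIV. x $ i * x $ i)" for x :: "real ^ 'k"
    by (simp add: power2_norm_eq_inner inner_vec_def)
  then show "integrable M (\<lambda>w. (norm (W t w - W s w))\<^sup>2)"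
    "expectation (\<lambda>w. (norm (W t w - W s w))\<^sup>2) = real CARD('k) * (t - s)"
    using increment_component_product[OF assms] by simp_all
qed

lemma expectation_mult_increment:
  fixes f :: "'a \<Rightarrow> real" and g :: "real ^ 'k \<Rightarrow> real"
  assumes "0 \<le> s" "s < t" "f \<in> borel_measurable (F s)" "g \<in> borel_measurable borel"
    "integrable M f" "integrable M (\<lambda>w. g (W t w - W s w))"
  shows "integrable M (\<lambda>w. f w * g (W t w - W s w))"
    "expectation (\<lambda>w. f w * g (W t w - W s w)) = expectation f * expectation (\<lambda>w. g (W t w - W s w))"
  using increment_indep_var[OF assms(1-4)] assms(5,6)
  by (auto intro: indep_var_integrable indep_var_lebesgue_integral)

lemma expectation_inner_increment:
  fixes c :: "'a \<Rightarrow> real ^ 'k"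
  assumes "0 \<le> s" "s < t" "c \<in> borel_measurable (F s)" "integrable M (\<lambda>w. norm (c w))"
  shows "integrable M (\<lambda>w. c w \<bullet> (W t w - W s w))" "expectation (\<lambda>w. c w \<bullet> (W t w - W s w)) = 0"
proof -
  have cm: "c \<in> borel_measurable M" by (rule F_measurable_M) fact
  have ci: "integrable M (\<lambda>w. c w $ i)" for i
    by (rule Bochner_Integration.integrable_bound[OF assms(4)])
       (use cm component_le_norm_cart in auto)
  have cF: "(\<lambda>w. c w $ i) \<in> borel_measurable (F s)" for i using assms(3) by measurable
  have eq: "c w \<bullet> (W t w - W s w) = (\<Sum>i\<in>UNIV. c w $ i * (W t w - W s w) $ i)" for w
    by (simp add: inner_vec_def)
  note E = expectation_mult_increment[OF assms(1,2) cF _ ci increment_component_mean(1)[OF assms(1,2)]]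
  show "integrable M (\<lambda>w. c w \<bullet> (W t w - W s w))"
    unfolding eq by (intro Bochner_Integration.integrable_sum E) auto
  show "expectation (\<lambda>w. c w \<bullet> (W t w - W s w)) = 0"
    unfolding eq by (subst Bochner_Integration.integral_sum)
      (use E increment_component_mean(2)[OF assms(1,2)] in auto)
qed

text \<open>The entries of \<open>B\<close> are independent of the increment, and distinct
  coordinates of the increment are uncorrelated. So only the diagonal survives, each entry
  multiplied by the variance t - s.\<close>

lemma expectation_quadratic_increment:
  fixes B :: "'a \<Rightarrow> real ^ 'k ^ 'k"
  assumes "0 \<le> s" "s < t" "B \<in> borel_measurable (F s)" "integrable M (\<lambda>w. norm (B w))"
  shows "integrable M (\<lambda>w. (W t w - W s w) \<bullet> (B w *v (W t w - W s w)))"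
    "expectation (\<lambda>w. (W t w - W s w) \<bullet> (B w *v (W t w - W s w))) = (t - s) * expectation (\<lambda>w. trace (B w))"
proof -
  have Bm: "B \<in> borel_measurable M" by (rule F_measurable_M) fact
  have ci: "integrable M (\<lambda>w. B w $ i $ j)" for i j
  proof (rule Bochner_Integration.integrable_bound[OF assms(4)])
    have "\<bar>B w $ i $ j\<bar> \<le> norm (B w)" for w
      using component_le_norm_cart[of "B w $ i" j] Finite_Cartesian_Product.norm_nth_le[of "B w" i] by linarith
    then show "AE w in M. norm (B w $ i $ j) \<le> norm (norm (B w))" by auto
  qed (use Bm in auto)
  have cF: "(\<lambda>w. B w $ i $ j) \<in> borel_measurable (F s)" for i j using assms(3) by measurable
  have eq: "(W t w - W s w) \<bullet> (B w *v (W t w - W s w)) =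
     (\<Sum>i\<in>UNIV. \<Sum>j\<in>UNIV. B w $ i $ j * ((W t w - W s w) $ i * (W t w - W s w) $ j))" for w
    by (simp add: inner_vec_def matrix_vector_mult_def sum_distrib_left mult_ac)
  note E = expectation_mult_increment[OF assms(1,2) cF _ ci increment_component_product(1)[OF assms(1,2)]]
  show "integrable M (\<lambda>w. (W t w - W s w) \<bullet> (B w *v (W t w - W s w)))"
    unfolding eq by (intro Bochner_Integration.integrable_sum E) auto
  have "expectation (\<lambda>w. (W t w - W s w) \<bullet> (B w *v (W t w - W s w))) =
     (\<Sum>i\<in>UNIV. \<Sum>j\<in>UNIV. expectation (\<lambda>w. B w $ i $ j) * (if i = j then t - s else 0))"
    unfolding eq
    by (subst Bochner_Integration.integral_sum, (intro Bochner_Integration.integrable_sum E; auto))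
       (subst Bochner_Integration.integral_sum, (intro E; auto),
        subst E, auto simp: increment_component_product(2)[OF assms(1,2), unfolded vector_minus_component])
  also have "\<dots> = (\<Sum>i\<in>UNIV. expectation (\<lambda>w. B w $ i $ i) * (t - s))"
    by (simp add: if_distrib cong: if_cong)
  also have "\<dots> = (t - s) * expectation (\<lambda>w. trace (B w))"
    unfolding trace_def by (subst Bochner_Integration.integral_sum) (use ci in \<open>auto simp: sum_distrib_left mult.commute\<close>)
  finally show "expectation (\<lambda>w. (W t w - W s w) \<bullet> (B w *v (W t w - W s w))) = (t - s) * expectation (\<lambda>w. trace (B w))" .
qed

end

section \<open>Matrix estimates\<close>

text \<open>The norm of a matrix is the Euclidean norm of the vector of its row norms, that is, the
  Frobenius norm. Product estimates can therefore be proved row by row.\<close>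

lemma norm_vec_le_mult:
  fixes x :: "'a::real_normed_vector ^ 'n" and y :: "'b::real_normed_vector ^ 'n"
  assumes "\<And>i. norm (x $ i) \<le> norm (y $ i) * c" "0 \<le> c"
  shows "norm x \<le> norm y * c"
proof -
  have "norm x \<le> L2_set (\<lambda>i. norm (y $ i) * c) UNIV"
    unfolding norm_vec_def by (rule L2_set_mono) (use assms in auto)
  also have "\<dots> = norm y * c"
    unfolding norm_vec_def by (rule L2_set_left_distrib[symmetric]) fact
  finally show ?thesis .
qed

lemma norm_sum_scaleR_le:
  fixes x :: "real ^ 'n" and A :: "real ^ 'm ^ 'n"
  shows "norm (\<Sum>k\<in>UNIV. x $ k *\<^sub>R A $ k) \<le> norm x * norm A"
proof -
  have "norm (\<Sum>k\<in>UNIV. x $ k *\<^sub>R A $ k) \<le> (\<Sum>k\<in>UNIV. \<bar>x $ k\<bar> * \<bar>norm (A $ k)\<bar>)"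
    by (rule sum_norm_le) auto
  also have "\<dots> \<le> L2_set (\<lambda>k. x $ k) UNIV * L2_set (\<lambda>k. norm (A $ k)) UNIV"
    by (rule L2_set_mult_ineq)
  finally show ?thesis by (simp add: norm_vec_def L2_set_def)
qed

lemma norm_matrix_vector_mult_le:
  fixes A :: "real ^ 'm ^ 'n"
  shows "norm (A *v x) \<le> norm A * norm x"
  by (rule norm_vec_le_mult) (auto simp: matrix_vector_mul_component Cauchy_Schwarz_ineq2)

lemma norm_matrix_matrix_mult_le:
  fixes A :: "real ^ 'm ^ 'n" and B :: "real ^ 'k ^ 'm"
  shows "norm (A ** B) \<le> norm A * norm B"
proof (rule norm_vec_le_mult)
  fix i
  have "(A ** B) $ i = (\<Sum>k\<in>UNIV. (A $ i) $ k *\<^sub>R B $ k)"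
    by (simp add: matrix_matrix_mult_def vec_eq_iff)
  then show "norm ((A ** B) $ i) \<le> norm (A $ i) * norm B"
    using norm_sum_scaleR_le[of "A $ i" B] by simp
qed auto

lemma norm_vector_matrix_mult_le:
  fixes A :: "real ^ 'm ^ 'n"
  shows "norm (x v* A) \<le> norm x * norm A"
proof -
  have "x v* A = (\<Sum>k\<in>UNIV. x $ k *\<^sub>R A $ k)"
    by (simp add: vector_matrix_mult_def vec_eq_iff mult.commute)
  then show ?thesis using norm_sum_scaleR_le[of x A] by simp
qed

lemma bounded_bilinear_matrix_vector_mult:
  "bounded_bilinear ((*v) :: real ^ 'm ^ 'n \<Rightarrow> real ^ 'm \<Rightarrow> real ^ 'n)"
proof (standard, goal_cases)
  case 5
  show ?case by (intro exI[of _ 1]) (simp add: norm_matrix_vector_mult_le)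
qed (auto simp: matrix_vector_mult_def vec_eq_iff sum_distrib_left sum.distrib algebra_simps)

lemma bounded_bilinear_matrix_matrix_mult:
  "bounded_bilinear ((**) :: real ^ 'm ^ 'n \<Rightarrow> real ^ 'k ^ 'm \<Rightarrow> real ^ 'k ^ 'n)"
proof (standard, goal_cases)
  case 5
  show ?case by (intro exI[of _ 1]) (simp add: norm_matrix_matrix_mult_le)
qed (auto simp: matrix_matrix_mult_def vec_eq_iff sum_distrib_left sum.distrib algebra_simps)

lemma bounded_bilinear_vector_matrix_mult:
  "bounded_bilinear ((v*) :: real ^ 'n \<Rightarrow> real ^ 'm ^ 'n \<Rightarrow> real ^ 'm)"
proof (standard, goal_cases)
  case 5
  show ?case by (intro exI[of _ 1]) (simp add: norm_vector_matrix_mult_le)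
qed (auto simp: vector_matrix_mult_def vec_eq_iff sum_distrib_left sum.distrib algebra_simps)

lemma borel_measurable_bilinear:
  fixes h :: "'a::{second_countable_topology,real_normed_vector} \<Rightarrow> 'b::{second_countable_topology,real_normed_vector} \<Rightarrow> 'c::real_normed_vector"
  assumes "bounded_bilinear h" "f \<in> borel_measurable M" "g \<in> borel_measurable M"
  shows "(\<lambda>x. h (f x) (g x)) \<in> borel_measurable M"
  by (rule borel_measurable_continuous_Pair[OF assms(2,3)])
     (intro bounded_bilinear.continuous_on[OF assms(1)] continuous_intros)

lemmas borel_measurable_matrix_mult [measurable (raw)] =
  borel_measurable_bilinear[OF bounded_bilinear_matrix_vector_mult]
  borel_measurable_bilinear[OF bounded_bilinear_matrix_matrix_mult]
  borel_measurable_bilinear[OF bounded_bilinear_vector_matrix_mult]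

lemma borel_measurable_transpose [measurable (raw)]:
  fixes f :: "'a \<Rightarrow> real ^ 'n ^ 'm"
  assumes "f \<in> borel_measurable M"
  shows "(\<lambda>x. transpose (f x)) \<in> borel_measurable M"
  unfolding transpose_def
  by (rule measurable_compose[OF assms borel_measurable_continuous_onI]) (intro continuous_intros)

lemma norm_transpose:
  fixes A :: "real ^ 'm ^ 'n"
  shows "norm (transpose A) = norm A"
proof -
  have "(norm (transpose A))\<^sup>2 = (\<Sum>i\<in>UNIV. \<Sum>j\<in>UNIV. A $ j $ i * A $ j $ i)"
    by (simp add: power2_norm_eq_inner inner_vec_def transpose_def)
  also have "\<dots> = (\<Sum>j\<in>UNIV. \<Sum>i\<in>UNIV. A $ j $ i * A $ j $ i)"
    by (rule sum.swap)
  also have "\<dots> = (norm A)\<^sup>2"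
    by (simp add: power2_norm_eq_inner inner_vec_def)
  finally show ?thesis by simp
qed

text \<open>Turns the second-order term of the generator into a Frobenius inner product, on which
  Cauchy-Schwarz and bilinearity act directly.\<close>

lemma trace_conjugate_eq_inner:
  fixes A :: "real ^ 'm ^ 'n" and Q :: "real ^ 'n ^ 'n"
  shows "trace (transpose A ** Q ** A) = A \<bullet> (Q ** A)"
proof -
  have "trace (transpose A ** (Q ** A)) = (\<Sum>j\<in>UNIV. \<Sum>i\<in>UNIV. A $ i $ j * (Q ** A) $ i $ j)"
    by (simp add: trace_def matrix_matrix_mult_def transpose_def)
  also have "\<dots> = (\<Sum>i\<in>UNIV. \<Sum>j\<in>UNIV. A $ i $ j * (Q ** A) $ i $ j)"
    by (rule sum.swap)
  also have "\<dots> = A \<bullet> (Q ** A)"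
    by (simp add: inner_vec_def)
  finally show ?thesis by (simp add: matrix_mul_assoc)
qed

text \<open>Shifts the matrix from the Gaussian vector to the quadratic form, so that
  \<open>expectation_quadratic_increment\<close> applies to the conjugated form.\<close>

lemma inner_matrix_quadratic:
  fixes A :: "real ^ 'm ^ 'n" and Q :: "real ^ 'n ^ 'n"
  shows "(A *v x) \<bullet> (Q *v (A *v x)) = x \<bullet> ((transpose A ** Q ** A) *v x)"
proof -
  have "(A *v x) \<bullet> (Q *v (A *v x)) = x \<bullet> (transpose A *v (Q *v (A *v x)))"
    by (metis dot_lmul_matrix vector_transpose_matrix)
  then show ?thesis by (simp add: matrix_vector_mul_assoc matrix_mul_assoc)
qed

lemma abs_inner_matrix_le:
  fixes A B :: "real ^ 'm ^ 'n" and Q :: "real ^ 'n ^ 'n"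
  shows "\<bar>A \<bullet> (Q ** B)\<bar> \<le> norm Q * norm A * norm B"
proof -
  have "\<bar>A \<bullet> (Q ** B)\<bar> \<le> norm A * norm (Q ** B)"
    by (rule Cauchy_Schwarz_ineq2)
  also have "\<dots> \<le> norm A * (norm Q * norm B)"
    by (intro mult_left_mono norm_matrix_matrix_mult_le) auto
  finally show ?thesis by (simp add: mult_ac)
qed

lemma abs_inner_matrix_diff_le:
  fixes A B :: "real ^ 'm ^ 'n" and Q :: "real ^ 'n ^ 'n"
  shows "\<bar>A \<bullet> (Q ** A) - B \<bullet> (Q ** B)\<bar> \<le> norm Q * (norm A + norm B) * norm (A - B)"
proof -
  interpret bounded_bilinear "(**) :: real ^ 'n ^ 'n \<Rightarrow> real ^ 'm ^ 'n \<Rightarrow> real ^ 'm ^ 'n"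
    by (rule bounded_bilinear_matrix_matrix_mult)
  have "A \<bullet> (Q ** A) - B \<bullet> (Q ** B) = A \<bullet> (Q ** (A - B)) + (A - B) \<bullet> (Q ** B)"
    by (simp add: diff_right inner_diff_left inner_diff_right)
  then show ?thesis
    using abs_inner_matrix_le[of A Q "A - B"] abs_inner_matrix_le[of "A - B" Q B]
    by (simp add: algebra_simps)
qed

lemma abs_inner_matrix_vector_le:
  fixes x :: "real ^ 'n" and Q :: "real ^ 'm ^ 'n"
  shows "\<bar>x \<bullet> (Q *v y)\<bar> \<le> norm Q * norm x * norm y"
proof -
  have "\<bar>x \<bullet> (Q *v y)\<bar> \<le> norm x * norm (Q *v y)"
    by (rule Cauchy_Schwarz_ineq2)
  also have "\<dots> \<le> norm x * (norm Q * norm y)"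
    by (intro mult_left_mono norm_matrix_vector_mult_le) auto
  finally show ?thesis by (simp add: mult_ac)
qed

text \<open>With m the maximum of 1, x and y the product is at most m ^ n. Integrability of pure
  fourth powers thus settles every mixed term of degree at most 4.\<close>

lemma mixed_power_le:
  fixes x y :: real
  assumes "0 \<le> x" "0 \<le> y" "a + b \<le> n"
  shows "x ^ a * y ^ b \<le> 1 + x ^ n + y ^ n"
proof -
  define m where "m = max 1 (max x y)"
  have "x ^ a * y ^ b \<le> m ^ a * m ^ b"
    by (intro mult_mono power_mono) (use assms in \<open>auto simp: m_def\<close>)
  also have "\<dots> \<le> m ^ n"
    using assms(3) unfolding power_add[symmetric] by (intro power_increasing) (auto simp: m_def)
  also have "m ^ n \<le> 1 + x ^ n + y ^ n"
  proof -
    have "m = 1 \<or> m = x \<or> m = y" by (auto simp: m_def max_def)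
    then show ?thesis using assms by auto
  qed
  finally show ?thesis .
qed

text \<open>The leading term linear in y is kept exactly, because it has mean zero when y is a new
  increment. The other mixed terms of the expansion are absorbed by Cauchy-Schwarz and the
  inequality between the arithmetic and geometric means: 8 = 4 + 2 + 2 and 3 = 1 + 2.\<close>

lemma norm_add_power4_le:
  fixes x y :: "'a::real_inner"
  shows "norm (x + y) ^ 4 \<le>
    norm x ^ 4 + 4 * ((norm x)\<^sup>2 * (x \<bullet> y)) + 8 * ((norm x)\<^sup>2 * (norm y)\<^sup>2) + 3 * norm y ^ 4"
proof -
  define p where "p = x \<bullet> y"
  define a where "a = norm x"
  define b where "b = norm y"
  have p: "\<bar>p\<bar> \<le> a * b" unfolding p_def a_def b_def by (rule Cauchy_Schwarz_ineq2)
  then have p2: "p\<^sup>2 \<le> (a * b)\<^sup>2" by (metis abs_ge_zero power2_abs power_mono)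
  have "norm (x + y) ^ 4 = ((norm (x + y))\<^sup>2)\<^sup>2" by (simp flip: power_mult)
  also have "(norm (x + y))\<^sup>2 = a\<^sup>2 + 2 * p + b\<^sup>2"
    by (simp add: power2_norm_eq_inner inner_add_left inner_add_right inner_commute p_def a_def b_def)
  also have "(a\<^sup>2 + 2 * p + b\<^sup>2)\<^sup>2 = a^4 + 4 * p\<^sup>2 + b^4 + 4 * (a\<^sup>2 * p) + 2 * (a\<^sup>2 * b\<^sup>2) + 4 * (p * b\<^sup>2)"
    by (simp add: power2_eq_square power4_eq_xxxx algebra_simps)
  also have "4 * (p * b\<^sup>2) \<le> 2 * (a\<^sup>2 * b\<^sup>2) + 2 * b ^ 4"
  proof -
    have "p * b\<^sup>2 \<le> (a * b) * b\<^sup>2" using p by (intro mult_right_mono) auto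
    moreover have "2 * ((a * b) * b\<^sup>2) \<le> a\<^sup>2 * b\<^sup>2 + b ^ 4"
      using sum_squares_bound[of "a * b" "b\<^sup>2"] by (simp add: power_mult_distrib flip: power_mult)
    ultimately show ?thesis by simp
  qed
  also have "4 * p\<^sup>2 \<le> 4 * (a\<^sup>2 * b\<^sup>2)" using p2 by (simp add: power_mult_distrib)
  finally show ?thesis unfolding a_def b_def p_def by simp
qed

section \<open>Stochastic integrals of bounded simple processes\<close>

text \<open>The discrete martingale transform of the increments along the grid \<open>q\<close>;
  \<open>\<eta> i\<close> multiplies the increment that starts at \<open>q i\<close>.\<close>

definition transform ::
    "(real \<Rightarrow> 'a \<Rightarrow> real ^ 'k) \<Rightarrow> (nat \<Rightarrow> real) \<Rightarrow> (nat \<Rightarrow> 'a \<Rightarrow> real ^ 'k ^ 'n) \<Rightarrow> nat \<Rightarrow> 'a \<Rightarrow> real ^ 'n" where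
  "transform W q \<eta> j w = (\<Sum>i<j. \<eta> i w *v (W (q (Suc i)) w - W (q i) w))"

lemma transform_0 [simp]: "transform W q \<eta> 0 w = 0"
  and transform_Suc: "transform W q \<eta> (Suc j) w =
    transform W q \<eta> j w + \<eta> j w *v (W (q (Suc j)) w - W (q j) w)"
  by (simp_all add: transform_def)

context brownian
begin

text \<open>Unlike in \<open>simple_process\<close> the bound is named: the moment estimates depend
  on \<open>K\<close> and on the length of the time interval, but not on the number of
  cells.\<close>

definition bounded_simple :: "nat \<Rightarrow> (nat \<Rightarrow> real) \<Rightarrow> (nat \<Rightarrow> 'a \<Rightarrow> real ^ 'k ^ 'n) \<Rightarrow> real \<Rightarrow> bool" where
  "bounded_simple N q \<eta> K \<longleftrightarrow> 0 \<le> q 0 \<and> (\<forall>i<N. q i < q (Suc i)) \<and>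
     (\<forall>i<N. \<eta> i \<in> borel_measurable (F (q i)) \<and> (\<forall>w\<in>space M. norm (\<eta> i w) \<le> K))"

context
  fixes N q and \<eta> :: "nat \<Rightarrow> 'a \<Rightarrow> real ^ 'k ^ 'n" and K
  assumes bs: "bounded_simple N q \<eta> K"
begin

lemma grid_le: "i \<le> j \<Longrightarrow> j \<le> N \<Longrightarrow> q i \<le> q j"
proof (induction j)
  case (Suc j)
  then have "q j \<le> q (Suc j)" using bs by (auto simp: bounded_simple_def less_imp_le)
  then show ?case using Suc by (cases "i = Suc j") auto
qed auto

lemma grid_nonneg: "j \<le> N \<Longrightarrow> 0 \<le> q j"
  using grid_le[of 0 j] bs by (auto simp: bounded_simple_def)

lemma grid_less: "j < N \<Longrightarrow> q j < q (Suc j)"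
  using bs by (auto simp: bounded_simple_def)

lemma eta_measurable: "j < N \<Longrightarrow> \<eta> j \<in> borel_measurable (F (q j))"
  using bs by (auto simp: bounded_simple_def)

lemma eta_bound: "j < N \<Longrightarrow> w \<in> space M \<Longrightarrow> norm (\<eta> j w) \<le> K"
  using bs by (auto simp: bounded_simple_def)

lemma transform_measurable: "j \<le> N \<Longrightarrow> transform W q \<eta> j \<in> borel_measurable (F (q j))"
proof (induction j)
  case 0
  then show ?case by (simp add: transform_def cong: measurable_cong)
next
  case (Suc j)
  have le: "q j \<le> q (Suc j)" "0 \<le> q j" "0 \<le> q (Suc j)"
    using grid_less[of j] grid_nonneg[of j] grid_nonneg[of "Suc j"] Suc by auto
  have [measurable]: "transform W q \<eta> j \<in> borel_measurable (F (q (Suc j)))"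
    "\<eta> j \<in> borel_measurable (F (q (Suc j)))"
    "W (q j) \<in> borel_measurable (F (q (Suc j)))" "W (q (Suc j)) \<in> borel_measurable (F (q (Suc j)))"
    using Suc le eta_measurable[of j] F_measurable_mono W_measurable_F by auto
  show ?case unfolding transform_Suc[abs_def] by measurable
qed

lemma increment_bound:
  "j < N \<Longrightarrow> w \<in> space M \<Longrightarrow>
    norm (\<eta> j w *v (W (q (Suc j)) w - W (q j) w)) \<le> K * norm (W (q (Suc j)) w - W (q j) w)"
  by (rule order_trans[OF norm_matrix_vector_mult_le mult_right_mono[OF eta_bound norm_ge_zero]])

lemma increment_measurable:
  assumes "j < N"
  shows "(\<lambda>w. \<eta> j w *v (W (q (Suc j)) w - W (q j) w)) \<in> borel_measurable M"
proof -
  have [measurable]: "\<eta> j \<in> borel_measurable M" "W (q j) \<in> borel_measurable M"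
     "W (q (Suc j)) \<in> borel_measurable M"
    using assms eta_measurable F_measurable_M grid_nonneg by auto
  show ?thesis by measurable
qed

lemma increment_integrable4:
  assumes "j < N"
  shows "integrable M (\<lambda>w. norm (\<eta> j w *v (W (q (Suc j)) w - W (q j) w)) ^ 4)"
proof (rule Bochner_Integration.integrable_bound)
  show "integrable M (\<lambda>w. K ^ 4 * norm (W (q (Suc j)) w - W (q j) w) ^ 4)"
    using increment_norm_fourth_moment(1)[of "q j" "q (Suc j)"] grid_nonneg[of j] grid_less assms by auto
  show "AE w in M. norm (norm (\<eta> j w *v (W (q (Suc j)) w - W (q j) w)) ^ 4)
      \<le> norm (K ^ 4 * norm (W (q (Suc j)) w - W (q j) w) ^ 4)"
  proof (rule AE_I2)
    fix w assume w: "w \<in> space M"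
    have "norm (\<eta> j w *v (W (q (Suc j)) w - W (q j) w)) ^ 4 \<le> (K * norm (W (q (Suc j)) w - W (q j) w)) ^ 4"
      by (intro power_mono increment_bound) (use w assms in auto)
    then show "norm (norm (\<eta> j w *v (W (q (Suc j)) w - W (q j) w)) ^ 4)
      \<le> norm (K ^ 4 * norm (W (q (Suc j)) w - W (q j) w) ^ 4)"
      by (simp add: power_mult_distrib abs_mult power_abs)
  qed
qed (use increment_measurable[OF assms] in measurable)

lemma transform_integrable4: "j \<le> N \<Longrightarrow> integrable M (\<lambda>w. norm (transform W q \<eta> j w) ^ 4)"
proof (induction j)
  case (Suc j)
  let ?S = "transform W q \<eta> j" and ?y = "\<lambda>w. \<eta> j w *v (W (q (Suc j)) w - W (q j) w)"
  have [measurable]: "?S \<in> borel_measurable M" "?y \<in> borel_measurable M"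
    using transform_measurable[of j] F_measurable_M increment_measurable[of j] Suc by auto
  show ?case unfolding transform_Suc[abs_def]
  proof (rule Bochner_Integration.integrable_bound)
    show "integrable M (\<lambda>w. 8 * (norm (?S w) ^ 4 + norm (?y w) ^ 4))"
      using increment_integrable4[of j] Suc by auto
    have "(a + b) ^ 4 \<le> 8 * (a ^ 4 + b ^ 4)" for a b :: real
    proof -
      have "(a + b) ^ 4 = ((a + b)\<^sup>2)\<^sup>2" by simp
      also have "\<dots> \<le> (2 * (a\<^sup>2 + b\<^sup>2))\<^sup>2"
        using sum_squares_bound[of a b] by (intro power_mono zero_le_power2) (simp add: power2_sum)
      also have "\<dots> \<le> 8 * (a ^ 4 + b ^ 4)"
        using sum_squares_bound[of "a\<^sup>2" "b\<^sup>2"] by (simp add: power2_sum power_mult_distrib flip: power_mult)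
      finally show ?thesis .
    qed
    note pow = this
    have "norm (?S w + ?y w) ^ 4 \<le> 8 * (norm (?S w) ^ 4 + norm (?y w) ^ 4)" for w
      by (rule order_trans[OF power_mono[OF norm_triangle_ineq] pow]) auto
    then show "AE w in M. norm (norm (?S w + ?y w) ^ 4) \<le> norm (8 * (norm (?S w) ^ 4 + norm (?y w) ^ 4))"
      by (intro AE_I2) auto
  qed measurable
qed simp

text \<open>One integrability criterion for all expressions in the running sum and the next
  increment: total degree at most 4 leaves only their fourth moments.\<close>

lemma transform_mixed_integrable:
  assumes "j < N" "f \<in> borel_measurable M" "a + b \<le> 4" "0 \<le> C"
    "\<And>w. w \<in> space M \<Longrightarrow> \<bar>f w\<bar> \<le> C * (norm (transform W q \<eta> j w) ^ a *
        norm (\<eta> j w *v (W (q (Suc j)) w - W (q j) w)) ^ b)"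
  shows "integrable M (f :: 'a \<Rightarrow> real)"
proof (rule Bochner_Integration.integrable_bound)
  let ?g = "\<lambda>w. C * (1 + norm (transform W q \<eta> j w) ^ 4 + norm (\<eta> j w *v (W (q (Suc j)) w - W (q j) w)) ^ 4)"
  show "integrable M ?g"
    using assms transform_integrable4[of j] increment_integrable4[of j] by auto
  show "AE w in M. norm (f w) \<le> norm (?g w)"
  proof (rule AE_I2)
    fix w assume w: "w \<in> space M"
    have "\<bar>f w\<bar> \<le> ?g w"
      using assms(5)[OF w] mult_left_mono[OF mixed_power_le[of "norm (transform W q \<eta> j w)"
        "norm (\<eta> j w *v (W (q (Suc j)) w - W (q j) w))" a b 4] assms(4)] assms(3) by simp
    then show "norm (f w) \<le> norm (?g w)" by simp
  qed
qed fact

text \<open>Moving the coefficient to the other side of the inner product leaves the vector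
  \<open>c w v* \<eta> j w\<close>, known at \<open>q j\<close>, paired with a Wiener increment that
  is independent of it and has mean zero.\<close>

lemma expectation_inner_transform_increment:
  fixes c :: "'a \<Rightarrow> real ^ 'n"
  assumes "j < N" "c \<in> borel_measurable (F (q j))" "integrable M (\<lambda>w. norm (c w))"
  shows "integrable M (\<lambda>w. c w \<bullet> (\<eta> j w *v (W (q (Suc j)) w - W (q j) w)))"
    "expectation (\<lambda>w. c w \<bullet> (\<eta> j w *v (W (q (Suc j)) w - W (q j) w))) = 0"
proof -
  have [measurable]: "\<eta> j \<in> borel_measurable (F (q j))" "c \<in> borel_measurable (F (q j))"
    using assms eta_measurable by auto
  have m: "(\<lambda>w. c w v* \<eta> j w) \<in> borel_measurable (F (q j))" by measurable
  have i: "integrable M (\<lambda>w. norm (c w v* \<eta> j w))"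
  proof (rule Bochner_Integration.integrable_bound)
    show "integrable M (\<lambda>w. K * norm (c w))" using assms by auto
    show "AE w in M. norm (norm (c w v* \<eta> j w)) \<le> norm (K * norm (c w))"
    proof (rule AE_I2)
      fix w assume "w \<in> space M"
      then have "norm (c w) * norm (\<eta> j w) \<le> K * norm (c w)"
        using mult_right_mono[OF eta_bound[OF assms(1)] norm_ge_zero] by (metis mult.commute)
      then show "norm (norm (c w v* \<eta> j w)) \<le> norm (K * norm (c w))"
        using norm_vector_matrix_mult_le[of "c w" "\<eta> j w"] by simp
    qed
  qed (use F_measurable_M[OF m] in auto)
  have s: "0 \<le> q j" "q j < q (Suc j)" using grid_nonneg[of j] grid_less[of j] assms by auto
  show "integrable M (\<lambda>w. c w \<bullet> (\<eta> j w *v (W (q (Suc j)) w - W (q j) w)))"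
    "expectation (\<lambda>w. c w \<bullet> (\<eta> j w *v (W (q (Suc j)) w - W (q j) w))) = 0"
    using expectation_inner_increment[OF s m i] unfolding dot_lmul_matrix by auto
qed

lemma expectation_inner_transform:
  fixes c :: "'a \<Rightarrow> real ^ 'n"
  assumes "j \<le> N" "c \<in> borel_measurable (F (q 0))" "\<And>w. w \<in> space M \<Longrightarrow> norm (c w) \<le> C"
  shows "integrable M (\<lambda>w. c w \<bullet> transform W q \<eta> j w)"
    "expectation (\<lambda>w. c w \<bullet> transform W q \<eta> j w) = 0"
proof -
  have "integrable M (\<lambda>w. c w \<bullet> transform W q \<eta> j w) \<and> expectation (\<lambda>w. c w \<bullet> transform W q \<eta> j w) = 0"
    using assms(1)
  proof (induction j)
    case (Suc j)
    have cm: "c \<in> borel_measurable (F (q j))"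
      using F_measurable_mono[OF assms(2)] grid_le[of 0 j] Suc by auto
    have ci: "integrable M (\<lambda>w. norm (c w))"
      by (rule integrable_const_bound[where B=C]) (use assms(3) F_measurable_M[OF cm] in auto)
    note E = expectation_inner_transform_increment[of j, OF _ cm ci]
    show ?case
      using E Suc unfolding transform_Suc[abs_def] inner_add_right by simp
  qed simp
  then show "integrable M (\<lambda>w. c w \<bullet> transform W q \<eta> j w)"
    "expectation (\<lambda>w. c w \<bullet> transform W q \<eta> j w) = 0" by auto
qed

lemma expectation_quadratic_transform_increment:
  fixes Q :: "'a \<Rightarrow> real ^ 'n ^ 'n"
  assumes "j < N" "Q \<in> borel_measurable (F (q j))" "\<And>w. w \<in> space M \<Longrightarrow> norm (Q w) \<le> C"
  defines "y \<equiv> \<lambda>w. \<eta> j w *v (W (q (Suc j)) w - W (q j) w)"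
  shows "integrable M (\<lambda>w. y w \<bullet> (Q w *v y w))"
    "expectation (\<lambda>w. y w \<bullet> (Q w *v y w)) = (q (Suc j) - q j) * expectation (\<lambda>w. \<eta> j w \<bullet> (Q w ** \<eta> j w))"
proof -
  have [measurable]: "\<eta> j \<in> borel_measurable (F (q j))" "Q \<in> borel_measurable (F (q j))"
    using assms eta_measurable by auto
  let ?B = "\<lambda>w. transpose (\<eta> j w) ** Q w ** \<eta> j w"
  have m: "?B \<in> borel_measurable (F (q j))" by measurable
  have i: "integrable M (\<lambda>w. norm (?B w))"
  proof (rule integrable_const_bound[where B="K * C * K"])
    show "AE w in M. norm (norm (?B w)) \<le> K * C * K"
    proof (rule AE_I2)
      fix w assume w: "w \<in> space M"
      have K: "0 \<le> K" using eta_bound[OF assms(1) w] norm_ge_zero order_trans by blast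
      have C: "0 \<le> C" using assms(3)[OF w] norm_ge_zero order_trans by blast
      have "norm (?B w) \<le> norm (transpose (\<eta> j w) ** Q w) * norm (\<eta> j w)"
        by (rule norm_matrix_matrix_mult_le)
      also have "\<dots> \<le> (norm (\<eta> j w) * norm (Q w)) * norm (\<eta> j w)"
        using norm_matrix_matrix_mult_le[of "transpose (\<eta> j w)" "Q w"]
        by (intro mult_right_mono) (auto simp: norm_transpose)
      also have "\<dots> \<le> K * C * K"
        by (intro mult_mono) (use eta_bound[OF assms(1) w] assms(3)[OF w] K C in auto)
      finally show "norm (norm (?B w)) \<le> K * C * K" by simp
    qed
  qed (use F_measurable_M[OF m] in auto)
  have s: "0 \<le> q j" "q j < q (Suc j)" using grid_nonneg[of j] grid_less[of j] assms by auto
  show "integrable M (\<lambda>w. y w \<bullet> (Q w *v y w))"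
    "expectation (\<lambda>w. y w \<bullet> (Q w *v y w)) = (q (Suc j) - q j) * expectation (\<lambda>w. \<eta> j w \<bullet> (Q w ** \<eta> j w))"
    using expectation_quadratic_increment[OF s m i]
    unfolding y_def inner_matrix_quadratic trace_conjugate_eq_inner by auto
qed

text \<open>The Ito isometry with a weight. Expanding the form at the old sum plus the new increment
  gives two cross terms, one for each side since \<open>Q\<close> is not assumed symmetric; each
  pairs a vector known at \<open>q j\<close> with the new increment and has mean zero.\<close>

lemma expectation_quadratic_transform:
  fixes Q :: "'a \<Rightarrow> real ^ 'n ^ 'n"
  assumes "j \<le> N" "Q \<in> borel_measurable (F (q 0))" "\<And>w. w \<in> space M \<Longrightarrow> norm (Q w) \<le> C"
  shows "integrable M (\<lambda>w. transform W q \<eta> j w \<bullet> (Q w *v transform W q \<eta> j w)) \<and>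
    expectation (\<lambda>w. transform W q \<eta> j w \<bullet> (Q w *v transform W q \<eta> j w)) =
      (\<Sum>i<j. (q (Suc i) - q i) * expectation (\<lambda>w. \<eta> i w \<bullet> (Q w ** \<eta> i w)))"
  using assms(1)
proof (induction j)
  case (Suc j)
  let ?S = "transform W q \<eta> j" and ?y = "\<lambda>w. \<eta> j w *v (W (q (Suc j)) w - W (q j) w)"
  interpret mv: bounded_bilinear "(*v) :: real ^ 'n ^ 'n \<Rightarrow> real ^ 'n \<Rightarrow> real ^ 'n"
    by (rule bounded_bilinear_matrix_vector_mult)
  have j: "j < N" "j \<le> N" using Suc by auto
  have Qm[measurable]: "Q \<in> borel_measurable (F (q j))"
    using F_measurable_mono[OF assms(2)] grid_le[of 0 j] Suc by auto
  have Sm[measurable]: "?S \<in> borel_measurable (F (q j))" using transform_measurable[OF j(2)] .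
  obtain w0 where "w0 \<in> space M" using not_empty by auto
  then have C: "0 \<le> C" using assms(3) norm_ge_zero order_trans by blast
  have i1: "integrable M (\<lambda>w. norm (c w))"
    if "c \<in> borel_measurable (F (q j))" "\<And>w. norm (c w) \<le> norm (Q w) * norm (?S w)"
    for c :: "'a \<Rightarrow> real ^ 'n"
  proof (rule transform_mixed_integrable[OF j(1), of _ 1 0 C])
    show "(\<lambda>w. norm (c w)) \<in> borel_measurable M" using F_measurable_M[OF that(1)] by measurable
    fix w assume "w \<in> space M"
    then have "norm (Q w) * norm (?S w) \<le> C * norm (?S w)"
      using assms(3) by (intro mult_right_mono) auto
    then show "\<bar>norm (c w)\<bar> \<le> C * (norm (transform W q \<eta> j w) ^ 1 * norm (?y w) ^ 0)"
      using that(2)[of w] by simp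
  qed (use C in auto)
  have m1: "(\<lambda>w. ?S w v* Q w) \<in> borel_measurable (F (q j))" and m2: "(\<lambda>w. Q w *v ?S w) \<in> borel_measurable (F (q j))"
    by measurable
  note E1 = expectation_inner_transform_increment[OF j(1) m1 i1[OF m1]]
  note E2 = expectation_inner_transform_increment[OF j(1) m2 i1[OF m2]]
  have n1: "norm (?S w v* Q w) \<le> norm (Q w) * norm (?S w)" for w
    using norm_vector_matrix_mult_le[of "?S w" "Q w"] by (simp add: mult.commute)
  have n2: "norm (Q w *v ?S w) \<le> norm (Q w) * norm (?S w)" for w
    by (rule norm_matrix_vector_mult_le)
  note E3 = expectation_quadratic_transform_increment[OF j(1) Qm assms(3)]
  have eq: "(?S w + ?y w) \<bullet> (Q w *v (?S w + ?y w)) =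
     ?S w \<bullet> (Q w *v ?S w) + (?S w v* Q w) \<bullet> ?y w + (Q w *v ?S w) \<bullet> ?y w + ?y w \<bullet> (Q w *v ?y w)" for w
    by (simp add: mv.add_right inner_add_left inner_add_right dot_lmul_matrix inner_commute)
  show ?case
    using E1[OF n1] E2[OF n2] E3 Suc unfolding transform_Suc[abs_def] eq by simp
qed simp

lemma expectation_transform_square:
  assumes "j \<le> N"
  shows "integrable M (\<lambda>w. (norm (transform W q \<eta> j w))\<^sup>2) \<and>
    expectation (\<lambda>w. (norm (transform W q \<eta> j w))\<^sup>2) =
      (\<Sum>i<j. (q (Suc i) - q i) * expectation (\<lambda>w. (norm (\<eta> i w))\<^sup>2))"
  using expectation_quadratic_transform[where Q = "\<lambda>_. mat 1", OF assms borel_measurable_const order_refl]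
  unfolding power2_norm_eq_inner matrix_vector_mul_lid matrix_mul_lid .

lemma expectation_transform_square_le:
  assumes "j \<le> N"
  shows "expectation (\<lambda>w. (norm (transform W q \<eta> j w))\<^sup>2) \<le> K\<^sup>2 * (q j - q 0)"
proof -
  have "expectation (\<lambda>w. (norm (\<eta> i w))\<^sup>2) \<le> K\<^sup>2" if "i < N" for i
  proof -
    have "expectation (\<lambda>w. (norm (\<eta> i w))\<^sup>2) \<le> expectation (\<lambda>w. K\<^sup>2)"
      by (rule integral_mono_AE') (use eta_bound[OF that] in \<open>auto intro!: AE_I2 power_mono\<close>)
    then show ?thesis by (simp add: prob_space)
  qed
  then have "(\<Sum>i<j. (q (Suc i) - q i) * expectation (\<lambda>w. (norm (\<eta> i w))\<^sup>2)) \<le> (\<Sum>i<j. (q (Suc i) - q i) * K\<^sup>2)"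
    using assms grid_less by (intro sum_mono mult_left_mono) (auto simp: less_imp_le)
  also have "\<dots> = K\<^sup>2 * (q j - q 0)"
    by (simp add: sum_lessThan_telescope flip: sum_distrib_right)
  finally show ?thesis using expectation_transform_square[OF assms] by simp
qed

text \<open>Induction on j, with L the elapsed time, \<Delta> the next step and k the dimension of
  \<open>W\<close>. By \<open>norm_add_power4_le\<close> a step adds at most 8 k K^4 L \<Delta> + 9
  k^2 K^4 \<Delta>^2. With c = 9 k^2 this fits into c K^4 ((L + \<Delta>)^2 - L^2), because 8 k
  \<le> 18 k^2.\<close>

lemma expectation_transform_fourth_le:
  assumes "j \<le> N"
  defines "c \<equiv> 9 * (real CARD('k))\<^sup>2"
  shows "expectation (\<lambda>w. norm (transform W q \<eta> j w) ^ 4) \<le> c * K ^ 4 * (q j - q 0)\<^sup>2"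
  using assms(1)
proof (induction j)
  case (Suc j)
  let ?S = "transform W q \<eta> j" and ?Y = "\<lambda>w. W (q (Suc j)) w - W (q j) w"
  let ?y = "\<lambda>w. \<eta> j w *v ?Y w"
  have j: "j < N" "j \<le> N" using Suc by auto
  define \<Delta> where "\<Delta> = q (Suc j) - q j"
  define L where "L = q j - q 0"
  define k where "k = real CARD('k)"
  have k: "1 \<le> k" unfolding k_def using one_le_card_finite by simp
  have kk: "k \<le> k\<^sup>2" using k by (simp add: power2_eq_square)
  have \<Delta>: "0 < \<Delta>" and L: "0 \<le> L" using grid_less[OF j(1)] grid_le[OF _ j(2), of 0] by (auto simp: \<Delta>_def L_def)
  have s: "0 \<le> q j" "q j < q (Suc j)" using grid_nonneg[OF j(2)] grid_less[OF j(1)] by auto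
  have SF[measurable]: "?S \<in> borel_measurable (F (q j))" by (rule transform_measurable[OF j(2)])
  have [measurable]: "?S \<in> borel_measurable M" "?y \<in> borel_measurable M"
    using F_measurable_M[OF SF] increment_measurable[OF j(1)] by auto
  have cm: "(\<lambda>w. (norm (?S w))\<^sup>2 *\<^sub>R ?S w) \<in> borel_measurable (F (q j))" by measurable
  have ci: "integrable M (\<lambda>w. norm ((norm (?S w))\<^sup>2 *\<^sub>R ?S w))"
    by (rule transform_mixed_integrable[OF j(1), of _ 3 0 1]) (auto simp: power2_eq_square power3_eq_cube)
  note E1 = expectation_inner_transform_increment[OF j(1) cm ci, unfolded inner_scaleR_left]
  have E2: "integrable M (\<lambda>w. (norm (?S w))\<^sup>2 * (norm (?Y w))\<^sup>2)"
    "expectation (\<lambda>w. (norm (?S w))\<^sup>2 * (norm (?Y w))\<^sup>2) \<le> K\<^sup>2 * L * (k * \<Delta>)"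
  proof -
    have Sm: "(\<lambda>w. (norm (?S w))\<^sup>2) \<in> borel_measurable (F (q j))" by measurable
    note sq = expectation_transform_square[OF j(2)]
    note E = expectation_mult_increment[OF s Sm, of "\<lambda>y. (norm y)\<^sup>2", OF _ sq[THEN conjunct1] increment_norm_second_moment(1)[OF s]]
    show "integrable M (\<lambda>w. (norm (?S w))\<^sup>2 * (norm (?Y w))\<^sup>2)" using E(1) by auto
    have "expectation (\<lambda>w. (norm (?S w))\<^sup>2 * (norm (?Y w))\<^sup>2) =
      expectation (\<lambda>w. (norm (?S w))\<^sup>2) * (k * \<Delta>)"
      using E(2) increment_norm_second_moment(2)[OF s] by (simp add: k_def \<Delta>_def)
    also have "\<dots> \<le> K\<^sup>2 * L * (k * \<Delta>)"
      using expectation_transform_square_le[OF j(2)] k \<Delta> by (intro mult_right_mono) (auto simp: L_def)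
    finally show "expectation (\<lambda>w. (norm (?S w))\<^sup>2 * (norm (?Y w))\<^sup>2) \<le> K\<^sup>2 * L * (k * \<Delta>)" .
  qed
  note E3 = increment_norm_fourth_moment[OF s]
  let ?bd = "\<lambda>w. norm (?S w) ^ 4 + 4 * ((norm (?S w))\<^sup>2 * (?S w \<bullet> ?y w)) +
     8 * (K\<^sup>2 * ((norm (?S w))\<^sup>2 * (norm (?Y w))\<^sup>2)) + 3 * (K ^ 4 * norm (?Y w) ^ 4)"
  have "expectation (\<lambda>w. norm (transform W q \<eta> (Suc j) w) ^ 4) \<le> expectation ?bd"
  proof (rule integral_mono_AE[OF transform_integrable4[OF Suc.prems]])
    show "integrable M ?bd" using E1(1) E2(1) E3(1) transform_integrable4[OF j(2)] by simp
    show "AE w in M. norm (transform W q \<eta> (Suc j) w) ^ 4 \<le> ?bd w"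
    proof (rule AE_I2)
      fix w assume w: "w \<in> space M"
      note y = increment_bound[OF j(1) w]
      have "(norm (?y w))\<^sup>2 \<le> K\<^sup>2 * (norm (?Y w))\<^sup>2" "norm (?y w) ^ 4 \<le> K ^ 4 * norm (?Y w) ^ 4"
        using power_mono[OF y, of 2] power_mono[OF y, of 4] by (auto simp: power_mult_distrib)
      then have "(norm (?S w))\<^sup>2 * (norm (?y w))\<^sup>2 \<le> (norm (?S w))\<^sup>2 * (K\<^sup>2 * (norm (?Y w))\<^sup>2)"
        "norm (?y w) ^ 4 \<le> K ^ 4 * norm (?Y w) ^ 4" by (auto intro: mult_left_mono)
      then show "norm (transform W q \<eta> (Suc j) w) ^ 4 \<le> ?bd w"
        using norm_add_power4_le[of "?S w" "?y w"] unfolding transform_Suc by (simp add: mult_ac)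
    qed
  qed
  also have "\<dots> = expectation (\<lambda>w. norm (?S w) ^ 4) + 8 * (K\<^sup>2 * expectation (\<lambda>w. (norm (?S w))\<^sup>2 * (norm (?Y w))\<^sup>2)) +
      3 * (K ^ 4 * expectation (\<lambda>w. norm (?Y w) ^ 4))"
    using E1 E2(1) E3(1) transform_integrable4[OF j(2)] by simp
  also have "\<dots> \<le> c * K ^ 4 * L\<^sup>2 + 8 * (K\<^sup>2 * (K\<^sup>2 * L * (k * \<Delta>))) + 3 * (K ^ 4 * (3 * k\<^sup>2 * \<Delta>\<^sup>2))"
    using Suc E2(2) E3(2) by (intro add_mono mult_left_mono) (auto simp: k_def \<Delta>_def L_def)
  also have "\<dots> \<le> c * K ^ 4 * (L + \<Delta>)\<^sup>2"
  proof -
    have "8 * k * (K ^ 4 * L * \<Delta>) \<le> 18 * k\<^sup>2 * (K ^ 4 * L * \<Delta>)"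
      using kk k \<Delta> L by (intro mult_right_mono) auto
    then show ?thesis unfolding c_def k_def[symmetric]
      by (simp add: power2_eq_square power4_eq_xxxx algebra_simps)
  qed
  finally show ?case by (simp add: L_def \<Delta>_def)
qed simp

end

end

section \<open>Refining the grid of a simple process\<close>

text \<open>The grid is the sorted list of s, t and the points of \<open>Q\<close> between them. The
  last condition, that no point of \<open>Q\<close> is interior to a cell, is stated for all of
  \<open>Q\<close>, so that it can be applied without asking which points lie between s and
  t.\<close>

lemma exists_grid:
  fixes s t :: real
  assumes "finite Q" "s < t"
  shows "\<exists>N q. q 0 = s \<and> q N = t \<and> (\<forall>i<N. q i < q (Suc i)) \<and>
    (\<forall>c\<in>Q. \<forall>i<N. c \<le> q i \<or> q (Suc i) \<le> c)"
proof -
  define P where "P = {s, t} \<union> (Q \<inter> {s..t})"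
  define xs where "xs = sorted_list_of_set P"
  have fin: "finite P" using assms by (auto simp: P_def)
  have set: "set xs = P" and sd: "sorted_wrt (<) xs"
    using fin by (auto simp: xs_def strict_sorted_list_of_set)
  then have srt: "sorted xs" by (simp add: strict_sorted_iff)
  define N where "N = length xs - 1"
  have len: "length xs = Suc N"
    using set assms by (cases xs) (auto simp: N_def P_def)
  have idx: "\<exists>k\<le>N. c = xs ! k" if "c \<in> P" for c
    using that set len by (metis in_set_conv_nth less_Suc_eq_le)
  have mono: "xs ! i \<le> xs ! j" if "i \<le> j" "j \<le> N" for i j
    using srt that len by (simp add: sorted_iff_nth_mono)
  have inP: "xs ! i \<in> P" if "i \<le> N" for i
    using that set len nth_mem[of i xs] by auto
  have P: "c \<in> P \<Longrightarrow> s \<le> c \<and> c \<le> t" for c using assms by (auto simp: P_def)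
  have "xs ! 0 = s"
  proof -
    obtain k where "k \<le> N" "s = xs ! k" using idx[of s] by (auto simp: P_def)
    then show ?thesis using mono[of 0 k] P[OF inP[of 0]] by auto
  qed
  moreover have "xs ! N = t"
  proof -
    obtain k where "k \<le> N" "t = xs ! k" using idx[of t] by (auto simp: P_def)
    then show ?thesis using mono[of k N] P[OF inP[of N]] by auto
  qed
  moreover have "xs ! i < xs ! Suc i" if "i < N" for i
    using sd that len by (simp add: sorted_wrt_iff_nth_less)
  moreover have "c \<le> xs ! i \<or> xs ! Suc i \<le> c" if "c \<in> Q" "i < N" for c i
  proof (cases "c \<in> P")
    case True
    then obtain k where k: "k \<le> N" "c = xs ! k" using idx by auto
    then show ?thesis using mono[of k i] mono[of "Suc i" k] that by (cases "k \<le> i") auto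
  next
    case False
    then have "c < s \<or> t < c" using that by (auto simp: P_def)
    then show ?thesis using P[OF inP[of i]] P[OF inP[of "Suc i"]] that by auto
  qed
  ultimately show ?thesis by (intro exI[of _ N] exI[of _ "(!) xs"]) auto
qed

lemma grid_mono:
  fixes q :: "nat \<Rightarrow> real"
  assumes "\<forall>i<N. q i < q (Suc i)" "i \<le> j" "j \<le> N"
  shows "q i \<le> q j"
  using assms(2,3)
proof (induction j)
  case (Suc j)
  then have "q j \<le> q (Suc j)" using assms(1) by (auto simp: less_imp_le)
  then show ?case using Suc by (cases "i = Suc j") auto
qed auto

lemma grid_cell:
  fixes q :: "nat \<Rightarrow> real"
  assumes "q 0 < u" "u \<le> q N"
  shows "\<exists>j<N. q j < u \<and> u \<le> q (Suc j)"
  using assms(2)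
proof (induction N)
  case 0
  then show ?case using assms by simp
next
  case (Suc N)
  show ?case
  proof (cases "u \<le> q N")
    case True
    then show ?thesis using Suc.IH less_SucI by blast
  qed (use Suc.prems in auto)
qed

lemma cell_unique:
  fixes q :: "nat \<Rightarrow> real"
  assumes "\<forall>i<N. q i < q (Suc i)" "j < N" "q j < u" "u \<le> q (Suc j)" "i < N"
  shows "q i < u \<and> u \<le> q (Suc i) \<longleftrightarrow> i = j"
proof -
  consider "i < j" | "i = j" | "j < i" by linarith
  then show ?thesis
  proof cases
    case 1
    then have "q (Suc i) \<le> q j" using grid_mono[OF assms(1), of "Suc i" j] assms by auto
    then show ?thesis using assms 1 by auto
  next
    case 3
    then have "q (Suc j) \<le> q i" using grid_mono[OF assms(1), of "Suc j" i] assms by auto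
    then show ?thesis using assms 3 by auto
  qed (use assms in auto)
qed

lemma simple_value_cell:
  assumes "\<forall>i<N. q i < q (Suc i)" "j < N" "q j < u" "u \<le> q (Suc j)"
  shows "simple_value N q \<eta> u w = \<eta> j w"
proof -
  have "simple_value N q \<eta> u w = (\<Sum>i<N. if i = j then \<eta> j w else 0)"
    unfolding simple_value_def
    by (rule sum.cong) (use cell_unique[OF assms] in \<open>auto simp: indicator_def\<close>)
  then show ?thesis using assms(2) by simp
qed

text \<open>A point of the grid interval lies in exactly one cell. The indicator on the left is
  there because \<open>f 0\<close> may be nonzero, whereas the sum vanishes off the grid.\<close>

lemma indicator_eq_sum_cells:
  fixes f :: "'c::real_normed_vector \<Rightarrow> 'b::semiring_1"
  assumes "\<forall>i<N. q i < q (Suc i)"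
  shows "f (simple_value N q \<eta> u w) * indicator {q 0<..q N} u =
    (\<Sum>i<N. f (\<eta> i w) * indicator {q i<..q (Suc i)} u)"
proof (cases "q 0 < u \<and> u \<le> q N")
  case True
  then obtain j where j: "j < N" "q j < u" "u \<le> q (Suc j)" using grid_cell by blast
  have "(\<Sum>i<N. f (\<eta> i w) * indicator {q i<..q (Suc i)} u) = (\<Sum>i<N. if i = j then f (\<eta> j w) else 0)"
    by (rule sum.cong) (use cell_unique[OF assms j] in \<open>auto simp: indicator_def\<close>)
  also have "\<dots> = f (\<eta> j w)" using j by simp
  finally show ?thesis using True simple_value_cell[OF assms j, of \<eta> w] by (simp add: indicator_def)
next
  case False
  have "f (\<eta> i w) * indicator {q i<..q (Suc i)} u = 0" if "i < N" for i
    using False grid_mono[OF assms, of 0 i] grid_mono[OF assms, of "Suc i" N] that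
    by (auto simp: indicator_def)
  then show ?thesis using False by (auto simp: indicator_def)
qed

lemma nn_integral_simple_value:
  fixes f :: "'c::real_normed_vector \<Rightarrow> ennreal"
  assumes "\<forall>i<N. q i < q (Suc i)"
  shows "(\<integral>\<^sup>+u\<in>{q 0<..q N}. f (simple_value N q \<eta> u w) \<partial>lborel) =
    (\<Sum>i<N. f (\<eta> i w) * ennreal (q (Suc i) - q i))"
  unfolding indicator_eq_sum_cells[OF assms]
  using assms by (subst nn_integral_sum) (auto simp: nn_integral_cmult less_imp_le)

lemma integral_simple_value:
  fixes f :: "'c::real_normed_vector \<Rightarrow> real"
  assumes "\<forall>i<N. q i < q (Suc i)"
  shows "(LINT u:{q 0<..q N}|lborel. f (simple_value N q \<eta> u w)) = (\<Sum>i<N. f (\<eta> i w) * (q (Suc i) - q i))"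
  unfolding set_lebesgue_integral_def real_scaleR_def mult.commute[of "indicator _ _"] indicator_eq_sum_cells[OF assms]
  using assms by (subst Bochner_Integration.integral_sum) (auto simp: less_imp_le)

lemma min_increment_cell:
  fixes q :: "nat \<Rightarrow> real" and W :: "real \<Rightarrow> 'a \<Rightarrow> 'b::real_vector"
  assumes "q j < q (Suc j)" "c \<le> q j \<or> q (Suc j) \<le> c"
  shows "W (min (q (Suc j)) c) w - W (min (q j) c) w =
    (if q (Suc j) \<le> c then 1 else 0) *\<^sub>R (W (q (Suc j)) w - W (q j) w)"
  using assms by (auto simp: min_def)

text \<open>Across a cell with no break point of \<open>p\<close> inside, each stopped value of
  \<open>W\<close> in the simple integral either moves with the full increment or stands still.
  Cells are open on the left and closed on the right, hence the value of the process in the cell is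
  read off at \<open>q (Suc i)\<close>.\<close>

lemma simple_integral_refine:
  fixes \<xi> :: "nat \<Rightarrow> 'a \<Rightarrow> real ^ 'k ^ 'n"
  assumes q: "\<forall>i<N. q i < q (Suc i)" and p: "\<forall>i<m. p i < p (Suc i)"
    and gap: "\<forall>l\<le>m. \<forall>i<N. p l \<le> q i \<or> q (Suc i) \<le> p l" and "j \<le> N"
  shows "simple_integral W m p \<xi> (q j) w - simple_integral W m p \<xi> (q 0) w =
    transform W q (\<lambda>i. simple_value m p \<xi> (q (Suc i))) j w"
  using \<open>j \<le> N\<close>
proof (induction j)
  case (Suc j)
  interpret mv: bounded_bilinear "(*v) :: real ^ 'k ^ 'n \<Rightarrow> real ^ 'k \<Rightarrow> real ^ 'n"
    by (rule bounded_bilinear_matrix_vector_mult)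
  let ?\<Delta> = "W (q (Suc j)) w - W (q j) w"
  have j: "j < N" "q j < q (Suc j)" using Suc q by auto
  have "simple_integral W m p \<xi> (q (Suc j)) w - simple_integral W m p \<xi> (q j) w =
     (\<Sum>l<m. \<xi> l w *v ((W (min (q (Suc j)) (p (Suc l))) w - W (min (q j) (p (Suc l))) w) -
        (W (min (q (Suc j)) (p l)) w - W (min (q j) (p l)) w)))"
    unfolding simple_integral_def sum_subtractf[symmetric] mv.diff_right[symmetric]
    by (simp add: algebra_simps)
  also have "\<dots> = (\<Sum>l<m. (indicator {p l<..p (Suc l)} (q (Suc j)) *\<^sub>R \<xi> l w) *v ?\<Delta>)"
  proof (rule sum.cong)
    fix l assume l: "l \<in> {..<m}"
    then have lt: "p l < p (Suc l)" using p by auto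
    have g: "p l \<le> q j \<or> q (Suc j) \<le> p l" "p (Suc l) \<le> q j \<or> q (Suc j) \<le> p (Suc l)"
      using gap l j by auto
    show "\<xi> l w *v ((W (min (q (Suc j)) (p (Suc l))) w - W (min (q j) (p (Suc l))) w) -
        (W (min (q (Suc j)) (p l)) w - W (min (q j) (p l)) w)) =
        (indicator {p l<..p (Suc l)} (q (Suc j)) *\<^sub>R \<xi> l w) *v ?\<Delta>"
      unfolding min_increment_cell[OF j(2) g(1)] min_increment_cell[OF j(2) g(2)]
      using lt by (auto simp: indicator_def)
  qed simp
  also have "\<dots> = simple_value m p \<xi> (q (Suc j)) w *v ?\<Delta>"
    unfolding simple_value_def mv.sum_left ..
  finally show ?case
    using Suc by (simp add: transform_Suc algebra_simps)
qed simp

lemma simple_value_gap: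
  assumes gap: "\<forall>l\<le>m. p l \<le> a \<or> b \<le> p l" and "a < u" "u \<le> b"
  shows "simple_value m p \<xi> u w = simple_value m p \<xi> b w"
proof -
  have "indicator {p l<..p (Suc l)} u = (indicator {p l<..p (Suc l)} b :: real)" if "l < m" for l
    using gap[rule_format, of l] gap[rule_format, of "Suc l"] that assms(2,3) by (auto simp: indicator_def)
  then show ?thesis unfolding simple_value_def by (intro sum.cong) auto
qed

lemma transform_add:
  fixes \<eta> \<eta>' :: "nat \<Rightarrow> 'a \<Rightarrow> real ^ 'k ^ 'n"
  shows "transform W q \<eta> j w + transform W q \<eta>' j w = transform W q (\<lambda>i w. \<eta> i w + \<eta>' i w) j w"
  by (simp add: transform_def matrix_vector_mult_add_rdistrib sum.distrib)

section \<open>Lenglart's inequality and measurability of simple processes\<close>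

context brownian
begin

lemma prob_tendsto_0:
  assumes "\<And>n. A n \<in> events" "AE w in M. eventually (\<lambda>n. w \<notin> A n) sequentially"
  shows "(\<lambda>n. prob (A n)) \<longlonglongrightarrow> 0"
proof -
  have "(\<lambda>n. \<integral>w. indicator (A n) w \<partial>M) \<longlonglongrightarrow> (\<integral>w. 0 \<partial>M :: real)"
  proof (rule integral_dominated_convergence[where w = "\<lambda>_. 1"])
    show "AE w in M. (\<lambda>n. indicator (A n) w) \<longlonglongrightarrow> (0::real)"
      using assms(2)
    proof eventually_elim
      case (elim w)
      then show ?case by (intro tendsto_eventually) (auto elim: eventually_mono)
    qed
  qed (use assms(1) in auto)
  then show ?thesis using assms(1) by simp
qed

text \<open>
  Lenglart's inequality. The integrand is switched off as soon as its accumulated square integral would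
  exceed \<open>\<delta>\<close>; Chebyshev applies to what remains.
\<close>

lemma transform_lenglart:
  assumes bs: "bounded_simple N q \<eta> K" and "0 < \<epsilon>" "0 \<le> \<delta>"
  shows "prob {w \<in> space M. \<epsilon> < norm (transform W q \<eta> N w)} \<le>
    \<delta> / \<epsilon>\<^sup>2 + prob {w \<in> space M. \<delta> < (\<Sum>i<N. (norm (\<eta> i w))\<^sup>2 * (q (Suc i) - q i))}"
proof -
  define A where "A j w = (\<Sum>i<j. (norm (\<eta> i w))\<^sup>2 * (q (Suc i) - q i))" for j w
  \<comment> \<open>The test at i already includes the i-th cell. It is still non-anticipating, as
    \<open>\<eta> i\<close> is known at \<open>q i\<close> and the cell length is deterministic, and
    it leaves no overshoot above \<delta>.\<close>
  define \<eta>' where "\<eta>' i w = (if A (Suc i) w \<le> \<delta> then \<eta> i w else 0)" for i w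
  note less = grid_less[OF bs] and em = eta_measurable[OF bs]
  have eM[measurable]: "i < N \<Longrightarrow> \<eta> i \<in> borel_measurable M" for i
    using em F_measurable_M by blast
  have AF: "A j \<in> borel_measurable (F (q i))" if "j \<le> Suc i" "i < N" for j i
    unfolding A_def
  proof (rule borel_measurable_sum)
    fix l assume "l \<in> {..<j}"
    then have l: "l \<le> i" "l < N" using that by auto
    have [measurable]: "\<eta> l \<in> borel_measurable (F (q i))"
      using em[OF l(2)] F_measurable_mono grid_le[OF bs l(1)] that by auto
    show "(\<lambda>w. (norm (\<eta> l w))\<^sup>2 * (q (Suc l) - q l)) \<in> borel_measurable (F (q i))" by measurable
  qed
  have AM: "j \<le> N \<Longrightarrow> A j \<in> borel_measurable M" for j
    unfolding A_def by measurable
  have bs': "bounded_simple N q \<eta>' K"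
    unfolding bounded_simple_def
  proof (intro conjI allI impI ballI)
    show "0 \<le> q 0" using bs by (auto simp: bounded_simple_def)
    fix i assume i: "i < N"
    show "q i < q (Suc i)" using less i .
    have [measurable]: "A (Suc i) \<in> borel_measurable (F (q i))" "\<eta> i \<in> borel_measurable (F (q i))"
      using AF em i by auto
    show "\<eta>' i \<in> borel_measurable (F (q i))" unfolding \<eta>'_def by measurable
    fix w assume w: "w \<in> space M"
    have "0 \<le> K" using eta_bound[OF bs i w] norm_ge_zero order_trans by blast
    then show "norm (\<eta>' i w) \<le> K" using eta_bound[OF bs i w] by (auto simp: \<eta>'_def)
  qed
  have step: "0 \<le> (norm (\<eta> i w))\<^sup>2 * (q (Suc i) - q i)" if "i < N" for i w
    using less[OF that] by simp
  have Amono: "A i w \<le> A j w" if "i \<le> j" "j \<le> N" for i j w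
    unfolding A_def by (rule sum_mono2) (use step that in auto)
  \<comment> \<open>As long as \<open>A\<close> is at most \<delta> nothing has been cut and the sum
    is \<open>A\<close> itself; since \<open>A\<close> increases, nothing is added after the first
    excess.\<close>
  have part: "(\<Sum>i<j. (norm (\<eta>' i w))\<^sup>2 * (q (Suc i) - q i)) \<le> (if A j w \<le> \<delta> then A j w else \<delta>)"
    if "j \<le> N" for j w
    using that
  proof (induction j)
    case 0
    then show ?case using assms by (auto simp: A_def)
  next
    case (Suc j)
    have "A (Suc j) w = A j w + (norm (\<eta> j w))\<^sup>2 * (q (Suc j) - q j)" by (simp add: A_def)
    then show ?case
      using Suc Amono[of j "Suc j" w] by (auto simp: \<eta>'_def split: if_splits)
  qed
  have sq: "integrable M (\<lambda>w. (norm (transform W q \<eta>' N w))\<^sup>2)"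
    "expectation (\<lambda>w. (norm (transform W q \<eta>' N w))\<^sup>2) =
      (\<Sum>i<N. (q (Suc i) - q i) * expectation (\<lambda>w. (norm (\<eta>' i w))\<^sup>2))"
    using expectation_transform_square[OF bs' order.refl] by auto
  have ei: "integrable M (\<lambda>w. (norm (\<eta>' i w))\<^sup>2)" if "i < N" for i
  proof (rule integrable_const_bound[where B = "K\<^sup>2"])
    show "AE w in M. norm ((norm (\<eta>' i w))\<^sup>2) \<le> K\<^sup>2"
      using eta_bound[OF bs' that] by (auto intro!: AE_I2 power_mono)
    show "(\<lambda>w. (norm (\<eta>' i w))\<^sup>2) \<in> borel_measurable M"
      using F_measurable_M[OF eta_measurable[OF bs' that]] by measurable
  qed
  have "(\<Sum>i<N. (q (Suc i) - q i) * expectation (\<lambda>w. (norm (\<eta>' i w))\<^sup>2)) =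
      expectation (\<lambda>w. \<Sum>i<N. (norm (\<eta>' i w))\<^sup>2 * (q (Suc i) - q i))"
    by (subst Bochner_Integration.integral_sum) (use ei in \<open>auto simp: mult.commute\<close>)
  also have "\<dots> \<le> expectation (\<lambda>w. \<delta>)"
  proof (rule integral_mono)
    fix w
    show "(\<Sum>i<N. (norm (\<eta>' i w))\<^sup>2 * (q (Suc i) - q i)) \<le> \<delta>"
      using part[OF order.refl, of w] by (auto split: if_splits)
  qed (use ei in auto)
  finally have E: "expectation (\<lambda>w. (norm (transform W q \<eta>' N w))\<^sup>2) \<le> \<delta>"
    using sq(2) by (simp add: prob_space)
  have tm[measurable]: "transform W q \<eta> N \<in> borel_measurable M" "transform W q \<eta>' N \<in> borel_measurable M"
    using transform_measurable[OF bs] transform_measurable[OF bs'] F_measurable_M by blast+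
  have AMN[measurable]: "A N \<in> borel_measurable M" using AM by simp
  have "prob {w \<in> space M. \<epsilon>\<^sup>2 \<le> (norm (transform W q \<eta>' N w))\<^sup>2} \<le>
      expectation (\<lambda>w. (norm (transform W q \<eta>' N w))\<^sup>2) / \<epsilon>\<^sup>2"
    by (rule integral_Markov_inequality_measure[where A = "{}"]) (use sq(1) assms in auto)
  also have "\<dots> \<le> \<delta> / \<epsilon>\<^sup>2" using E assms by (intro divide_right_mono) auto
  finally have Mk: "prob {w \<in> space M. \<epsilon>\<^sup>2 \<le> (norm (transform W q \<eta>' N w))\<^sup>2} \<le> \<delta> / \<epsilon>\<^sup>2" .
  have "prob {w \<in> space M. \<epsilon> < norm (transform W q \<eta> N w)} \<le>
     prob ({w \<in> space M. \<epsilon>\<^sup>2 \<le> (norm (transform W q \<eta>' N w))\<^sup>2} \<union> {w \<in> space M. \<delta> < A N w})"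
  proof (rule finite_measure_mono)
    show "{w \<in> space M. \<epsilon> < norm (transform W q \<eta> N w)} \<subseteq>
      {w \<in> space M. \<epsilon>\<^sup>2 \<le> (norm (transform W q \<eta>' N w))\<^sup>2} \<union> {w \<in> space M. \<delta> < A N w}"
    proof (rule subsetI)
      fix w assume w: "w \<in> {w \<in> space M. \<epsilon> < norm (transform W q \<eta> N w)}"
      show "w \<in> {w \<in> space M. \<epsilon>\<^sup>2 \<le> (norm (transform W q \<eta>' N w))\<^sup>2} \<union> {w \<in> space M. \<delta> < A N w}"
      proof (cases "\<delta> < A N w")
        case False
        have "\<eta>' i w = \<eta> i w" if "i < N" for i
          using Amono[of "Suc i" N w] that False by (auto simp: \<eta>'_def)
        then have "transform W q \<eta>' N w = transform W q \<eta> N w"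
          unfolding transform_def by (intro sum.cong) auto
        then show ?thesis using w assms(2) by (auto intro!: power_mono)
      qed (use w in auto)
    qed
  qed measurable
  also have "\<dots> \<le> prob {w \<in> space M. \<epsilon>\<^sup>2 \<le> (norm (transform W q \<eta>' N w))\<^sup>2} + prob {w \<in> space M. \<delta> < A N w}"
    by (rule measure_Un_le) measurable
  finally show ?thesis using Mk unfolding A_def by linarith
qed

text \<open>An interval of \<open>p\<close> that contains b starts before b, hence by the gap
  condition no later than a. So the value at the right end of a cell is known at its left end, which
  makes it an admissible coefficient.\<close>

lemma simple_value_measurable:
  fixes \<xi> :: "nat \<Rightarrow> 'a \<Rightarrow> real ^ 'k ^ 'n"
  assumes sp: "simple_process F m p \<xi>" and gap: "\<forall>l\<le>m. p l \<le> a \<or> b \<le> p l" and "a < b"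
  shows "simple_value m p \<xi> b \<in> borel_measurable (F a)"
proof -
  have "(\<lambda>w. indicator {p l<..p (Suc l)} b *\<^sub>R \<xi> l w) \<in> borel_measurable (F a)" if "l < m" for l
  proof (cases "p l < b")
    case True
    then have "p l \<le> a" using gap that by (meson less_imp_le_nat not_le)
    then have "\<xi> l \<in> borel_measurable (F a)"
      using sp that F_measurable_mono[of "\<xi> l" "p l" borel a] by (auto simp: simple_process_def)
    then show ?thesis by measurable
  qed (auto simp: indicator_def)
  then show ?thesis
    unfolding simple_value_def[abs_def] by (intro borel_measurable_sum) auto
qed

lemma simple_value_bounded:
  fixes \<xi> :: "nat \<Rightarrow> 'a \<Rightarrow> real ^ 'k ^ 'n"
  assumes sp: "simple_process F m p \<xi>"
  shows "\<exists>C. \<forall>u. \<forall>w\<in>space M. norm (simple_value m p \<xi> u w) \<le> C"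
proof -
  have "\<exists>B. \<forall>w\<in>space M. norm (\<xi> l w) \<le> B" if "l < m" for l
    using sp that by (auto simp: simple_process_def bounded_iff)
  then obtain B where B: "\<And>l w. l < m \<Longrightarrow> w \<in> space M \<Longrightarrow> norm (\<xi> l w) \<le> B l" by metis
  have "norm (simple_value m p \<xi> u w) \<le> (\<Sum>l<m. \<bar>B l\<bar>)" if "w \<in> space M" for u w
    unfolding simple_value_def
  proof (rule sum_norm_le)
    fix l assume "l \<in> {..<m}"
    then show "norm (indicator {p l<..p (Suc l)} u *\<^sub>R \<xi> l w) \<le> \<bar>B l\<bar>"
      using B[of l w] that by (auto simp: indicator_def)
  qed
  then show ?thesis by blast
qed

lemma simple_value_joint_measurable:
  fixes \<xi> :: "nat \<Rightarrow> 'a \<Rightarrow> real ^ 'k ^ 'n"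
  assumes "\<And>i. i < m \<Longrightarrow> \<xi> i \<in> borel_measurable M"
  shows "(\<lambda>(u, w). simple_value m p \<xi> u w) \<in> borel_measurable (borel \<Otimes>\<^sub>M M)"
proof -
  have "(\<lambda>x. indicator {p i<..p (Suc i)} (fst x) *\<^sub>R \<xi> i (snd x)) \<in> borel_measurable (borel \<Otimes>\<^sub>M M)"
    if "i < m" for i
    using assms[OF that] by measurable
  then show ?thesis unfolding simple_value_def split_beta by (intro borel_measurable_sum) auto
qed

lemma simple_integral_measurable:
  fixes \<xi> :: "nat \<Rightarrow> 'a \<Rightarrow> real ^ 'k ^ 'n"
  assumes sp: "simple_process F m p \<xi>" and "0 \<le> t"
  shows "simple_integral W m p \<xi> t \<in> borel_measurable M"
proof -
  have p0: "0 \<le> p l" if "l \<le> m" for l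
    using grid_mono[of m p 0 l] sp that by (auto simp: simple_process_def)
  have "(\<lambda>w. \<xi> l w *v (W (min t (p (Suc l))) w - W (min t (p l)) w)) \<in> borel_measurable M"
    if "l < m" for l
  proof -
    have [measurable]: "\<xi> l \<in> borel_measurable M" "W (min t (p (Suc l))) \<in> borel_measurable M"
      "W (min t (p l)) \<in> borel_measurable M"
      using sp F_measurable_M[of "\<xi> l" "p l" borel] that p0[of l] p0[of "Suc l"] assms by (auto simp: simple_process_def)
    show ?thesis by measurable
  qed
  then show ?thesis unfolding simple_integral_def[abs_def] by (intro borel_measurable_sum) auto
qed

end

section \<open>Truncation to a ball\<close>

text \<open>The projection picks the nearest point of the ball, is nonexpansive and fixes y. If x
  approximates a value y in the ball, then both the part cut off from x and the error after
  truncation are at most the original error.\<close>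

lemma closest_point_cball_le:
  fixes x y :: "'a::euclidean_space"
  assumes "norm y \<le> K"
  shows "norm (closest_point (cball 0 K) x - x) \<le> norm (x - y)"
    "norm (closest_point (cball 0 K) x - y) \<le> norm (x - y)"
proof -
  have K: "0 \<le> K" using assms norm_ge_zero order_trans by blast
  have y: "y \<in> cball 0 K" using assms by simp
  show "norm (closest_point (cball 0 K) x - x) \<le> norm (x - y)"
    using closest_point_le[OF closed_cball y, of x] by (simp add: dist_norm norm_minus_commute)
  have "dist (closest_point (cball 0 K) x) (closest_point (cball 0 K) y) \<le> dist x y"
    by (rule closest_point_lipschitz) (use K in auto)
  then show "norm (closest_point (cball 0 K) x - y) \<le> norm (x - y)"
    using closest_point_self[OF y] by (simp add: dist_norm)
qed

lemma norm_closest_point_cball: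
  fixes x :: "'a::euclidean_space"
  assumes "0 \<le> K"
  shows "norm (closest_point (cball 0 K) x) \<le> K"
  using closest_point_in_set[OF closed_cball, of 0 K x] assms by auto

lemma borel_measurable_closest_point_cball:
  assumes "0 \<le> K" "f \<in> borel_measurable M"
  shows "(\<lambda>w. closest_point (cball 0 K) (f w) :: 'a::euclidean_space) \<in> borel_measurable M"
  by (rule measurable_compose[OF assms(2) borel_measurable_continuous_onI])
     (intro continuous_on_closest_point, use assms in auto)

lemma null_in_prob_eventually:
  assumes "null_in_prob M Z" "0 < \<epsilon>" "0 < d"
  shows "\<forall>\<^sub>F n in sequentially. measure M {w \<in> space M. ennreal \<epsilon> < Z n w} < d"
proof (rule order_tendstoD(2))
  show "(\<lambda>n. measure M {w \<in> space M. ennreal \<epsilon> < Z n w}) \<longlonglongrightarrow> 0"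
    using assms by (auto simp: null_in_prob_def)
qed fact

section \<open>The Ito integral of a bounded stopped integrand\<close>

text \<open>
  \<open>Hs\<close> and \<open>Y\<close> are versions, bounded and jointly measurable respectively adjusted on a null set, of
  the stopped integrand \<open>H 1\<^bsub>u \<le> \<tau>\<^esub>\<close> and of its integral. Writing \<open>max 0 u\<close> avoids the values of \<open>H\<close> at
  negative times, about which nothing is known.
\<close>

locale stopped_ito = brownian M W
  for M :: "'a measure" and W :: "real \<Rightarrow> 'a \<Rightarrow> real ^ 'k" +
  fixes H :: "real \<Rightarrow> 'a \<Rightarrow> real ^ 'k ^ 'n" and I :: "real \<Rightarrow> 'a \<Rightarrow> real ^ 'n" and \<tau> :: "'a \<Rightarrow> real"
    and Hs :: "real \<Rightarrow> 'a \<Rightarrow> real ^ 'k ^ 'n" and Y :: "real \<Rightarrow> 'a \<Rightarrow> real ^ 'n" and K :: real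
  assumes ito: "has_ito_integral M F W H I"
    and \<tau>_nonneg: "w \<in> space M \<Longrightarrow> 0 \<le> \<tau> w"
    and \<tau>_stop: "0 \<le> r \<Longrightarrow> {w \<in> space M. r < \<tau> w} \<in> sets (F r)"
    and H_joint: "(\<lambda>(u, w). H (max 0 u) w) \<in> borel_measurable (borel \<Otimes>\<^sub>M M)"
    and H_path: "w \<in> space M \<Longrightarrow> \<exists>C. \<forall>u\<ge>0. norm (H u w) \<le> C"
    and Hs_joint: "(\<lambda>(u, w). Hs u w) \<in> borel_measurable (borel \<Otimes>\<^sub>M M)"
    and Hs_bound: "w \<in> space M \<Longrightarrow> norm (Hs u w) \<le> K"
    and Hs_eq: "AE w in M. \<forall>u>0. Hs u w = (if u \<le> \<tau> w then H u w else 0)"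
    and Y_measurable: "0 \<le> t \<Longrightarrow> Y t \<in> borel_measurable M"
    and Y_eq: "AE w in M. \<forall>t\<ge>0. Y t w = I (min t (\<tau> w)) w"
begin

lemma \<tau>_measurable [measurable]: "\<tau> \<in> borel_measurable M"
  unfolding borel_measurable_iff_greater
proof
  fix r
  show "{w \<in> space M. r < \<tau> w} \<in> events"
  proof (cases "0 \<le> r")
    case True
    then show ?thesis using \<tau>_stop[OF True] sets_F_le by blast
  next
    case False
    then have "{w \<in> space M. r < \<tau> w} = space M" using \<tau>_nonneg by fastforce
    then show ?thesis by simp
  qed
qed

lemma H_measurable [measurable (raw)]:
  assumes "f \<in> borel_measurable L" "g \<in> measurable L M"
  shows "(\<lambda>x. H (max 0 (f x)) (g x)) \<in> borel_measurable L"
  using measurable_compose[OF measurable_Pair[OF assms] H_joint] by simp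

lemma K_nonneg: "0 \<le> K"
  using Hs_bound norm_ge_zero order_trans not_empty by blast

lemma I_measurable: "0 \<le> t \<Longrightarrow> I t \<in> borel_measurable M"
  using ito F_measurable_M[of "I t" t borel] by (auto simp: has_ito_integral_def)

text \<open>The increment of the stopped integral from s to t is the increment of \<open>I\<close>
  from s to this time. This includes the paths with \<tau> below s, where both increments
  vanish.\<close>

definition clip :: "real \<Rightarrow> real \<Rightarrow> 'a \<Rightarrow> real" where
  "clip s t w = max s (min t (\<tau> w))"

definition mesh :: "real \<Rightarrow> real \<Rightarrow> nat \<Rightarrow> real" where
  "mesh s t n = (t - s) / real (Suc n)"

text \<open>
  The stopping time, clipped to the interval from \<open>s\<close> to \<open>t\<close> and rounded up to a grid, so that it becomes
  a stopping time with finitely many values.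
\<close>

definition upper :: "real \<Rightarrow> real \<Rightarrow> nat \<Rightarrow> 'a \<Rightarrow> real" where
  "upper s t n w = s + mesh s t n * of_int \<lceil>(clip s t w - s) / mesh s t n\<rceil>"

context
  fixes s t :: real
  assumes st: "0 \<le> s" "s < t"
begin

abbreviation "h n \<equiv> mesh s t n"

lemma h_pos: "0 < h n" using st by (simp add: mesh_def)

lemma clip_bounds: "s \<le> clip s t w" "clip s t w \<le> t"
  using st by (auto simp: clip_def)

lemma clip_measurable [measurable]: "clip s t \<in> borel_measurable M"
  unfolding clip_def[abs_def] by measurable

lemma upper_measurable [measurable]: "upper s t n \<in> borel_measurable M"
  unfolding upper_def[abs_def] by measurable

lemma upper_bounds: "clip s t w \<le> upper s t n w" "0 < clip s t w + h n - upper s t n w"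
proof -
  let ?x = "(clip s t w - s) / h n"
  have "h n * ?x \<le> h n * of_int \<lceil>?x\<rceil>" "h n * of_int \<lceil>?x\<rceil> < h n * (?x + 1)"
    using h_pos[of n] by (intro mult_left_mono mult_strict_left_mono; linarith)+
  moreover have "h n * ?x = clip s t w - s" using h_pos[of n] by simp
  ultimately show "clip s t w \<le> upper s t n w" "0 < clip s t w + h n - upper s t n w"
    unfolding upper_def by (auto simp: algebra_simps)
qed

lemma upper_grid: "\<exists>l\<le>Suc n. upper s t n w = s + h n * real l"
proof -
  let ?x = "(clip s t w - s) / h n"
  have "0 \<le> ?x" using clip_bounds[of w] h_pos[of n] by auto
  then have 0: "0 \<le> \<lceil>?x\<rceil>" by linarith
  have "?x \<le> (t - s) / h n" using clip_bounds[of w] h_pos[of n] by (intro divide_right_mono) auto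
  also have "\<dots> = real (Suc n)" using st by (simp add: mesh_def)
  finally have "\<lceil>?x\<rceil> \<le> int (Suc n)" by linarith
  then have "nat \<lceil>?x\<rceil> \<le> Suc n" by (simp only: nat_le_iff)
  moreover have "real (nat \<lceil>?x\<rceil>) = of_int \<lceil>?x\<rceil>" using 0 by (rule of_nat_nat)
  ultimately show ?thesis unfolding upper_def by metis
qed

lemma upper_ge: "s \<le> upper s t n w" using upper_bounds(1)[of w n] clip_bounds(1)[of w] by linarith

text \<open>Because of the rounding upwards, the rounded time exceeds r exactly when \<tau> exceeds
  r', the last grid point not after r; this event is known at r' and so at r. As r' is below t, the
  clipping at t does not interfere.\<close>

lemma upper_event:
  assumes "s \<le> r" "r < t"
  shows "{w \<in> space M. r < upper s t n w} \<in> sets (F r)"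
proof -
  define r' where "r' = s + h n * of_int \<lfloor>(r - s) / h n\<rfloor>"
  have r': "s \<le> r'" "r' \<le> r"
  proof -
    have "0 \<le> (r - s) / h n" using assms h_pos[of n] by auto
    then have "0 \<le> \<lfloor>(r - s) / h n\<rfloor>" by linarith
    then show "s \<le> r'" using h_pos[of n] unfolding r'_def by auto
    have "h n * of_int \<lfloor>(r - s) / h n\<rfloor> \<le> h n * ((r - s) / h n)"
      using h_pos[of n] by (intro mult_left_mono) auto
    also have "\<dots> = r - s" using h_pos[of n] by simp
    finally show "r' \<le> r" by (simp add: r'_def)
  qed
  have "r < upper s t n w \<longleftrightarrow> r' < \<tau> w" for w
  proof -
    have "r < upper s t n w \<longleftrightarrow> (r - s) / h n < of_int \<lceil>(clip s t w - s) / h n\<rceil>"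
      unfolding upper_def using h_pos[of n] by (subst pos_divide_less_eq) (auto simp: algebra_simps)
    also have "\<dots> \<longleftrightarrow> \<lfloor>(r - s) / h n\<rfloor> < \<lceil>(clip s t w - s) / h n\<rceil>"
      by linarith
    also have "\<dots> \<longleftrightarrow> of_int \<lfloor>(r - s) / h n\<rfloor> < (clip s t w - s) / h n"
      by linarith
    also have "\<dots> \<longleftrightarrow> r' < clip s t w"
      unfolding r'_def using h_pos[of n] by (subst pos_less_divide_eq) (auto simp: algebra_simps)
    also have "\<dots> \<longleftrightarrow> r' < \<tau> w"
      using r' assms by (auto simp: clip_def)
    finally show ?thesis .
  qed
  then have "{w \<in> space M. r < upper s t n w} = {w \<in> space M. r' < \<tau> w}" by auto
  moreover have "{w \<in> space M. r' < \<tau> w} \<in> sets (F r')"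
    by (rule \<tau>_stop) (use r' st in auto)
  ultimately show ?thesis using sets_augmented_filtration_mono[OF r'(2), of M W] by auto
qed

text \<open>\<open>I\<close> is known to be measurable at fixed times only. The rounded time is
  indexed by an integer, so countably many fixed times suffice; \<open>max 0\<close> supplies an
  admissible time for the integers that would give a negative one.\<close>

lemma I_upper_measurable: "(\<lambda>w. I (upper s t n w) w) \<in> borel_measurable M"
proof -
  let ?g = "\<lambda>w. \<lceil>(clip s t w - s) / h n\<rceil>"
  have "(\<lambda>w. I (max 0 (s + h n * of_int (?g w))) w) \<in> borel_measurable M"
    by (rule measurable_compose_countable[where g = ?g, OF I_measurable]) (simp, measurable)
  moreover have "max 0 (s + h n * of_int (?g w)) = upper s t n w" for w
    using upper_ge[of n w] st by (simp add: upper_def)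
  ultimately show ?thesis by simp
qed

lemma upper_tendsto: "(\<lambda>n. upper s t n w) \<longlonglongrightarrow> clip s t w"
proof (rule tendsto_sandwich[where f = "\<lambda>_. clip s t w" and h = "\<lambda>n. clip s t w + h n"])
  show "(\<lambda>n. clip s t w + h n) \<longlonglongrightarrow> clip s t w"
  proof -
    have "(\<lambda>n. clip s t w + (t - s) * inverse (real (Suc n))) \<longlonglongrightarrow> clip s t w + (t - s) * 0"
      by (intro tendsto_intros LIMSEQ_inverse_real_of_nat)
    then show ?thesis by (simp add: divide_inverse mesh_def)
  qed
  have "upper s t n w \<le> clip s t w + h n" for n using upper_bounds(2)[of w n] by linarith
  then show "\<forall>\<^sub>F n in sequentially. upper s t n w \<le> clip s t w + h n" by simp
qed (use upper_bounds(1) in auto)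

lemma h_tendsto: "(\<lambda>n. c * h n) \<longlonglongrightarrow> 0"
proof -
  have "(\<lambda>n. c * (t - s) * inverse (real (Suc n))) \<longlonglongrightarrow> c * (t - s) * 0"
    by (intro tendsto_intros LIMSEQ_inverse_real_of_nat)
  then show ?thesis by (simp add: divide_inverse mult_ac mesh_def)
qed

lemma prob_I_upper:
  assumes "0 < \<epsilon>"
  shows "(\<lambda>n. prob {w \<in> space M. \<epsilon> < norm (I (upper s t n w) w - I s w - (Y t w - Y s w))}) \<longlonglongrightarrow> 0"
proof (rule prob_tendsto_0)
  fix n
  have [measurable]: "I s \<in> borel_measurable M" "Y t \<in> borel_measurable M" "Y s \<in> borel_measurable M"
    using I_measurable Y_measurable st by auto
  show "{w \<in> space M. \<epsilon> < norm (I (upper s t n w) w - I s w - (Y t w - Y s w))} \<in> events"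
    using I_upper_measurable[of n] by measurable
next
  have "AE w in M. continuous_on {0..} (\<lambda>t. I t w)"
    using ito by (simp add: has_ito_integral_def)
  with Y_eq show "AE w in M. \<forall>\<^sub>F n in sequentially.
      w \<notin> {w \<in> space M. \<epsilon> < norm (I (upper s t n w) w - I s w - (Y t w - Y s w))}"
  proof eventually_elim
    case (elim w)
    have "(\<lambda>n. I (upper s t n w) w) \<longlonglongrightarrow> I (clip s t w) w"
      by (rule continuous_on_tendsto_compose[OF elim(2) upper_tendsto])
         (use clip_bounds[of w] upper_ge[of _ w] st order_trans in \<open>auto intro!: always_eventually\<close>)
    moreover have "Y t w - Y s w = I (clip s t w) w - I s w"
      using elim(1)[rule_format, of t] elim(1)[rule_format, of s] st by (auto simp: clip_def min_def max_def)
    ultimately have "(\<lambda>n. norm (I (upper s t n w) w - I s w - (Y t w - Y s w))) \<longlonglongrightarrow>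
        norm (I (clip s t w) w - I s w - (I (clip s t w) w - I s w))"
      by (simp only:) (intro tendsto_intros)
    then have "(\<lambda>n. norm (I (upper s t n w) w - I s w - (Y t w - Y s w))) \<longlonglongrightarrow> 0"
      by simp
    then have "\<forall>\<^sub>F n in sequentially. norm (I (upper s t n w) w - I s w - (Y t w - Y s w)) < \<epsilon>"
      using assms by (rule order_tendstoD(2))
    then show ?case by eventually_elim auto
  qed
qed

lemma gap_integral_measurable [measurable]:
  "(\<lambda>w. \<integral>\<^sup>+u\<in>{clip s t w<..upper s t n w}. ennreal ((norm (H (max 0 u) w))\<^sup>2) \<partial>lborel) \<in> borel_measurable M"
proof -
  have "(\<lambda>w. \<integral>\<^sup>+u. ennreal ((norm (H (max 0 u) w))\<^sup>2) *
      (if clip s t w < u \<and> u \<le> upper s t n w then 1 else 0) \<partial>lborel) \<in> borel_measurable M"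
    by measurable
  then show ?thesis by (simp add: indicator_def)
qed

text \<open>Rounding up lets the simple processes follow \<open>H\<close> beyond \<tau>, where only
  a bound for the individual path is at hand. The excess lasts at most \<open>h n\<close>, so its
  contribution vanishes path by path and hence in probability.\<close>

lemma prob_gap_integral:
  assumes "0 < \<epsilon>"
  shows "(\<lambda>n. prob {w \<in> space M. ennreal \<epsilon> <
    (\<integral>\<^sup>+u\<in>{clip s t w<..upper s t n w}. ennreal ((norm (H (max 0 u) w))\<^sup>2) \<partial>lborel)}) \<longlonglongrightarrow> 0"
proof (rule prob_tendsto_0)
  show "AE w in M. \<forall>\<^sub>F n in sequentially. w \<notin> {w \<in> space M. ennreal \<epsilon> <
    (\<integral>\<^sup>+u\<in>{clip s t w<..upper s t n w}. ennreal ((norm (H (max 0 u) w))\<^sup>2) \<partial>lborel)}"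
  proof (rule AE_I2)
    fix w assume "w \<in> space M"
    then obtain C where C: "\<And>u. 0 \<le> u \<Longrightarrow> norm (H u w) \<le> C" using H_path by blast
    have "0 \<le> C" using C[of 0] norm_ge_zero order_trans by blast
    have le: "(\<integral>\<^sup>+u\<in>{clip s t w<..upper s t n w}. ennreal ((norm (H (max 0 u) w))\<^sup>2) \<partial>lborel) \<le> ennreal (C\<^sup>2 * h n)" for n
    proof -
      have "(\<integral>\<^sup>+u\<in>{clip s t w<..upper s t n w}. ennreal ((norm (H (max 0 u) w))\<^sup>2) \<partial>lborel) \<le>
          (\<integral>\<^sup>+u\<in>{clip s t w<..upper s t n w}. ennreal (C\<^sup>2) \<partial>lborel)"
        by (intro nn_integral_mono mult_right_mono ennreal_leI power_mono C) auto
      also have "\<dots> = ennreal (C\<^sup>2) * ennreal (upper s t n w - clip s t w)"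
        using upper_bounds[of w n] by (simp add: nn_integral_cmult)
      also have "\<dots> \<le> ennreal (C\<^sup>2 * h n)"
        using upper_bounds[of w n] by (auto simp: ennreal_mult'[symmetric] intro!: ennreal_leI mult_left_mono)
      finally show ?thesis .
    qed
    have "\<forall>\<^sub>F n in sequentially. C\<^sup>2 * h n < \<epsilon>"
      using h_tendsto[of "C\<^sup>2"] assms by (auto simp: order_tendsto_iff)
    then show "\<forall>\<^sub>F n in sequentially. w \<notin> {w \<in> space M. ennreal \<epsilon> <
      (\<integral>\<^sup>+u\<in>{clip s t w<..upper s t n w}. ennreal ((norm (H (max 0 u) w))\<^sup>2) \<partial>lborel)}"
    proof eventually_elim
      case (elim n)
      then have "ennreal (C\<^sup>2 * h n) \<le> ennreal \<epsilon>" by (intro ennreal_leI) auto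
      then show ?case using le[of n] by (auto simp: not_less intro: order_trans)
    qed
  qed
qed measurable

text \<open>The order of choice matters: n fixes the rounding \<open>R\<close> of the stopping time
  and thereby finitely many times; then k is taken so large that the given simple integrals are
  close to \<open>I\<close> at all of these. Switching the k-th simple process off after
  \<open>R\<close> and projecting onto the ball gives \<open>\<eta>\<close>. The part
  \<open>\<rho>\<close> that is cut off has a small square integral outside a small event, and
  \<open>transform_lenglart\<close> turns this into a small stochastic integral.\<close>

lemma approximation:
  assumes "0 < e"
  shows "\<exists>N q \<eta>. bounded_simple N q \<eta> K \<and> q 0 = s \<and> q N = t \<and>
    prob {w \<in> space M. e < norm (transform W q \<eta> N w - (Y t w - Y s w))} \<le> e \<and>
    prob {w \<in> space M. ennreal e <
      (\<integral>\<^sup>+u\<in>{s<..t}. ennreal ((norm (simple_value N q \<eta> u w - Hs u w))\<^sup>2) \<partial>lborel)} \<le> e"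
proof -
  \<comment> \<open>The quotient 16 \<epsilon> / e^2 is the Lenglart term for level e / 2 and square
    integral 4 \<epsilon>; it takes one half of e. The remaining errors, at most 4 \<epsilon> in
    probability and 3 \<epsilon> in distance, fit into the other half.\<close>
  define \<epsilon> where "\<epsilon> = min (e / 10) (e ^ 3 / 32)"
  have \<epsilon>: "0 < \<epsilon>" "10 * \<epsilon> \<le> e" "16 * \<epsilon> / e\<^sup>2 \<le> e / 2"
  proof -
    show "0 < \<epsilon>" "10 * \<epsilon> \<le> e" using assms by (auto simp: \<epsilon>_def)
    have "16 * \<epsilon> / e\<^sup>2 \<le> 16 * (e ^ 3 / 32) / e\<^sup>2"
      by (intro divide_right_mono mult_left_mono) (auto simp: \<epsilon>_def)
    also have "\<dots> = e / 2" using assms by (simp add: power2_eq_square power3_eq_cube)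
    finally show "16 * \<epsilon> / e\<^sup>2 \<le> e / 2" .
  qed
  define A1 where "A1 n = {w \<in> space M. \<epsilon> < norm (I (upper s t n w) w - I s w - (Y t w - Y s w))}" for n
  define A2 where "A2 n = {w \<in> space M. ennreal \<epsilon> <
    (\<integral>\<^sup>+u\<in>{clip s t w<..upper s t n w}. ennreal ((norm (H (max 0 u) w))\<^sup>2) \<partial>lborel)}" for n
  have "\<forall>\<^sub>F n in sequentially. prob (A1 n) < \<epsilon> \<and> prob (A2 n) < \<epsilon> \<and> K\<^sup>2 * h n < \<epsilon>"
    unfolding A1_def A2_def
    by (intro eventually_conj order_tendstoD(2)[OF prob_I_upper] order_tendstoD(2)[OF prob_gap_integral]
       order_tendstoD(2)[OF h_tendsto] \<epsilon>(1))
  then obtain n where n: "prob (A1 n) < \<epsilon>" "prob (A2 n) < \<epsilon>" "K\<^sup>2 * h n < \<epsilon>"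
    by (auto simp: eventually_sequentially)
  define R where "R = upper s t n"
  define r where "r l = s + h n * real l" for l
  have r: "s \<le> r l" for l using h_pos[of n] by (auto simp: r_def)
  have R_meas[measurable]: "R \<in> borel_measurable M" unfolding R_def by measurable
  obtain m p \<xi> where sp: "\<And>k. simple_process F (m k) (p k) (\<xi> k)"
    and lim1: "\<And>t. 0 \<le> t \<Longrightarrow> null_in_prob M (\<lambda>k w. \<integral>\<^sup>+ u\<in>{0..t}.
             ennreal ((norm (simple_value (m k) (p k) (\<xi> k) u w - H u w))\<^sup>2) \<partial>lborel)"
    and lim2: "\<And>t. 0 \<le> t \<Longrightarrow> null_in_prob M (\<lambda>k w.
             ennreal (norm (simple_integral W (m k) (p k) (\<xi> k) t w - I t w)))"
    using ito unfolding has_ito_integral_def by blast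
  have "\<forall>\<^sub>F k in sequentially. \<forall>l\<in>{..Suc n}. prob {w \<in> space M. ennreal \<epsilon> <
      ennreal (norm (simple_integral W (m k) (p k) (\<xi> k) (r l) w - I (r l) w))} < \<epsilon> / real (n + 2)"
  \<comment> \<open>The n + 2 possible values of the rounded time share the probability \<epsilon>
    equally.\<close>
  proof (intro eventually_ball_finite ballI)
    fix l
    show "\<forall>\<^sub>F k in sequentially. prob {w \<in> space M. ennreal \<epsilon> <
      ennreal (norm (simple_integral W (m k) (p k) (\<xi> k) (r l) w - I (r l) w))} < \<epsilon> / real (n + 2)"
      by (rule null_in_prob_eventually[OF lim2]) (use r[of l] st \<epsilon> in auto)
  qed simp
  moreover have "\<forall>\<^sub>F k in sequentially. prob {w \<in> space M. ennreal \<epsilon> <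
      (\<integral>\<^sup>+ u\<in>{0..t}. ennreal ((norm (simple_value (m k) (p k) (\<xi> k) u w - H u w))\<^sup>2) \<partial>lborel)} < \<epsilon>"
    by (rule null_in_prob_eventually[OF lim1]) (use st \<epsilon> in auto)
  ultimately have "\<forall>\<^sub>F k in sequentially. (\<forall>l\<in>{..Suc n}. prob {w \<in> space M. ennreal \<epsilon> <
      ennreal (norm (simple_integral W (m k) (p k) (\<xi> k) (r l) w - I (r l) w))} < \<epsilon> / real (n + 2)) \<and>
      prob {w \<in> space M. ennreal \<epsilon> <
      (\<integral>\<^sup>+ u\<in>{0..t}. ennreal ((norm (simple_value (m k) (p k) (\<xi> k) u w - H u w))\<^sup>2) \<partial>lborel)} < \<epsilon>"
    by eventually_elim auto
  then obtain k where k1: "\<And>l. l \<le> Suc n \<Longrightarrow> prob {w \<in> space M. ennreal \<epsilon> <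
      ennreal (norm (simple_integral W (m k) (p k) (\<xi> k) (r l) w - I (r l) w))} < \<epsilon> / real (n + 2)"
    and k2: "prob {w \<in> space M. ennreal \<epsilon> <
      (\<integral>\<^sup>+ u\<in>{0..t}. ennreal ((norm (simple_value (m k) (p k) (\<xi> k) u w - H u w))\<^sup>2) \<partial>lborel)} < \<epsilon>"
    by (auto simp: eventually_sequentially)
  define J where "J = simple_integral W (m k) (p k) (\<xi> k)"
  define V where "V = simple_value (m k) (p k) (\<xi> k)"
  define B where "B l = {w \<in> space M. \<epsilon> < norm (J (r l) w - I (r l) w)}" for l
  define A3 where "A3 = (\<Union>l\<in>{..Suc n}. B l)"
  define A4 where "A4 = {w \<in> space M. ennreal \<epsilon> <
      (\<integral>\<^sup>+ u\<in>{0..t}. ennreal ((norm (V u w - H (max 0 u) w))\<^sup>2) \<partial>lborel)}"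
  have \<xi>_meas: "i < m k \<Longrightarrow> \<xi> k i \<in> borel_measurable M" for i
    using sp[of k] F_measurable_M[of "\<xi> k i" "p k i" borel] by (auto simp: simple_process_def)
  have V_joint: "(\<lambda>(u, w). V u w) \<in> borel_measurable (borel \<Otimes>\<^sub>M M)"
    unfolding V_def by (rule simple_value_joint_measurable[OF \<xi>_meas])
  have V_meas[measurable (raw)]: "(\<lambda>x. V (f x) (g x)) \<in> borel_measurable L"
    if "f \<in> borel_measurable L" "g \<in> measurable L M" for f g and L :: "'z measure"
    using measurable_compose[OF measurable_Pair[OF that] V_joint] by simp
  have V_meas1[measurable]: "w \<in> space M \<Longrightarrow> (\<lambda>u. V u w) \<in> borel_measurable borel" for w
    using measurable_compose[OF measurable_Pair2' V_joint, of w] by simp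
  have H_meas1[measurable]: "w \<in> space M \<Longrightarrow> (\<lambda>u. H (max 0 u) w) \<in> borel_measurable borel" for w
    using measurable_compose[OF measurable_Pair2' H_joint, of w] by simp
  have J_meas: "0 \<le> t \<Longrightarrow> J t \<in> borel_measurable M" for t
    unfolding J_def by (rule simple_integral_measurable[OF sp])
  have B_ev[measurable]: "B l \<in> events" for l
  proof -
    have [measurable]: "J (r l) \<in> borel_measurable M" "I (r l) \<in> borel_measurable M"
      using J_meas I_measurable r[of l] st by auto
    show ?thesis unfolding B_def by measurable
  qed
  have A1_ev[measurable]: "A1 n \<in> events"
  proof -
    have [measurable]: "I s \<in> borel_measurable M" "Y t \<in> borel_measurable M" "Y s \<in> borel_measurable M"
      using I_measurable Y_measurable st by auto
    show ?thesis unfolding A1_def using I_upper_measurable[of n] by measurable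
  qed
  have A2_ev[measurable]: "A2 n \<in> events" unfolding A2_def by measurable
  have A3_ev[measurable]: "A3 \<in> events" unfolding A3_def by measurable
  have A4_ev[measurable]: "A4 \<in> events"
  proof -
    have "(\<lambda>w. \<integral>\<^sup>+ u. ennreal ((norm (V u w - H (max 0 u) w))\<^sup>2) * indicator {0..t} u \<partial>lborel) \<in> borel_measurable M"
      by measurable
    then show ?thesis unfolding A4_def by measurable
  qed
  have P3: "prob A3 \<le> \<epsilon>"
  proof -
    have "prob A3 \<le> (\<Sum>l\<in>{..Suc n}. prob (B l))"
      unfolding A3_def by (rule finite_measure_subadditive_finite) auto
    also have "\<dots> \<le> (\<Sum>l\<in>{..Suc n}. \<epsilon> / real (n + 2))"
      using k1 \<epsilon> by (intro sum_mono) (auto simp: B_def J_def ennreal_less_iff less_imp_le)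
    also have "\<dots> = \<epsilon>" by simp
    finally show ?thesis .
  qed
  have P4: "prob A4 \<le> \<epsilon>"
  proof -
    have "A4 = {w \<in> space M. ennreal \<epsilon> <
      (\<integral>\<^sup>+ u\<in>{0..t}. ennreal ((norm (V u w - H u w))\<^sup>2) \<partial>lborel)}"
    proof -
      have "(\<integral>\<^sup>+ u\<in>{0..t}. ennreal ((norm (V u w - H (max 0 u) w))\<^sup>2) \<partial>lborel) =
         (\<integral>\<^sup>+ u\<in>{0..t}. ennreal ((norm (V u w - H u w))\<^sup>2) \<partial>lborel)" for w
        by (rule nn_integral_cong) (auto simp: indicator_def)
      then show ?thesis unfolding A4_def by simp
    qed
    then show ?thesis using k2 unfolding V_def by simp
  qed
  \<comment> \<open>The break points of the simple process make \<open>V\<close> constant on cells.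
    The rounding points ensure that each cell lies entirely before or entirely after
    \<open>R w\<close>, so that switching off respects the grid.\<close>
  obtain N q where q: "q 0 = s" "q N = t" "\<forall>i<N. q i < q (Suc i)"
    and gap: "\<forall>c\<in>(p k ` {..m k} \<union> r ` {..Suc n}). \<forall>i<N. c \<le> q i \<or> q (Suc i) \<le> c"
    using exists_grid[of "p k ` {..m k} \<union> r ` {..Suc n}" s t] st by auto
  have gap_p: "\<forall>l\<le>m k. p k l \<le> q i \<or> q (Suc i) \<le> p k l" if "i < N" for i
    using gap that by auto
  have gap_R: "R w \<le> q i \<or> q (Suc i) \<le> R w" if "i < N" for i w
    using gap that upper_grid[of n w] unfolding R_def r_def by auto
  have q_ge: "s \<le> q i" if "i \<le> N" for i using grid_mono[OF q(3), of 0 i] that q by auto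
  have q_lt: "q i < t" if "i < N" for i using grid_mono[OF q(3), of "Suc i" N] that q by fastforce
  define \<eta>0 where "\<eta>0 i w = (if q i < R w then V (q (Suc i)) w else 0)" for i w
  define \<eta> where "\<eta> i w = closest_point (cball 0 K) (\<eta>0 i w)" for i w
  define \<rho> where "\<rho> i w = \<eta>0 i w - \<eta> i w" for i w
  obtain C where C: "\<And>u w. w \<in> space M \<Longrightarrow> norm (V u w) \<le> C"
    using simple_value_bounded[OF sp[of k]] unfolding V_def by blast
  have C0: "0 \<le> C" using C norm_ge_zero order_trans not_empty by blast
  have \<eta>0_meas: "\<eta>0 i \<in> borel_measurable (F (q i))" if "i < N" for i
  proof -
    have [measurable]: "V (q (Suc i)) \<in> borel_measurable (F (q i))"
      unfolding V_def by (rule simple_value_measurable[OF sp gap_p[OF that]]) (use q that in auto)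
    have "{w \<in> space M. q i < R w} \<in> sets (F (q i))"
      unfolding R_def by (rule upper_event) (use q_ge q_lt that in auto)
    then have [measurable]: "Measurable.pred (F (q i)) (\<lambda>w. q i < R w)"
      by (simp add: Measurable.pred_def)
    show ?thesis unfolding \<eta>0_def by measurable
  qed
  have \<eta>_meas: "\<eta> i \<in> borel_measurable (F (q i))" if "i < N" for i
    unfolding \<eta>_def by (rule borel_measurable_closest_point_cball[OF K_nonneg \<eta>0_meas[OF that]])
  have bs: "bounded_simple N q \<eta> K"
    unfolding bounded_simple_def using q st \<eta>_meas norm_closest_point_cball[OF K_nonneg]
    by (auto simp: \<eta>_def)
  have \<rho>_meas: "\<rho> i \<in> borel_measurable (F (q i))" if "i < N" for i
    using \<eta>0_meas[OF that] \<eta>_meas[OF that] unfolding \<rho>_def by measurable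
  have \<rho>_le: "norm (\<rho> i w) \<le> C + K" if "w \<in> space M" for i w
  proof -
    have "norm (\<eta>0 i w) \<le> C" using C[OF that] C0 by (auto simp: \<eta>0_def)
    moreover have "norm (\<eta> i w) \<le> K" unfolding \<eta>_def by (rule norm_closest_point_cball[OF K_nonneg])
    ultimately show ?thesis unfolding \<rho>_def using norm_triangle_ineq4[of "\<eta>0 i w" "\<eta> i w"] by linarith
  qed
  have bs\<rho>: "bounded_simple N q \<rho> (C + K)"
    unfolding bounded_simple_def using q st \<rho>_meas \<rho>_le by auto
  \<comment> \<open>\<open>R w\<close> is a grid point, so switching off there means summing the
    first j cells, which is an increment of the simple integral.\<close>
  have T0: "transform W q \<eta>0 N w = J (R w) w - J s w" for w
  proof -
    have "\<exists>j\<le>N. q j = R w"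
    proof (cases "R w = s")
      case False
      obtain l where l: "l \<le> Suc n" "R w = r l" using upper_grid[of n w] unfolding R_def r_def by auto
      have "h n * real l \<le> h n * real (Suc n)" using l h_pos[of n] by (intro mult_left_mono) auto
      also have "\<dots> = t - s" using st by (simp add: mesh_def)
      finally have "R w \<le> t" using l by (simp add: r_def)
      moreover have "s < R w" using False upper_ge[of n w] by (auto simp: R_def)
      ultimately obtain j where "j < N" "q j < R w" "R w \<le> q (Suc j)"
        using grid_cell[of q "R w" N] q by auto
      then show ?thesis using gap_R[of j w] by (intro exI[of _ "Suc j"]) auto
    qed (use q in auto)
    then obtain j where j: "j \<le> N" "q j = R w" by auto
    have lt: "q i < R w \<longleftrightarrow> i < j" if "i < N" for i
    proof (cases "i < j")
      case True
      then have "q (Suc i) \<le> q j" using grid_mono[OF q(3), of "Suc i" j] j by auto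
      then show ?thesis using True j q that by fastforce
    next
      case False
      then show ?thesis using grid_mono[OF q(3), of j i] j that by auto
    qed
    have "transform W q \<eta>0 N w = (\<Sum>i<N. if i < j then V (q (Suc i)) w *v (W (q (Suc i)) w - W (q i) w) else 0)"
      unfolding transform_def by (rule sum.cong) (auto simp: \<eta>0_def lt)
    also have "\<dots> = (\<Sum>i\<in>{..<N} \<inter> {i. i < j}. V (q (Suc i)) w *v (W (q (Suc i)) w - W (q i) w))"
      by (simp add: sum.inter_restrict)
    also have "{..<N} \<inter> {i. i < j} = {..<j}" using j by auto
    also have "(\<Sum>i<j. V (q (Suc i)) w *v (W (q (Suc i)) w - W (q i) w)) = transform W q (\<lambda>i. V (q (Suc i))) j w"
      by (simp add: transform_def)
    also have "\<dots> = J (q j) w - J (q 0) w"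
      unfolding V_def J_def
      by (rule simple_integral_refine[OF q(3), symmetric]) (use sp[of k] gap_p j in \<open>auto simp: simple_process_def\<close>)
    finally show ?thesis using j q by simp
  qed
  have T: "transform W q \<eta> N w = J (R w) w - J s w - transform W q \<rho> N w" for w
  proof -
    have "transform W q \<eta> N w + transform W q \<rho> N w = transform W q \<eta>0 N w"
      unfolding transform_add by (simp add: \<rho>_def)
    then show ?thesis using T0[of w] by (simp add: algebra_simps)
  qed
  have cell: "\<exists>i<N. simple_value N q \<eta> u w = \<eta> i w \<and> simple_value N q \<rho> u w = \<rho> i w \<and>
      \<eta>0 i w = (if u \<le> R w then V u w else 0)" if "s < u" "u \<le> t" for u w
  proof -
    obtain i where i: "i < N" "q i < u" "u \<le> q (Suc i)" using grid_cell[of q u N] q \<open>s < u\<close> \<open>u \<le> t\<close> by auto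
    have "V u w = V (q (Suc i)) w" unfolding V_def by (rule simple_value_gap[OF gap_p]) (use i in auto)
    moreover have "q i < R w \<longleftrightarrow> u \<le> R w" using gap_R[OF i(1), of w] i by auto
    ultimately show ?thesis
      using i simple_value_cell[OF q(3) i] by (intro exI[of _ i]) (auto simp: \<eta>0_def)
  qed
  let ?D = "\<lambda>w u. (norm (V u w - H (max 0 u) w))\<^sup>2"
  \<comment> \<open>Three regimes. Up to \<tau> the target \<open>H\<close> lies in the ball and
    truncation costs no more than the error \<open>?D\<close>. Between \<tau> and \<open>R w\<close>
    the target is 0: the truncated value is bounded by \<open>K\<close>, and what is cut off by the
    size of \<open>V\<close>, hence by that of \<open>H\<close> plus the error. After
    \<open>R w\<close> everything is 0.\<close>
  have key: "(norm (simple_value N q \<rho> u w))\<^sup>2 \<le> 2 * ?D w u + 2 * ((norm (H (max 0 u) w))\<^sup>2 * indicator {clip s t w<..R w} u) \<and>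
      (norm (simple_value N q \<eta> u w - Hs u w))\<^sup>2 \<le> ?D w u + K\<^sup>2 * indicator {clip s t w<..R w} u"
    if w: "w \<in> space M" and H: "\<forall>u>0. Hs u w = (if u \<le> \<tau> w then H u w else 0)" and u: "s < u" "u \<le> t" for u w
  proof -
    obtain i where i: "simple_value N q \<eta> u w = \<eta> i w" "simple_value N q \<rho> u w = \<rho> i w"
      "\<eta>0 i w = (if u \<le> R w then V u w else 0)" using cell[OF u] by blast
    have u0: "0 < u" "max 0 u = u" using u st by auto
    show ?thesis
    proof (cases "u \<le> \<tau> w")
      case True
      then have "u \<le> clip s t w" using u by (auto simp: clip_def)
      then have uR: "u \<le> R w" using upper_bounds(1)[of w n] unfolding R_def by linarith
      have Hu: "Hs u w = H u w" using H u0 True by auto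
      then have nH: "norm (H u w) \<le> K" using Hs_bound[OF w, of u] by simp
      have "norm (\<rho> i w) \<le> norm (V u w - H u w)" "norm (\<eta> i w - H u w) \<le> norm (V u w - H u w)"
        using closest_point_cball_le[OF nH, of "V u w"] i(3) uR
        by (auto simp: \<rho>_def \<eta>_def norm_minus_commute)
      then have "(norm (\<rho> i w))\<^sup>2 \<le> (norm (V u w - H u w))\<^sup>2" "(norm (\<eta> i w - H u w))\<^sup>2 \<le> (norm (V u w - H u w))\<^sup>2"
        by (auto intro: power_mono)
      moreover have "0 \<le> (norm (V u w - H u w))\<^sup>2"
        "0 \<le> 2 * ((norm (H u w))\<^sup>2 * indicator {clip s t w<..R w} u)" "0 \<le> K\<^sup>2 * indicator {clip s t w<..R w} u"
        by auto
      ultimately show ?thesis unfolding i u0 Hu by linarith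
    next
      case False
      then have cl: "clip s t w < u" using u by (auto simp: clip_def)
      have Hu: "Hs u w = 0" using H u0 False by auto
      show ?thesis
      proof (cases "u \<le> R w")
        case True
        have "norm (\<rho> i w) \<le> norm (V u w)"
          using closest_point_cball_le(1)[of 0 K "V u w"] K_nonneg i(3) True
          by (auto simp: \<rho>_def \<eta>_def norm_minus_commute)
        then have "(norm (\<rho> i w))\<^sup>2 \<le> (norm (V u w))\<^sup>2" by (auto intro: power_mono)
        also have "\<dots> \<le> (norm (V u w - H u w) + norm (H u w))\<^sup>2"
          using norm_triangle_sub[of "V u w" "H u w"] by (intro power_mono) (auto simp: add.commute)
        also have "\<dots> \<le> 2 * (norm (V u w - H u w))\<^sup>2 + 2 * (norm (H u w))\<^sup>2"
          using sum_squares_bound[of "norm (V u w - H u w)" "norm (H u w)"] by (simp add: power2_sum)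
        finally have 1: "(norm (\<rho> i w))\<^sup>2 \<le> 2 * (norm (V u w - H u w))\<^sup>2 + 2 * (norm (H u w))\<^sup>2" .
        have "(norm (\<eta> i w))\<^sup>2 \<le> K\<^sup>2"
          unfolding \<eta>_def by (intro power_mono norm_closest_point_cball K_nonneg) auto
        then have "(norm (\<eta> i w))\<^sup>2 \<le> (norm (V u w - H u w))\<^sup>2 + K\<^sup>2"
          using zero_le_power2[of "norm (V u w - H u w)"] by linarith
        then show ?thesis using 1 cl True unfolding i u0 Hu by simp
      next
        case uR: False
        have "\<eta>0 i w = 0" using i(3) uR by simp
        moreover have "closest_point (cball 0 K) 0 = (0 :: real ^ 'k ^ 'n)"
          by (rule closest_point_self) (use K_nonneg in auto)
        ultimately have "\<eta> i w = 0" "\<rho> i w = 0" by (auto simp: \<rho>_def \<eta>_def)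
        then show ?thesis unfolding i u0 Hu by simp
      qed
    qed
  qed
  have IV: "(\<integral>\<^sup>+u\<in>{s<..t}. ennreal (?D w u) \<partial>lborel) \<le> ennreal \<epsilon>" if "w \<in> space M" "w \<notin> A4" for w
  proof -
    have "(\<integral>\<^sup>+u\<in>{s<..t}. ennreal (?D w u) \<partial>lborel) \<le> (\<integral>\<^sup>+u\<in>{0..t}. ennreal (?D w u) \<partial>lborel)"
      using st by (intro nn_integral_mono mult_left_mono) (auto simp: indicator_def)
    also have "\<dots> \<le> ennreal \<epsilon>" using that by (auto simp: A4_def not_less)
    finally show ?thesis .
  qed
  have \<rho>_int: "(\<Sum>i<N. (norm (\<rho> i w))\<^sup>2 * (q (Suc i) - q i)) \<le> 4 * \<epsilon>"
    if w: "w \<in> space M" "w \<notin> A2 n" "w \<notin> A4" and H: "\<forall>u>0. Hs u w = (if u \<le> \<tau> w then H u w else 0)" for w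
  proof -
    have [measurable]: "(\<lambda>u. V u w) \<in> borel_measurable borel" "(\<lambda>u. H (max 0 u) w) \<in> borel_measurable borel"
      using w by auto
    have "ennreal (\<Sum>i<N. (norm (\<rho> i w))\<^sup>2 * (q (Suc i) - q i)) =
       (\<Sum>i<N. ennreal ((norm (\<rho> i w))\<^sup>2) * ennreal (q (Suc i) - q i))"
      using q(3) by (subst sum_ennreal[symmetric]) (auto simp: ennreal_mult' less_imp_le)
    also have "\<dots> = (\<integral>\<^sup>+u\<in>{q 0<..q N}. ennreal ((norm (simple_value N q \<rho> u w))\<^sup>2) \<partial>lborel)"
      by (rule nn_integral_simple_value[OF q(3), symmetric])
    also have "\<dots> = (\<integral>\<^sup>+u\<in>{s<..t}. ennreal ((norm (simple_value N q \<rho> u w))\<^sup>2) \<partial>lborel)"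
      using q by simp
    also have "\<dots> \<le> (\<integral>\<^sup>+u. 2 * (ennreal (?D w u) * indicator {s<..t} u) +
        2 * (ennreal ((norm (H (max 0 u) w))\<^sup>2) * indicator {clip s t w<..R w} u) \<partial>lborel)"
    proof (rule nn_integral_mono)
      fix u
      show "ennreal ((norm (simple_value N q \<rho> u w))\<^sup>2) * indicator {s<..t} u \<le>
        2 * (ennreal (?D w u) * indicator {s<..t} u) +
        2 * (ennreal ((norm (H (max 0 u) w))\<^sup>2) * indicator {clip s t w<..R w} u)"
      proof (cases "s < u \<and> u \<le> t")
        case True
        have "ennreal ((norm (simple_value N q \<rho> u w))\<^sup>2) \<le>
          ennreal (2 * ?D w u + 2 * ((norm (H (max 0 u) w))\<^sup>2 * indicator {clip s t w<..R w} u))"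
          using key[OF w(1) H, of u] True by (intro ennreal_leI) auto
        also have "\<dots> = 2 * ennreal (?D w u) + 2 * (ennreal ((norm (H (max 0 u) w))\<^sup>2) * indicator {clip s t w<..R w} u)"
          by (auto simp: ennreal_plus ennreal_mult' indicator_def)
        finally show ?thesis using True by simp
      qed simp
    qed
    also have "\<dots> = 2 * (\<integral>\<^sup>+u\<in>{s<..t}. ennreal (?D w u) \<partial>lborel) +
        2 * (\<integral>\<^sup>+u\<in>{clip s t w<..R w}. ennreal ((norm (H (max 0 u) w))\<^sup>2) \<partial>lborel)"
      by (simp add: nn_integral_add nn_integral_cmult)
    also have "\<dots> \<le> 2 * ennreal \<epsilon> + 2 * ennreal \<epsilon>"
      using IV[OF w(1) w(3)] w by (intro add_mono mult_left_mono) (auto simp: A2_def R_def not_less)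
    also have "\<dots> = ennreal (4 * \<epsilon>)"
      using \<epsilon> by (simp add: ennreal_mult' flip: distrib_right)
    finally show ?thesis using \<epsilon> by (subst (asm) ennreal_le_iff) auto
  qed
  have \<eta>_int: "(\<integral>\<^sup>+u\<in>{s<..t}. ennreal ((norm (simple_value N q \<eta> u w - Hs u w))\<^sup>2) \<partial>lborel) \<le> ennreal e"
    if w: "w \<in> space M" "w \<notin> A4" and H: "\<forall>u>0. Hs u w = (if u \<le> \<tau> w then H u w else 0)" for w
  proof -
    have [measurable]: "(\<lambda>u. V u w) \<in> borel_measurable borel" "(\<lambda>u. H (max 0 u) w) \<in> borel_measurable borel"
      using w by auto
    have "(\<integral>\<^sup>+u\<in>{s<..t}. ennreal ((norm (simple_value N q \<eta> u w - Hs u w))\<^sup>2) \<partial>lborel) \<le>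
      (\<integral>\<^sup>+u. ennreal (?D w u) * indicator {s<..t} u + ennreal (K\<^sup>2) * indicator {clip s t w<..R w} u \<partial>lborel)"
    proof (rule nn_integral_mono)
      fix u
      show "ennreal ((norm (simple_value N q \<eta> u w - Hs u w))\<^sup>2) * indicator {s<..t} u \<le>
        ennreal (?D w u) * indicator {s<..t} u + ennreal (K\<^sup>2) * indicator {clip s t w<..R w} u"
      proof (cases "s < u \<and> u \<le> t")
        case True
        have "ennreal ((norm (simple_value N q \<eta> u w - Hs u w))\<^sup>2) \<le>
          ennreal (?D w u + K\<^sup>2 * indicator {clip s t w<..R w} u)"
          using key[OF w(1) H, of u] True by (intro ennreal_leI) auto
        also have "\<dots> = ennreal (?D w u) + ennreal (K\<^sup>2) * indicator {clip s t w<..R w} u"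
          by (auto simp: ennreal_plus ennreal_mult' indicator_def)
        finally show ?thesis using True by simp
      qed simp
    qed
    also have "\<dots> = (\<integral>\<^sup>+u\<in>{s<..t}. ennreal (?D w u) \<partial>lborel) + ennreal (K\<^sup>2) * ennreal (R w - clip s t w)"
      using upper_bounds(1)[of w n] by (simp add: nn_integral_add nn_integral_cmult R_def)
    also have "\<dots> \<le> ennreal \<epsilon> + ennreal (K\<^sup>2 * h n)"
      using IV[OF w] upper_bounds[of w n]
      by (intro add_mono) (auto simp: ennreal_mult'[symmetric] R_def intro!: ennreal_leI mult_left_mono)
    also have "\<dots> \<le> ennreal \<epsilon> + ennreal \<epsilon>"
      using n(3) by (intro add_mono ennreal_leI) auto
    also have "\<dots> \<le> ennreal e"
      using \<epsilon> by (auto simp: ennreal_plus[symmetric] simp del: ennreal_plus intro!: ennreal_leI)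
    finally show ?thesis .
  qed
  have tm[measurable]: "transform W q \<eta> N \<in> borel_measurable M" "transform W q \<rho> N \<in> borel_measurable M"
    using transform_measurable[OF bs order.refl] transform_measurable[OF bs\<rho> order.refl] F_measurable_M by blast+
  define A5 where "A5 = {w \<in> space M. e / 2 < norm (transform W q \<rho> N w)}"
  have A5_ev[measurable]: "A5 \<in> events" unfolding A5_def by measurable
  have \<rho>M: "i < N \<Longrightarrow> \<rho> i \<in> borel_measurable M" for i using \<rho>_meas F_measurable_M by blast
  have P5: "prob A5 \<le> e / 2 + 2 * \<epsilon>"
  proof -
    have "prob A5 \<le> 4 * \<epsilon> / (e / 2)\<^sup>2 + prob {w \<in> space M. 4 * \<epsilon> < (\<Sum>i<N. (norm (\<rho> i w))\<^sup>2 * (q (Suc i) - q i))}"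
      unfolding A5_def by (rule transform_lenglart[OF bs\<rho>]) (use assms \<epsilon> in auto)
    moreover have "prob {w \<in> space M. 4 * \<epsilon> < (\<Sum>i<N. (norm (\<rho> i w))\<^sup>2 * (q (Suc i) - q i))} \<le> prob (A2 n \<union> A4)"
    proof (rule finite_measure_mono_AE)
      show "AE w in M. w \<in> {w \<in> space M. 4 * \<epsilon> < (\<Sum>i<N. (norm (\<rho> i w))\<^sup>2 * (q (Suc i) - q i))} \<longrightarrow> w \<in> A2 n \<union> A4"
        using Hs_eq
      proof eventually_elim
        case (elim w)
        then show ?case using \<rho>_int[of w] by force
      qed
    qed measurable
    moreover have "prob (A2 n \<union> A4) \<le> prob (A2 n) + prob A4"
      by (rule measure_Un_le) auto
    moreover have "4 * \<epsilon> / (e / 2)\<^sup>2 = 16 * \<epsilon> / e\<^sup>2" by (simp add: power_divide)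
    ultimately show ?thesis using P4 n(2) \<epsilon>(3) by linarith
  qed
  have [measurable]: "Y t \<in> borel_measurable M" "Y s \<in> borel_measurable M"
    using Y_measurable st by auto
  have "prob {w \<in> space M. e < norm (transform W q \<eta> N w - (Y t w - Y s w))} \<le> prob (A1 n \<union> A3 \<union> A5)"
  proof (rule finite_measure_mono)
    show "{w \<in> space M. e < norm (transform W q \<eta> N w - (Y t w - Y s w))} \<subseteq> A1 n \<union> A3 \<union> A5"
    proof (rule subsetI, rule ccontr)
      fix w assume w: "w \<in> {w \<in> space M. e < norm (transform W q \<eta> N w - (Y t w - Y s w))}"
        and no: "w \<notin> A1 n \<union> A3 \<union> A5"
      obtain l where l: "l \<le> Suc n" "R w = r l" using upper_grid[of n w] unfolding R_def r_def by auto
      have 1: "norm (J (R w) w - I (R w) w) \<le> \<epsilon>"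
        using no l w by (auto simp: A3_def B_def not_less)
      have "w \<notin> B 0" using no by (auto simp: A3_def)
      then have 2: "norm (J s w - I s w) \<le> \<epsilon>" using w by (auto simp: B_def r_def not_less)
      have 3: "norm (I (R w) w - I s w - (Y t w - Y s w)) \<le> \<epsilon>"
        using no w by (auto simp: A1_def R_def not_less)
      have 4: "norm (transform W q \<rho> N w) \<le> e / 2" using no w by (auto simp: A5_def not_less)
      have "transform W q \<eta> N w - (Y t w - Y s w) =
         ((J (R w) w - I (R w) w) - (J s w - I s w)) + ((I (R w) w - I s w - (Y t w - Y s w)) - transform W q \<rho> N w)"
        unfolding T by (simp add: algebra_simps)
      also have "norm \<dots> \<le> (\<epsilon> + \<epsilon>) + (\<epsilon> + e / 2)"
        using 1 2 3 4 norm_triangle_ineq4[of "J (R w) w - I (R w) w" "J s w - I s w"]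
          norm_triangle_ineq4[of "I (R w) w - I s w - (Y t w - Y s w)" "transform W q \<rho> N w"]
          norm_triangle_ineq[of "(J (R w) w - I (R w) w) - (J s w - I s w)" "(I (R w) w - I s w - (Y t w - Y s w)) - transform W q \<rho> N w"]
        by linarith
      finally show False using w \<epsilon> by auto
    qed
  qed measurable
  also have "\<dots> \<le> prob (A1 n) + prob A3 + prob A5"
    by (rule order_trans[OF measure_Un_le add_right_mono[OF measure_Un_le]]) auto
  also have "\<dots> \<le> e" using n(1) P3 P5 \<epsilon> by linarith
  finally have 1: "prob {w \<in> space M. e < norm (transform W q \<eta> N w - (Y t w - Y s w))} \<le> e" .
  have "prob {w \<in> space M. ennreal e <
      (\<integral>\<^sup>+u\<in>{s<..t}. ennreal ((norm (simple_value N q \<eta> u w - Hs u w))\<^sup>2) \<partial>lborel)} \<le> prob A4"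
  proof (rule finite_measure_mono_AE)
    show "AE w in M. w \<in> {w \<in> space M. ennreal e <
      (\<integral>\<^sup>+u\<in>{s<..t}. ennreal ((norm (simple_value N q \<eta> u w - Hs u w))\<^sup>2) \<partial>lborel)} \<longrightarrow> w \<in> A4"
      using Hs_eq
    proof eventually_elim
      case (elim w)
      then show ?case using \<eta>_int[of w] by (auto simp: not_less[symmetric])
    qed
  qed measurable
  also have "\<dots> \<le> e" using P4 \<epsilon> by linarith
  finally show ?thesis using bs q 1 by blast
qed

end

end

section \<open>Time integrals of bounded, jointly measurable processes\<close>

lemma time_integral_measurable:
  fixes B :: "real \<Rightarrow> 'a \<Rightarrow> 'b::{banach, second_countable_topology}"
  assumes B: "(\<lambda>(u, w). B u w) \<in> borel_measurable (borel \<Otimes>\<^sub>M M)"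
  shows "(\<lambda>w. LINT u:{s<..t}|lborel. B u w) \<in> borel_measurable M"
  unfolding set_lebesgue_integral_def
proof (rule lborel.borel_measurable_lebesgue_integral)
  have "(\<lambda>p. (snd p, fst p)) \<in> measurable (M \<Otimes>\<^sub>M lborel) (borel \<Otimes>\<^sub>M M)"
    by (rule measurable_Pair) (simp_all add: measurable_lborel1)
  from measurable_compose[OF this B]
  have "(\<lambda>p. B (snd p) (fst p)) \<in> borel_measurable (M \<Otimes>\<^sub>M lborel)" by simp
  moreover have "(\<lambda>p. indicat_real {s<..t} (snd p)) \<in> borel_measurable (M \<Otimes>\<^sub>M lborel)"
    by (rule measurable_compose[OF measurable_snd]) simp
  ultimately show "(\<lambda>(w, u). indicat_real {s<..t} u *\<^sub>R B u w) \<in> borel_measurable (M \<Otimes>\<^sub>M lborel)"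
    unfolding split_beta' by (rule borel_measurable_scaleR[rotated])
qed

context prob_space
begin

context
  fixes f :: "real \<Rightarrow> 'a \<Rightarrow> real" and s t C :: real
  assumes joint: "(\<lambda>(u, w). f u w) \<in> borel_measurable (borel \<Otimes>\<^sub>M M)"
    and bound: "\<And>u w. s < u \<Longrightarrow> u \<le> t \<Longrightarrow> w \<in> space M \<Longrightarrow> \<bar>f u w\<bar> \<le> C"
    and le: "s \<le> t"
begin

lemma joint_lborel [measurable]: "(\<lambda>(u, w). f u w) \<in> borel_measurable (lborel \<Otimes>\<^sub>M M)"
proof -
  have "borel_measurable (lborel \<Otimes>\<^sub>M M) = borel_measurable (borel \<Otimes>\<^sub>M M)"
    by (intro measurable_cong_sets sets_pair_measure_cong) auto
  then show ?thesis using joint by simp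
qed

lemma time_integrable_pair:
  "integrable (lborel \<Otimes>\<^sub>M M) (\<lambda>(u, w). indicator {s<..t} u * f u w)"
proof (rule integrableI_bounded_set[where A = "{s<..t} \<times> space M" and B = C])
  have "emeasure (lborel \<Otimes>\<^sub>M M) ({s<..t} \<times> space M) = emeasure lborel {s<..t} * emeasure M (space M)"
    by (rule emeasure_pair_measure_Times) auto
  then show "emeasure (lborel \<Otimes>\<^sub>M M) ({s<..t} \<times> space M) < \<infinity>"
    using le by (simp add: emeasure_space_1)
  show "(\<lambda>(u, w). indicator {s<..t} u * f u w) \<in> borel_measurable (lborel \<Otimes>\<^sub>M M)"
    using joint_lborel by measurable
qed (use bound in \<open>auto intro!: AE_I2 simp: indicator_def space_pair_measure\<close>)

lemma time_section_measurable: "w \<in> space M \<Longrightarrow> (\<lambda>u. f u w) \<in> borel_measurable borel"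
  using measurable_compose[OF measurable_Pair2' joint, of w] by simp

lemma time_integrable: "w \<in> space M \<Longrightarrow> set_integrable lborel {s<..t} (\<lambda>u. f u w)"
  unfolding set_integrable_def
  by (rule integrableI_bounded_set[where A = "{s<..t}" and B = C])
     (use bound le time_section_measurable in \<open>auto intro!: AE_I2 simp: indicator_def\<close>)

lemma time_integral_bound:
  assumes w: "w \<in> space M"
  shows "\<bar>LINT u:{s<..t}|lborel. f u w\<bar> \<le> C * (t - s)"
proof -
  have "\<bar>LINT u:{s<..t}|lborel. f u w\<bar> \<le> (LINT u:{s<..t}|lborel. \<bar>f u w\<bar>)"
    using set_integral_norm_bound[OF time_integrable[OF w]] by simp
  also have "\<dots> \<le> (LINT u:{s<..t}|lborel. C)"
    by (rule set_integral_mono[OF set_integrable_abs[OF time_integrable[OF w]]])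
       (use bound w le in \<open>auto simp: set_integrable_def\<close>)
  also have "\<dots> = C * (t - s)" using le by (simp add: set_integral_const)
  finally show ?thesis .
qed

lemma time_integral_integrable: "integrable M (\<lambda>w. LINT u:{s<..t}|lborel. f u w)"
  by (rule integrable_const_bound[where B = "C * (t - s)"])
     (use time_integral_bound time_integral_measurable[OF joint] in \<open>auto intro!: AE_I2\<close>)

lemma expectation_time_integral_le:
  assumes "\<And>u. s < u \<Longrightarrow> u \<le> t \<Longrightarrow> expectation (f u) \<le> c"
  shows "expectation (\<lambda>w. LINT u:{s<..t}|lborel. f u w) \<le> c * (t - s)"
proof -
  interpret P: pair_sigma_finite lborel M ..
  have "expectation (\<lambda>w. LINT u:{s<..t}|lborel. f u w) = (LINT u|lborel. expectation (\<lambda>w. indicator {s<..t} u * f u w))"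
    using P.Fubini_integral[OF time_integrable_pair]
    by (simp add: set_lebesgue_integral_def)
  also have "\<dots> \<le> (LINT u:{s<..t}|lborel. c)"
    unfolding set_lebesgue_integral_def
  proof (rule integral_mono)
    show "integrable lborel (\<lambda>u. expectation (\<lambda>w. indicator {s<..t} u * f u w))"
      using P.integrable_fst'[OF time_integrable_pair] by simp
    show "expectation (\<lambda>w. indicator {s<..t} u * f u w) \<le> indicator {s<..t} u *\<^sub>R c" for u
      using assms[of u] by (auto simp: indicator_def)
  qed (use le in auto)
  also have "\<dots> = c * (t - s)" using le by (simp add: set_integral_const)
  finally show ?thesis .
qed

end

lemma integrable_indicator_event: "A \<in> events \<Longrightarrow> integrable M (indicator A :: 'a \<Rightarrow> real)"
  by (rule integrable_const_bound[where B = 1]) auto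

lemma integrable_bounded:
  assumes "f \<in> borel_measurable M" "\<And>w. w \<in> space M \<Longrightarrow> norm (f w) \<le> C"
  shows "integrable M (f :: 'a \<Rightarrow> real)"
proof (rule integrable_const_bound[where B = C])
  show "AE w in M. norm (f w) \<le> C" using assms(2) by (rule AE_I2)
qed fact

lemma expectation_le_of_prob:
  fixes f :: "'a \<Rightarrow> real"
  assumes "f \<in> borel_measurable M" "\<And>w. w \<in> space M \<Longrightarrow> f w \<le> C" "\<And>w. w \<in> space M \<Longrightarrow> 0 \<le> f w"
    "0 \<le> C" "0 \<le> a" "prob {w \<in> space M. a < f w} \<le> e"
  shows "expectation f \<le> a + C * e"
proof -
  define B where "B = {w \<in> space M. a < f w}"
  have B: "B \<in> events" unfolding B_def using assms(1) by measurable
  have "expectation f \<le> expectation (\<lambda>w. a + C * indicator B w)"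
  proof (rule integral_mono)
    show "integrable M f"
    proof (rule integrable_const_bound[where B = C])
      show "AE w in M. norm (f w) \<le> C"
        using assms(2,3) by (intro AE_I2) simp
    qed fact
    show "f w \<le> a + C * indicator B w" if "w \<in> space M" for w
      using assms(2)[OF that] assms(5) that by (auto simp: indicator_def B_def)
    show "integrable M (\<lambda>w. a + C * indicator B w)"
      using integrable_indicator_event[OF B] by simp
  qed
  also have "\<dots> = a + C * prob B" using B integrable_indicator_event[OF B]
    by (subst Bochner_Integration.integral_add) (auto simp: prob_space)
  also have "\<dots> \<le> a + C * e" using assms(4,6) by (intro add_left_mono mult_left_mono) (auto simp: B_def)
  finally show ?thesis .
qed

end

lemma nonpos_of_le_all:
  fixes a C :: real
  assumes "\<And>d. 0 < d \<Longrightarrow> d \<le> 1 \<Longrightarrow> a \<le> C * d"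
  shows "a \<le> 0"
proof (rule tendsto_lowerbound)
  show "((\<lambda>d. C * d) \<longlongrightarrow> 0) (at_right 0)"
    by (auto intro!: tendsto_eq_intros)
  show "\<forall>\<^sub>F d in at_right 0. a \<le> C * d"
    unfolding eventually_at_right_field by (intro exI[of _ 1]) (use assms in auto)
qed simp

lemma power4_add_le:
  fixes a b :: real
  shows "(a + b) ^ 4 \<le> 8 * (a ^ 4 + b ^ 4)"
proof -
  have "(a + b) ^ 4 = ((a + b)\<^sup>2)\<^sup>2" by simp
  also have "\<dots> \<le> (2 * (a\<^sup>2 + b\<^sup>2))\<^sup>2"
    using sum_squares_bound[of a b] by (intro power_mono zero_le_power2) (simp add: power2_sum)
  also have "\<dots> \<le> 8 * (a ^ 4 + b ^ 4)"
    using sum_squares_bound[of "a\<^sup>2" "b\<^sup>2"] by (simp add: power2_sum power_mult_distrib flip: power_mult)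
  finally show ?thesis .
qed

text \<open>Young's inequality in the form that trades a first moment for a second one: if the
  second moment of x is at most d^2, the right-hand side has expectation at most 2 d.\<close>

lemma le_scaled_square:
  fixes x d :: real
  assumes "0 < d"
  shows "x \<le> d + x\<^sup>2 / d"
proof -
  have "2 * (x * d) \<le> x\<^sup>2 + d\<^sup>2" using sum_squares_bound[of x d] by simp
  then have "x * d \<le> d\<^sup>2 + x\<^sup>2"
    using zero_le_power2[of x] zero_le_power2[of d] by linarith
  then show ?thesis using assms by (simp add: field_simps power2_eq_square)
qed

section \<open>Moments of the increments of the stopped integral\<close>

context stopped_ito
begin

context
  fixes s t L :: real
  assumes st: "0 \<le> s" "s < t"
    and Y_bound: "\<And>w. w \<in> space M \<Longrightarrow> norm (Y t w - Y s w) \<le> L"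
begin

lemma L_nonneg: "0 \<le> L"
  using Y_bound norm_ge_zero order_trans not_empty by blast

lemma DY_measurable [measurable]: "(\<lambda>w. Y t w - Y s w) \<in> borel_measurable M"
proof -
  have [measurable]: "Y t \<in> borel_measurable M" "Y s \<in> borel_measurable M"
    using Y_measurable st by auto
  show ?thesis by measurable
qed

definition "fourth_bound = 9 * (real CARD('k))\<^sup>2 * K ^ 4 * (t - s)\<^sup>2"

lemma bounded_simple_joint:
  assumes "bounded_simple N q \<eta> K"
  shows "(\<lambda>(u, w). simple_value N q \<eta> u w) \<in> borel_measurable (borel \<Otimes>\<^sub>M M)"
  by (rule simple_value_joint_measurable) (use eta_measurable[OF assms] F_measurable_M in blast)

lemma bounded_simple_value_le:
  assumes bs: "bounded_simple N q \<eta> K" and w: "w \<in> space M"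
  shows "norm (simple_value N q \<eta> u w) \<le> K"
proof (cases "q 0 < u \<and> u \<le> q N")
  case True
  then obtain i where i: "i < N" "q i < u" "u \<le> q (Suc i)" using grid_cell by blast
  have "simple_value N q \<eta> u w = \<eta> i w"
    by (rule simple_value_cell[OF _ i]) (use grid_less[OF bs] in auto)
  then show ?thesis using eta_bound[OF bs i(1) w] by simp
next
  case False
  have "indicator {q i<..q (Suc i)} u *\<^sub>R \<eta> i w = 0" if "i < N" for i
    using False grid_le[OF bs, of 0 i] grid_le[OF bs, of "Suc i" N] that by (auto simp: indicator_def)
  then have "simple_value N q \<eta> u w = 0"
    unfolding simple_value_def by (intro sum.neutral) auto
  then show ?thesis using K_nonneg by simp
qed

text \<open>Convergence in probability becomes convergence in mean square through fourth moments:
  that of the simple integral is at most \<open>fourth_bound\<close> whatever the grid, and the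
  increment of \<open>Y\<close> is bounded by \<open>L\<close>. On the exceptional event, of
  probability at most c^2, the square is bounded by 1 / c plus c times the fourth power.\<close>

lemma L2_approximation:
  assumes "0 < d"
  shows "\<exists>N q \<eta>. bounded_simple N q \<eta> K \<and> q 0 = s \<and> q N = t \<and>
    expectation (\<lambda>w. (norm (transform W q \<eta> N w - (Y t w - Y s w)))\<^sup>2) \<le> d \<and>
    expectation (\<lambda>w. LINT u:{s<..t}|lborel. (norm (simple_value N q \<eta> u w - Hs u w))\<^sup>2) \<le> d"
proof -
  define C5 where "C5 = 8 * (fourth_bound + L ^ 4)"
  have fb: "0 \<le> fourth_bound" by (simp add: fourth_bound_def)
  have C5: "0 \<le> C5" using fb by (simp add: C5_def)
  \<comment> \<open>The first quotient serves the mean square, which comes out as at most c (2 +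
    C5). The second serves the time integral, whose integrand is bounded by 4 K^2.\<close>
  define c where "c = min (min 1 (d / (2 + C5))) (d / (1 + 4 * K\<^sup>2 * (t - s)))"
  have pos: "0 < 1 + 4 * K\<^sup>2 * (t - s)"
    by (intro add_pos_nonneg mult_nonneg_nonneg) (use st in auto)
  have c: "0 < c" "c \<le> 1" "c * (2 + C5) \<le> d" "c * (1 + 4 * K\<^sup>2 * (t - s)) \<le> d"
  proof -
    show "0 < c" "c \<le> 1" using assms C5 pos by (auto simp: c_def)
    have "c \<le> d / (2 + C5)" "c \<le> d / (1 + 4 * K\<^sup>2 * (t - s))" by (auto simp: c_def)
    then show "c * (2 + C5) \<le> d" "c * (1 + 4 * K\<^sup>2 * (t - s)) \<le> d"
      using C5 pos by (auto simp: pos_le_divide_eq)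
  qed
  have c2: "0 < c\<^sup>2" "c\<^sup>2 \<le> c" using c by (auto simp: power2_eq_square mult_left_le)
  obtain N q \<eta> where bs: "bounded_simple N q \<eta> K" and q: "q 0 = s" "q N = t"
    and P1: "prob {w \<in> space M. c\<^sup>2 < norm (transform W q \<eta> N w - (Y t w - Y s w))} \<le> c\<^sup>2"
    and P2: "prob {w \<in> space M. ennreal (c\<^sup>2) <
      (\<integral>\<^sup>+u\<in>{s<..t}. ennreal ((norm (simple_value N q \<eta> u w - Hs u w))\<^sup>2) \<partial>lborel)} \<le> c\<^sup>2"
    using approximation[OF st c2(1)] by blast
  let ?S = "transform W q \<eta> N" and ?X = "\<lambda>w. Y t w - Y s w"
  let ?B = "{w \<in> space M. c\<^sup>2 < norm (?S w - ?X w)}"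
  have [measurable]: "?S \<in> borel_measurable M"
    using transform_measurable[OF bs order.refl] F_measurable_M by blast
  have B_ev: "?B \<in> events" by measurable
  note iB = integrable_indicator_event[OF B_ev]
  have S4: "integrable M (\<lambda>w. norm (?S w) ^ 4)" "expectation (\<lambda>w. norm (?S w) ^ 4) \<le> fourth_bound"
    using transform_integrable4[OF bs order.refl] expectation_transform_fourth_le[OF bs order.refl] q
    by (auto simp: fourth_bound_def)
  have D4: "norm (?S w - ?X w) ^ 4 \<le> 8 * (norm (?S w) ^ 4 + L ^ 4)" if "w \<in> space M" for w
  proof -
    have "norm (?S w - ?X w) ^ 4 \<le> (norm (?S w) + L) ^ 4"
      using norm_triangle_ineq4[of "?S w" "?X w"] Y_bound[OF that] by (intro power_mono) auto
    also have "\<dots> \<le> 8 * (norm (?S w) ^ 4 + L ^ 4)" by (rule power4_add_le)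
    finally show ?thesis .
  qed
  have pt: "(norm (?S w - ?X w))\<^sup>2 \<le> c ^ 4 + c * (8 * (norm (?S w) ^ 4 + L ^ 4)) + indicator ?B w / c"
    if "w \<in> space M" for w
  proof (cases "w \<in> ?B")
    case True
    have "(norm (?S w - ?X w))\<^sup>2 * 1 \<le> 1 / c + c * ((norm (?S w - ?X w))\<^sup>2)\<^sup>2"
      using le_scaled_square[of "1 / c" "(norm (?S w - ?X w))\<^sup>2"] c by (simp add: mult.commute)
    also have "\<dots> \<le> 1 / c + c * (8 * (norm (?S w) ^ 4 + L ^ 4))"
      using D4[OF that] c by (intro add_left_mono mult_left_mono) auto
    finally have "(norm (?S w - ?X w))\<^sup>2 \<le> 1 / c + c * (8 * (norm (?S w) ^ 4 + L ^ 4))" by simp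
    moreover have "0 \<le> c ^ 4" by simp
    moreover have "indicator ?B w / c = 1 / c" using True by simp
    ultimately show ?thesis by linarith
  next
    case False
    then have "norm (?S w - ?X w) \<le> c\<^sup>2" using that by auto
    then have "(norm (?S w - ?X w))\<^sup>2 \<le> (c\<^sup>2)\<^sup>2" by (intro power_mono) auto
    moreover have "0 \<le> c * (8 * (norm (?S w) ^ 4 + L ^ 4))" using c by simp
    ultimately show ?thesis using False by simp
  qed
  have "expectation (\<lambda>w. (norm (?S w - ?X w))\<^sup>2) \<le>
      expectation (\<lambda>w. c ^ 4 + c * (8 * (norm (?S w) ^ 4 + L ^ 4)) + indicator ?B w / c)"
  proof (rule integral_mono')
    show "integrable M (\<lambda>w. c ^ 4 + c * (8 * (norm (?S w) ^ 4 + L ^ 4)) + indicator ?B w / c)"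
      using S4(1) iB by simp
    show "0 \<le> c ^ 4 + c * (8 * (norm (?S w) ^ 4 + L ^ 4)) + indicator ?B w / c" for w
      using c by simp
  qed (rule pt)
  also have "\<dots> = c ^ 4 + c * (8 * (expectation (\<lambda>w. norm (?S w) ^ 4) + L ^ 4)) + prob ?B / c"
    using S4(1) iB B_ev by (simp add: prob_space)
  also have "\<dots> \<le> c + c * C5 + c"
  proof (intro add_mono)
    have "c * c ^ 3 \<le> c * 1" using c power_le_one[of c 3] by (intro mult_left_mono) auto
    moreover have "c ^ 4 = c * c ^ 3" by (simp add: power_numeral_reduce)
    ultimately show "c ^ 4 \<le> c" by simp
    show "c * (8 * (expectation (\<lambda>w. norm (?S w) ^ 4) + L ^ 4)) \<le> c * C5"
      using S4(2) c by (auto simp: C5_def)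
    show "prob ?B / c \<le> c" using P1 c by (simp add: divide_le_eq power2_eq_square)
  qed
  also have "\<dots> \<le> d" using c(3) by (simp add: algebra_simps)
  finally have 1: "expectation (\<lambda>w. (norm (?S w - ?X w))\<^sup>2) \<le> d" .
  let ?G = "\<lambda>u w. (norm (simple_value N q \<eta> u w - Hs u w))\<^sup>2"
  have Gj: "(\<lambda>(u, w). ?G u w) \<in> borel_measurable (borel \<Otimes>\<^sub>M M)"
    using bounded_simple_joint[OF bs] Hs_joint by (simp add: split_beta')
  have Gb: "\<bar>?G u w\<bar> \<le> 4 * K\<^sup>2" if "w \<in> space M" for u w
  proof -
    have "norm (simple_value N q \<eta> u w - Hs u w) \<le> K + K"
      using norm_triangle_ineq4[of "simple_value N q \<eta> u w" "Hs u w"]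
        bounded_simple_value_le[OF bs that, of u] Hs_bound[OF that, of u] by linarith
    then have "?G u w \<le> (K + K)\<^sup>2" by (intro power_mono) auto
    then show ?thesis by (simp add: power2_eq_square)
  qed
  note tG = Gj Gb less_imp_le[OF st(2)]
  have "expectation (\<lambda>w. LINT u:{s<..t}|lborel. ?G u w) \<le> c\<^sup>2 + (4 * K\<^sup>2 * (t - s)) * c\<^sup>2"
  proof (rule expectation_le_of_prob)
    show "(\<lambda>w. LINT u:{s<..t}|lborel. ?G u w) \<in> borel_measurable M"
      by (rule time_integral_measurable[OF Gj])
    fix w assume w: "w \<in> space M"
    show "(LINT u:{s<..t}|lborel. ?G u w) \<le> 4 * K\<^sup>2 * (t - s)"
      using time_integral_bound[OF tG w] by simp
    show "0 \<le> (LINT u:{s<..t}|lborel. ?G u w)"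
      unfolding set_lebesgue_integral_def by (rule integral_nonneg_AE) auto
  next
    have eq: "ennreal (LINT u:{s<..t}|lborel. ?G u w) = (\<integral>\<^sup>+u\<in>{s<..t}. ennreal (?G u w) \<partial>lborel)"
      if "w \<in> space M" for w
    proof -
      have "(\<integral>\<^sup>+u. ennreal (indicator {s<..t} u *\<^sub>R ?G u w) \<partial>lborel) = ennreal (\<integral>u. indicator {s<..t} u *\<^sub>R ?G u w \<partial>lborel)"
        by (rule nn_integral_eq_integral)
           (use time_integrable[OF tG that] in \<open>auto simp: set_integrable_def\<close>)
      moreover have "(\<integral>\<^sup>+u. ennreal (indicator {s<..t} u *\<^sub>R ?G u w) \<partial>lborel) =
        (\<integral>\<^sup>+u\<in>{s<..t}. ennreal (?G u w) \<partial>lborel)"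
        by (rule nn_integral_cong) (auto simp: indicator_def)
      ultimately show ?thesis by (simp add: set_lebesgue_integral_def)
    qed
    have "{w \<in> space M. c\<^sup>2 < (LINT u:{s<..t}|lborel. ?G u w)} =
      {w \<in> space M. ennreal (c\<^sup>2) < (\<integral>\<^sup>+u\<in>{s<..t}. ennreal (?G u w) \<partial>lborel)}"
      by (rule Collect_cong, rule conj_cong[OF refl], subst eq[symmetric]) (auto simp: ennreal_less_iff)
    then show "prob {w \<in> space M. c\<^sup>2 < (LINT u:{s<..t}|lborel. ?G u w)} \<le> c\<^sup>2"
      using P2 by simp
  qed (use st in auto)
  also have "\<dots> \<le> d"
  proof -
    have "c\<^sup>2 * (1 + 4 * K\<^sup>2 * (t - s)) \<le> c * (1 + 4 * K\<^sup>2 * (t - s))"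
      using c2(2) pos by (intro mult_right_mono) auto
    then show ?thesis using c(4) by (simp add: algebra_simps)
  qed
  finally have 2: "expectation (\<lambda>w. LINT u:{s<..t}|lborel. ?G u w) \<le> d" .
  show ?thesis using bs q 1 2 by blast
qed

lemma DY_square_integrable:
  assumes "bounded_simple N q \<eta> K"
  shows "integrable M (\<lambda>w. (norm (transform W q \<eta> N w - (Y t w - Y s w)))\<^sup>2)"
proof (rule Bochner_Integration.integrable_bound)
  let ?S = "transform W q \<eta> N" and ?X = "\<lambda>w. Y t w - Y s w"
  have S: "?S \<in> borel_measurable M"
    using transform_measurable[OF assms order.refl] F_measurable_M by blast
  show "(\<lambda>w. (norm (?S w - ?X w))\<^sup>2) \<in> borel_measurable M"
    using borel_measurable_diff[OF S DY_measurable] by (rule measurable_compose) measurable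
  show "integrable M (\<lambda>w. 2 * (norm (?S w))\<^sup>2 + 2 * L\<^sup>2)"
    using expectation_transform_square[OF assms order.refl, THEN conjunct1] by simp
  show "AE w in M. norm ((norm (?S w - ?X w))\<^sup>2) \<le> norm (2 * (norm (?S w))\<^sup>2 + 2 * L\<^sup>2)"
  proof (rule AE_I2)
    fix w assume w: "w \<in> space M"
    have "(norm (?S w - ?X w))\<^sup>2 \<le> (norm (?S w) + L)\<^sup>2"
      using norm_triangle_ineq4[of "?S w" "?X w"] Y_bound[OF w] by (intro power_mono) auto
    also have "\<dots> \<le> 2 * (norm (?S w))\<^sup>2 + 2 * L\<^sup>2"
      using sum_squares_bound[of "norm (?S w)" L] by (simp add: power2_sum)
    finally show "norm ((norm (?S w - ?X w))\<^sup>2) \<le> norm (2 * (norm (?S w))\<^sup>2 + 2 * L\<^sup>2)" by simp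
  qed
qed

text \<open>The identity is exact for simple integrals. The error is at most \<open>C\<close> times
  a first moment of the difference, which \<open>le_scaled_square\<close> turns into a second
  moment.\<close>

lemma expectation_inner_DY:
  assumes A: "A \<in> borel_measurable (F s)" "\<And>w. w \<in> space M \<Longrightarrow> norm (A w) \<le> C"
  shows "expectation (\<lambda>w. A w \<bullet> (Y t w - Y s w)) = 0"
proof -
  let ?X = "\<lambda>w. Y t w - Y s w"
  have [measurable]: "A \<in> borel_measurable M" by (rule F_measurable_M[OF A(1)])
  have C: "0 \<le> C" using A(2) norm_ge_zero order_trans not_empty by blast
  have AXb: "\<bar>A w \<bullet> ?X w\<bar> \<le> C * L" if "w \<in> space M" for w
    using order_trans[OF Cauchy_Schwarz_ineq2 mult_mono[OF A(2)[OF that] Y_bound[OF that] C norm_ge_zero]] .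
  have AX: "integrable M (\<lambda>w. A w \<bullet> ?X w)"
    by (rule integrable_bounded[where C = "C * L"]) (use AXb in auto)
  have "\<bar>expectation (\<lambda>w. A w \<bullet> ?X w)\<bar> \<le> 2 * C * d" if d: "0 < d" "d \<le> 1" for d
  proof -
    have "0 < d\<^sup>2" using d by simp
    from L2_approximation[OF this] obtain N q \<eta> where bs: "bounded_simple N q \<eta> K" and q: "q 0 = s" "q N = t"
      and 1: "expectation (\<lambda>w. (norm (transform W q \<eta> N w - ?X w))\<^sup>2) \<le> d\<^sup>2" by blast
    let ?S = "transform W q \<eta> N"
    note D = DY_square_integrable[OF bs]
    have S: "integrable M (\<lambda>w. A w \<bullet> ?S w)" "expectation (\<lambda>w. A w \<bullet> ?S w) = 0"
      using expectation_inner_transform[OF bs order.refl _ A(2)] A(1) q by auto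
    have "\<bar>expectation (\<lambda>w. A w \<bullet> ?X w)\<bar> = \<bar>expectation (\<lambda>w. A w \<bullet> ?S w - A w \<bullet> ?X w)\<bar>"
      using S AX by simp
    also have "\<dots> \<le> expectation (\<lambda>w. C * (d + (norm (?S w - ?X w))\<^sup>2 / d))"
    proof (rule order_trans[OF integral_abs_bound integral_mono])
      show "integrable M (\<lambda>w. \<bar>A w \<bullet> ?S w - A w \<bullet> ?X w\<bar>)" using S AX by simp
      show "integrable M (\<lambda>w. C * (d + (norm (?S w - ?X w))\<^sup>2 / d))" using D by simp
      fix w assume w: "w \<in> space M"
      have "\<bar>A w \<bullet> ?S w - A w \<bullet> ?X w\<bar> = \<bar>A w \<bullet> (?S w - ?X w)\<bar>" by (simp add: inner_diff_right)
      also have "\<dots> \<le> C * norm (?S w - ?X w)"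
        by (rule order_trans[OF Cauchy_Schwarz_ineq2 mult_right_mono[OF A(2)[OF w] norm_ge_zero]])
      also have "\<dots> \<le> C * (d + (norm (?S w - ?X w))\<^sup>2 / d)"
        by (rule mult_left_mono[OF le_scaled_square[OF d(1)] C])
      finally show "\<bar>A w \<bullet> ?S w - A w \<bullet> ?X w\<bar> \<le> C * (d + (norm (?S w - ?X w))\<^sup>2 / d)" .
    qed
    also have "\<dots> = C * (d + expectation (\<lambda>w. (norm (?S w - ?X w))\<^sup>2) / d)"
      using D by (simp add: prob_space)
    also have "\<dots> \<le> C * (d + d\<^sup>2 / d)"
      using 1 d C by (intro mult_left_mono add_left_mono divide_right_mono) auto
    also have "\<dots> = 2 * C * d" using d by (simp add: power2_eq_square)
    finally show ?thesis .
  qed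
  then have "\<bar>expectation (\<lambda>w. A w \<bullet> ?X w)\<bar> \<le> 0" by (rule nonpos_of_le_all)
  then show ?thesis by simp
qed

text \<open>Only mean square approximation is available, so x^4 is bounded by x^2 (2 y^2 + 2 z^2),
  where z is the approximation error. In the part with z, x is bounded by \<open>L\<close>; the part
  with y is at most x^4 / 2 + 2 y^4, and absorbing x^4 / 2 on the left produces the factor
  4.\<close>

lemma expectation_fourth_DY: "expectation (\<lambda>w. norm (Y t w - Y s w) ^ 4) \<le> 4 * fourth_bound"
proof -
  let ?X = "\<lambda>w. Y t w - Y s w"
  have "expectation (\<lambda>w. norm (?X w) ^ 4) - 4 * fourth_bound \<le> 4 * L\<^sup>2 * d" if d: "0 < d" "d \<le> 1" for d
  proof -
    from L2_approximation[OF d(1)] obtain N q \<eta> where bs: "bounded_simple N q \<eta> K" and q: "q 0 = s" "q N = t"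
      and 1: "expectation (\<lambda>w. (norm (transform W q \<eta> N w - ?X w))\<^sup>2) \<le> d" by blast
    let ?S = "transform W q \<eta> N"
    note D = DY_square_integrable[OF bs]
    have S4: "integrable M (\<lambda>w. norm (?S w) ^ 4)" "expectation (\<lambda>w. norm (?S w) ^ 4) \<le> fourth_bound"
      using transform_integrable4[OF bs order.refl] expectation_transform_fourth_le[OF bs order.refl] q
      by (auto simp: fourth_bound_def)
    have "expectation (\<lambda>w. norm (?X w) ^ 4) \<le> expectation (\<lambda>w. 4 * norm (?S w) ^ 4 + 4 * L\<^sup>2 * (norm (?S w - ?X w))\<^sup>2)"
    proof (rule integral_mono')
      show "integrable M (\<lambda>w. 4 * norm (?S w) ^ 4 + 4 * L\<^sup>2 * (norm (?S w - ?X w))\<^sup>2)"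
        using S4(1) D by simp
      fix w assume w: "w \<in> space M"
      define x y z where "x = norm (?X w)" "y = norm (?S w)" "z = norm (?S w - ?X w)"
      have "x \<le> y + z" using norm_triangle_ineq4[of "?S w" "?S w - ?X w"] by (simp add: x_y_z_def)
      then have "x\<^sup>2 \<le> (y + z)\<^sup>2" by (intro power_mono) (auto simp: x_y_z_def)
      also have "\<dots> \<le> 2 * y\<^sup>2 + 2 * z\<^sup>2" using sum_squares_bound[of y z] by (simp add: power2_sum)
      finally have xyz: "x\<^sup>2 \<le> 2 * y\<^sup>2 + 2 * z\<^sup>2" .
      have xL: "x\<^sup>2 \<le> L\<^sup>2" using Y_bound[OF w] by (intro power_mono) (auto simp: x_y_z_def)
      have "x ^ 4 = x\<^sup>2 * x\<^sup>2" by (simp flip: power_add)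
      also have "\<dots> \<le> x\<^sup>2 * (2 * y\<^sup>2 + 2 * z\<^sup>2)" using xyz by (intro mult_left_mono) auto
      also have "\<dots> \<le> 2 * (x\<^sup>2 * y\<^sup>2) + 2 * (L\<^sup>2 * z\<^sup>2)"
        using mult_right_mono[OF xL, of "z\<^sup>2"] by (simp add: algebra_simps)
      also have "2 * (x\<^sup>2 * y\<^sup>2) \<le> x ^ 4 / 2 + 2 * y ^ 4"
      proof -
        have "0 \<le> (x\<^sup>2 / 2 - y\<^sup>2)\<^sup>2" by simp
        then show ?thesis by (simp add: power2_diff power_mult_distrib power_divide flip: power_mult)
      qed
      finally show "norm (?X w) ^ 4 \<le> 4 * norm (?S w) ^ 4 + 4 * L\<^sup>2 * (norm (?S w - ?X w))\<^sup>2"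
        unfolding x_y_z_def[symmetric] by simp
    qed auto
    also have "\<dots> = 4 * expectation (\<lambda>w. norm (?S w) ^ 4) + 4 * L\<^sup>2 * expectation (\<lambda>w. (norm (?S w - ?X w))\<^sup>2)"
      using S4(1) D by simp
    also have "\<dots> \<le> 4 * fourth_bound + 4 * L\<^sup>2 * d"
      using S4(2) 1 by (intro add_mono mult_left_mono) auto
    finally show ?thesis by simp
  qed
  then have "expectation (\<lambda>w. norm (?X w) ^ 4) - 4 * fourth_bound \<le> 0" by (rule nonpos_of_le_all)
  then show ?thesis by simp
qed

lemma quadratic_joint:
  fixes G :: "real \<Rightarrow> 'a \<Rightarrow> real ^ 'k ^ 'n" and Q :: "'a \<Rightarrow> real ^ 'n ^ 'n"
  assumes "(\<lambda>(u, w). G u w) \<in> borel_measurable (borel \<Otimes>\<^sub>M M)" and [measurable]: "Q \<in> borel_measurable M"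
  shows "(\<lambda>(u, w). G u w \<bullet> (Q w ** G u w)) \<in> borel_measurable (borel \<Otimes>\<^sub>M M)"
  using assms(1) unfolding split_beta' by measurable

text \<open>Limit of the weighted isometry for simple integrands. Both sides are quadratic in
  quantities approximated in mean square, so each moves by a multiple of d. In \<open>C'\<close> the
  first summand comes from replacing the simple integral by the increment of \<open>Y\<close>, the
  second from replacing the simple integrand by \<open>Hs\<close>.\<close>

lemma expectation_quadratic_DY:
  assumes Q: "Q \<in> borel_measurable (F s)" "\<And>w. w \<in> space M \<Longrightarrow> norm (Q w) \<le> C"
  shows "expectation (\<lambda>w. (Y t w - Y s w) \<bullet> (Q w *v (Y t w - Y s w))) =
    expectation (\<lambda>w. LINT u:{s<..t}|lborel. Hs u w \<bullet> (Q w ** Hs u w))"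
proof -
  let ?X = "\<lambda>w. Y t w - Y s w"
  interpret mv: bounded_bilinear "(*v) :: real ^ 'n ^ 'n \<Rightarrow> real ^ 'n \<Rightarrow> real ^ 'n"
    by (rule bounded_bilinear_matrix_vector_mult)
  have QM[measurable]: "Q \<in> borel_measurable M" by (rule F_measurable_M[OF Q(1)])
  have C: "0 \<le> C" using Q(2) norm_ge_zero order_trans not_empty by blast
  have XX: "integrable M (\<lambda>w. ?X w \<bullet> (Q w *v ?X w))"
  proof (rule integrable_bounded[where C = "C * L * L"])
    fix w assume w: "w \<in> space M"
    have "norm (Q w) * norm (?X w) * norm (?X w) \<le> C * L * L"
      using Q(2)[OF w] Y_bound[OF w] C L_nonneg by (intro mult_mono) auto
    then show "norm (?X w \<bullet> (Q w *v ?X w)) \<le> C * L * L"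
      using abs_inner_matrix_vector_le[of "?X w" "Q w" "?X w"] by simp
  qed measurable
  have qb: "\<bar>A \<bullet> (Q w ** A)\<bar> \<le> C * K * K" if "w \<in> space M" "norm A \<le> K" for w and A :: "real ^ 'k ^ 'n"
  proof -
    have "norm (Q w) * norm A * norm A \<le> C * K * K"
      using Q(2)[OF that(1)] that(2) C K_nonneg by (intro mult_mono) auto
    then show ?thesis using abs_inner_matrix_le[of A "Q w" A] by linarith
  qed
  have hj: "(\<lambda>(u, w). Hs u w \<bullet> (Q w ** Hs u w)) \<in> borel_measurable (borel \<Otimes>\<^sub>M M)"
    by (rule quadratic_joint[OF Hs_joint QM])
  note tH = hj qb[OF _ Hs_bound] less_imp_le[OF st(2)]
  let ?lhs = "expectation (\<lambda>w. ?X w \<bullet> (Q w *v ?X w))"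
  let ?rhs = "expectation (\<lambda>w. LINT u:{s<..t}|lborel. Hs u w \<bullet> (Q w ** Hs u w))"
  define C' where "C' = C * (4 * L + 1) + 2 * K * C * ((t - s) + 1)"
  have "\<bar>?lhs - ?rhs\<bar> \<le> C' * d" if d: "0 < d" "d \<le> 1" for d
  proof -
    have "0 < d\<^sup>2" using d by simp
    from L2_approximation[OF this] obtain N q \<eta> where bs: "bounded_simple N q \<eta> K" and q: "q 0 = s" "q N = t"
      and 1: "expectation (\<lambda>w. (norm (transform W q \<eta> N w - ?X w))\<^sup>2) \<le> d\<^sup>2"
      and 2: "expectation (\<lambda>w. LINT u:{s<..t}|lborel. (norm (simple_value N q \<eta> u w - Hs u w))\<^sup>2) \<le> d\<^sup>2" by blast
    let ?S = "transform W q \<eta> N" and ?G = "simple_value N q \<eta>"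
    note D = DY_square_integrable[OF bs]
    have q3: "\<forall>i<N. q i < q (Suc i)" using grid_less[OF bs] by auto
    have S: "integrable M (\<lambda>w. ?S w \<bullet> (Q w *v ?S w))"
      "expectation (\<lambda>w. ?S w \<bullet> (Q w *v ?S w)) = (\<Sum>i<N. (q (Suc i) - q i) * expectation (\<lambda>w. \<eta> i w \<bullet> (Q w ** \<eta> i w)))"
      using expectation_quadratic_transform[OF bs order.refl _ Q(2)] Q(1) q by auto
    have gj: "(\<lambda>(u, w). ?G u w \<bullet> (Q w ** ?G u w)) \<in> borel_measurable (borel \<Otimes>\<^sub>M M)"
      by (rule quadratic_joint[OF bounded_simple_joint[OF bs] QM])
    note tG = gj qb[OF _ bounded_simple_value_le[OF bs]] less_imp_le[OF st(2)]
    have ei: "integrable M (\<lambda>w. \<eta> i w \<bullet> (Q w ** \<eta> i w))" if "i < N" for i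
    proof (rule integrable_bounded[where C = "C * K * K"])
      have [measurable]: "\<eta> i \<in> borel_measurable M"
        by (rule F_measurable_M[OF eta_measurable[OF bs that]])
      show "(\<lambda>w. \<eta> i w \<bullet> (Q w ** \<eta> i w)) \<in> borel_measurable M" by measurable
    qed (use qb eta_bound[OF bs that] in auto)
    have "expectation (\<lambda>w. LINT u:{s<..t}|lborel. ?G u w \<bullet> (Q w ** ?G u w)) =
       expectation (\<lambda>w. \<Sum>i<N. (\<eta> i w \<bullet> (Q w ** \<eta> i w)) * (q (Suc i) - q i))"
      using integral_simple_value[OF q3, where f = "\<lambda>A. A \<bullet> (Q w ** A)" and \<eta> = \<eta> and w = w for w] q by simp
    also have "\<dots> = (\<Sum>i<N. (q (Suc i) - q i) * expectation (\<lambda>w. \<eta> i w \<bullet> (Q w ** \<eta> i w)))"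
      by (subst Bochner_Integration.integral_sum) (use ei in \<open>auto simp: mult.commute\<close>)
    finally have SG: "expectation (\<lambda>w. ?S w \<bullet> (Q w *v ?S w)) =
      expectation (\<lambda>w. LINT u:{s<..t}|lborel. ?G u w \<bullet> (Q w ** ?G u w))" using S(2) by simp
    have e1: "\<bar>?lhs - expectation (\<lambda>w. ?S w \<bullet> (Q w *v ?S w))\<bar> \<le> C * (4 * L + 1) * d"
    proof -
      have "\<bar>?lhs - expectation (\<lambda>w. ?S w \<bullet> (Q w *v ?S w))\<bar> = \<bar>expectation (\<lambda>w. ?S w \<bullet> (Q w *v ?S w) - ?X w \<bullet> (Q w *v ?X w))\<bar>"
        using XX S(1) by simp
      also have "\<dots> \<le> expectation (\<lambda>w. C * (2 * L * (d + (norm (?S w - ?X w))\<^sup>2 / d) + (norm (?S w - ?X w))\<^sup>2))"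
      proof (rule order_trans[OF integral_abs_bound integral_mono])
        show "integrable M (\<lambda>w. \<bar>?S w \<bullet> (Q w *v ?S w) - ?X w \<bullet> (Q w *v ?X w)\<bar>)" using S XX by simp
        show "integrable M (\<lambda>w. C * (2 * L * (d + (norm (?S w - ?X w))\<^sup>2 / d) + (norm (?S w - ?X w))\<^sup>2))"
          using D by simp
        fix w assume w: "w \<in> space M"
        let ?R = "?S w - ?X w"
        have "?S w \<bullet> (Q w *v ?S w) - ?X w \<bullet> (Q w *v ?X w) = ?R \<bullet> (Q w *v ?R) + (?R \<bullet> (Q w *v ?X w) + ?X w \<bullet> (Q w *v ?R))"
          by (simp add: mv.diff_right inner_diff_left inner_diff_right)
        moreover have "\<bar>?R \<bullet> (Q w *v ?R)\<bar> \<le> C * (norm ?R * norm ?R)"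
          using order_trans[OF abs_inner_matrix_vector_le[of ?R "Q w" ?R]] mult_right_mono[OF Q(2)[OF w], of "norm ?R * norm ?R"]
          by (simp add: mult.assoc)
        moreover have "\<bar>?R \<bullet> (Q w *v ?X w)\<bar> \<le> C * (L * norm ?R)" "\<bar>?X w \<bullet> (Q w *v ?R)\<bar> \<le> C * (L * norm ?R)"
        proof -
          have "norm (Q w) * (norm (?X w) * norm ?R) \<le> C * (L * norm ?R)"
            using Q(2)[OF w] Y_bound[OF w] C L_nonneg by (intro mult_mono) auto
          then show "\<bar>?R \<bullet> (Q w *v ?X w)\<bar> \<le> C * (L * norm ?R)" "\<bar>?X w \<bullet> (Q w *v ?R)\<bar> \<le> C * (L * norm ?R)"
            using abs_inner_matrix_vector_le[of ?R "Q w" "?X w"] abs_inner_matrix_vector_le[of "?X w" "Q w" ?R]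
            by (auto simp: mult_ac)
        qed
        ultimately have "\<bar>?S w \<bullet> (Q w *v ?S w) - ?X w \<bullet> (Q w *v ?X w)\<bar> \<le> C * (2 * L * norm ?R + norm ?R * norm ?R)"
          by (simp add: algebra_simps)
        also have "\<dots> \<le> C * (2 * L * (d + (norm ?R)\<^sup>2 / d) + (norm ?R)\<^sup>2)"
          using le_scaled_square[OF d(1), of "norm ?R"] L_nonneg C
          by (intro mult_left_mono add_mono) (auto simp: power2_eq_square)
        finally show "\<bar>?S w \<bullet> (Q w *v ?S w) - ?X w \<bullet> (Q w *v ?X w)\<bar> \<le>
          C * (2 * L * (d + (norm ?R)\<^sup>2 / d) + (norm ?R)\<^sup>2)" .
      qed
      also have "\<dots> = C * (2 * L * (d + expectation (\<lambda>w. (norm (?S w - ?X w))\<^sup>2) / d) + expectation (\<lambda>w. (norm (?S w - ?X w))\<^sup>2))"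
        using D by (simp add: prob_space)
      also have "\<dots> \<le> C * (2 * L * (d + d\<^sup>2 / d) + d\<^sup>2)"
        using 1 d C L_nonneg by (intro mult_left_mono add_mono divide_right_mono) auto
      also have "\<dots> \<le> C * (4 * L + 1) * d"
      proof -
        have "d * d \<le> d * 1" using d by (intro mult_left_mono) auto
        then have "2 * L * (d + d\<^sup>2 / d) + d\<^sup>2 \<le> (4 * L + 1) * d"
          using d by (simp add: power2_eq_square algebra_simps)
        then show ?thesis using mult_left_mono[OF _ C] by (simp add: mult.assoc)
      qed
      finally show ?thesis .
    qed
    have e2: "\<bar>expectation (\<lambda>w. LINT u:{s<..t}|lborel. ?G u w \<bullet> (Q w ** ?G u w)) - ?rhs\<bar> \<le> 2 * K * C * ((t - s) + 1) * d"
    proof -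
      let ?E = "\<lambda>u w. (norm (?G u w - Hs u w))\<^sup>2"
      have Ej: "(\<lambda>(u, w). ?E u w) \<in> borel_measurable (borel \<Otimes>\<^sub>M M)"
        using bounded_simple_joint[OF bs] Hs_joint by (simp add: split_beta')
      have Eb: "\<bar>?E u w\<bar> \<le> (K + K)\<^sup>2" if "w \<in> space M" for u w
      proof -
        have "norm (?G u w - Hs u w) \<le> K + K"
          using norm_triangle_ineq4[of "?G u w" "Hs u w"]
            bounded_simple_value_le[OF bs that, of u] Hs_bound[OF that, of u] by linarith
        then have "?E u w \<le> (K + K)\<^sup>2" by (intro power_mono) auto
        then show ?thesis by simp
      qed
      note tE = Ej Eb less_imp_le[OF st(2)]
      have "\<bar>expectation (\<lambda>w. LINT u:{s<..t}|lborel. ?G u w \<bullet> (Q w ** ?G u w)) - ?rhs\<bar> =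
        \<bar>expectation (\<lambda>w. (LINT u:{s<..t}|lborel. ?G u w \<bullet> (Q w ** ?G u w)) - (LINT u:{s<..t}|lborel. Hs u w \<bullet> (Q w ** Hs u w)))\<bar>"
        using time_integral_integrable[OF tG] time_integral_integrable[OF tH] by simp
      also have "\<dots> \<le> expectation (\<lambda>w. 2 * K * C * (d * (t - s) + (LINT u:{s<..t}|lborel. ?E u w) / d))"
      proof (rule order_trans[OF integral_abs_bound integral_mono])
        show "integrable M (\<lambda>w. \<bar>(LINT u:{s<..t}|lborel. ?G u w \<bullet> (Q w ** ?G u w)) - (LINT u:{s<..t}|lborel. Hs u w \<bullet> (Q w ** Hs u w))\<bar>)"
          using time_integral_integrable[OF tG] time_integral_integrable[OF tH] by simp
        show "integrable M (\<lambda>w. 2 * K * C * (d * (t - s) + (LINT u:{s<..t}|lborel. ?E u w) / d))"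
          using time_integral_integrable[OF tE] by simp
        fix w assume w: "w \<in> space M"
        note i1 = time_integrable[OF tG w] and i2 = time_integrable[OF tH w] and i3 = time_integrable[OF tE w]
        have ic: "set_integrable lborel {s<..t} (\<lambda>u. c :: real)" for c
          unfolding set_integrable_def using st by auto
        have "\<bar>(LINT u:{s<..t}|lborel. ?G u w \<bullet> (Q w ** ?G u w)) - (LINT u:{s<..t}|lborel. Hs u w \<bullet> (Q w ** Hs u w))\<bar> =
          \<bar>LINT u:{s<..t}|lborel. ?G u w \<bullet> (Q w ** ?G u w) - Hs u w \<bullet> (Q w ** Hs u w)\<bar>"
          using set_integral_diff(2)[OF i1 i2] by simp
        also have "\<dots> \<le> (LINT u:{s<..t}|lborel. \<bar>?G u w \<bullet> (Q w ** ?G u w) - Hs u w \<bullet> (Q w ** Hs u w)\<bar>)"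
          using set_integral_norm_bound[OF set_integral_diff(1)[OF i1 i2]] by simp
        also have "\<dots> \<le> (LINT u:{s<..t}|lborel. 2 * K * C * (d + ?E u w / d))"
        proof (rule set_integral_mono)
          show "set_integrable lborel {s<..t} (\<lambda>u. \<bar>?G u w \<bullet> (Q w ** ?G u w) - Hs u w \<bullet> (Q w ** Hs u w)\<bar>)"
            by (rule set_integrable_abs[OF set_integral_diff(1)[OF i1 i2]])
          show "set_integrable lborel {s<..t} (\<lambda>u. 2 * K * C * (d + ?E u w / d))"
            using i3 ic by (auto intro!: set_integrable_mult_right set_integral_add set_integrable_divide)
          fix u
          have "\<bar>?G u w \<bullet> (Q w ** ?G u w) - Hs u w \<bullet> (Q w ** Hs u w)\<bar> \<le>
            norm (Q w) * (norm (?G u w) + norm (Hs u w)) * norm (?G u w - Hs u w)"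
            by (rule abs_inner_matrix_diff_le)
          also have "\<dots> \<le> C * (K + K) * norm (?G u w - Hs u w)"
            using Q(2)[OF w] bounded_simple_value_le[OF bs w, of u] Hs_bound[OF w, of u] C K_nonneg
            by (intro mult_right_mono mult_mono add_mono) auto
          also have "\<dots> \<le> C * (K + K) * (d + ?E u w / d)"
            using C K_nonneg by (intro mult_left_mono le_scaled_square d) auto
          finally show "\<bar>?G u w \<bullet> (Q w ** ?G u w) - Hs u w \<bullet> (Q w ** Hs u w)\<bar> \<le> 2 * K * C * (d + ?E u w / d)"
            by (simp add: algebra_simps)
        qed
        also have "\<dots> = 2 * K * C * (LINT u:{s<..t}|lborel. d + ?E u w / d)"
          by (rule set_integral_mult_right)
        also have "(LINT u:{s<..t}|lborel. d + ?E u w / d) = (LINT u:{s<..t}|lborel. d) + (LINT u:{s<..t}|lborel. ?E u w / d)"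
          by (rule set_integral_add(2)) (use i3 ic in \<open>auto intro!: set_integrable_divide\<close>)
        also have "\<dots> = d * (t - s) + (LINT u:{s<..t}|lborel. ?E u w) / d"
          using st by (simp add: set_integral_const set_integral_divide_zero)
        finally show "\<bar>(LINT u:{s<..t}|lborel. ?G u w \<bullet> (Q w ** ?G u w)) - (LINT u:{s<..t}|lborel. Hs u w \<bullet> (Q w ** Hs u w))\<bar> \<le>
          2 * K * C * (d * (t - s) + (LINT u:{s<..t}|lborel. ?E u w) / d)" .
      qed
      also have "\<dots> = 2 * K * C * (d * (t - s) + expectation (\<lambda>w. LINT u:{s<..t}|lborel. ?E u w) / d)"
        using time_integral_integrable[OF tE] by (simp add: prob_space)
      also have "\<dots> \<le> 2 * K * C * (d * (t - s) + d\<^sup>2 / d)"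
        using 2 d C K_nonneg by (intro mult_left_mono add_left_mono divide_right_mono) auto
      also have "\<dots> = 2 * K * C * ((t - s) + 1) * d"
        using d by (simp add: power2_eq_square algebra_simps)
      finally show ?thesis .
    qed
    show ?thesis using e1 e2 SG unfolding C'_def by (simp add: algebra_simps)
  qed
  then have "\<bar>?lhs - ?rhs\<bar> \<le> 0" by (rule nonpos_of_le_all)
  then show ?thesis by simp
qed

end

end

section \<open>Dynkin's formula\<close>

lemma set_integral_Ioc_additive:
  fixes f :: "real \<Rightarrow> 'b::{banach, second_countable_topology}"
  assumes "set_integrable lborel {a<..c} f" "a \<le> b" "b \<le> c"
  shows "(LINT u:{a<..c}|lborel. f u) = (LINT u:{a<..b}|lborel. f u) + (LINT u:{b<..c}|lborel. f u)"
proof -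
  have eq: "{a<..c} = {a<..b} \<union> {b<..c}" using assms by auto
  show ?thesis unfolding eq
    by (rule set_integral_Un)
       (use assms in \<open>auto intro: set_integrable_subset[OF assms(1)]\<close>)
qed

lemma set_integrable_Ioc_bounded:
  fixes f :: "real \<Rightarrow> 'b::{banach, second_countable_topology}"
  assumes "f \<in> borel_measurable borel" "\<And>u. s < u \<Longrightarrow> u \<le> t \<Longrightarrow> norm (f u) \<le> C" "s \<le> t"
  shows "set_integrable lborel {s<..t} f"
  unfolding set_integrable_def
proof (rule integrableI_bounded_set[where A = "{s<..t}" and B = C])
  show "AE u \<in> {s<..t} in lborel. norm (indicator {s<..t} u *\<^sub>R f u) \<le> C"
    using assms(2) by (intro AE_I2) (simp add: indicator_def)
qed (use assms(1,3) in auto)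

lemma norm_set_integral_Ioc_le:
  fixes f :: "real \<Rightarrow> 'b::{banach, second_countable_topology}"
  assumes "set_integrable lborel {s<..t} f" "set_integrable lborel {s<..t} g"
    "\<And>u. s < u \<Longrightarrow> u \<le> t \<Longrightarrow> norm (f u) \<le> g u"
  shows "norm (LINT u:{s<..t}|lborel. f u) \<le> (LINT u:{s<..t}|lborel. g u)"
proof -
  have "norm (LINT u:{s<..t}|lborel. f u) \<le> (LINT u:{s<..t}|lborel. norm (f u))"
    by (rule set_integral_norm_bound[OF assms(1)])
  also have "\<dots> \<le> (LINT u:{s<..t}|lborel. g u)"
    by (rule set_integral_mono[OF set_integrable_norm[OF assms(1)] assms(2)]) (use assms(3) in auto)
  finally show ?thesis .
qed

lemma set_integral_Ioc_const:
  fixes c :: real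
  assumes "s \<le> t"
  shows "(LINT u:{s<..t}|lborel. c) = c * (t - s)"
  using assms by (simp add: set_integral_const)

text \<open>
  A modulus of continuity that is quadratic in \<open>x\<close>: its expectation along the process is controlled by
  second moments.
\<close>

lemma quadratic_modulus:
  fixes f :: "real \<times> 'b::euclidean_space \<Rightarrow> 'c::real_normed_vector"
  assumes cont: "continuous_on ({0..T} \<times> UNIV) f" and "0 < \<epsilon>"
  shows "\<exists>c h. 0 \<le> c \<and> 0 < h \<and> (\<forall>u\<in>{0..T}. \<forall>u'\<in>{0..T}. \<forall>x\<in>cball 0 R. \<forall>x'\<in>cball 0 R.
    \<bar>u - u'\<bar> \<le> h \<longrightarrow> norm (f (u, x) - f (u', x')) \<le> \<epsilon> + c * (norm (x - x'))\<^sup>2)"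
proof -
  let ?S = "{0..T} \<times> cball (0::'b) R"
  have S: "compact ?S" by (intro compact_Times) auto
  have contS: "continuous_on ?S f" by (rule continuous_on_subset[OF cont]) auto
  have "uniformly_continuous_on ?S f" by (rule compact_uniformly_continuous[OF contS S])
  then obtain \<delta> where \<delta>: "0 < \<delta>" "\<And>p p'. p \<in> ?S \<Longrightarrow> p' \<in> ?S \<Longrightarrow> dist p' p < \<delta> \<Longrightarrow> dist (f p') (f p) < \<epsilon>"
    using \<open>0 < \<epsilon>\<close> unfolding uniformly_continuous_on_def by metis
  have "bounded (f ` ?S)" by (rule compact_imp_bounded[OF compact_continuous_image[OF contS S]])
  then obtain b where b: "0 < b" "\<And>p. p \<in> ?S \<Longrightarrow> norm (f p) \<le> b" unfolding bounded_pos by auto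
  \<comment> \<open>With this choice the crude bound 2 b of a difference equals c (\<delta> / 2)^2,
    which covers all pairs at spatial distance at least \<delta> / 2.\<close>
  define c where "c = 2 * b * 4 / \<delta>\<^sup>2"
  show ?thesis
  proof (rule exI[of _ c], rule exI[of _ "\<delta> / 4"], intro conjI ballI impI)
    show "0 \<le> c" "0 < \<delta> / 4" using b \<delta> by (auto simp: c_def)
    fix u u' :: real and x x' :: 'b assume *: "u \<in> {0..T}" "u' \<in> {0..T}" "x \<in> cball 0 R" "x' \<in> cball 0 R" "\<bar>u - u'\<bar> \<le> \<delta> / 4"
    then have p: "(u, x) \<in> ?S" "(u', x') \<in> ?S" by auto
    show "norm (f (u, x) - f (u', x')) \<le> \<epsilon> + c * (norm (x - x'))\<^sup>2"
    proof (cases "norm (x - x') < \<delta> / 2")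
      case True
      have "dist (u, x) (u', x') \<le> dist u u' + dist x x'"
        unfolding dist_Pair_Pair by (rule sqrt_sum_squares_le_sum) auto
      also have "\<dots> < \<delta>" using True * \<delta> by (simp add: dist_norm)
      finally have "dist (f (u, x)) (f (u', x')) < \<epsilon>" using \<delta>(2)[OF p(2) p(1)] by simp
      moreover have "0 \<le> c * (norm (x - x'))\<^sup>2" using b \<delta> by (auto simp: c_def)
      ultimately show ?thesis by (simp add: dist_norm)
    next
      case False
      have "norm (f (u, x) - f (u', x')) \<le> 2 * b"
        using norm_triangle_ineq4[of "f (u, x)" "f (u', x')"] b(2)[OF p(1)] b(2)[OF p(2)] by linarith
      also have "2 * b = c * (\<delta> / 2)\<^sup>2" using \<delta> by (simp add: c_def power_divide)
      also have "\<dots> \<le> c * (norm (x - x'))\<^sup>2"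
        using False b \<delta> by (intro mult_left_mono power_mono) (auto simp: c_def)
      finally show ?thesis using \<open>0 < \<epsilon>\<close> by linarith
    qed
  qed
qed

lemma second_order_taylor_bound:
  fixes f :: "real ^ 'n \<Rightarrow> real"
  assumes f: "\<And>x. (f has_derivative (\<lambda>h. g x \<bullet> h)) (at x)"
    and g: "\<And>x. (g has_derivative (\<lambda>h. Q x *v h)) (at x)"
    and Q: "\<And>r. 0 \<le> r \<Longrightarrow> r \<le> 1 \<Longrightarrow> norm (Q (x + r *\<^sub>R d) - Q x) \<le> \<omega>"
  shows "\<bar>f (x + d) - f x - g x \<bullet> d - 1 / 2 * (d \<bullet> (Q x *v d))\<bar> \<le> 1 / 2 * \<omega> * (norm d)\<^sup>2"
proof -
  \<comment> \<open>The function along the segment with its first two derivatives, as input for the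
    Maclaurin expansion. Its Lagrange remainder contains the Hessian at an intermediate point, which
    \<omega> compares with the one at x.\<close>
  define D where "D m r = (if m = 0 then f (x + r *\<^sub>R d) else if m = 1 then g (x + r *\<^sub>R d) \<bullet> d
     else d \<bullet> (Q (x + r *\<^sub>R d) *v d))" for m :: nat and r :: real
  have line: "((\<lambda>r. x + r *\<^sub>R d) has_derivative (\<lambda>k. k *\<^sub>R d)) (at r)" for r
    by (auto intro!: derivative_eq_intros)
  have D0: "(D 0 has_real_derivative D 1 r) (at r)" for r
  proof -
    have "((\<lambda>r. f (x + r *\<^sub>R d)) has_derivative (\<lambda>k. g (x + r *\<^sub>R d) \<bullet> (k *\<^sub>R d))) (at r)"
      using has_derivative_compose[OF line f] .
    then show ?thesis unfolding has_field_derivative_def D_def[abs_def] by (simp add: mult_commute_abs)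
  qed
  have D1: "(D 1 has_real_derivative D 2 r) (at r)" for r
  proof -
    have "((\<lambda>r. g (x + r *\<^sub>R d)) has_derivative (\<lambda>k. Q (x + r *\<^sub>R d) *v (k *\<^sub>R d))) (at r)"
      using has_derivative_compose[OF line g] .
    then have "((\<lambda>r. g (x + r *\<^sub>R d) \<bullet> d) has_derivative (\<lambda>k. (Q (x + r *\<^sub>R d) *v (k *\<^sub>R d)) \<bullet> d)) (at r)"
      by (rule has_derivative_inner_left)
    then show ?thesis unfolding has_field_derivative_def D_def[abs_def]
      by (simp add: matrix_vector_mult_scaleR inner_commute mult_commute_abs)
  qed
  have diff: "\<forall>m t. m < 2 \<and> 0 \<le> t \<and> t \<le> 1 \<longrightarrow> (D m has_real_derivative D (Suc m) t) (at t)"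
  proof (intro allI impI)
    fix m :: nat and t :: real assume "m < 2 \<and> 0 \<le> t \<and> t \<le> 1"
    then have "m = 0 \<or> m = 1" by auto
    then show "(D m has_real_derivative D (Suc m) t) (at t)"
      using D0 D1 by (auto simp: numeral_2_eq_2)
  qed
  have "\<exists>t>0. t < 1 \<and> D 0 1 = (\<Sum>m<2. D m 0 / fact m * 1 ^ m) + D 2 t / fact 2 * 1 ^ 2"
    by (rule Maclaurin) (use diff in auto)
  then obtain t where t: "0 < t" "t < 1" and eq: "D 0 1 = D 0 0 + D 1 0 + D 2 t / 2"
    by (auto simp: numeral_2_eq_2)
  have eq2: "f (x + d) - f x - g x \<bullet> d - 1 / 2 * (d \<bullet> (Q x *v d)) = 1 / 2 * (d \<bullet> ((Q (x + t *\<^sub>R d) - Q x) *v d))"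
    using eq by (simp add: D_def matrix_vector_mult_diff_rdistrib inner_diff_right)
  have "\<bar>d \<bullet> ((Q (x + t *\<^sub>R d) - Q x) *v d)\<bar> \<le> norm (Q (x + t *\<^sub>R d) - Q x) * norm d * norm d"
    by (rule abs_inner_matrix_vector_le)
  also have "\<dots> \<le> \<omega> * norm d * norm d"
    using Q[of t] t by (intro mult_right_mono) auto
  finally show ?thesis unfolding eq2 by (simp add: abs_mult power2_eq_square)
qed

section \<open>A bounded process with drift, and its moments\<close>

text \<open>The data of Dynkin's formula, detached from the equation and from the exit problem. The
  increment identity is demanded on every path, so that no exceptional set enters the estimates of a
  single step.\<close>

locale dynkin_process = stopped_ito M W H I \<tau> Hs Y K
  for M :: "'a measure" and W :: "real \<Rightarrow> 'a \<Rightarrow> real ^ 'k"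
    and H :: "real \<Rightarrow> 'a \<Rightarrow> real ^ 'k ^ 'n" and I :: "real \<Rightarrow> 'a \<Rightarrow> real ^ 'n" and \<tau> :: "'a \<Rightarrow> real"
    and Hs :: "real \<Rightarrow> 'a \<Rightarrow> real ^ 'k ^ 'n" and Y :: "real \<Rightarrow> 'a \<Rightarrow> real ^ 'n" and K :: real +
  fixes Z B :: "real \<Rightarrow> 'a \<Rightarrow> real ^ 'n" and T R :: real
    and V Vt :: "real \<Rightarrow> real ^ 'n \<Rightarrow> real"
    and Vx :: "real \<Rightarrow> real ^ 'n \<Rightarrow> real ^ 'n"
    and Vxx :: "real \<Rightarrow> real ^ 'n \<Rightarrow> real ^ 'n ^ 'n"
  assumes T_pos: "0 < T"
    and Z_adapted: "0 \<le> t \<Longrightarrow> t \<le> T \<Longrightarrow> Z t \<in> borel_measurable (F t)"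
    and Z_joint: "(\<lambda>(u, w). Z u w) \<in> borel_measurable (borel \<Otimes>\<^sub>M M)"
    and Z_bound: "w \<in> space M \<Longrightarrow> norm (Z u w) \<le> R"
    and B_joint: "(\<lambda>(u, w). B u w) \<in> borel_measurable (borel \<Otimes>\<^sub>M M)"
    and B_bound: "w \<in> space M \<Longrightarrow> norm (B u w) \<le> K"
    and Z_increment: "w \<in> space M \<Longrightarrow> 0 \<le> s \<Longrightarrow> s \<le> t \<Longrightarrow> t \<le> T \<Longrightarrow>
      Z t w - Z s w = (LINT u:{s<..t}|lborel. B u w) + (Y t w - Y s w)"
    and C12: "C12_on T V Vt Vx Vxx"
begin

text \<open>\<open>V\<close> and its derivatives are controlled on the time interval from 0 to T
  only. Clamping the time makes their compositions with the process measurable on the whole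
  line.\<close>

abbreviation "cl u \<equiv> max 0 (min T u)"

lemma cl_in: "cl u \<in> {0..T}" using T_pos by auto

lemma cl_eq: "0 \<le> u \<Longrightarrow> u \<le> T \<Longrightarrow> cl u = u" by auto

lemma continuous_compose_measurable:
  fixes f :: "real \<Rightarrow> real ^ 'n \<Rightarrow> 'c::topological_space"
  assumes f: "continuous_on ({0..T} \<times> UNIV) (\<lambda>(t, x). f t x)"
    and a: "a \<in> borel_measurable L" and z: "z \<in> borel_measurable L"
  shows "(\<lambda>x. f (cl (a x)) (z x)) \<in> borel_measurable L"
proof -
  have "continuous_on UNIV (\<lambda>p :: real \<times> (real ^ 'n). (cl (fst p), snd p))"
    by (intro continuous_intros)
  then have "continuous_on UNIV ((\<lambda>(t, x). f t x) \<circ> (\<lambda>p :: real \<times> (real ^ 'n). (cl (fst p), snd p)))"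
    using cl_in by (intro continuous_on_compose continuous_on_subset[OF f]) auto
  then have f': "(\<lambda>p :: real \<times> (real ^ 'n). f (cl (fst p)) (snd p)) \<in> borel_measurable borel"
    by (intro borel_measurable_continuous_onI) (simp add: comp_def)
  have "(\<lambda>x. (a x, z x)) \<in> borel_measurable L" using a z by measurable
  from measurable_compose[OF this f'] show ?thesis by simp
qed

lemma V_deriv:
  assumes "t \<in> {0..T}"
  shows "((\<lambda>s. V s x) has_real_derivative Vt t x) (at t within {0..T})"
    "(V t has_derivative (\<lambda>h. Vx t x \<bullet> h)) (at x)"
    "(Vx t has_derivative (\<lambda>h. Vxx t x *v h)) (at x)"
  using C12 assms by (auto simp: C12_on_def)

lemma V_cont: "continuous_on ({0..T} \<times> UNIV) (\<lambda>(t, x). V t x)"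
  "continuous_on ({0..T} \<times> UNIV) (\<lambda>(t, x). Vt t x)"
  "continuous_on ({0..T} \<times> UNIV) (\<lambda>(t, x). Vx t x)"
  "continuous_on ({0..T} \<times> UNIV) (\<lambda>(t, x). Vxx t x)"
  using C12 by (auto simp: C12_on_def)

lemma Z_measurable: "Z u \<in> borel_measurable M"
  using measurable_compose[OF measurable_Pair1' Z_joint, of u] by simp

lemma Z_section [measurable]: "w \<in> space M \<Longrightarrow> (\<lambda>u. Z u w) \<in> borel_measurable borel"
  using measurable_compose[OF measurable_Pair2' Z_joint, of w] by simp

lemma B_section [measurable]: "w \<in> space M \<Longrightarrow> (\<lambda>u. B u w) \<in> borel_measurable borel"
  using measurable_compose[OF measurable_Pair2' B_joint, of w] by simp

lemma Hs_section [measurable]: "w \<in> space M \<Longrightarrow> (\<lambda>u. Hs u w) \<in> borel_measurable borel"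
  using measurable_compose[OF measurable_Pair2' Hs_joint, of w] by simp

lemma bounded_on_ball:
  fixes f :: "real \<Rightarrow> real ^ 'n \<Rightarrow> 'c::real_normed_vector"
  assumes f: "continuous_on ({0..T} \<times> UNIV) (\<lambda>(t, x). f t x)"
  shows "\<exists>C\<ge>0. \<forall>u\<in>{0..T}. \<forall>x\<in>cball 0 R. norm (f u x) \<le> C"
proof -
  have "compact ((\<lambda>(t, x). f t x) ` ({0..T} \<times> cball 0 R))"
    by (intro compact_continuous_image continuous_on_subset[OF f] compact_Times) auto
  then have "bounded ((\<lambda>(t, x). f t x) ` ({0..T} \<times> cball 0 R))" by (rule compact_imp_bounded)
  then obtain C where "0 < C" "\<forall>y\<in>(\<lambda>(t, x). f t x) ` ({0..T} \<times> cball 0 R). norm y \<le> C"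
    unfolding bounded_pos by auto
  then show ?thesis by (intro exI[of _ C]) auto
qed

text \<open>The Ito drift of \<open>V\<close> along \<open>Z\<close>. It uses the coefficients of
  the process itself, which cease to be functions of its position once the process is
  stopped.\<close>

definition drift :: "real \<Rightarrow> 'a \<Rightarrow> real" where
  "drift u w = Vt (cl u) (Z u w) + Vx (cl u) (Z u w) \<bullet> B u w +
     1 / 2 * (Hs u w \<bullet> (Vxx (cl u) (Z u w) ** Hs u w))"

lemma drift_joint: "(\<lambda>(u, w). drift u w) \<in> borel_measurable (borel \<Otimes>\<^sub>M M)"
proof -
  have Z: "(\<lambda>p. Z (fst p) (snd p)) \<in> borel_measurable (borel \<Otimes>\<^sub>M M)"
    and B: "(\<lambda>p. B (fst p) (snd p)) \<in> borel_measurable (borel \<Otimes>\<^sub>M M)"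
    and Hs: "(\<lambda>p. Hs (fst p) (snd p)) \<in> borel_measurable (borel \<Otimes>\<^sub>M M)"
    using Z_joint B_joint Hs_joint by (simp_all add: split_beta')
  note 1 = continuous_compose_measurable[OF V_cont(2) measurable_fst Z]
    and 2 = continuous_compose_measurable[OF V_cont(3) measurable_fst Z]
    and 3 = continuous_compose_measurable[OF V_cont(4) measurable_fst Z]
  show ?thesis unfolding drift_def split_beta'
    by (intro borel_measurable_add borel_measurable_times borel_measurable_const
        borel_measurable_inner 1 2 B Hs borel_measurable_matrix_mult(2)[OF 3 Hs])
qed

text \<open>The bound for the increments of \<open>Y\<close> is inherited from those of
  \<open>Z\<close> and \<open>B\<close>. It supplies the constant that the moment identities
  presuppose, and it is the reason for confining the process to a ball.\<close>

lemma Z_increment_bound: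
  assumes w: "w \<in> space M" and st: "0 \<le> s" "s \<le> t" "t \<le> T"
  shows "norm (LINT u:{s<..t}|lborel. B u w) \<le> K * (t - s)"
    "norm (Y t w - Y s w) \<le> 2 * R + K * T"
proof -
  have "norm (LINT u:{s<..t}|lborel. B u w) \<le> (LINT u:{s<..t}|lborel. K)"
  proof (rule norm_set_integral_Ioc_le)
    show "set_integrable lborel {s<..t} (\<lambda>u. B u w)"
      by (rule set_integrable_Ioc_bounded[where C = K]) (use B_section B_bound w st in auto)
    show "set_integrable lborel {s<..t} (\<lambda>u. K)"
      by (rule set_integrable_Ioc_bounded[where C = "\<bar>K\<bar>"]) (use st in auto)
  qed (use B_bound[OF w] in auto)
  then show 1: "norm (LINT u:{s<..t}|lborel. B u w) \<le> K * (t - s)"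
    using st by (simp add: set_integral_Ioc_const)
  have "Y t w - Y s w = Z t w - Z s w - (LINT u:{s<..t}|lborel. B u w)"
    using Z_increment[OF w st] by simp
  also have "norm \<dots> \<le> norm (Z t w) + norm (Z s w) + norm (LINT u:{s<..t}|lborel. B u w)"
    using norm_triangle_ineq4[of "Z t w - Z s w" "LINT u:{s<..t}|lborel. B u w"]
      norm_triangle_ineq4[of "Z t w" "Z s w"] by linarith
  also have "\<dots> \<le> R + R + K * (t - s)"
    using Z_bound[OF w] 1 by (intro add_mono) auto
  also have "\<dots> \<le> 2 * R + K * T"
    using st K_nonneg mult_left_mono[of "t - s" T K] by simp
  finally show "norm (Y t w - Y s w) \<le> 2 * R + K * T" .
qed

lemma DY_second_moment:
  assumes st: "0 \<le> s" "s < t" "t \<le> T"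
  shows "expectation (\<lambda>w. (norm (Y t w - Y s w))\<^sup>2) \<le> K\<^sup>2 * (t - s)"
proof -
  have "expectation (\<lambda>w. (norm (Y t w - Y s w))\<^sup>2) =
      expectation (\<lambda>w. (Y t w - Y s w) \<bullet> (mat 1 *v (Y t w - Y s w)))"
    by (simp add: power2_norm_eq_inner)
  also have "\<dots> = expectation (\<lambda>w. LINT u:{s<..t}|lborel. Hs u w \<bullet> (mat 1 ** Hs u w))"
    by (rule expectation_quadratic_DY[OF st(1,2) Z_increment_bound(2) borel_measurable_const order_refl])
       (use st in auto)
  also have "\<dots> = expectation (\<lambda>w. LINT u:{s<..t}|lborel. (norm (Hs u w))\<^sup>2)"
    by (simp add: power2_norm_eq_inner)
  also have "\<dots> \<le> expectation (\<lambda>w. K\<^sup>2 * (t - s))"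
  proof -
    have j: "(\<lambda>(u, w). (norm (Hs u w))\<^sup>2) \<in> borel_measurable (borel \<Otimes>\<^sub>M M)"
      using Hs_joint by (simp add: split_beta')
    have b: "\<bar>(norm (Hs u w))\<^sup>2\<bar> \<le> K\<^sup>2" if "w \<in> space M" for u w
      using Hs_bound[OF that] by (simp add: power_mono)
    note tH = j b less_imp_le[OF st(2)]
    show ?thesis
    proof (rule integral_mono[OF time_integral_integrable[OF tH]])
      fix w assume "w \<in> space M"
      then show "(LINT u:{s<..t}|lborel. (norm (Hs u w))\<^sup>2) \<le> K\<^sup>2 * (t - s)"
        using time_integral_bound[OF tH, of w] by simp
    qed (assumption | rule integrable_const)+
  qed
  finally show ?thesis by (simp add: prob_space)
qed

lemma DY_measurable': "0 \<le> s \<Longrightarrow> 0 \<le> t \<Longrightarrow> (\<lambda>w. Y t w - Y s w) \<in> borel_measurable M"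
  using borel_measurable_diff[OF Y_measurable Y_measurable] by simp

definition "m2 = 2 * K\<^sup>2 * (T + 1)"

text \<open>Here 36 = 4 * 9 combines the loss in \<open>expectation_fourth_DY\<close> with the
  constant of the discrete estimate. The term with T^2 accounts for the drift part, and 8 comes from
  \<open>power4_add_le\<close>.\<close>

definition "m4 = 8 * (K ^ 4 * T\<^sup>2 + 36 * (real CARD('k))\<^sup>2 * K ^ 4)"

lemma m_nonneg: "0 \<le> m2" "0 \<le> m4"
  using T_pos by (auto simp: m2_def m4_def)

lemma Z_second_moment:
  assumes st: "0 \<le> s" "s \<le> t" "t \<le> T"
  shows "expectation (\<lambda>w. (norm (Z t w - Z s w))\<^sup>2) \<le> m2 * (t - s)"
proof (cases "s = t")
  case False
  then have st': "0 \<le> s" "s < t" "t \<le> T" using st by auto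
  let ?Y = "\<lambda>w. Y t w - Y s w"
  have iY: "integrable M (\<lambda>w. (norm (?Y w))\<^sup>2)"
  proof (rule integrable_bounded)
    show "(\<lambda>w. (norm (?Y w))\<^sup>2) \<in> borel_measurable M"
      using DY_measurable'[of s t] st by (rule_tac measurable_compose) auto
    show "norm ((norm (?Y w))\<^sup>2) \<le> (2 * R + K * T)\<^sup>2" if "w \<in> space M" for w
      using Z_increment_bound(2)[OF that st] by (simp add: power_mono)
  qed
  have "expectation (\<lambda>w. (norm (Z t w - Z s w))\<^sup>2) \<le> expectation (\<lambda>w. 2 * (K * (t - s))\<^sup>2 + 2 * (norm (?Y w))\<^sup>2)"
  proof (rule integral_mono')
    show "integrable M (\<lambda>w. 2 * (K * (t - s))\<^sup>2 + 2 * (norm (?Y w))\<^sup>2)" using iY by simp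
    fix w assume w: "w \<in> space M"
    have "norm (Z t w - Z s w) \<le> K * (t - s) + norm (?Y w)"
      unfolding Z_increment[OF w st]
      using Z_increment_bound(1)[OF w st] norm_triangle_ineq[of "LINT u:{s<..t}|lborel. B u w" "?Y w"] by linarith
    then have "(norm (Z t w - Z s w))\<^sup>2 \<le> (K * (t - s) + norm (?Y w))\<^sup>2"
      by (intro power_mono) auto
    also have "\<dots> \<le> 2 * (K * (t - s))\<^sup>2 + 2 * (norm (?Y w))\<^sup>2"
      using sum_squares_bound[of "K * (t - s)" "norm (?Y w)"] by (simp add: power2_sum)
    finally show "(norm (Z t w - Z s w))\<^sup>2 \<le> 2 * (K * (t - s))\<^sup>2 + 2 * (norm (?Y w))\<^sup>2" .
  qed auto
  also have "\<dots> = 2 * (K * (t - s))\<^sup>2 + 2 * expectation (\<lambda>w. (norm (?Y w))\<^sup>2)"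
    using iY by (simp add: prob_space)
  also have "\<dots> \<le> 2 * (K\<^sup>2 * (T * (t - s))) + 2 * (K\<^sup>2 * (t - s))"
  proof (intro add_mono mult_left_mono DY_second_moment st')
    have "(t - s) * (t - s) \<le> T * (t - s)" using st by (intro mult_right_mono) auto
    then show "(K * (t - s))\<^sup>2 \<le> K\<^sup>2 * (T * (t - s))"
      by (simp add: power_mult_distrib power2_eq_square[of "t - s"] mult_left_mono)
  qed auto
  also have "\<dots> = m2 * (t - s)" by (simp add: m2_def algebra_simps)
  finally show ?thesis .
qed simp

lemma Z_fourth_moment:
  assumes st: "0 \<le> s" "s < t" "t \<le> T"
  shows "expectation (\<lambda>w. norm (Z t w - Z s w) ^ 4) \<le> m4 * (t - s)\<^sup>2"
proof -
  have st': "0 \<le> s" "s \<le> t" "t \<le> T" using st by auto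
  let ?Y = "\<lambda>w. Y t w - Y s w"
  have iY: "integrable M (\<lambda>w. norm (?Y w) ^ 4)"
  proof (rule integrable_bounded)
    show "(\<lambda>w. norm (?Y w) ^ 4) \<in> borel_measurable M"
      using DY_measurable'[of s t] st' by (rule_tac measurable_compose) auto
    show "norm (norm (?Y w) ^ 4) \<le> (2 * R + K * T) ^ 4" if "w \<in> space M" for w
      using Z_increment_bound(2)[OF that st'] by (simp add: power_mono)
  qed
  have Y4: "expectation (\<lambda>w. norm (?Y w) ^ 4) \<le> 4 * (9 * (real CARD('k))\<^sup>2 * K ^ 4 * (t - s)\<^sup>2)"
  proof -
    have fb: "fourth_bound s t = 9 * (real CARD('k))\<^sup>2 * K ^ 4 * (t - s)\<^sup>2"
      by (rule fourth_bound_def[OF st(1,2) Z_increment_bound(2)[OF _ st']])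
    have "expectation (\<lambda>w. norm (?Y w) ^ 4) \<le> 4 * fourth_bound s t"
      by (rule expectation_fourth_DY[OF st(1,2) Z_increment_bound(2)[OF _ st']])
    then show ?thesis unfolding fb .
  qed
  have "expectation (\<lambda>w. norm (Z t w - Z s w) ^ 4) \<le> expectation (\<lambda>w. 8 * ((K * (t - s)) ^ 4 + norm (?Y w) ^ 4))"
  proof (rule integral_mono')
    show "integrable M (\<lambda>w. 8 * ((K * (t - s)) ^ 4 + norm (?Y w) ^ 4))" using iY by simp
    fix w assume w: "w \<in> space M"
    have "norm (Z t w - Z s w) \<le> K * (t - s) + norm (?Y w)"
      unfolding Z_increment[OF w st']
      using Z_increment_bound(1)[OF w st'] norm_triangle_ineq[of "LINT u:{s<..t}|lborel. B u w" "?Y w"] by linarith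
    then have "norm (Z t w - Z s w) ^ 4 \<le> (K * (t - s) + norm (?Y w)) ^ 4"
      by (intro power_mono) auto
    also have "\<dots> \<le> 8 * ((K * (t - s)) ^ 4 + norm (?Y w) ^ 4)" by (rule power4_add_le)
    finally show "norm (Z t w - Z s w) ^ 4 \<le> 8 * ((K * (t - s)) ^ 4 + norm (?Y w) ^ 4)" .
  qed auto
  also have "\<dots> = 8 * ((K * (t - s)) ^ 4 + expectation (\<lambda>w. norm (?Y w) ^ 4))"
    using iY by (simp add: prob_space)
  also have "\<dots> \<le> 8 * (K ^ 4 * (T\<^sup>2 * (t - s)\<^sup>2) + 4 * (9 * (real CARD('k))\<^sup>2 * K ^ 4 * (t - s)\<^sup>2))"
  proof (intro mult_left_mono add_mono Y4)
    have "(t - s)\<^sup>2 * (t - s)\<^sup>2 \<le> T\<^sup>2 * (t - s)\<^sup>2" using st by (intro mult_right_mono power_mono) auto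
    then have "(t - s) ^ 4 \<le> T\<^sup>2 * (t - s)\<^sup>2" by (simp flip: power_add)
    then show "(K * (t - s)) ^ 4 \<le> K ^ 4 * (T\<^sup>2 * (t - s)\<^sup>2)"
      by (simp add: power_mult_distrib mult_left_mono)
  qed auto
  also have "\<dots> = m4 * (t - s)\<^sup>2" by (simp add: m4_def algebra_simps)
  finally show ?thesis .
qed

lemma V_time_increment:
  assumes "0 \<le> s" "s \<le> t" "t \<le> T"
  shows "V t x - V s x = (LINT u:{s<..t}|lborel. Vt (cl u) x)"
proof -
  have cont: "continuous_on {s..t} (\<lambda>u. Vt u x)"
  proof -
    have "continuous_on {s..t} ((\<lambda>(t, x). Vt t x) \<circ> (\<lambda>u. (u, x)))"
      using assms by (intro continuous_on_compose continuous_on_subset[OF V_cont(2)] continuous_intros) auto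
    then show ?thesis by (simp add: comp_def)
  qed
  have "(\<integral>u. indicator {s..t} u *\<^sub>R Vt u x \<partial>lborel) = V t x - V s x"
  proof (rule integral_FTC_Icc[OF assms(2) _ cont])
    fix u assume u: "s \<le> u" "u \<le> t"
    then have "((\<lambda>s. V s x) has_real_derivative Vt u x) (at u within {s..t})"
      using assms by (intro DERIV_subset[OF V_deriv(1)]) auto
    then show "((\<lambda>u. V u x) has_vector_derivative Vt u x) (at u within {s..t})"
      by (simp add: has_real_derivative_iff_has_vector_derivative)
  qed
  moreover have "(\<integral>u. indicator {s..t} u *\<^sub>R Vt u x \<partial>lborel) = (LINT u:{s<..t}|lborel. Vt (cl u) x)"
    unfolding set_lebesgue_integral_def
  proof (rule integral_cong_AE)
    show "(\<lambda>u. indicator {s<..t} u *\<^sub>R Vt (cl u) x) \<in> borel_measurable lborel"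
      by (intro borel_measurable_scaleR borel_measurable_indicator
          continuous_compose_measurable[OF V_cont(2)]) auto
    show "(\<lambda>u. indicator {s..t} u *\<^sub>R Vt u x) \<in> borel_measurable lborel"
      unfolding measurable_lborel2 by (rule borel_measurable_continuous_on_indicator[OF _ cont]) simp
    show "AE u in lborel. indicator {s..t} u *\<^sub>R Vt u x = indicator {s<..t} u *\<^sub>R Vt (cl u) x"
      using AE_lborel_singleton[of s]
    proof eventually_elim
      case (elim u)
      then show ?case using assms cl_eq[of u] by (auto simp: indicator_def)
    qed
  qed
  ultimately show ?thesis by simp
qed

end

section \<open>The error of one time step, and the formula\<close>

context dynkin_process
begin

lemma drift_bound: "\<exists>C. \<forall>w\<in>space M. \<forall>u. \<bar>drift u w\<bar> \<le> C"
proof -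
  obtain C1 where C1: "0 \<le> C1" "\<And>u x. u \<in> {0..T} \<Longrightarrow> x \<in> cball 0 R \<Longrightarrow> norm (Vt u x) \<le> C1"
    using bounded_on_ball[OF V_cont(2)] by auto
  obtain C2 where C2: "0 \<le> C2" "\<And>u x. u \<in> {0..T} \<Longrightarrow> x \<in> cball 0 R \<Longrightarrow> norm (Vx u x) \<le> C2"
    using bounded_on_ball[OF V_cont(3)] by auto
  obtain C3 where C3: "0 \<le> C3" "\<And>u x. u \<in> {0..T} \<Longrightarrow> x \<in> cball 0 R \<Longrightarrow> norm (Vxx u x) \<le> C3"
    using bounded_on_ball[OF V_cont(4)] by auto
  have "\<bar>drift u w\<bar> \<le> C1 + C2 * K + 1 / 2 * (C3 * K * K)" if w: "w \<in> space M" for w u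
  proof -
    have Z: "Z u w \<in> cball 0 R" using Z_bound[OF w] by simp
    have "\<bar>Vx (cl u) (Z u w) \<bullet> B u w\<bar> \<le> norm (Vx (cl u) (Z u w)) * norm (B u w)"
      by (rule Cauchy_Schwarz_ineq2)
    also have "\<dots> \<le> C2 * K"
      using C2 B_bound[OF w] cl_in Z by (intro mult_mono) auto
    finally have 2: "\<bar>Vx (cl u) (Z u w) \<bullet> B u w\<bar> \<le> C2 * K" .
    have "\<bar>Hs u w \<bullet> (Vxx (cl u) (Z u w) ** Hs u w)\<bar> \<le> norm (Vxx (cl u) (Z u w)) * norm (Hs u w) * norm (Hs u w)"
      by (rule abs_inner_matrix_le)
    also have "\<dots> \<le> C3 * K * K"
      using C3 Hs_bound[OF w] cl_in Z K_nonneg by (intro mult_mono) auto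
    finally have 3: "\<bar>Hs u w \<bullet> (Vxx (cl u) (Z u w) ** Hs u w)\<bar> \<le> C3 * K * K" .
    have 1: "\<bar>Vt (cl u) (Z u w)\<bar> \<le> C1" using C1(2)[OF cl_in Z] by simp
    show ?thesis using 1 2 3 unfolding drift_def by linarith
  qed
  then show ?thesis by blast
qed

lemma V_Z_integrable:
  assumes "t \<in> {0..T}"
  shows "integrable M (\<lambda>w. V t (Z t w))"
proof -
  obtain C where "0 \<le> C" and C: "\<And>u x. u \<in> {0..T} \<Longrightarrow> x \<in> cball 0 R \<Longrightarrow> norm (V u x) \<le> C"
    using bounded_on_ball[OF V_cont(1)] by auto
  have "(\<lambda>w. V (cl t) (Z t w)) \<in> borel_measurable M"
    by (rule continuous_compose_measurable[OF V_cont(1) _ Z_measurable]) simp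
  moreover have "cl t = t" by (rule cl_eq) (use assms in auto)
  ultimately have m: "(\<lambda>w. V t (Z t w)) \<in> borel_measurable M" by (simp only:)
  show ?thesis
  proof (rule integrable_bounded[OF m])
    show "norm (V t (Z t w)) \<le> C" if "w \<in> space M" for w
      by (rule C[OF assms]) (use Z_bound[OF that] in simp)
  qed
qed

lemma Z_square_joint: "(\<lambda>(u, w). (norm (Z r w - Z u w))\<^sup>2) \<in> borel_measurable (borel \<Otimes>\<^sub>M M)"
proof -
  have [measurable]: "(\<lambda>p. Z (fst p) (snd p)) \<in> borel_measurable (borel \<Otimes>\<^sub>M M)"
    using Z_joint by (simp add: split_beta')
  have [measurable]: "(\<lambda>p. Z r (snd p)) \<in> borel_measurable (borel \<Otimes>\<^sub>M M)"
    by (rule measurable_compose[OF measurable_snd Z_measurable])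
  show ?thesis unfolding split_beta' by measurable
qed

lemma norm_Z_diff_le: "w \<in> space M \<Longrightarrow> norm (Z r w - Z u w) \<le> 2 * R"
  using norm_triangle_ineq4[of "Z r w" "Z u w"] Z_bound[of w r] Z_bound[of w u] by linarith

definition "modulus f \<epsilon> c \<delta> \<longleftrightarrow> (\<forall>u\<in>{0..T}. \<forall>u'\<in>{0..T}. \<forall>x\<in>cball 0 R. \<forall>x'\<in>cball 0 R.
    \<bar>u - u'\<bar> \<le> \<delta> \<longrightarrow> norm (f u x - f u' x') \<le> \<epsilon> + c * (norm (x - x'))\<^sup>2)"
  for f :: "real \<Rightarrow> real ^ 'n \<Rightarrow> 'c::real_normed_vector"

lemma exists_modulus:
  fixes f :: "real \<Rightarrow> real ^ 'n \<Rightarrow> 'c::real_normed_vector"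
  assumes "continuous_on ({0..T} \<times> UNIV) (\<lambda>(t, x). f t x)" "0 < \<epsilon>"
  shows "\<exists>c \<delta>. 0 \<le> c \<and> 0 < \<delta> \<and> modulus f \<epsilon> c \<delta>"
  using quadratic_modulus[OF assms, of R] unfolding modulus_def by simp

lemma modulus_mono:
  assumes "modulus f \<epsilon> c \<delta>" "c \<le> c'" "\<delta>' \<le> \<delta>"
  shows "modulus f \<epsilon> c' \<delta>'"
  unfolding modulus_def
proof (intro ballI impI)
  fix u u' :: real and x x' :: "real ^ 'n" assume *: "u \<in> {0..T}" "u' \<in> {0..T}" "x \<in> cball 0 R" "x' \<in> cball 0 R" "\<bar>u - u'\<bar> \<le> \<delta>'"
  then have "norm (f u x - f u' x') \<le> \<epsilon> + c * (norm (x - x'))\<^sup>2"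
    using assms unfolding modulus_def by auto
  also have "\<dots> \<le> \<epsilon> + c' * (norm (x - x'))\<^sup>2"
    using assms by (intro add_left_mono mult_right_mono) auto
  finally show "norm (f u x - f u' x') \<le> \<epsilon> + c' * (norm (x - x'))\<^sup>2" .
qed

context
  fixes s t \<epsilon> c \<delta> CQ :: real
  assumes st: "0 \<le> s" "s < t" "t \<le> T" and \<epsilon>: "0 < \<epsilon>" and c: "0 \<le> c" and \<delta>: "t - s \<le> \<delta>"
    and mods: "modulus Vt \<epsilon> c \<delta>" "modulus Vx \<epsilon> c \<delta>" "modulus Vxx \<epsilon> c \<delta>"
    and CQ: "0 \<le> CQ" "\<And>u x. u \<in> {0..T} \<Longrightarrow> x \<in> cball 0 R \<Longrightarrow> norm (Vxx u x) \<le> CQ"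
begin

text \<open>The step is split into a move in space at time s, by Taylor's formula, and a move in
  time at the fixed point \<open>Z t w\<close>. Gradient and Hessian are thus taken at
  \<open>Z s w\<close> and known at time s, as the moment identities require; the terms with
  \<open>y\<close> subtracted on the left have total mean zero. On the right stand, in this order,
  the errors from freezing the coefficients, from the Taylor remainder, and from replacing
  \<open>d\<close> by its martingale part \<open>y\<close> in the quadratic form.\<close>

lemma step_pointwise:
  assumes w: "w \<in> space M"
  defines "Q \<equiv> Vxx s (Z s w)" and "y \<equiv> Y t w - Y s w" and "d \<equiv> Z t w - Z s w"
  shows "\<bar>V t (Z t w) - V s (Z s w) - (LINT u:{s<..t}|lborel. drift u w) - Vx s (Z s w) \<bullet> y -
      1 / 2 * (y \<bullet> (Q *v y) - (LINT u:{s<..t}|lborel. Hs u w \<bullet> (Q ** Hs u w)))\<bar> \<le>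
    (LINT u:{s<..t}|lborel. (\<epsilon> + c * (norm (Z t w - Z u w))\<^sup>2) + (K + 1 / 2 * K\<^sup>2) * (\<epsilon> + c * (norm (Z s w - Z u w))\<^sup>2)) +
    1 / 2 * (\<epsilon> * (norm d)\<^sup>2 + c * norm d ^ 4) +
    1 / 2 * (CQ * (K\<^sup>2 * (t - s)\<^sup>2 + 2 * K * (t - s) * (\<epsilon> + (norm y)\<^sup>2 / \<epsilon>)))"
proof -
  interpret mv: bounded_bilinear "(*v) :: real ^ 'n ^ 'n \<Rightarrow> real ^ 'n \<Rightarrow> real ^ 'n"
    by (rule bounded_bilinear_matrix_vector_mult)
  interpret mm: bounded_bilinear "(**) :: real ^ 'n ^ 'n \<Rightarrow> real ^ 'k ^ 'n \<Rightarrow> real ^ 'k ^ 'n"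
    by (rule bounded_bilinear_matrix_matrix_mult)
  have st': "0 \<le> s" "s \<le> t" "t \<le> T" using st by auto
  have sT: "s \<in> {0..T}" using st by auto
  have Zb: "Z u w \<in> cball 0 R" for u using Z_bound[OF w] by simp
  define a where "a = Vx s (Z s w)"
  define b where "b = (LINT u:{s<..t}|lborel. B u w)"
  have b: "norm b \<le> K * (t - s)" unfolding b_def by (rule Z_increment_bound(1)[OF w st'])
  have d: "d = b + y" unfolding d_def b_def y_def by (rule Z_increment[OF w st'])
  have Q: "norm Q \<le> CQ" unfolding Q_def by (rule CQ(2)[OF sT Zb])
  have Bs[measurable]: "(\<lambda>u. B u w) \<in> borel_measurable borel" and
    Hss[measurable]: "(\<lambda>u. Hs u w) \<in> borel_measurable borel" and
    Zs[measurable]: "(\<lambda>u. Z u w) \<in> borel_measurable borel"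
    using B_section Hs_section Z_section w by auto
  have iB: "set_integrable lborel {s<..t} (\<lambda>u. B u w)"
    by (rule set_integrable_Ioc_bounded[where C = K]) (use B_bound[OF w] st in auto)
  obtain Cd where Cd': "\<forall>w\<in>space M. \<forall>u. \<bar>drift u w\<bar> \<le> Cd" using drift_bound by (rule exE)
  have Cd: "\<bar>drift u w\<bar> \<le> Cd" for u by (rule Cd'[rule_format, OF w])
  have dm: "(\<lambda>u. drift u w) \<in> borel_measurable borel"
    using measurable_compose[OF measurable_Pair2'[OF w] drift_joint] by (simp only: prod.case)
  have i4: "set_integrable lborel {s<..t} (\<lambda>u. drift u w)"
  proof (rule set_integrable_Ioc_bounded[OF dm])
    show "norm (drift u w) \<le> Cd" for u using Cd[of u] unfolding real_norm_def .
    show "s \<le> t" using st by linarith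
  qed
  obtain C1 where "0 \<le> C1" and C1: "\<And>u x. u \<in> {0..T} \<Longrightarrow> x \<in> cball 0 R \<Longrightarrow> norm (Vt u x) \<le> C1"
    using bounded_on_ball[OF V_cont(2)] by auto
  have i1: "set_integrable lborel {s<..t} (\<lambda>u. Vt (cl u) (Z t w))"
  proof (rule set_integrable_Ioc_bounded[where C = C1])
    show "(\<lambda>u. Vt (cl u) (Z t w)) \<in> borel_measurable borel"
      by (rule continuous_compose_measurable[OF V_cont(2)]) auto
  qed (simp_all only: C1[OF cl_in Zb] less_imp_le[OF st(2)])
  have i2: "set_integrable lborel {s<..t} (\<lambda>u. a \<bullet> B u w)"
  proof (rule set_integrable_Ioc_bounded[where C = "norm a * K"])
    show "norm (a \<bullet> B u w) \<le> norm a * K" for u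
      using Cauchy_Schwarz_ineq2[of a "B u w"] mult_left_mono[OF B_bound[OF w, of u], of "norm a"] by simp
  qed (use st in auto)
  have i3: "set_integrable lborel {s<..t} (\<lambda>u. Hs u w \<bullet> (Q ** Hs u w))"
  proof (rule set_integrable_Ioc_bounded[where C = "CQ * K * K"])
    show "norm (Hs u w \<bullet> (Q ** Hs u w)) \<le> CQ * K * K" for u
      using abs_inner_matrix_le[of "Hs u w" Q "Hs u w"]
        mult_mono[OF mult_mono[OF Q Hs_bound[OF w, of u] CQ(1) norm_ge_zero] Hs_bound[OF w, of u] _ norm_ge_zero] CQ(1) K_nonneg
      by auto
    show "(\<lambda>u. Hs u w \<bullet> (Q ** Hs u w)) \<in> borel_measurable borel"
      by (intro borel_measurable_inner borel_measurable_matrix_mult(2) borel_measurable_const Hss)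
  qed (use st in linarith)
  define \<psi> where "\<psi> u = Vt (cl u) (Z t w) + a \<bullet> B u w + 1 / 2 * (Hs u w \<bullet> (Q ** Hs u w)) - drift u w" for u
  define \<phi> where "\<phi> u = (\<epsilon> + c * (norm (Z t w - Z u w))\<^sup>2) + (K + 1 / 2 * K\<^sup>2) * (\<epsilon> + c * (norm (Z s w - Z u w))\<^sup>2)" for u
  have i3': "set_integrable lborel {s<..t} (\<lambda>u. 1 / 2 * (Hs u w \<bullet> (Q ** Hs u w)))"
    by (rule set_integrable_mult_right[OF i3])
  note i12 = set_integral_add(1)[OF i1 i2]
  note i123 = set_integral_add(1)[OF i12 i3']
  have i5: "set_integrable lborel {s<..t} \<psi>"
    unfolding \<psi>_def[abs_def]
    by (rule set_integral_diff(1)[OF i123 i4])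
  have iZ: "set_integrable lborel {s<..t} (\<lambda>u. (norm (Z r w - Z u w))\<^sup>2)" for r
  proof (rule set_integrable_Ioc_bounded[where C = "(2 * R)\<^sup>2"])
    show "norm ((norm (Z r w - Z u w))\<^sup>2) \<le> (2 * R)\<^sup>2" for u
      using power_mono[OF norm_Z_diff_le[OF w, of r u] norm_ge_zero, of 2] by simp
    show "(\<lambda>u. (norm (Z r w - Z u w))\<^sup>2) \<in> borel_measurable borel"
      using borel_measurable_diff[OF borel_measurable_const Zs] by (rule measurable_compose) measurable
  qed (use st in linarith)
  have ic: "set_integrable lborel {s<..t} (\<lambda>u. k :: real)" for k
    by (rule set_integrable_Ioc_bounded[where C = "\<bar>k\<bar>"]) (use st in auto)
  have iZ': "set_integrable lborel {s<..t} (\<lambda>u. \<epsilon> + c * (norm (Z r w - Z u w))\<^sup>2)" for r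
    by (rule set_integral_add(1)[OF ic set_integrable_mult_right[OF iZ]])
  have i6: "set_integrable lborel {s<..t} \<phi>"
    unfolding \<phi>_def[abs_def]
    by (rule set_integral_add(1)[OF iZ'[of t] set_integrable_mult_right[OF iZ'[of s]]])
  have \<psi>\<phi>: "norm (\<psi> u) \<le> \<phi> u" if u: "s < u" "u \<le> t" for u
  proof -
    have uT: "u \<in> {0..T}" "cl u = u" using u st by auto
    have us: "\<bar>u - u\<bar> \<le> \<delta>" "\<bar>s - u\<bar> \<le> \<delta>" using u \<delta> st by auto
    have 1: "\<bar>Vt u (Z t w) - Vt u (Z u w)\<bar> \<le> \<epsilon> + c * (norm (Z t w - Z u w))\<^sup>2"
      using mods(1) uT(1) Zb us(1) unfolding modulus_def real_norm_def by blast
    have 2: "norm (a - Vx u (Z u w)) \<le> \<epsilon> + c * (norm (Z s w - Z u w))\<^sup>2"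
      using mods(2) uT(1) sT Zb us(2) unfolding modulus_def a_def by blast
    have 3: "norm (Q - Vxx u (Z u w)) \<le> \<epsilon> + c * (norm (Z s w - Z u w))\<^sup>2"
      using mods(3) uT(1) sT Zb us(2) unfolding modulus_def Q_def by blast
    have eq: "\<psi> u = (Vt u (Z t w) - Vt u (Z u w)) + (a - Vx u (Z u w)) \<bullet> B u w +
        1 / 2 * (Hs u w \<bullet> ((Q - Vxx u (Z u w)) ** Hs u w))"
      unfolding \<psi>_def drift_def uT(2)
      by (simp add: inner_diff_left mm.diff_left inner_diff_right algebra_simps)
    let ?e = "\<epsilon> + c * (norm (Z s w - Z u w))\<^sup>2"
    have e0: "0 \<le> ?e" using \<epsilon> c by simp
    have 4: "\<bar>(a - Vx u (Z u w)) \<bullet> B u w\<bar> \<le> ?e * K"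
      by (rule order_trans[OF Cauchy_Schwarz_ineq2 mult_mono[OF 2 B_bound[OF w] e0 norm_ge_zero]])
    have 5: "\<bar>Hs u w \<bullet> ((Q - Vxx u (Z u w)) ** Hs u w)\<bar> \<le> ?e * K * K"
      by (rule order_trans[OF abs_inner_matrix_le mult_mono[OF mult_mono[OF 3 Hs_bound[OF w] e0 norm_ge_zero] Hs_bound[OF w]]])
         (use e0 K_nonneg in auto)
    have "\<bar>\<psi> u\<bar> \<le> (\<epsilon> + c * (norm (Z t w - Z u w))\<^sup>2) + ?e * K + 1 / 2 * (?e * K * K)"
      unfolding eq using 1 4 5 by linarith
    also have "\<dots> = \<phi> u" unfolding \<phi>_def by (simp add: algebra_simps power2_eq_square)
    finally show ?thesis by simp
  qed
  have A: "\<bar>LINT u:{s<..t}|lborel. \<psi> u\<bar> \<le> (LINT u:{s<..t}|lborel. \<phi> u)"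
    using norm_set_integral_Ioc_le[OF i5 i6 \<psi>\<phi>] by simp
  define Rem where "Rem = V s (Z t w) - V s (Z s w) - a \<bullet> d - 1 / 2 * (d \<bullet> (Q *v d))"
  have "\<bar>V s (Z s w + d) - V s (Z s w) - Vx s (Z s w) \<bullet> d - 1 / 2 * (d \<bullet> (Vxx s (Z s w) *v d))\<bar> \<le>
      1 / 2 * (\<epsilon> + c * (norm d)\<^sup>2) * (norm d)\<^sup>2"
  proof (rule second_order_taylor_bound[OF V_deriv(2)[OF sT] V_deriv(3)[OF sT]])
    fix r :: real assume r: "0 \<le> r" "r \<le> 1"
    \<comment> \<open>Convexity of the ball keeps the whole segment where the modulus of
      \<open>Vxx\<close> is available.\<close>
    have "Z s w + r *\<^sub>R d = (1 - r) *\<^sub>R Z s w + r *\<^sub>R Z t w" by (simp add: d_def algebra_simps)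
    then have in_ball: "Z s w + r *\<^sub>R d \<in> cball 0 R"
      using convexD_alt[OF convex_cball Zb Zb r, of s t] by simp
    have "norm (Vxx s (Z s w + r *\<^sub>R d) - Vxx s (Z s w)) \<le> \<epsilon> + c * (norm (Z s w + r *\<^sub>R d - Z s w))\<^sup>2"
      using mods(3)[unfolded modulus_def, rule_format, OF sT sT in_ball Zb, of s] \<delta> st by simp
    also have "\<dots> \<le> \<epsilon> + c * (norm d)\<^sup>2"
      using r c by (intro add_left_mono mult_left_mono power_mono) (auto intro: mult_left_le_one_le)
    finally show "norm (Vxx s (Z s w + r *\<^sub>R d) - Vxx s (Z s w)) \<le> \<epsilon> + c * (norm d)\<^sup>2" .
  qed
  also have "1 / 2 * (\<epsilon> + c * (norm d)\<^sup>2) * (norm d)\<^sup>2 = 1 / 2 * (\<epsilon> * (norm d)\<^sup>2 + c * norm d ^ 4)"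
    by (simp add: algebra_simps flip: power_add)
  finally have Rem: "\<bar>Rem\<bar> \<le> 1 / 2 * (\<epsilon> * (norm d)\<^sup>2 + c * norm d ^ 4)"
    unfolding Rem_def a_def Q_def by (simp add: d_def)
  \<comment> \<open>Since d = b + y with |b| at most K (t - s), the cross terms are of order (t - s)
    |y|. Bounding |y| by \<epsilon> + |y|^2 / \<epsilon> makes their expectation a small multiple of
    t - s plus a term of order (t - s)^2.\<close>
  have quad: "\<bar>d \<bullet> (Q *v d) - y \<bullet> (Q *v y)\<bar> \<le> CQ * (K\<^sup>2 * (t - s)\<^sup>2 + 2 * K * (t - s) * (\<epsilon> + (norm y)\<^sup>2 / \<epsilon>))"
  proof -
    have Kt: "0 \<le> K * (t - s)" using K_nonneg st by simp
    have "d \<bullet> (Q *v d) - y \<bullet> (Q *v y) = b \<bullet> (Q *v b) + (b \<bullet> (Q *v y) + y \<bullet> (Q *v b))"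
      unfolding d by (simp add: mv.add_right inner_add_left inner_add_right)
    moreover have "\<bar>b \<bullet> (Q *v b)\<bar> \<le> CQ * (K * (t - s)) * (K * (t - s))"
      by (rule order_trans[OF abs_inner_matrix_vector_le mult_mono[OF mult_mono[OF Q b CQ(1) norm_ge_zero] b]])
         (use CQ(1) Kt in auto)
    moreover have "\<bar>b \<bullet> (Q *v y)\<bar> \<le> CQ * (K * (t - s)) * norm y"
      by (rule order_trans[OF abs_inner_matrix_vector_le mult_right_mono[OF mult_mono[OF Q b CQ(1) norm_ge_zero] norm_ge_zero]])
    moreover have "\<bar>y \<bullet> (Q *v b)\<bar> \<le> CQ * norm y * (K * (t - s))"
      by (rule order_trans[OF abs_inner_matrix_vector_le mult_mono[OF mult_right_mono[OF Q norm_ge_zero] b]])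
         (use CQ(1) in auto)
    ultimately have "\<bar>d \<bullet> (Q *v d) - y \<bullet> (Q *v y)\<bar> \<le> CQ * ((K * (t - s))\<^sup>2 + 2 * (K * (t - s)) * norm y)"
      by (simp add: algebra_simps power2_eq_square)
    also have "\<dots> \<le> CQ * ((K * (t - s))\<^sup>2 + 2 * (K * (t - s)) * (\<epsilon> + (norm y)\<^sup>2 / \<epsilon>))"
      using Kt CQ(1) le_scaled_square[OF \<epsilon>, of "norm y"] by (intro mult_left_mono add_left_mono) auto
    finally show ?thesis by (simp add: power_mult_distrib mult.assoc)
  qed
  have "(LINT u:{s<..t}|lborel. \<psi> u) = (LINT u:{s<..t}|lborel. Vt (cl u) (Z t w)) + (LINT u:{s<..t}|lborel. a \<bullet> B u w) +
      1 / 2 * (LINT u:{s<..t}|lborel. Hs u w \<bullet> (Q ** Hs u w)) - (LINT u:{s<..t}|lborel. drift u w)"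
    unfolding \<psi>_def set_integral_diff(2)[OF i123 i4] set_integral_add(2)[OF i12 i3']
      set_integral_add(2)[OF i1 i2] set_integral_mult_right ..
  also have "(LINT u:{s<..t}|lborel. a \<bullet> B u w) = a \<bullet> b"
  proof -
    have "integrable lborel (\<lambda>u. indicator {s<..t} u *\<^sub>R B u w)" using iB by (simp add: set_integrable_def)
    then show ?thesis unfolding b_def set_lebesgue_integral_def
      by (subst integral_inner_right[symmetric]) (auto simp: inner_scaleR_right)
  qed
  also have "(LINT u:{s<..t}|lborel. Vt (cl u) (Z t w)) = V t (Z t w) - V s (Z t w)"
    by (rule V_time_increment[OF st', symmetric])
  finally have eq: "V t (Z t w) - V s (Z s w) - (LINT u:{s<..t}|lborel. drift u w) - a \<bullet> y -
      1 / 2 * (y \<bullet> (Q *v y) - (LINT u:{s<..t}|lborel. Hs u w \<bullet> (Q ** Hs u w))) =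
      (LINT u:{s<..t}|lborel. \<psi> u) + Rem + 1 / 2 * (d \<bullet> (Q *v d) - y \<bullet> (Q *v y))"
    unfolding Rem_def using d by (simp add: inner_add_right algebra_simps)
  have abs3: "\<bar>x\<bar> \<le> A \<Longrightarrow> \<bar>r\<bar> \<le> B \<Longrightarrow> \<bar>q\<bar> \<le> C \<Longrightarrow> \<bar>x + r + 1 / 2 * q\<bar> \<le> A + B + 1 / 2 * C"
    for x r q A B C :: real by linarith
  show ?thesis
    unfolding a_def[symmetric] eq using abs3[OF A Rem quad] unfolding \<phi>_def .
qed

lemma Z_power_integrable: "integrable M (\<lambda>w. norm (Z r w - Z u w) ^ n)"
proof (rule integrable_bounded)
  show "(\<lambda>w. norm (Z r w - Z u w) ^ n) \<in> borel_measurable M"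
    using borel_measurable_diff[OF Z_measurable Z_measurable] by (rule measurable_compose) measurable
  show "norm (norm (Z r w - Z u w) ^ n) \<le> (2 * R) ^ n" if "w \<in> space M" for w
    using power_mono[OF norm_Z_diff_le[OF that, of r u] norm_ge_zero, of n] by simp
qed

lemma DY_power_integrable: "integrable M (\<lambda>w. norm (Y t w - Y s w) ^ n)"
proof (rule integrable_bounded)
  show "(\<lambda>w. norm (Y t w - Y s w) ^ n) \<in> borel_measurable M"
    by (rule measurable_compose[OF DY_measurable']) (use st in auto)
  show "norm (norm (Y t w - Y s w) ^ n) \<le> (2 * R + K * T) ^ n" if "w \<in> space M" for w
    using power_mono[OF Z_increment_bound(2)[OF that st(1) less_imp_le[OF st(2)] st(3)] norm_ge_zero, of n] by simp
qed

text \<open>In expectation the linear term vanishes and the quadratic one cancels against its time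
  integral. Of the two remaining errors, the one of first order in t - s carries the factor
  \<epsilon>; the constant of the other may explode as \<epsilon> tends to 0.\<close>

lemma step_expectation:
  defines "k \<equiv> 1 + K + 1 / 2 * K\<^sup>2"
  shows "\<bar>expectation (\<lambda>w. V t (Z t w)) - expectation (\<lambda>w. V s (Z s w)) -
      expectation (\<lambda>w. LINT u:{s<..t}|lborel. drift u w)\<bar> \<le>
    (k + m2 / 2 + CQ * K) * \<epsilon> * (t - s) +
    (k * c * m2 + c * m4 / 2 + CQ * K\<^sup>2 / 2 + CQ * K ^ 3 / \<epsilon>) * (t - s)\<^sup>2"
proof -
  have st': "0 \<le> s" "s \<le> t" "t \<le> T" using st by auto
  have sT: "s \<in> {0..T}" "t \<in> {0..T}" using st by auto
  define Q where "Q w = Vxx s (Z s w)" for w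
  define a where "a w = Vx s (Z s w)" for w
  define y where "y w = Y t w - Y s w" for w
  define d where "d w = Z t w - Z s w" for w
  define \<phi> where "\<phi> u w = (\<epsilon> + c * (norm (Z t w - Z u w))\<^sup>2) + (K + 1 / 2 * K\<^sup>2) * (\<epsilon> + c * (norm (Z s w - Z u w))\<^sup>2)" for u w
  have cls: "cl s = s" by (rule cl_eq) (use st in auto)
  have ZF: "Z s \<in> borel_measurable (F s)" by (rule Z_adapted) (use st in auto)
  have QF: "Q \<in> borel_measurable (F s)"
    using continuous_compose_measurable[OF V_cont(4) borel_measurable_const ZF, of s]
    unfolding cls Q_def[abs_def] .
  have aF: "a \<in> borel_measurable (F s)"
    using continuous_compose_measurable[OF V_cont(3) borel_measurable_const ZF, of s]
    unfolding cls a_def[abs_def] .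
  have Zb: "w \<in> space M \<Longrightarrow> Z u w \<in> cball 0 R" for u w using Z_bound by simp
  have Qb: "norm (Q w) \<le> CQ" if "w \<in> space M" for w
    unfolding Q_def by (rule CQ(2)[OF sT(1) Zb[OF that]])
  obtain Ca where "0 \<le> Ca" and Ca: "\<And>u x. u \<in> {0..T} \<Longrightarrow> x \<in> cball 0 R \<Longrightarrow> norm (Vx u x) \<le> Ca"
    using bounded_on_ball[OF V_cont(3)] by auto
  have ab: "norm (a w) \<le> Ca" if "w \<in> space M" for w
    unfolding a_def by (rule Ca[OF sT(1) Zb[OF that]])
  define Ly where "Ly = 2 * R + K * T"
  have yb: "norm (y w) \<le> Ly" if "w \<in> space M" for w
    unfolding y_def Ly_def by (rule Z_increment_bound(2)[OF that st'])
  have ym: "y \<in> borel_measurable M"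
    unfolding y_def[abs_def] by (rule DY_measurable') (use st in auto)
  obtain Cd where Cd': "\<forall>w\<in>space M. \<forall>u. \<bar>drift u w\<bar> \<le> Cd" using drift_bound by (rule exE)
  have Cd: "\<bar>drift u w\<bar> \<le> Cd" if "w \<in> space M" for u w by (rule Cd'[rule_format, OF that])
  have i_drift: "integrable M (\<lambda>w. LINT u:{s<..t}|lborel. drift u w)"
    by (rule time_integral_integrable[OF drift_joint Cd st'(2)])
  have i_ay: "integrable M (\<lambda>w. a w \<bullet> y w)"
  proof (rule integrable_bounded)
    show "(\<lambda>w. a w \<bullet> y w) \<in> borel_measurable M"
      by (rule borel_measurable_inner[OF F_measurable_M[OF aF] ym])
    show "norm (a w \<bullet> y w) \<le> Ca * Ly" if "w \<in> space M" for w
      using order_trans[OF Cauchy_Schwarz_ineq2 mult_mono[OF ab[OF that] yb[OF that] \<open>0 \<le> Ca\<close> norm_ge_zero]] by simp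
  qed
  have i_yQy: "integrable M (\<lambda>w. y w \<bullet> (Q w *v y w))"
  proof (rule integrable_bounded)
    show "(\<lambda>w. y w \<bullet> (Q w *v y w)) \<in> borel_measurable M"
      by (rule borel_measurable_inner[OF ym borel_measurable_matrix_mult(1)[OF F_measurable_M[OF QF] ym]])
    show "norm (y w \<bullet> (Q w *v y w)) \<le> CQ * Ly * Ly" if w: "w \<in> space M" for w
    proof -
      have "0 \<le> Ly" using yb[OF w] norm_ge_zero order_trans by blast
      then have "norm (Q w) * norm (y w) * norm (y w) \<le> CQ * Ly * Ly"
        by (intro mult_mono mult_nonneg_nonneg Qb yb w CQ(1) norm_ge_zero)
      then show ?thesis using abs_inner_matrix_vector_le[of "y w" "Q w" "y w"] by simp
    qed
  qed
  have hj: "(\<lambda>(u, w). Hs u w \<bullet> (Q w ** Hs u w)) \<in> borel_measurable (borel \<Otimes>\<^sub>M M)"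
  proof -
    have Hs: "(\<lambda>p. Hs (fst p) (snd p)) \<in> borel_measurable (borel \<Otimes>\<^sub>M M)"
      using Hs_joint by (simp only: split_beta')
    have Q: "(\<lambda>p. Q (snd p)) \<in> borel_measurable (borel \<Otimes>\<^sub>M M)"
      by (rule measurable_compose[OF measurable_snd F_measurable_M[OF QF]])
    show ?thesis unfolding split_beta'
      by (rule borel_measurable_inner[OF Hs borel_measurable_matrix_mult(2)[OF Q Hs]])
  qed
  have hb: "\<bar>Hs u w \<bullet> (Q w ** Hs u w)\<bar> \<le> CQ * K * K" if w: "w \<in> space M" for u w
  proof -
    have "norm (Q w) * norm (Hs u w) * norm (Hs u w) \<le> CQ * K * K"
      by (intro mult_mono mult_nonneg_nonneg Qb Hs_bound w CQ(1) K_nonneg norm_ge_zero)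
    then show ?thesis using abs_inner_matrix_le[of "Hs u w" "Q w" "Hs u w"] by linarith
  qed
  have i_HQH: "integrable M (\<lambda>w. LINT u:{s<..t}|lborel. Hs u w \<bullet> (Q w ** Hs u w))"
    by (rule time_integral_integrable[OF hj hb st'(2)])
  have E1: "expectation (\<lambda>w. a w \<bullet> y w) = 0"
    unfolding y_def by (rule expectation_inner_DY[OF st(1,2) yb[unfolded y_def] aF ab])
  have E2: "expectation (\<lambda>w. y w \<bullet> (Q w *v y w)) =
     expectation (\<lambda>w. LINT u:{s<..t}|lborel. Hs u w \<bullet> (Q w ** Hs u w))"
    unfolding y_def by (rule expectation_quadratic_DY[OF st(1,2) yb[unfolded y_def] QF Qb])
  have \<phi>j: "(\<lambda>(u, w). \<phi> u w) \<in> borel_measurable (borel \<Otimes>\<^sub>M M)"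
  proof -
    have Z2: "(\<lambda>p. (norm (Z r (snd p) - Z (fst p) (snd p)))\<^sup>2) \<in> borel_measurable (borel \<Otimes>\<^sub>M M)" for r
      using Z_square_joint[of r] by (simp only: split_beta')
    show ?thesis unfolding \<phi>_def split_beta'
      by (intro borel_measurable_add borel_measurable_times borel_measurable_const Z2)
  qed
  define C\<phi> where "C\<phi> = (\<epsilon> + c * (2 * R)\<^sup>2) + (K + 1 / 2 * K\<^sup>2) * (\<epsilon> + c * (2 * R)\<^sup>2)"
  have \<phi>b: "\<bar>\<phi> u w\<bar> \<le> C\<phi>" if w: "w \<in> space M" for u w
  proof -
    have "(norm (Z r w - Z u w))\<^sup>2 \<le> (2 * R)\<^sup>2" for r
      by (rule power_mono[OF norm_Z_diff_le[OF w] norm_ge_zero])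
    then have e: "\<epsilon> + c * (norm (Z r w - Z u w))\<^sup>2 \<le> \<epsilon> + c * (2 * R)\<^sup>2" for r
      using c by (intro add_left_mono mult_left_mono)
    have e0: "0 \<le> \<epsilon> + c * (norm (Z r w - Z u w))\<^sup>2" for r using \<epsilon> c by simp
    have "0 \<le> \<phi> u w" unfolding \<phi>_def using K_nonneg
      by (intro add_nonneg_nonneg[OF e0 mult_nonneg_nonneg[OF _ e0]]) simp
    moreover have "\<phi> u w \<le> C\<phi>" unfolding \<phi>_def C\<phi>_def
      using K_nonneg by (intro add_mono[OF e mult_left_mono[OF e]]) simp
    ultimately show ?thesis by simp
  qed
  note t\<phi> = \<phi>j \<phi>b st'(2)
  have i_\<phi>: "integrable M (\<lambda>w. LINT u:{s<..t}|lborel. \<phi> u w)"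
    by (rule time_integral_integrable[OF t\<phi>])
  have E\<phi>: "expectation (\<lambda>w. LINT u:{s<..t}|lborel. \<phi> u w) \<le> (k * (\<epsilon> + c * (m2 * (t - s)))) * (t - s)"
  proof (rule expectation_time_integral_le[OF t\<phi>])
    fix u assume u: "s < u" "u \<le> t"
    have Zt: "expectation (\<lambda>w. (norm (Z t w - Z u w))\<^sup>2) \<le> m2 * (t - s)"
    proof -
      have "expectation (\<lambda>w. (norm (Z t w - Z u w))\<^sup>2) \<le> m2 * (t - u)"
        by (rule Z_second_moment) (use u st in auto)
      also have "\<dots> \<le> m2 * (t - s)" using u m_nonneg(1) by (intro mult_left_mono) auto
      finally show ?thesis .
    qed
    have Zs: "expectation (\<lambda>w. (norm (Z s w - Z u w))\<^sup>2) \<le> m2 * (t - s)"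
    proof -
      have "expectation (\<lambda>w. (norm (Z s w - Z u w))\<^sup>2) \<le> m2 * (u - s)"
        unfolding norm_minus_commute[of "Z s _"] by (rule Z_second_moment) (use u st in auto)
      also have "\<dots> \<le> m2 * (t - s)" using u m_nonneg(1) by (intro mult_left_mono) auto
      finally show ?thesis .
    qed
    have "expectation (\<phi> u) = (\<epsilon> + c * expectation (\<lambda>w. (norm (Z t w - Z u w))\<^sup>2)) +
        (K + 1 / 2 * K\<^sup>2) * (\<epsilon> + c * expectation (\<lambda>w. (norm (Z s w - Z u w))\<^sup>2))"
      unfolding \<phi>_def[abs_def] using Z_power_integrable[of _ _ 2] by (simp add: prob_space)
    also have "\<dots> \<le> (\<epsilon> + c * (m2 * (t - s))) + (K + 1 / 2 * K\<^sup>2) * (\<epsilon> + c * (m2 * (t - s)))"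
      using Zt Zs c K_nonneg by (intro add_mono mult_left_mono add_nonneg_nonneg) auto
    also have "\<dots> = k * (\<epsilon> + c * (m2 * (t - s)))" unfolding k_def by (simp add: algebra_simps)
    finally show "expectation (\<phi> u) \<le> k * (\<epsilon> + c * (m2 * (t - s)))" .
  qed assumption
  have i_d: "integrable M (\<lambda>w. norm (d w) ^ n)" for n unfolding d_def by (rule Z_power_integrable)
  have i_y: "integrable M (\<lambda>w. norm (y w) ^ n)" for n unfolding y_def by (rule DY_power_integrable)
  have Ed: "expectation (\<lambda>w. (norm (d w))\<^sup>2) \<le> m2 * (t - s)" "expectation (\<lambda>w. norm (d w) ^ 4) \<le> m4 * (t - s)\<^sup>2"
    unfolding d_def by (rule Z_second_moment[OF st'], rule Z_fourth_moment[OF st])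
  have Ey: "expectation (\<lambda>w. (norm (y w))\<^sup>2) \<le> K\<^sup>2 * (t - s)"
    unfolding y_def by (rule DY_second_moment[OF st])
  have i_V: "integrable M (\<lambda>w. V t (Z t w))" "integrable M (\<lambda>w. V s (Z s w))"
    using V_Z_integrable sT by auto
  define lhs where "lhs w = V t (Z t w) - V s (Z s w) - (LINT u:{s<..t}|lborel. drift u w) - a w \<bullet> y w -
      1 / 2 * (y w \<bullet> (Q w *v y w) - (LINT u:{s<..t}|lborel. Hs u w \<bullet> (Q w ** Hs u w)))" for w
  define rhs where "rhs w = (LINT u:{s<..t}|lborel. \<phi> u w) + 1 / 2 * (\<epsilon> * (norm (d w))\<^sup>2 + c * norm (d w) ^ 4) +
    1 / 2 * (CQ * (K\<^sup>2 * (t - s)\<^sup>2 + 2 * K * (t - s) * (\<epsilon> + (norm (y w))\<^sup>2 / \<epsilon>)))" for w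
  have i_lhs: "integrable M lhs"
    unfolding lhs_def[abs_def]
    by (intro Bochner_Integration.integrable_diff integrable_mult_right i_V i_drift i_ay i_yQy i_HQH)
  have i_rhs: "integrable M rhs"
    unfolding rhs_def[abs_def]
    by (intro Bochner_Integration.integrable_add integrable_mult_right integrable_divide i_\<phi> i_d i_y integrable_const)
  have "expectation lhs = expectation (\<lambda>w. V t (Z t w)) - expectation (\<lambda>w. V s (Z s w)) -
      expectation (\<lambda>w. LINT u:{s<..t}|lborel. drift u w)"
    unfolding lhs_def[abs_def] using i_V i_drift i_ay i_yQy i_HQH E1 E2 by simp
  moreover have "\<bar>expectation lhs\<bar> \<le> expectation rhs"
  proof (rule order_trans[OF integral_abs_bound integral_mono])
    show "integrable M (\<lambda>w. \<bar>lhs w\<bar>)" using i_lhs by (rule integrable_abs)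
    show "\<bar>lhs w\<bar> \<le> rhs w" if "w \<in> space M" for w
      using step_pointwise[OF that] unfolding lhs_def rhs_def \<phi>_def Q_def a_def y_def d_def .
  qed (rule i_rhs)
  moreover have "expectation rhs = expectation (\<lambda>w. LINT u:{s<..t}|lborel. \<phi> u w) +
      1 / 2 * (\<epsilon> * expectation (\<lambda>w. (norm (d w))\<^sup>2) + c * expectation (\<lambda>w. norm (d w) ^ 4)) +
      1 / 2 * (CQ * (K\<^sup>2 * (t - s)\<^sup>2 + 2 * K * (t - s) * (\<epsilon> + expectation (\<lambda>w. (norm (y w))\<^sup>2) / \<epsilon>)))"
    unfolding rhs_def[abs_def] using i_\<phi> i_d i_y by (simp add: prob_space)
  moreover have "\<dots> \<le> (k * (\<epsilon> + c * (m2 * (t - s)))) * (t - s) +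
      1 / 2 * (\<epsilon> * (m2 * (t - s)) + c * (m4 * (t - s)\<^sup>2)) +
      1 / 2 * (CQ * (K\<^sup>2 * (t - s)\<^sup>2 + 2 * K * (t - s) * (\<epsilon> + (K\<^sup>2 * (t - s)) / \<epsilon>)))"
    using E\<phi> Ed Ey \<epsilon> c CQ(1) K_nonneg st
    by (intro add_mono mult_left_mono divide_right_mono order_refl) auto
  moreover have "\<dots> = (k + m2 / 2 + CQ * K) * \<epsilon> * (t - s) +
    (k * c * m2 + c * m4 / 2 + CQ * K\<^sup>2 / 2 + CQ * K ^ 3 / \<epsilon>) * (t - s)\<^sup>2"
    using \<epsilon> by (simp add: field_simps power2_eq_square power3_eq_cube)
  ultimately show ?thesis by linarith
qed

end

text \<open>The defect \<open>\<Phi>\<close> has derivative 0 at every point from 0 to T, since by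
  \<open>step_expectation\<close> its increments are eventually smaller than any multiple of the
  step length. It is therefore constant.\<close>

theorem dynkin_formula:
  "expectation (\<lambda>w. V T (Z T w)) =
    expectation (\<lambda>w. V 0 (Z 0 w)) + expectation (\<lambda>w. LINT u:{0<..T}|lborel. drift u w)"
proof -
  define \<Phi> where "\<Phi> t = expectation (\<lambda>w. V t (Z t w)) - expectation (\<lambda>w. LINT u:{0<..t}|lborel. drift u w)" for t
  obtain Cd where Cd': "\<forall>w\<in>space M. \<forall>u. \<bar>drift u w\<bar> \<le> Cd" using drift_bound by (rule exE)
  have Cd: "\<bar>drift u w\<bar> \<le> Cd" if "w \<in> space M" for u w by (rule Cd'[rule_format, OF that])
  obtain CQ where CQ: "0 \<le> CQ" "\<And>u x. u \<in> {0..T} \<Longrightarrow> x \<in> cball 0 R \<Longrightarrow> norm (Vxx u x) \<le> CQ"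
    using bounded_on_ball[OF V_cont(4)] by auto
  have \<Phi>_diff: "\<Phi> t - \<Phi> s = expectation (\<lambda>w. V t (Z t w)) - expectation (\<lambda>w. V s (Z s w)) -
      expectation (\<lambda>w. LINT u:{s<..t}|lborel. drift u w)" if "0 \<le> s" "s \<le> t" for s t
  proof -
    have "expectation (\<lambda>w. LINT u:{0<..t}|lborel. drift u w) =
      expectation (\<lambda>w. (LINT u:{0<..s}|lborel. drift u w) + (LINT u:{s<..t}|lborel. drift u w))"
    proof (rule Bochner_Integration.integral_cong[OF refl])
      fix w assume w: "w \<in> space M"
      show "(LINT u:{0<..t}|lborel. drift u w) = (LINT u:{0<..s}|lborel. drift u w) + (LINT u:{s<..t}|lborel. drift u w)"
        by (rule set_integral_Ioc_additive[OF time_integrable[OF drift_joint Cd _ w]]) (use that in auto)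
    qed
    also have "\<dots> = expectation (\<lambda>w. LINT u:{0<..s}|lborel. drift u w) + expectation (\<lambda>w. LINT u:{s<..t}|lborel. drift u w)"
      by (rule Bochner_Integration.integral_add[OF time_integral_integrable[OF drift_joint Cd that(1)]
            time_integral_integrable[OF drift_joint Cd that(2)]])
    finally show ?thesis unfolding \<Phi>_def by simp
  qed
  have small: "\<exists>d>0. \<forall>s t. 0 \<le> s \<and> s < t \<and> t \<le> T \<and> t - s < d \<longrightarrow> \<bar>\<Phi> t - \<Phi> s\<bar> \<le> e * (t - s)" if e: "0 < e" for e
  proof -
    define k where "k = 1 + K + 1 / 2 * K\<^sup>2"
    have k: "0 \<le> k" using K_nonneg by (simp add: k_def)
    define L1 where "L1 = k + m2 / 2 + CQ * K"
    have L1: "0 \<le> L1" using k m_nonneg CQ(1) K_nonneg by (simp add: L1_def)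
    \<comment> \<open>\<open>L1\<close> does not involve \<epsilon>, so \<epsilon> can be chosen
      from it. \<open>L2\<close> depends on \<epsilon>, directly and through c, and is compensated
      afterwards by the step length.\<close>
    define \<epsilon> where "\<epsilon> = e / 2 / (L1 + 1)"
    have \<epsilon>: "0 < \<epsilon>" using e L1 by (simp add: \<epsilon>_def)
    have L1\<epsilon>: "L1 * \<epsilon> \<le> e / 2"
    proof -
      have "L1 * \<epsilon> \<le> (L1 + 1) * \<epsilon>" using \<epsilon> by simp
      also have "\<dots> = e / 2" using L1 unfolding \<epsilon>_def by (intro nonzero_mult_div_cancel_left[THEN trans[OF times_divide_eq_right]]) simp
      finally show ?thesis .
    qed
    obtain c1 d1 where 1: "0 \<le> c1" "0 < d1" "modulus Vt \<epsilon> c1 d1"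
      using exists_modulus[OF V_cont(2) \<epsilon>] by blast
    obtain c2 d2 where 2: "0 \<le> c2" "0 < d2" "modulus Vx \<epsilon> c2 d2"
      using exists_modulus[OF V_cont(3) \<epsilon>] by blast
    obtain c3 d3 where 3: "0 \<le> c3" "0 < d3" "modulus Vxx \<epsilon> c3 d3"
      using exists_modulus[OF V_cont(4) \<epsilon>] by blast
    define c where "c = max c1 (max c2 c3)"
    define \<delta> where "\<delta> = min d1 (min d2 d3)"
    have c: "0 \<le> c" and \<delta>: "0 < \<delta>" using 1 2 3 by (auto simp: c_def \<delta>_def)
    have mods: "modulus Vt \<epsilon> c \<delta>" "modulus Vx \<epsilon> c \<delta>" "modulus Vxx \<epsilon> c \<delta>"
      using modulus_mono[OF 1(3)] modulus_mono[OF 2(3)] modulus_mono[OF 3(3)] by (auto simp: c_def \<delta>_def)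
    define L2 where "L2 = k * c * m2 + c * m4 / 2 + CQ * K\<^sup>2 / 2 + CQ * K ^ 3 / \<epsilon>"
    have L2: "0 \<le> L2" unfolding L2_def using k c m_nonneg CQ(1) K_nonneg \<epsilon> by simp
    show ?thesis
    proof (intro exI[of _ "min \<delta> (e / 2 / (L2 + 1))"] conjI allI impI)
      show "0 < min \<delta> (e / 2 / (L2 + 1))" using \<delta> e L2 by simp
      fix s t assume st: "0 \<le> s \<and> s < t \<and> t \<le> T \<and> t - s < min \<delta> (e / 2 / (L2 + 1))"
      have "\<bar>\<Phi> t - \<Phi> s\<bar> \<le> L1 * \<epsilon> * (t - s) + L2 * (t - s)\<^sup>2"
        unfolding \<Phi>_diff[OF conjunct1[OF st] less_imp_le[OF conjunct1[OF conjunct2[OF st]]]] L1_def L2_def k_def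
        by (rule step_expectation[OF _ _ _ \<epsilon> c _ mods CQ]) (use st in auto)
      also have "\<dots> \<le> e / 2 * (t - s) + e / 2 * (t - s)"
      proof (rule add_mono)
        show "L1 * \<epsilon> * (t - s) \<le> e / 2 * (t - s)" using L1\<epsilon> st by (intro mult_right_mono) auto
        have "L2 * (t - s) \<le> (L2 + 1) * (e / 2 / (L2 + 1))"
          using st L2 by (intro mult_mono) auto
        also have "\<dots> = e / 2" using L2 by (intro nonzero_mult_div_cancel_left[THEN trans[OF times_divide_eq_right]]) simp
        finally have "L2 * (t - s) * (t - s) \<le> e / 2 * (t - s)" using st by (intro mult_right_mono) auto
        then show "L2 * (t - s)\<^sup>2 \<le> e / 2 * (t - s)" by (simp add: power2_eq_square mult.assoc)
      qed
      finally show "\<bar>\<Phi> t - \<Phi> s\<bar> \<le> e * (t - s)" by (simp add: algebra_simps)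
    qed
  qed
  have "(\<Phi> has_derivative (\<lambda>_. 0)) (at x within {0..T})" if x: "x \<in> {0..T}" for x
    unfolding has_derivative_within_alt
  proof (intro conjI allI impI)
    fix e :: real assume "0 < e"
    from small[OF this] obtain d where d1: "0 < d"
      and d2: "\<forall>s t. 0 \<le> s \<and> s < t \<and> t \<le> T \<and> t - s < d \<longrightarrow> \<bar>\<Phi> t - \<Phi> s\<bar> \<le> e * (t - s)"
      by (elim exE conjE)
    show "\<exists>d>0. \<forall>y\<in>{0..T}. norm (y - x) < d \<longrightarrow> norm (\<Phi> y - \<Phi> x - 0) \<le> e * norm (y - x)"
    proof (intro exI[of _ d] conjI ballI impI d1)
      fix y assume y: "y \<in> {0..T}" "norm (y - x) < d"
      consider "x < y" | "y < x" | "x = y" by linarith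
      then show "norm (\<Phi> y - \<Phi> x - 0) \<le> e * norm (y - x)"
      proof cases
        case 1
        then show ?thesis using d2[rule_format, of x y] x y by simp
      next
        case 2
        then show ?thesis using d2[rule_format, of y x] x y by (simp add: abs_minus_commute)
      qed simp
    qed
  qed simp
  then have "\<exists>c. \<forall>x\<in>{0..T}. \<Phi> x = c"
    by (intro has_derivative_zero_constant) auto
  then have "\<Phi> T = \<Phi> 0" using T_pos by auto
  then show ?thesis unfolding \<Phi>_def by (simp add: set_lebesgue_integral_def)
qed

end

section \<open>Stopping at the exit from a bounded open set\<close>

text \<open>Step processes on the grid of mesh 1 / (n + 1) involve only countably many of the
  variables and converge along continuous paths.\<close>

lemma continuous_process_joint_measurable:
  fixes Z :: "real \<Rightarrow> 'a \<Rightarrow> 'b::metric_space"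
  assumes Z: "\<And>u. Z u \<in> borel_measurable M" and cont: "\<And>w. w \<in> space M \<Longrightarrow> continuous_on UNIV (\<lambda>u. Z u w)"
  shows "(\<lambda>(u, w). Z u w) \<in> borel_measurable (borel \<Otimes>\<^sub>M M)"
proof (rule borel_measurable_LIMSEQ_metric)
  fix n
  have f: "(\<lambda>p. Z (of_int i / real (Suc n)) (snd p)) \<in> borel_measurable (borel \<Otimes>\<^sub>M M)" for i :: int
    by (rule measurable_compose[OF measurable_snd Z])
  have g: "(\<lambda>p. \<lfloor>real (Suc n) * fst p\<rfloor>) \<in> measurable (borel \<Otimes>\<^sub>M M) (count_space UNIV)"
    by measurable
  show "(\<lambda>p. Z (of_int \<lfloor>real (Suc n) * fst p\<rfloor> / real (Suc n)) (snd p)) \<in> borel_measurable (borel \<Otimes>\<^sub>M M)"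
    by (rule measurable_compose_countable[OF f g])
next
  fix p assume "p \<in> space ((borel :: real measure) \<Otimes>\<^sub>M M)"
  then obtain u w where p: "p = (u, w)" and w: "w \<in> space M"
    by (metis mem_Times_iff prod.collapse space_pair_measure)
  have "(\<lambda>n. of_int \<lfloor>real (Suc n) * u\<rfloor> / real (Suc n)) \<longlonglongrightarrow> u"
  proof (rule tendsto_sandwich)
    show "\<forall>\<^sub>F n in sequentially. u - 1 / real (Suc n) \<le> of_int \<lfloor>real (Suc n) * u\<rfloor> / real (Suc n)"
    proof (intro always_eventually allI)
      fix n
      have "real (Suc n) * u - 1 \<le> of_int \<lfloor>real (Suc n) * u\<rfloor>" by linarith
      then have "(real (Suc n) * u - 1) / real (Suc n) \<le> of_int \<lfloor>real (Suc n) * u\<rfloor> / real (Suc n)"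
        by (rule divide_right_mono) simp
      then show "u - 1 / real (Suc n) \<le> of_int \<lfloor>real (Suc n) * u\<rfloor> / real (Suc n)"
        by (simp add: diff_divide_distrib)
    qed
    show "\<forall>\<^sub>F n in sequentially. of_int \<lfloor>real (Suc n) * u\<rfloor> / real (Suc n) \<le> u"
      by (intro always_eventually allI) (simp add: divide_le_eq mult.commute)
    show "(\<lambda>n. u - 1 / real (Suc n)) \<longlonglongrightarrow> u"
      using tendsto_diff[OF tendsto_const LIMSEQ_inverse_real_of_nat] by (simp add: inverse_eq_divide)
  qed simp
  from isCont_tendsto_compose[OF _ this, of "\<lambda>u. Z u w"] cont[OF w]
  show "(\<lambda>n. Z (of_int \<lfloor>real (Suc n) * fst p\<rfloor> / real (Suc n)) (snd p)) \<longlonglongrightarrow> (case p of (u, w) \<Rightarrow> Z u w)"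
    by (simp add: p continuous_on_eq_continuous_at)
qed

text \<open>With the time cut off at n, progressive measurability up to n applies; at each fixed
  time the cut-off eventually has no effect.\<close>

lemma (in brownian) progressively_measurable_joint:
  fixes H :: "real \<Rightarrow> 'a \<Rightarrow> 'b::metric_space"
  assumes H: "progressively_measurable F H"
  shows "(\<lambda>(u, w). H (max 0 u) w) \<in> borel_measurable (borel \<Otimes>\<^sub>M M)"
proof (rule borel_measurable_LIMSEQ_metric)
  fix n
  have Hn: "(\<lambda>(s, w). H s w) \<in> borel_measurable (restrict_space borel {0..real n} \<Otimes>\<^sub>M F (real n))"
    using H by (simp add: progressively_measurable_def)
  have a: "(\<lambda>p. max 0 (min (real n) (fst p))) \<in> measurable (borel \<Otimes>\<^sub>M M) (restrict_space borel {0..real n})"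
    by (rule measurable_restrict_space2) auto
  have b: "snd \<in> measurable (borel \<Otimes>\<^sub>M M) (F (real n))"
    by (rule measurable_compose[OF measurable_snd]) (use sets_F_le in \<open>auto simp: measurable_def\<close>)
  show "(\<lambda>p. H (max 0 (min (real n) (fst p))) (snd p)) \<in> borel_measurable (borel \<Otimes>\<^sub>M M)"
    using measurable_compose[OF measurable_Pair[OF a b] Hn] by simp
next
  fix p :: "real \<times> 'a"
  have "\<forall>\<^sub>F n in sequentially. fst p \<le> real n"
    by (metis eventually_sequentiallyI nat_ceiling_le_eq)
  then have "\<forall>\<^sub>F n in sequentially. H (max 0 (min (real n) (fst p))) (snd p) = (case p of (u, w) \<Rightarrow> H (max 0 u) w)"
    by eventually_elim (simp add: split_beta min_absorb2)
  then show "(\<lambda>n. H (max 0 (min (real n) (fst p))) (snd p)) \<longlonglongrightarrow> (case p of (u, w) \<Rightarrow> H (max 0 u) w)"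
    by (rule tendsto_eventually)
qed

text \<open>The start at 0 is not part of the definition of the integral but follows from it: the
  approximating simple integrals vanish at time 0. It turns the equation at time 0 into the initial
  condition.\<close>

lemma (in brownian) ito_integral_0:
  fixes I :: "real \<Rightarrow> 'a \<Rightarrow> real ^ 'n"
  assumes "has_ito_integral M F W H I"
  shows "AE w in M. I 0 w = 0"
proof -
  have "\<exists>m p (\<xi> :: nat \<Rightarrow> nat \<Rightarrow> 'a \<Rightarrow> real ^ 'k ^ 'n). (\<forall>n. simple_process F (m n) (p n) (\<xi> n)) \<and>
      null_in_prob M (\<lambda>n w. ennreal (norm (simple_integral W (m n) (p n) (\<xi> n) 0 w - I 0 w)))"
    using assms unfolding has_ito_integral_def
    by (elim conjE) (erule ex_forward, erule ex_forward, erule ex_forward, erule conj_forward, assumption,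
        drule spec[of _ "0::real"], simp)
  then obtain m p and \<xi> :: "nat \<Rightarrow> nat \<Rightarrow> 'a \<Rightarrow> real ^ 'k ^ 'n" where sp: "\<And>n. simple_process F (m n) (p n) (\<xi> n)"
    and lim: "null_in_prob M (\<lambda>n w. ennreal (norm (simple_integral W (m n) (p n) (\<xi> n) 0 w - I 0 w)))"
    by auto
  have I0: "I 0 \<in> borel_measurable M"
    using assms F_measurable_M[of "I 0" 0 borel] by (auto simp: has_ito_integral_def)
  have S0: "simple_integral W (m n) (p n) (\<xi> n) 0 w = 0" for n w
  proof -
    have "0 \<le> p n i" if "i \<le> m n" for i
      using grid_mono[of "m n" "p n" 0 i] sp[of n] that by (auto simp: simple_process_def)
    then show ?thesis unfolding simple_integral_def by (intro sum.neutral) (auto simp: min_absorb1)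
  qed
  have "AE w in M. norm (I 0 w) \<le> 1 / real (Suc j)" for j
  proof -
    have "(\<lambda>n::nat. prob {w \<in> space M. ennreal (1 / real (Suc j)) < ennreal (norm (I 0 w))}) \<longlonglongrightarrow> 0"
      using lim[unfolded null_in_prob_def S0, rule_format, of "ennreal (1 / real (Suc j))"] by simp
    then have p0: "prob {w \<in> space M. \<not> norm (I 0 w) \<le> 1 / real (Suc j)} = 0"
      by (simp add: LIMSEQ_const_iff not_le ennreal_less_iff)
    have ev: "{w \<in> space M. \<not> norm (I 0 w) \<le> 1 / real (Suc j)} \<in> events"
      using I0 by measurable
    show ?thesis
      by (rule AE_I[OF subset_refl _ ev]) (simp only: emeasure_eq_measure p0 ennreal_0)
  qed
  then have "AE w in M. \<forall>j. norm (I 0 w) \<le> 1 / real (Suc j)" by (intro AE_all_countable[THEN iffD2] allI)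
  then show ?thesis
  proof eventually_elim
    case (elim w)
    have "norm (I 0 w) \<le> 0"
    proof (rule LIMSEQ_le_const)
      show "(\<lambda>j. 1 / real (Suc j)) \<longlonglongrightarrow> 0" using LIMSEQ_inverse_real_of_nat by (simp add: inverse_eq_divide)
    qed (use elim in auto)
    then show ?case by simp
  qed
qed

text \<open>
  On the null set \<open>N\<close>, where the starting point or the equation may be wrong, \<open>Z\<close> is set to \<open>x0\<close>; it then
  stays in the closure of \<open>U\<close> everywhere.
\<close>

locale exit_process = brownian M W
  for M :: "'a measure" and W :: "real \<Rightarrow> 'a \<Rightarrow> real ^ 'k" +
  fixes X :: "real \<Rightarrow> 'a \<Rightarrow> real ^ 'n" and \<theta> :: "'a \<Rightarrow> real" and U :: "(real ^ 'n) set"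
    and N :: "'a set" and x0 :: "real ^ 'n" and T :: real
  assumes X_path: "w \<in> space M \<Longrightarrow> continuous_on {0..\<theta> w} (\<lambda>t. X t w)"
    and X_event: "0 \<le> t \<Longrightarrow> t \<le> r \<Longrightarrow> A \<in> sets borel \<Longrightarrow> {w \<in> space M. r < \<theta> w \<and> X t w \<in> A} \<in> sets (F r)"
    and \<theta>_nonneg: "w \<in> space M \<Longrightarrow> 0 \<le> \<theta> w"
    and U: "open U" "bounded U" "x0 \<in> U"
    and N: "N \<in> null_sets M"
    and X_0: "w \<in> space M \<Longrightarrow> w \<notin> N \<Longrightarrow> X 0 w = x0"
    and T_pos: "0 < T"
begin

text \<open>The first exit from \<open>U\<close>, capped by \<open>\<theta>\<close> and
  \<open>T\<close>. The two caps also make the set nonempty, so that the infimum is meaningful on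
  paths that never leave.\<close>

definition \<rho> :: "'a \<Rightarrow> real" where
  "\<rho> w = Inf {t. 0 \<le> t \<and> (\<theta> w \<le> t \<or> T \<le> t \<or> X t w \<notin> U)}"

definition Z :: "real \<Rightarrow> 'a \<Rightarrow> real ^ 'n" where
  "Z t w = (if w \<in> N then x0 else X (min (max 0 t) (\<rho> w)) w)"

context
  fixes w assumes w: "w \<in> space M"
begin

lemma \<rho>_upper: "0 \<le> t \<Longrightarrow> \<theta> w \<le> t \<or> T \<le> t \<or> X t w \<notin> U \<Longrightarrow> \<rho> w \<le> t"
  unfolding \<rho>_def by (rule cInf_lower) (auto intro: bdd_belowI[of _ 0])

lemma \<rho>_greatest:
  assumes "\<And>t. 0 \<le> t \<Longrightarrow> \<theta> w \<le> t \<or> T \<le> t \<or> X t w \<notin> U \<Longrightarrow> c \<le> t"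
  shows "c \<le> \<rho> w"
  unfolding \<rho>_def by (rule cInf_greatest) (use assms \<theta>_nonneg[OF w] in auto)

lemma \<rho>_bounds: "0 \<le> \<rho> w" "\<rho> w \<le> \<theta> w" "\<rho> w \<le> T"
  using \<rho>_greatest[of 0] \<rho>_upper[of "\<theta> w"] \<rho>_upper[of T] \<theta>_nonneg[OF w] T_pos by auto

lemma X_before_\<rho>: "0 \<le> t \<Longrightarrow> t < \<rho> w \<Longrightarrow> X t w \<in> U"
  using \<rho>_upper[of t] by auto

text \<open>As \<open>U\<close> is open and the path continuous, a path that is in \<open>U\<close>
  at r stays there a little longer, and the infimum is strictly larger than r. The right-hand side
  looks at the path up to time r only, which is what a stopping time requires.\<close>

lemma less_\<rho>_iff:
  assumes r: "0 \<le> r"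
  shows "r < \<rho> w \<longleftrightarrow> r < \<theta> w \<and> r < T \<and> (\<forall>t\<in>{0..r}. X t w \<in> U)"
proof
  assume "r < \<rho> w"
  then show "r < \<theta> w \<and> r < T \<and> (\<forall>t\<in>{0..r}. X t w \<in> U)"
    using \<rho>_bounds X_before_\<rho> by auto
next
  assume H: "r < \<theta> w \<and> r < T \<and> (\<forall>t\<in>{0..r}. X t w \<in> U)"
  have "((\<lambda>t. X t w) \<longlongrightarrow> X r w) (at r within {0..\<theta> w})"
    using X_path[OF w] H r by (auto simp: continuous_on_def)
  then have "\<forall>\<^sub>F t in at r within {0..\<theta> w}. X t w \<in> U"
    using U(1) H r by (intro topological_tendstoD) auto
  then obtain d where d: "0 < d" "\<And>t. t \<in> {0..\<theta> w} \<Longrightarrow> t \<noteq> r \<Longrightarrow> dist t r < d \<Longrightarrow> X t w \<in> U"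
    unfolding eventually_at by blast
  have "min (r + d) (min (\<theta> w) T) \<le> \<rho> w"
  proof (rule \<rho>_greatest, rule ccontr)
    fix t assume t: "0 \<le> t" "\<theta> w \<le> t \<or> T \<le> t \<or> X t w \<notin> U" "\<not> min (r + d) (min (\<theta> w) T) \<le> t"
    then have "X t w \<notin> U" "r < t" using H by (auto simp: not_le)
    then show False using t d(2)[of t] by (auto simp: dist_real_def)
  qed
  then show "r < \<rho> w" using H d(1) by linarith
qed

lemma X_at_\<rho>: "\<rho> w < \<theta> w \<Longrightarrow> \<rho> w < T \<Longrightarrow> X (\<rho> w) w \<notin> U"
  using less_\<rho>_iff[OF \<rho>_bounds(1)] X_before_\<rho> by (metis atLeastAtMost_iff less_irrefl order_le_less)

lemma X_\<rho>_closure: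
  assumes "w \<notin> N" "0 \<le> t" "t \<le> \<rho> w"
  shows "X t w \<in> closure U"
proof (cases "t = 0 \<or> t < \<rho> w")
  case True
  then show ?thesis using X_0[OF w assms(1)] U(3) X_before_\<rho> assms closure_subset by auto
next
  case False
  then have t: "0 < t" "t = \<rho> w" using assms by auto
  have "X (\<rho> w) w \<in> closure ((\<lambda>t. X t w) ` {0..<\<rho> w})"
  proof -
    have "(\<lambda>t. X t w) ` closure {0..<\<rho> w} \<subseteq> closure ((\<lambda>t. X t w) ` {0..<\<rho> w})"
      by (rule image_closure_subset[OF continuous_on_subset[OF X_path[OF w]]])
         (use t \<rho>_bounds closure_subset[of "(\<lambda>t. X t w) ` {0..<\<rho> w}"] in \<open>auto simp: closure_atLeastLessThan\<close>)
    then show ?thesis using t by (auto simp: closure_atLeastLessThan)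
  qed
  also have "\<dots> \<subseteq> closure U" by (rule closure_mono) (auto intro: X_before_\<rho>)
  finally show ?thesis using t by simp
qed

lemma Z_closure: "Z t w \<in> closure U"
  using X_\<rho>_closure \<rho>_bounds U(3) closure_subset by (auto simp: Z_def)

lemma Z_path: "continuous_on UNIV (\<lambda>t. Z t w)"
proof (cases "w \<in> N")
  case False
  have "continuous_on UNIV ((\<lambda>t. X t w) \<circ> (\<lambda>t. min (max 0 t) (\<rho> w)))"
    by (intro continuous_on_compose continuous_intros continuous_on_subset[OF X_path[OF w]])
       (use \<rho>_bounds in auto)
  then show ?thesis using False by (simp add: Z_def comp_def)
qed (simp add: Z_def)

end

lemma N_F: "N \<in> sets (F t)"
  unfolding sets_augmented_filtration using N by (intro sigma_sets.Basic) auto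

text \<open>Staying in \<open>U\<close> up to time r has to be expressed by countably many times.
  Membership in \<open>U\<close> at rational times alone would overlook a path that touches the
  boundary at an irrational time. But a compact piece of path inside \<open>U\<close> keeps a
  positive distance from the complement, so it lies in one of the closed sets \<open>C n\<close>,
  and membership in a closed set passes from a dense set of times to all times.\<close>

lemma \<rho>_stop:
  assumes r: "0 \<le> r"
  shows "{w \<in> space M. r < \<rho> w} \<in> sets (F r)"
proof (cases "r < T")
  case False
  then have "{w \<in> space M. r < \<rho> w} = {}" using \<rho>_bounds(3) by fastforce
  then show ?thesis by (simp only: sets.empty_sets)
next
  case rT: True
  define Q where "Q = insert r (insert 0 (\<rat> \<inter> {0<..<r}))"
  have Q: "countable Q" "Q \<noteq> {}"
    unfolding Q_def by (intro countable_insert countable_Int1 countable_rat, rule insert_not_empty)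
  have Q0: "Q \<subseteq> {0..r}" using r by (auto simp: Q_def)
  have clQ: "{0..r} \<subseteq> closure Q"
  proof (cases "r = 0")
    case False
    have "closure ({0<..<r} \<inter> \<rat>) = closure {0<..<r}"
      by (rule closure_open_Int_superset) (auto simp: Rats_closure_real)
    then have "{0..r} = closure (\<rat> \<inter> {0<..<r})" using False r by (simp add: Int_commute)
    also have "\<dots> \<subseteq> closure Q" unfolding Q_def by (rule closure_mono) auto
    finally show ?thesis .
  qed (use closure_subset[of Q] in \<open>auto simp: Q_def\<close>)
  define C where "C n = {x :: real ^ 'n. 1 / real (Suc n) \<le> infdist x (- U)}" for n
  have U': "- U \<noteq> {}" using U(2) not_bounded_UNIV by (metis compl_bot_eq double_compl)
  have C: "closed (C n)" for n
    unfolding C_def by (intro closed_Collect_le continuous_intros)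
  have CU: "C n \<subseteq> U" for n
  proof
    fix x assume "x \<in> C n"
    then have "0 < infdist x (- U)" unfolding C_def by (auto intro: less_le_trans[of _ "1 / real (Suc n)"])
    then show "x \<in> U" by (metis ComplI infdist_zero less_irrefl)
  qed
  have eq: "{w \<in> space M. r < \<rho> w} =
    (\<Union>n. \<Inter>q\<in>Q. {w \<in> space M. r < \<theta> w \<and> X q w \<in> C n})" (is "?L = ?R")
  proof safe
    fix w assume w: "w \<in> space M" and "r < \<rho> w"
    then have r\<theta>: "r < \<theta> w" and XU: "\<And>t. t \<in> {0..r} \<Longrightarrow> X t w \<in> U"
      using less_\<rho>_iff[OF w r] by auto
    have "continuous_on {0..r} (\<lambda>t. infdist (X t w) (- U))"
      using r\<theta> by (intro continuous_intros continuous_on_subset[OF X_path[OF w]]) auto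
    then obtain s where s: "s \<in> {0..r}" "\<And>t. t \<in> {0..r} \<Longrightarrow> infdist (X s w) (- U) \<le> infdist (X t w) (- U)"
      using continuous_attains_inf[of "{0..r}" "\<lambda>t. infdist (X t w) (- U)"] r by auto
    have "infdist (X s w) (- U) \<noteq> 0"
      using in_closed_iff_infdist_zero[of "- U" "X s w"] U' U(1) XU[OF s(1)] by (auto simp: closed_Compl)
    then have "0 < infdist (X s w) (- U)" using infdist_nonneg[of "X s w" "- U"] by linarith
    then obtain n where n: "1 / real (Suc n) < infdist (X s w) (- U)" using nat_approx_posE by blast
    show "w \<in> ?R"
    proof (intro UN_I[of n] INT_I CollectI conjI w r\<theta>)
      fix q assume "q \<in> Q"
      then show "X q w \<in> C n" unfolding C_def using Q0 s(2)[of q] n by auto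
    qed simp
  next
    fix w n assume H: "w \<in> (\<Inter>q\<in>Q. {w \<in> space M. r < \<theta> w \<and> X q w \<in> C n})"
    then have w: "w \<in> space M" and r\<theta>: "r < \<theta> w" and XC: "\<And>q. q \<in> Q \<Longrightarrow> X q w \<in> C n"
      using Q(2) by auto
    have cl: "closure Q = {0..r}"
      using clQ closure_mono[OF Q0] by auto
    have "X t w \<in> U" if "t \<in> {0..r}" for t
    proof -
      have "(\<lambda>t. X t w) ` closure Q \<subseteq> closure ((\<lambda>t. X t w) ` Q)"
        by (rule image_closure_subset[OF continuous_on_subset[OF X_path[OF w]]])
           (use r\<theta> closure_subset[of "(\<lambda>t. X t w) ` Q"] in \<open>auto simp: cl\<close>)
      also have "\<dots> \<subseteq> C n" by (rule closure_minimal[OF _ C]) (use XC in auto)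
      also have "\<dots> \<subseteq> U" by (rule CU)
      finally show ?thesis using that cl by auto
    qed
    then show "r < \<rho> w" using less_\<rho>_iff[OF w r] r\<theta> rT by auto
    show "w \<in> space M" by (rule w)
  qed
  show ?thesis unfolding eq
    by (intro sets.countable_UN'' sets.countable_INT' Q countableI_type image_subsetI X_event borel_closed C)
       (use Q0 in auto)
qed

text \<open>\<open>X r\<close> is under control only where r is below \<open>\<theta>\<close>.
  Masking it where \<open>\<rho>\<close> has passed gives a variable that is measurable
  everywhere.\<close>

lemma X_before_\<rho>_measurable:
  assumes "0 \<le> r" "r \<le> t"
  shows "(\<lambda>w. if r < \<rho> w then X r w else x0) \<in> borel_measurable (F t)"
proof (rule F_measurable_mono[OF measurableI assms(2)])
  fix A :: "(real ^ 'n) set" assume A: "A \<in> sets borel"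
  have 1: "{w \<in> space M. r < \<rho> w} \<in> sets (F r)" by (rule \<rho>_stop[OF assms(1)])
  have 2: "{w \<in> space M. r < \<theta> w \<and> X r w \<in> A} \<in> sets (F r)" by (rule X_event[OF assms(1) order_refl A])
  have "(\<lambda>w. if r < \<rho> w then X r w else x0) -` A \<inter> space (F r) =
    ({w \<in> space M. r < \<rho> w} \<inter> {w \<in> space M. r < \<theta> w \<and> X r w \<in> A}) \<union>
    (if x0 \<in> A then space (F r) - {w \<in> space M. r < \<rho> w} else {})"
    by (auto split: if_splits dest: less_le_trans[OF _ \<rho>_bounds(2)])
  also have "\<dots> \<in> sets (F r)"
    using sets.compl_sets[OF 1] by (intro sets.Un sets.Int 1 2) (simp only: sets.empty_sets simp_thms split: if_split)
  finally show "(\<lambda>w. if r < \<rho> w then X r w else x0) -` A \<inter> space (F r) \<in> sets (F r)" .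
qed auto

text \<open>The solution is adapted at fixed times only, so its value at the random time is a limit
  of values at grid points. These are taken before \<open>\<rho>\<close>, because \<open>X\<close>
  is not controlled beyond \<open>\<theta>\<close>; knowing which grid points up to t precede
  \<open>\<rho>\<close> requires no information from after t.\<close>

lemma Z_adapted:
  assumes t: "0 \<le> t"
  shows "Z t \<in> borel_measurable (F t)"
proof -
  define q where "q n i = t * real i / real (Suc n)" for n i
  \<comment> \<open>the value of \<open>X\<close> at the last grid point before \<open>\<rho> w\<close>, written as a telescoping sum\<close>
  define S where "S n w = (if 0 < \<rho> w then X 0 w else x0) +
    (\<Sum>i<Suc n. if q n (Suc i) < \<rho> w then X (q n (Suc i)) w - X (q n i) w else 0)" for n w
  have q: "0 \<le> q n i" "q n i \<le> q n (Suc i)" for n i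
    using t unfolding q_def by (auto intro!: divide_right_mono mult_left_mono)
  have qt: "q n i \<le> t" if "i \<le> Suc n" for n i
  proof -
    have "t * real i \<le> t * real (Suc n)" using that t by (intro mult_left_mono) auto
    then show ?thesis unfolding q_def by (simp add: divide_le_eq)
  qed
  have m: "S n \<in> borel_measurable (F t)" for n
  proof -
    have "(\<lambda>w. if q n (Suc i) < \<rho> w then X (q n (Suc i)) w - X (q n i) w else 0) \<in> borel_measurable (F t)"
      if "i < Suc n" for i
    proof -
      have "(\<lambda>w. if q n (Suc i) < \<rho> w then (if q n (Suc i) < \<rho> w then X (q n (Suc i)) w else x0) -
          (if q n i < \<rho> w then X (q n i) w else x0) else 0) \<in> borel_measurable (F t)"
      proof (rule measurable_If)
        show "{w \<in> space (F t). q n (Suc i) < \<rho> w} \<in> sets (F t)"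
          unfolding space_augmented_filtration
          by (rule subsetD[OF sets_augmented_filtration_mono \<rho>_stop], rule qt) (use that q(1) in auto)
        have "i \<le> Suc n" "Suc i \<le> Suc n" using that by auto
        then show "(\<lambda>w. (if q n (Suc i) < \<rho> w then X (q n (Suc i)) w else x0) -
          (if q n i < \<rho> w then X (q n i) w else x0)) \<in> borel_measurable (F t)"
          by (intro borel_measurable_diff X_before_\<rho>_measurable q(1) qt)
      qed (rule borel_measurable_const)
      also have "(\<lambda>w. if q n (Suc i) < \<rho> w then (if q n (Suc i) < \<rho> w then X (q n (Suc i)) w else x0) -
          (if q n i < \<rho> w then X (q n i) w else x0) else 0) =
          (\<lambda>w. if q n (Suc i) < \<rho> w then X (q n (Suc i)) w - X (q n i) w else 0)"
        using q(2)[of n i] by (auto simp: fun_eq_iff)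
      finally show ?thesis .
    qed
    then show ?thesis unfolding S_def[abs_def]
      by (intro borel_measurable_add borel_measurable_sum X_before_\<rho>_measurable t order_refl) auto
  qed
  have S_eq: "\<exists>r. S n w = X r w \<and> 0 \<le> r \<and> r \<le> min t (\<rho> w) \<and> min t (\<rho> w) \<le> r + t / real (Suc n)"
    if w: "w \<in> space M" "w \<notin> N" for n w
  proof -
    \<comment> \<open>The last clause strengthens the induction: as long as \<open>\<rho> w\<close>
      has not been reached, r is the current grid point, so that the next summand
      telescopes.\<close>
    have "\<exists>r. (if 0 < \<rho> w then X 0 w else x0) +
        (\<Sum>i<k. if q n (Suc i) < \<rho> w then X (q n (Suc i)) w - X (q n i) w else 0) = X r w \<and>
        0 \<le> r \<and> r \<le> min (q n k) (\<rho> w) \<and> min (q n k) (\<rho> w) \<le> r + t / real (Suc n) \<and> (q n k < \<rho> w \<longrightarrow> r = q n k)" for k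
    proof (induction k)
      case 0
      show ?case by (rule exI[of _ 0]) (use X_0[OF w] \<rho>_bounds(1)[OF w(1)] t in \<open>auto simp: q_def\<close>)
    next
      case (Suc k)
      then obtain r where r: "(if 0 < \<rho> w then X 0 w else x0) +
        (\<Sum>i<k. if q n (Suc i) < \<rho> w then X (q n (Suc i)) w - X (q n i) w else 0) = X r w"
        "0 \<le> r" "r \<le> min (q n k) (\<rho> w)" "min (q n k) (\<rho> w) \<le> r + t / real (Suc n)" "q n k < \<rho> w \<longrightarrow> r = q n k"
        by blast
      have step: "q n (Suc k) = q n k + t / real (Suc n)"
        unfolding q_def of_nat_Suc[of k] distrib_left add_divide_distrib by simp
      show ?case
      proof (cases "q n (Suc k) < \<rho> w")
        case True
        then have "r = q n k" using r(5) q(2)[of n k] by auto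
        then show ?thesis using True r(1) q(1)[of n "Suc k"] t
          by (intro exI[of _ "q n (Suc k)"]) (simp add: algebra_simps)
      next
        case False
        have "min (q n (Suc k)) (\<rho> w) \<le> r + t / real (Suc n)"
          using r(3-5) step False by (cases "q n k < \<rho> w") auto
        then show ?thesis using False r q(2)[of n k] by (intro exI[of _ r]) auto
      qed
    qed
    moreover have "q n (Suc n) = t" unfolding q_def by (simp del: of_nat_Suc)
    ultimately show ?thesis unfolding S_def by metis
  qed
  have lim: "(\<lambda>n. S n w) \<longlonglongrightarrow> Z t w" if w: "w \<in> space M" "w \<notin> N" for w
  proof -
    obtain r where r: "\<And>n. S n w = X (r n) w" "\<And>n. 0 \<le> r n" "\<And>n. r n \<le> min t (\<rho> w)"
      "\<And>n. min t (\<rho> w) \<le> r n + t / real (Suc n)"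
      using S_eq[OF w] by metis
    have "r \<longlonglongrightarrow> min t (\<rho> w)"
    proof (rule tendsto_sandwich)
      show "(\<lambda>n. min t (\<rho> w) - t * (1 / real (Suc n))) \<longlonglongrightarrow> min t (\<rho> w)"
        using tendsto_diff[OF tendsto_const tendsto_mult_right_zero[OF LIMSEQ_inverse_real_of_nat]]
        by (simp add: inverse_eq_divide)
    qed (use r(3,4) in \<open>auto simp: algebra_simps\<close>)
    moreover have "r n \<le> \<theta> w" for n using r(3)[of n] \<rho>_bounds(2)[OF w(1)] by simp
    ultimately have "(\<lambda>n. X (r n) w) \<longlonglongrightarrow> X (min t (\<rho> w)) w"
      using r(2) \<rho>_bounds[OF w(1)] t
      by (intro continuous_on_tendsto_compose[OF X_path[OF w(1)]] always_eventually allI) auto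
    then show ?thesis using r(1) w(2) t by (simp add: Z_def)
  qed
  have "(\<lambda>w. if w \<in> N then x0 else S n w) \<in> borel_measurable (F t)" for n
    by (rule measurable_If_set[OF borel_measurable_const m]) (rule sets.Int[OF N_F sets.top])
  then show ?thesis
    by (rule borel_measurable_LIMSEQ_metric) (use lim in \<open>auto simp: Z_def\<close>)
qed

lemma Z_before: "u \<le> 0 \<Longrightarrow> Z u = Z 0"
  by (simp add: Z_def fun_eq_iff)

lemma Z_measurable: "Z u \<in> borel_measurable M"
  using F_measurable_M[OF Z_adapted, of "max 0 u"] Z_before[of u] by (cases "0 \<le> u") auto

lemma Z_joint: "(\<lambda>(u, w). Z u w) \<in> borel_measurable (borel \<Otimes>\<^sub>M M)"
  by (rule continuous_process_joint_measurable[OF Z_measurable Z_path])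

lemma \<rho>_measurable: "\<rho> \<in> borel_measurable M"
  unfolding borel_measurable_iff_greater
proof
  fix r
  show "{w \<in> space M. r < \<rho> w} \<in> events"
  proof (cases "0 \<le> r")
    case True
    then show ?thesis using \<rho>_stop[OF True] sets_F_le by blast
  next
    case False
    then have "{w \<in> space M. r < \<rho> w} = space M" using \<rho>_bounds(1) by fastforce
    then show ?thesis by (simp only: sets.top)
  qed
qed

end

section \<open>The stopped solution as input for Dynkin's formula\<close>

text \<open>The equation of the solution is written with the gauge integral over closed intervals,
  the stopped process with the Lebesgue integral over half-open ones, which split without
  overlap.\<close>

lemma set_integral_Ioc_eq_integral:
  fixes f :: "real \<Rightarrow> 'b::euclidean_space"
  assumes "continuous_on {a..b} f"
  shows "(LINT u:{a<..b}|lborel. f u) = integral {a..b} f"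
proof -
  have "set_integrable lborel {a<..b} f"
    by (rule set_integrable_subset[OF borel_integrable_atLeastAtMost'[OF assms]]) auto
  then have "(LINT u:{a<..b}|lborel. f u) = integral {a<..b} f"
    by (rule set_borel_integral_eq_integral(2))
  also have "\<dots> = integral {a..b} f"
    by (rule integral_subset_negligible[symmetric, where T="{a..b}" and S="{a<..b}" and f = f, THEN sym])
       (auto intro: negligible_subset[OF negligible_sing[of a]])
  finally show ?thesis .
qed

locale stopped_solution = exit_process M W X \<theta> U N x0 T
  for M :: "'a measure" and W :: "real \<Rightarrow> 'a \<Rightarrow> real ^ 'k"
    and X :: "real \<Rightarrow> 'a \<Rightarrow> real ^ 'n" and \<theta> :: "'a \<Rightarrow> real" and U :: "(real ^ 'n) set"
    and N :: "'a set" and x0 :: "real ^ 'n" and T :: real +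
  fixes b :: "real ^ 'n \<Rightarrow> real ^ 'n" and \<sigma> :: "real ^ 'n \<Rightarrow> real ^ 'k ^ 'n"
    and I :: "real \<Rightarrow> 'a \<Rightarrow> real ^ 'n" and K R :: real
    and V Vt :: "real \<Rightarrow> real ^ 'n \<Rightarrow> real"
    and Vx :: "real \<Rightarrow> real ^ 'n \<Rightarrow> real ^ 'n"
    and Vxx :: "real \<Rightarrow> real ^ 'n \<Rightarrow> real ^ 'n ^ 'n"
  assumes b_cont: "continuous_on UNIV b" and \<sigma>_cont: "continuous_on UNIV \<sigma>"
    and ito: "has_ito_integral M F W (\<lambda>s w. if s \<le> \<theta> w then \<sigma> (X s w) else 0) I"
    and equation: "w \<in> space M \<Longrightarrow> w \<notin> N \<Longrightarrow> 0 \<le> t \<Longrightarrow>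
      X (min t (\<theta> w)) w = x0 + integral {0..min t (\<theta> w)} (\<lambda>s. b (X s w)) + I t w"
    and K: "x \<in> closure U \<Longrightarrow> norm (b x) \<le> K" "x \<in> closure U \<Longrightarrow> norm (\<sigma> x) \<le> K"
    and R: "x \<in> closure U \<Longrightarrow> norm x \<le> R"
    and C12: "C12_on T V Vt Vx Vxx"
begin

text \<open>The time \<open>\<rho> w\<close> itself is included, in agreement with the convention
  for stopped integrands in \<open>stopped_ito\<close>. On \<open>N\<close> the value 0 matches the
  constant path of \<open>Z\<close>.\<close>

definition B :: "real \<Rightarrow> 'a \<Rightarrow> real ^ 'n" where
  "B u w = (if 0 < u \<and> u \<le> \<rho> w \<and> w \<notin> N then b (Z u w) else 0)"

definition Hs :: "real \<Rightarrow> 'a \<Rightarrow> real ^ 'k ^ 'n" where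
  "Hs u w = (if 0 < u \<and> u \<le> \<rho> w \<and> w \<notin> N then \<sigma> (Z u w) else 0)"

text \<open>Defined as what the drift leaves over rather than as a stopped Ito integral: the
  increment identity then holds on every path, and the relation to \<open>I\<close> only has to hold
  almost surely.\<close>

definition Y :: "real \<Rightarrow> 'a \<Rightarrow> real ^ 'n" where
  "Y t w = Z t w - x0 - (LINT u:{0<..t}|lborel. B u w)"

lemma before_exit_joint:
  fixes f :: "real ^ 'n \<Rightarrow> 'c::real_normed_vector"
  assumes f: "continuous_on UNIV f"
  shows "(\<lambda>(u, w). if 0 < u \<and> u \<le> \<rho> w \<and> w \<notin> N then f (Z u w) else 0) \<in> borel_measurable (borel \<Otimes>\<^sub>M M)"
proof -
  have \<rho>: "(\<lambda>p. \<rho> (snd p)) \<in> borel_measurable (borel \<Otimes>\<^sub>M M)"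
    by (rule measurable_compose[OF measurable_snd \<rho>_measurable])
  have N': "{p \<in> space ((borel :: real measure) \<Otimes>\<^sub>M M). snd p \<notin> N} \<in> sets (borel \<Otimes>\<^sub>M M)"
  proof -
    have "space M - N \<in> events" using N by auto
    then have "snd -` (space M - N) \<inter> space ((borel :: real measure) \<Otimes>\<^sub>M M) \<in> sets (borel \<Otimes>\<^sub>M M)"
      by (rule measurable_sets[OF measurable_snd])
    also have "snd -` (space M - N) \<inter> space ((borel :: real measure) \<Otimes>\<^sub>M M) =
      {p \<in> space ((borel :: real measure) \<Otimes>\<^sub>M M). snd p \<notin> N}"
      by (auto simp: space_pair_measure)
    finally show ?thesis .
  qed
  have c: "{p \<in> space (borel \<Otimes>\<^sub>M M). 0 < fst p \<and> fst p \<le> \<rho> (snd p) \<and> snd p \<notin> N} \<in> sets (borel \<Otimes>\<^sub>M M)"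
    by (intro sets.sets_Collect_conj N' borel_measurable_less borel_measurable_le borel_measurable_const \<rho> measurable_fst)
  have "(\<lambda>p. f (Z (fst p) (snd p))) \<in> borel_measurable (borel \<Otimes>\<^sub>M M)"
    using measurable_compose[OF Z_joint borel_measurable_continuous_onI[OF f]] by (simp only: split_beta')
  then show ?thesis unfolding split_beta'
    by (rule measurable_If[OF _ borel_measurable_const c])
qed

lemma Z_eq_X: "w \<notin> N \<Longrightarrow> 0 \<le> t \<Longrightarrow> t \<le> \<rho> w \<Longrightarrow> Z t w = X t w"
  by (simp add: Z_def min_absorb1)

lemma K_nonneg': "0 \<le> K"
  using K(1)[of x0] U(3) closure_subset norm_ge_zero order_trans by blast

lemma B_joint: "(\<lambda>(u, w). B u w) \<in> borel_measurable (borel \<Otimes>\<^sub>M M)"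
  unfolding B_def by (rule before_exit_joint[OF b_cont])

lemma B_bound: "w \<in> space M \<Longrightarrow> norm (B u w) \<le> K"
  using K(1)[OF Z_closure] K_nonneg' by (simp add: B_def)

lemma B_integrable:
  assumes w: "w \<in> space M" and "s \<le> t"
  shows "set_integrable lborel {s<..t} (\<lambda>u. B u w)"
proof (rule set_integrable_Ioc_bounded[OF _ B_bound[OF w] assms(2)])
  show "(\<lambda>u. B u w) \<in> borel_measurable borel"
    using measurable_compose[OF measurable_Pair2'[OF w] B_joint] by simp
qed

lemma Y_eq:
  assumes w: "w \<in> space M" "w \<notin> N" and t: "0 \<le> t"
  shows "Y t w = I (min t (\<rho> w)) w"
proof -
  let ?s = "min t (\<rho> w)"
  have s: "0 \<le> ?s" "?s \<le> \<theta> w" using t \<rho>_bounds[OF w(1)] by auto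
  have "continuous_on {0..?s} (\<lambda>u. X u w)"
    by (rule continuous_on_subset[OF X_path[OF w(1)]]) (use s in auto)
  then have "continuous_on {0..?s} (\<lambda>u. b (X u w))"
    by (intro continuous_on_compose2[OF b_cont]) auto
  note c = set_integral_Ioc_eq_integral[OF this]
  have "(LINT u:{0<..t}|lborel. B u w) = (LINT u:{0<..?s}|lborel. b (X u w))"
    unfolding set_lebesgue_integral_def
    by (rule Bochner_Integration.integral_cong) (use w Z_eq_X in \<open>auto simp: B_def indicator_def\<close>)
  moreover have "X ?s w = x0 + integral {0..?s} (\<lambda>u. b (X u w)) + I ?s w"
    using equation[OF w s(1)] s(2) by (simp add: min_absorb1)
  moreover have "Z t w = X ?s w" using t w by (simp add: Z_def)
  ultimately show ?thesis unfolding Y_def c by simp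
qed

lemma ae_good: "AE w in M. w \<notin> N"
  by (rule AE_not_in[OF N])

lemma H_path:
  assumes w: "w \<in> space M"
  shows "\<exists>C. \<forall>u\<ge>0. norm (if u \<le> \<theta> w then \<sigma> (X u w) else 0) \<le> C"
proof -
  have "continuous_on {0..\<theta> w} (\<lambda>u. \<sigma> (X u w))"
    by (rule continuous_on_compose2[OF \<sigma>_cont X_path[OF w]]) auto
  then have "bounded ((\<lambda>u. \<sigma> (X u w)) ` {0..\<theta> w})"
    by (intro compact_imp_bounded compact_continuous_image) auto
  then obtain C where "0 < C" "\<forall>y\<in>(\<lambda>u. \<sigma> (X u w)) ` {0..\<theta> w}. norm y \<le> C"
    unfolding bounded_pos by blast
  then show ?thesis by (intro exI[of _ C]) auto
qed

sublocale dyn: dynkin_process M W "\<lambda>s w. if s \<le> \<theta> w then \<sigma> (X s w) else 0" I \<rho> Hs Y K Z B T R V Vt Vx Vxx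
proof unfold_locales
  show "has_ito_integral M F W (\<lambda>s w. if s \<le> \<theta> w then \<sigma> (X s w) else 0) I" by (rule ito)
  then have "progressively_measurable F (\<lambda>s w. if s \<le> \<theta> w then \<sigma> (X s w) else 0)"
    by (simp only: has_ito_integral_def)
  from progressively_measurable_joint[OF this]
  show "(\<lambda>(u, w). if max 0 u \<le> \<theta> w then \<sigma> (X (max 0 u) w) else 0) \<in> borel_measurable (borel \<Otimes>\<^sub>M M)" .
  show "(\<lambda>(u, w). Hs u w) \<in> borel_measurable (borel \<Otimes>\<^sub>M M)"
    unfolding Hs_def by (rule before_exit_joint[OF \<sigma>_cont])
  show "norm (Hs u w) \<le> K" if "w \<in> space M" for u w
    using K(2)[OF Z_closure[OF that]] K_nonneg' by (simp add: Hs_def)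
  show "AE w in M. \<forall>u>0. Hs u w = (if u \<le> \<rho> w then if u \<le> \<theta> w then \<sigma> (X u w) else 0 else 0)"
    using ae_good AE_space
  proof eventually_elim
    case (elim w)
    then show ?case using \<rho>_bounds(2)[of w] Z_eq_X[of w] by (auto simp: Hs_def)
  qed
  show "Y t \<in> borel_measurable M" if "0 \<le> t" for t
    unfolding Y_def[abs_def]
    by (intro borel_measurable_diff Z_measurable borel_measurable_const time_integral_measurable B_joint)
  show "AE w in M. \<forall>t\<ge>0. Y t w = I (min t (\<rho> w)) w"
    using ae_good AE_space
  proof eventually_elim
    case (elim w)
    then show ?case using Y_eq by blast
  qed
  show "Z t w - Z s w = (LINT u:{s<..t}|lborel. B u w) + (Y t w - Y s w)"
    if w: "w \<in> space M" and st: "0 \<le> s" "s \<le> t" "t \<le> T" for w s t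
  proof -
    have "(LINT u:{0<..t}|lborel. B u w) = (LINT u:{0<..s}|lborel. B u w) + (LINT u:{s<..t}|lborel. B u w)"
      by (rule set_integral_Ioc_additive[OF B_integrable[OF w]]) (use st in auto)
    then show ?thesis unfolding Y_def by simp
  qed
qed (assumption | rule \<rho>_bounds(1) \<rho>_stop H_path T_pos Z_adapted Z_joint R[OF Z_closure] B_joint B_bound C12)+

text \<open>
  The paths that are stopped by \<open>\<theta>\<close> before leaving \<open>U\<close>; only on these may the stopped process be left
  with a positive drift.
\<close>

definition announced :: "'a set" where
  "announced = {w \<in> space M. w \<notin> N \<and> \<rho> w = \<theta> w \<and> \<theta> w < T \<and> Z T w \<in> U}"

text \<open>Before the exit the drift is the generator; afterwards only the time derivative is left,
  which has a sign on the boundary and is bounded by \<open>C\<close> on the paths stopped inside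
  \<open>U\<close>. At \<open>\<rho> w\<close> itself the coefficients are still switched on while
  the path may already be on the boundary, where the generator has no sign; this single time is
  excluded.\<close>

lemma drift_le:
  assumes gen: "\<And>t x. t \<in> {0..T} \<Longrightarrow> x \<in> U \<Longrightarrow> generator b \<sigma> Vt Vx Vxx t x \<le> 0"
    and bd: "\<And>t x. t \<in> {0..T} \<Longrightarrow> x \<in> frontier U \<Longrightarrow> Vt t x \<le> 0"
    and C: "0 \<le> C" "\<And>t x. t \<in> {0..T} \<Longrightarrow> x \<in> closure U \<Longrightarrow> Vt t x \<le> C"
    and w: "w \<in> space M" "w \<notin> N" and u: "0 < u" "u \<le> T" "u \<noteq> \<rho> w"
  shows "dyn.drift u w \<le> C * indicator announced w"
proof -
  have ind: "0 \<le> C * indicator announced w" using C(1) by simp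
  have cl: "max 0 (min T u) = u" "u \<in> {0..T}" using u by auto
  show ?thesis
  proof (cases "u < \<rho> w")
    case True
    then have "Z u w \<in> U" using Z_eq_X[OF w(2)] X_before_\<rho>[OF w(1)] u by simp
    moreover have "dyn.drift u w = generator b \<sigma> Vt Vx Vxx u (Z u w)"
      using True u w unfolding dyn.drift_def cl generator_def B_def Hs_def
      by (simp add: trace_conjugate_eq_inner)
    ultimately show ?thesis using gen[OF cl(2)] ind order_trans by metis
  next
    case False
    then have \<rho>u: "\<rho> w < u" using u by simp
    have ZT: "Z u w = X (\<rho> w) w" "Z T w = X (\<rho> w) w"
      using \<rho>u \<rho>_bounds[OF w(1)] u w by (simp_all add: Z_def min_absorb2)
    have d: "dyn.drift u w = Vt u (Z u w)"
      using \<rho>u unfolding dyn.drift_def cl B_def Hs_def by simp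
    show ?thesis
    proof (cases "Z u w \<in> U")
      case True
      then have "\<rho> w = \<theta> w" using X_at_\<rho>[OF w(1)] \<rho>_bounds[OF w(1)] \<rho>u u ZT by force
      then have "w \<in> announced" using True w \<rho>u u ZT by (simp add: announced_def)
      then show ?thesis unfolding d using C(2)[OF cl(2) Z_closure[OF w(1)]] by simp
    next
      case False
      then have "Z u w \<in> frontier U"
        using Z_closure[OF w(1)] U(1) by (simp add: frontier_def interior_open)
      then show ?thesis unfolding d using bd[OF cl(2)] ind order_trans by metis
    qed
  qed
qed

lemma announced_event: "announced \<in> events"
proof -
  have th: "\<theta> \<in> borel_measurable M"
    unfolding borel_measurable_iff_greater
  proof
    fix r
    show "{w \<in> space M. r < \<theta> w} \<in> events"
    proof (cases "0 \<le> r")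
      case True
      have "{w \<in> space M. r < \<theta> w \<and> X r w \<in> UNIV} \<in> sets (F r)"
        by (rule X_event[OF True order_refl sets.top[of borel, unfolded space_borel]])
      from subsetD[OF sets_F_le this] show ?thesis by (simp only: UNIV_I simp_thms)
    next
      case False
      then have "{w \<in> space M. r < \<theta> w} = space M" using \<theta>_nonneg by fastforce
      then show ?thesis by (simp only: sets.top)
    qed
  qed
  have N': "{w \<in> space M. w \<notin> N} \<in> events"
  proof -
    have "space M - N \<in> events" by (rule sets.compl_sets[OF null_setsD2[OF N]])
    then show ?thesis by (simp only: set_diff_eq)
  qed
  have ZU: "{w \<in> space M. Z T w \<in> U} \<in> events"
  proof -
    have "Z T -` U \<inter> space M \<in> events"
      by (rule measurable_sets[OF Z_measurable borel_open[OF U(1)]])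
    also have "Z T -` U \<inter> space M = {w \<in> space M. Z T w \<in> U}" by auto
    finally show ?thesis .
  qed
  show ?thesis unfolding announced_def
    by (intro sets.sets_Collect_conj N' ZU borel_measurable_eq borel_measurable_less borel_measurable_const th \<rho>_measurable)
qed

lemma expectation_terminal_le:
  assumes gen: "\<And>t x. t \<in> {0..T} \<Longrightarrow> x \<in> U \<Longrightarrow> generator b \<sigma> Vt Vx Vxx t x \<le> 0"
    and bd: "\<And>t x. t \<in> {0..T} \<Longrightarrow> x \<in> frontier U \<Longrightarrow> Vt t x \<le> 0"
    and C: "0 \<le> C" "\<And>t x. t \<in> {0..T} \<Longrightarrow> x \<in> closure U \<Longrightarrow> Vt t x \<le> C"
  shows "expectation (\<lambda>w. V T (Z T w)) \<le> V 0 x0 + C * T * prob announced"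
proof -
  obtain Cd where Cd': "\<forall>w\<in>space M. \<forall>u. \<bar>dyn.drift u w\<bar> \<le> Cd" using dyn.drift_bound by (rule exE)
  have Cd: "\<bar>dyn.drift u w\<bar> \<le> Cd" if "w \<in> space M" for u w by (rule Cd'[rule_format, OF that])
  have T: "0 \<le> T" using T_pos by simp
  have "expectation (\<lambda>w. V 0 (Z 0 w)) = expectation (\<lambda>w. V 0 x0)"
  proof (rule integral_cong_AE)
    show "(\<lambda>w. V 0 (Z 0 w)) \<in> borel_measurable M"
      by (rule borel_measurable_integrable[OF dyn.V_Z_integrable]) (use T in simp)
    show "AE w in M. V 0 (Z 0 w) = V 0 x0"
      using ae_good AE_space
    proof eventually_elim
      case (elim w)
      then show ?case using \<rho>_bounds(1)[of w] X_0[of w] by (simp add: Z_def min_absorb1)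
    qed
  qed (rule borel_measurable_const)
  moreover have "expectation (\<lambda>w. LINT u:{0<..T}|lborel. dyn.drift u w) \<le> expectation (\<lambda>w. C * T * indicator announced w)"
  proof (rule integral_mono_AE)
    show "integrable M (\<lambda>w. LINT u:{0<..T}|lborel. dyn.drift u w)"
      by (rule time_integral_integrable[OF dyn.drift_joint Cd T])
    show "integrable M (\<lambda>w. C * T * indicator announced w)"
      by (intro integrable_mult_right integrable_indicator_event announced_event)
    show "AE w in M. (LINT u:{0<..T}|lborel. dyn.drift u w) \<le> C * T * indicator announced w"
      using ae_good AE_space
    proof eventually_elim
      case (elim w)
      have "(LINT u:{0<..T}|lborel. dyn.drift u w) \<le> (LINT u:{0<..T}|lborel. C * indicator announced w)"
        unfolding set_lebesgue_integral_def
      proof (rule integral_mono_AE)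
        show "integrable lborel (\<lambda>u. indicat_real {0<..T} u *\<^sub>R dyn.drift u w)"
          using time_integrable[OF dyn.drift_joint Cd T elim(2)] by (simp only: set_integrable_def)
        show "integrable lborel (\<lambda>u. indicat_real {0<..T} u *\<^sub>R (C * indicator announced w))"
          unfolding set_integrable_def[symmetric]
          by (rule set_integrable_Ioc_bounded[OF borel_measurable_const order_refl T])
        show "AE u in lborel. indicat_real {0<..T} u *\<^sub>R dyn.drift u w \<le> indicat_real {0<..T} u *\<^sub>R (C * indicator announced w)"
          using AE_lborel_singleton[of "\<rho> w"]
        proof eventually_elim
          case (elim u)
          then show ?case
            using drift_le[OF gen bd C \<open>w \<in> space M\<close> \<open>w \<notin> N\<close>, of u] by (cases "u \<in> {0<..T}") auto
        qed
      qed
      also have "\<dots> = C * indicator announced w * (T - 0)" by (rule set_integral_Ioc_const[OF T])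
      finally show ?case by (simp add: ac_simps)
    qed
  qed
  moreover have "expectation (\<lambda>w. C * T * indicator announced w) = C * T * prob announced"
  proof -
    have "announced \<inter> space M = announced" by (auto simp: announced_def)
    then show ?thesis by simp
  qed
  moreover have "expectation (\<lambda>w. V 0 x0) = V 0 x0" by (simp add: prob_space)
  ultimately show ?thesis using dyn.dynkin_formula by linarith
qed

text \<open>The times at which the path is in \<open>Ds\<close> form a compact set with a first
  element s. Before s the path lies in \<open>U\<close>, so off \<open>announced\<close> it is
  stopped exactly at s. Its position then belongs to \<open>Ds\<close> and to the closure of
  \<open>U\<close>; the latter misses the interior of \<open>Ds\<close>, because \<open>U\<close>
  does.\<close>

lemma reach_terminal:
  assumes D: "U = D - Ds" "closed Ds" and w: "w \<in> space M" "w \<notin> N" "w \<notin> announced"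
    and path: "continuous_on {0..t} (\<lambda>s. X s w)"
    and t: "0 \<le> t" "t \<le> T" "X t w \<in> Ds" and avoid: "\<And>s. 0 \<le> s \<Longrightarrow> s < t \<Longrightarrow> X s w \<in> D"
  shows "Z T w \<in> frontier Ds"
proof -
  define S where "S = {0..t} \<inter> (\<lambda>s. X s w) -` Ds"
  have "bounded S" by (rule bounded_subset[OF bounded_closed_interval[of 0 t]]) (simp add: S_def)
  moreover have "closed S"
    unfolding S_def by (rule continuous_closed_preimage[OF path closed_atLeastAtMost D(2)])
  ultimately have "compact S" by (simp add: compact_eq_bounded_closed)
  moreover have "t \<in> S" using t by (simp add: S_def)
  ultimately obtain s where s: "s \<in> S" "\<And>r. r \<in> S \<Longrightarrow> s \<le> r"
    using compact_attains_inf[of S] by blast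
  have sD: "X s w \<in> Ds" "0 \<le> s" "s \<le> t" using s(1) by (auto simp: S_def)
  have before: "X r w \<in> U" if "0 \<le> r" "r < s" for r
    using avoid[of r] s(2)[of r] that sD(3) by (auto simp: D(1) S_def)
  have "\<rho> w \<le> s" by (rule \<rho>_upper[OF w(1) sD(2)]) (use sD(1) D(1) in auto)
  moreover have "\<not> \<rho> w < s"
  proof
    assume less: "\<rho> w < s"
    then have XU: "X (\<rho> w) w \<in> U" and \<rho>T: "\<rho> w < T" using before \<rho>_bounds(1)[OF w(1)] sD(3) t(2) by auto
    then have \<theta>: "\<rho> w = \<theta> w" using X_at_\<rho>[OF w(1)] \<rho>_bounds(2)[OF w(1)] by force
    have "Z T w = X (\<rho> w) w" using \<rho>T T_pos w(2) by (simp add: Z_def)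
    then show False using w XU \<rho>T \<theta> by (simp add: announced_def)
  qed
  ultimately have \<rho>: "\<rho> w = s" by simp
  then have ZT: "Z T w = X s w" using sD t(2) T_pos w(2) by (simp add: Z_def)
  have "X s w \<notin> interior Ds"
  proof
    assume "X s w \<in> interior Ds"
    moreover have "X s w \<in> closure U" using Z_closure[OF w(1), of T] by (simp only: ZT)
    ultimately have "interior Ds \<inter> U \<noteq> {}"
      using open_Int_closure_eq_empty[OF open_interior, of Ds U] by auto
    then show False using interior_subset[of Ds] by (auto simp: D(1))
  qed
  then show ?thesis using sD(1) D(2) ZT by (simp add: frontier_def closure_closed)
qed

lemma prob_le_terminal:
  assumes V: "\<And>x. x \<in> closure U \<Longrightarrow> 0 \<le> V T x"
    and A: "\<And>w. w \<in> space M \<Longrightarrow> w \<in> A \<Longrightarrow> w \<notin> N \<Longrightarrow> w \<notin> announced \<Longrightarrow> 1 \<le> V T (Z T w)"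
  shows "prob A \<le> expectation (\<lambda>w. V T (Z T w)) + prob announced"
proof (cases "A \<in> events")
  \<comment> \<open>A set that is not an event has measure 0 by convention, so nonnegativity of the
    expectation suffices.\<close>
  case False
  have "0 \<le> expectation (\<lambda>w. V T (Z T w))"
    by (rule integral_nonneg_AE, rule AE_I2, rule V, rule Z_closure)
  then show ?thesis using False by (simp add: measure_notin_sets)
next
  case True
  have i: "integrable M (\<lambda>w. V T (Z T w))" by (rule dyn.V_Z_integrable) (use T_pos in simp)
  have "prob A = expectation (indicator A)" using True by (simp add: sets.Int_space_eq2)
  also have "\<dots> \<le> expectation (\<lambda>w. V T (Z T w) + indicator announced w)"
  proof (rule integral_mono_AE)
    show "integrable M (indicator A :: 'a \<Rightarrow> real)" by (rule integrable_indicator_event[OF True])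
    show "integrable M (\<lambda>w. V T (Z T w) + indicator announced w)"
      by (intro Bochner_Integration.integrable_add i integrable_indicator_event announced_event)
    show "AE w in M. indicator A w \<le> V T (Z T w) + indicator announced w"
      using ae_good AE_space
    proof eventually_elim
      case (elim w)
      then show ?case using A[of w] V[OF Z_closure[of w T]] by (auto simp: indicator_def)
    qed
  qed
  also have "\<dots> = expectation (\<lambda>w. V T (Z T w)) + expectation (indicator announced)"
    by (rule Bochner_Integration.integral_add[OF i integrable_indicator_event[OF announced_event]])
  also have "expectation (indicator announced) = prob announced"
    using announced_event by (simp add: sets.Int_space_eq2)
  finally show ?thesis .
qed

end

section \<open>The reach-avoid bound\<close>

text \<open>The bound for a single announcing time. The exceptional event \<open>A\<close> is
  described by properties of the path and of \<open>\<theta>\<close> alone, without the exit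
  construction, which is what the passage along the announcing sequence uses.\<close>

lemma (in brownian) local_solution_reach_bound:
  fixes X :: "real \<Rightarrow> 'a \<Rightarrow> real ^ 'n" and b :: "real ^ 'n \<Rightarrow> real ^ 'n" and \<sigma> :: "real ^ 'n \<Rightarrow> real ^ 'k ^ 'n"
    and \<theta> :: "'a \<Rightarrow> real"
  assumes path: "\<And>w. w \<in> space M \<Longrightarrow> continuous_on {t. 0 \<le> t \<and> ereal t < \<zeta> w} (\<lambda>t. X t w)"
    and adapted: "\<And>t. 0 \<le> t \<Longrightarrow> X t \<in> borel_measurable (restrict_space (F t) {w. ereal t < \<zeta> w})"
    and stop: "stopping_time F \<theta>"
    and \<theta>: "\<And>w. w \<in> space M \<Longrightarrow> 0 \<le> \<theta> w \<and> ereal (\<theta> w) < \<zeta> w"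
    and ito: "has_ito_integral M F W (\<lambda>s w. if s \<le> \<theta> w then \<sigma> (X s w) else 0) I"
    and equation: "AE w in M. \<forall>t\<ge>0. X (min t (\<theta> w)) w = x0 + integral {0..min t (\<theta> w)} (\<lambda>s. b (X s w)) + I t w"
    and b_cont: "continuous_on UNIV b" and \<sigma>_cont: "continuous_on UNIV \<sigma>"
    and D: "open D" "bounded D" "closed Ds" "x0 \<in> D - Ds" and T: "0 < T"
    and C12: "C12_on T V Vt Vx Vxx"
    and gen: "\<And>t x. t \<in> {0..T} \<Longrightarrow> x \<in> D - Ds \<Longrightarrow> generator b \<sigma> Vt Vx Vxx t x \<le> 0"
    and bd: "\<And>t x. t \<in> {0..T} \<Longrightarrow> x \<in> frontier (D - Ds) \<Longrightarrow> Vt t x \<le> 0"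
    and terminal: "\<And>x. x \<in> closure (D - Ds) \<Longrightarrow> indicator (frontier Ds) x \<le> V T x"
    and C: "0 \<le> C" "\<And>t x. t \<in> {0..T} \<Longrightarrow> x \<in> closure (D - Ds) \<Longrightarrow> Vt t x \<le> C"
  shows "\<exists>A\<in>events. reach_avoid_prob M X \<zeta> D Ds T \<le> V 0 x0 + (C * T + 1) * prob A \<and>
    (\<forall>w\<in>A. w \<in> space M \<and> \<theta> w < T \<and> (\<forall>s. 0 \<le> s \<longrightarrow> s < \<theta> w \<longrightarrow> X s w \<in> D - Ds))"
proof -
  let ?U = "D - Ds"
  have "AE w in M. I 0 w = 0 \<and>
    (\<forall>t\<ge>0. X (min t (\<theta> w)) w = x0 + integral {0..min t (\<theta> w)} (\<lambda>s. b (X s w)) + I t w)"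
    using ito_integral_0[OF ito] equation by (rule AE_conjI)
  then obtain N where N: "N \<in> null_sets M"
    and good: "\<And>w. w \<in> space M - N \<Longrightarrow> I 0 w = 0 \<and>
      (\<forall>t\<ge>0. X (min t (\<theta> w)) w = x0 + integral {0..min t (\<theta> w)} (\<lambda>s. b (X s w)) + I t w)"
    by (rule AE_E3) blast
  have cU: "compact (closure ?U)"
    using D(2) by (auto simp: compact_eq_bounded_closed intro: bounded_closure bounded_subset[of D])
  have "bounded (b ` closure ?U)" "bounded (\<sigma> ` closure ?U)"
    by (intro compact_imp_bounded compact_continuous_image continuous_on_subset[OF b_cont]
        continuous_on_subset[OF \<sigma>_cont] cU subset_UNIV)+
  then obtain K1 K2 where K1: "\<forall>y\<in>b ` closure ?U. norm y \<le> K1" and K2: "\<forall>y\<in>\<sigma> ` closure ?U. norm y \<le> K2"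
    unfolding bounded_iff by blast
  obtain R where R: "\<forall>x\<in>closure ?U. norm x \<le> R"
    using compact_imp_bounded[OF cU] unfolding bounded_iff by blast
  \<comment> \<open>Adaptedness is stated on the trace of the filtration on the set where t is below
    the lifetime. Where r is below \<open>\<theta> w\<close> this holds for all t up to r, so
    intersecting with that event removes the restriction.\<close>
  have event: "{w \<in> space M. r < \<theta> w \<and> X t w \<in> A} \<in> sets (F r)"
    if t: "0 \<le> t" "t \<le> r" and A: "A \<in> sets borel" for t r A
  proof -
    have "X t -` A \<inter> space (restrict_space (F t) {w. ereal t < \<zeta> w}) \<in> sets (restrict_space (F t) {w. ereal t < \<zeta> w})"
      by (rule measurable_sets[OF adapted[OF t(1)] A])
    then obtain E where E: "E \<in> sets (F t)"
      "X t -` A \<inter> ({w. ereal t < \<zeta> w} \<inter> space M) = {w. ereal t < \<zeta> w} \<inter> E"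
      unfolding sets_restrict_space space_restrict_space space_augmented_filtration by blast
    have E': "E \<in> sets (F r)" using sets_augmented_filtration_mono[OF t(2)] E(1) by blast
    have "{w \<in> space (F r). \<theta> w \<le> r} \<in> sets (F r)"
      using stop by (simp only: stopping_time_def pred_def)
    from sets.compl_sets[OF this] have "space M - {w \<in> space M. \<theta> w \<le> r} \<in> sets (F r)"
      by (simp only: space_augmented_filtration)
    also have "space M - {w \<in> space M. \<theta> w \<le> r} = {w \<in> space M. r < \<theta> w}" by auto
    finally have c: "{w \<in> space M. r < \<theta> w} \<in> sets (F r)" .
    have "{w \<in> space M. r < \<theta> w \<and> X t w \<in> A} = {w \<in> space M. r < \<theta> w} \<inter> E"
    proof -
      have "ereal t < \<zeta> w" if "w \<in> space M" "r < \<theta> w" for w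
      proof -
        have "ereal t < ereal (\<theta> w)" using that t by simp
        also have "\<dots> < \<zeta> w" using \<theta>[OF that(1)] by simp
        finally show ?thesis .
      qed
      then show ?thesis using E(2) by blast
    qed
    then show ?thesis using sets.Int[OF c E'] by (simp only:)
  qed
  interpret S: stopped_solution M W X \<theta> ?U N x0 T b \<sigma> I "max K1 K2" R V Vt Vx Vxx
  proof unfold_locales
    show "continuous_on {0..\<theta> w} (\<lambda>t. X t w)" if w: "w \<in> space M" for w
    proof (rule continuous_on_subset[OF path[OF w]], safe)
      fix t assume "t \<in> {0..\<theta> w}"
      then have *: "ereal t \<le> ereal (\<theta> w)" "0 \<le> t" by auto
      show "ereal t < \<zeta> w" by (rule le_less_trans[OF *(1)]) (use \<theta>[OF w] in simp)
      show "0 \<le> t" by (rule *)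
    qed
    show "X 0 w = x0" if "w \<in> space M" "w \<notin> N" for w
      using good[of w] that \<theta>[OF that(1)] by (auto dest!: spec[of _ 0] simp: min_absorb1)
    show "X (min t (\<theta> w)) w = x0 + integral {0..min t (\<theta> w)} (\<lambda>s. b (X s w)) + I t w"
      if "w \<in> space M" "w \<notin> N" "0 \<le> t" for w t
      using good[of w] that by blast
    show "norm (b x) \<le> max K1 K2" "norm (\<sigma> x) \<le> max K1 K2" if "x \<in> closure ?U" for x
      using K1 K2 that by (auto simp: le_max_iff_disj)
    show "bounded ?U" using D(2) by (rule bounded_subset) auto
    show "open ?U" by (rule open_Diff[OF D(1,3)])
    show "norm x \<le> R" if "x \<in> closure ?U" for x using R that by blast
    show "0 \<le> \<theta> w" if "w \<in> space M" for w using \<theta>[OF that] by simp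
  qed (assumption | rule event N ito b_cont \<sigma>_cont D(4) T C12)+
  define A where "A = {w \<in> space M. \<exists>t\<in>{0..T}. ereal t < \<zeta> w \<and> X t w \<in> Ds \<and> (\<forall>\<tau>\<in>{0..<t}. X \<tau> w \<in> D)}"
  have "prob A \<le> expectation (\<lambda>w. V T (S.Z T w)) + prob S.announced"
  proof (rule S.prob_le_terminal)
    show "0 \<le> V T x" if "x \<in> closure ?U" for x
      using terminal[OF that] by (rule order_trans[rotated]) (simp add: indicator_def)
    fix w assume w: "w \<in> space M" "w \<in> A" "w \<notin> N" "w \<notin> S.announced"
    then obtain t where t: "0 \<le> t" "t \<le> T" "ereal t < \<zeta> w" "X t w \<in> Ds" "\<forall>\<tau>\<in>{0..<t}. X \<tau> w \<in> D"
      unfolding A_def by auto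
    have "S.Z T w \<in> frontier Ds"
    proof (rule S.reach_terminal[OF refl D(3) w(1,3,4) _ t(1,2,4)])
      show "continuous_on {0..t} (\<lambda>s. X s w)"
      proof (rule continuous_on_subset[OF path[OF w(1)]], safe)
        fix s assume "s \<in> {0..t}"
        then have *: "ereal s \<le> ereal t" "0 \<le> s" by auto
        show "ereal s < \<zeta> w" by (rule le_less_trans[OF *(1) t(3)])
        show "0 \<le> s" by (rule *)
      qed
    qed (use t(5) in auto)
    then show "1 \<le> V T (S.Z T w)" using terminal[OF S.Z_closure[OF w(1), of T]] by simp
  qed
  moreover have "expectation (\<lambda>w. V T (S.Z T w)) \<le> V 0 x0 + C * T * prob S.announced"
    by (rule S.expectation_terminal_le[OF gen bd C])
  moreover have "reach_avoid_prob M X \<zeta> D Ds T = prob A"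
    by (simp only: reach_avoid_prob_def A_def)
  ultimately have "reach_avoid_prob M X \<zeta> D Ds T \<le> V 0 x0 + (C * T + 1) * prob S.announced"
    by (simp add: algebra_simps)
  moreover have "w \<in> space M \<and> \<theta> w < T \<and> (\<forall>s. 0 \<le> s \<longrightarrow> s < \<theta> w \<longrightarrow> X s w \<in> D - Ds)"
    if "w \<in> S.announced" for w
  proof -
    have a: "w \<in> space M" "S.\<rho> w = \<theta> w" "\<theta> w < T" using that unfolding S.announced_def by auto
    then show ?thesis using S.X_before_\<rho>[OF a(1)] by auto
  qed
  ultimately show ?thesis using S.announced_event by blast
qed

text \<open>If the lifetime is infinite, the announcing times pass \<open>T\<close>. If it is
  finite, the norm is unbounded near it, so the path is outside the bounded set at some earlier
  time, which the announcing times eventually pass.\<close>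

lemma announced_eventually_avoided:
  fixes x :: "real \<Rightarrow> 'b::real_normed_vector" and \<zeta> :: ereal and \<theta> :: "nat \<Rightarrow> real"
  assumes \<theta>: "(\<lambda>k. ereal (\<theta> k)) \<longlonglongrightarrow> \<zeta>" and \<zeta>: "0 < \<zeta>"
    and explode: "\<zeta> < \<infinity> \<longrightarrow> Limsup (at_left (real_of_ereal \<zeta>)) (\<lambda>t. ereal (norm (x t))) = \<infinity>"
    and U: "bounded U"
  shows "\<forall>\<^sub>F k in sequentially. \<not> (\<theta> k < T \<and> (\<forall>s. 0 \<le> s \<longrightarrow> s < \<theta> k \<longrightarrow> x s \<in> U))"
proof (cases "\<zeta> = \<infinity>")
  case True
  then have "\<forall>\<^sub>F k in sequentially. ereal T < ereal (\<theta> k)"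
    using order_tendstoD(1)[OF \<theta>, of "ereal T"] by simp
  then show ?thesis by eventually_elim auto
next
  case False
  then obtain z where z: "\<zeta> = ereal z" "0 < z" using \<zeta> by (cases \<zeta>) auto
  have "\<exists>s. 0 \<le> s \<and> s < z \<and> x s \<notin> U"
  proof (rule ccontr)
    assume H: "\<not> ?thesis"
    obtain R where R: "\<forall>y\<in>U. norm y \<le> R" using U unfolding bounded_iff by blast
    have "\<forall>\<^sub>F t in at_left z. ereal (norm (x t)) \<le> ereal R"
      unfolding eventually_at_left[OF z(2)]
    proof (intro exI[of _ 0] conjI allI impI z(2))
      fix t assume "0 < t" "t < z"
      then have "x t \<in> U" using H by auto
      then show "ereal (norm (x t)) \<le> ereal R" using R by simp
    qed
    then have "Limsup (at_left z) (\<lambda>t. ereal (norm (x t))) \<le> ereal R"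
      by (rule Limsup_bounded)
    then show False using explode z by simp
  qed
  then obtain s where s: "0 \<le> s" "s < z" "x s \<notin> U" by blast
  then have "\<forall>\<^sub>F k in sequentially. ereal s < ereal (\<theta> k)"
    using order_tendstoD(1)[OF \<theta>, of "ereal s"] z by simp
  then show ?thesis by eventually_elim (use s in auto)
qed

section \<open>Reduction to \<alpha> = \<beta> = 0, and the limit along the announcing times\<close>

definition discounted_time :: "real \<Rightarrow> real \<Rightarrow> real" where
  "discounted_time \<alpha> s = (if \<alpha> = 0 then s else (exp (\<alpha> * s) - 1) / \<alpha>)"

lemma discounted_time_derivative:
  "(discounted_time \<alpha> has_real_derivative exp (\<alpha> * s)) (at s within A)"
proof (cases "\<alpha> = 0")
  case False
  then show ?thesis unfolding discounted_time_def[abs_def]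
    by (auto intro!: derivative_eq_intros simp: field_simps)
qed (auto simp: discounted_time_def[abs_def] intro!: derivative_eq_intros)

text \<open>The time derivative of \<open>discounted_time \<alpha> (T - t)\<close> is minus the
  discount factor. So this factor comes out of the whole time derivative, whose sign is then that of
  vt - \<alpha> v - \<beta>.\<close>

lemma C12_on_discount:
  fixes v :: "real \<Rightarrow> real ^ 'n \<Rightarrow> real"
  assumes C: "C12_on T v vt vx vxx"
  shows "C12_on T (\<lambda>t x. exp (\<alpha> * (T - t)) * v t x + \<beta> * discounted_time \<alpha> (T - t))
    (\<lambda>t x. exp (\<alpha> * (T - t)) * (vt t x - \<alpha> * v t x - \<beta>))
    (\<lambda>t x. exp (\<alpha> * (T - t)) *\<^sub>R vx t x) (\<lambda>t x. exp (\<alpha> * (T - t)) *\<^sub>R vxx t x)"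
proof -
  have cont: "continuous_on ({0..T} \<times> UNIV) (\<lambda>p. v (fst p) (snd p))"
    "continuous_on ({0..T} \<times> UNIV) (\<lambda>p. vt (fst p) (snd p))"
    "continuous_on ({0..T} \<times> UNIV) (\<lambda>p. vx (fst p) (snd p))"
    "continuous_on ({0..T} \<times> UNIV) (\<lambda>p. vxx (fst p) (snd p))"
    using C by (auto simp: C12_on_def split_beta')
  have dt: "continuous_on UNIV (discounted_time \<alpha>)"
    by (rule DERIV_continuous_on[OF discounted_time_derivative])
  show ?thesis unfolding C12_on_def split_beta'
  proof (intro conjI ballI allI)
    fix t x assume t: "t \<in> {0..T}"
    have d: "((\<lambda>s. v s x) has_real_derivative vt t x) (at t within {0..T})"
      "(v t has_derivative (\<lambda>h. vx t x \<bullet> h)) (at x)"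
      "(vx t has_derivative (\<lambda>h. vxx t x *v h)) (at x)"
      using C t by (auto simp: C12_on_def)
    have dd: "((\<lambda>s. discounted_time \<alpha> (T - s)) has_real_derivative - exp (\<alpha> * (T - t))) (at t within {0..T})"
    proof -
      have "((\<lambda>s. T - s) has_real_derivative - 1) (at t within {0..T})"
        by (auto intro!: derivative_eq_intros)
      from DERIV_chain'[OF this discounted_time_derivative] show ?thesis by simp
    qed
    show "((\<lambda>s. exp (\<alpha> * (T - s)) * v s x + \<beta> * discounted_time \<alpha> (T - s)) has_real_derivative
        exp (\<alpha> * (T - t)) * (vt t x - \<alpha> * v t x - \<beta>)) (at t within {0..T})"
      by (rule derivative_eq_intros d(1) dd refl)+ (simp add: algebra_simps)
    show "((\<lambda>x. exp (\<alpha> * (T - t)) * v t x + \<beta> * discounted_time \<alpha> (T - t)) has_derivative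
        (\<lambda>h. (exp (\<alpha> * (T - t)) *\<^sub>R vx t x) \<bullet> h)) (at x)"
      using has_derivative_add[OF has_derivative_mult_right[OF d(2)] has_derivative_const,
          of "exp (\<alpha> * (T - t))" "\<beta> * discounted_time \<alpha> (T - t)"] by simp
    show "((\<lambda>x. exp (\<alpha> * (T - t)) *\<^sub>R vx t x) has_derivative
        (\<lambda>h. (exp (\<alpha> * (T - t)) *\<^sub>R vxx t x) *v h)) (at x)"
      using has_derivative_scaleR_right[OF d(3), of "exp (\<alpha> * (T - t))"]
      by (simp add: scaleR_matrix_vector_assoc)
  qed (intro continuous_intros cont continuous_on_compose2[OF dt]; simp)+
qed

text \<open>The added term depends on time only, and the spatial derivatives carry the same positive
  factor as the time derivative. Hence the hypothesis on \<open>v\<close> becomes a sign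
  condition.\<close>

lemma generator_discount:
  fixes \<sigma> :: "real ^ 'n \<Rightarrow> real ^ 'k ^ 'n"
  shows "generator b \<sigma> (\<lambda>t x. exp (\<alpha> * (T - t)) * (vt t x - \<alpha> * v t x - \<beta>))
    (\<lambda>t x. exp (\<alpha> * (T - t)) *\<^sub>R vx t x) (\<lambda>t x. exp (\<alpha> * (T - t)) *\<^sub>R vxx t x) t x =
    exp (\<alpha> * (T - t)) * (generator b \<sigma> vt vx vxx t x - \<alpha> * v t x - \<beta>)"
  unfolding generator_def trace_conjugate_eq_inner scalar_matrix_assoc[symmetric]
  by (simp add: algebra_simps)

text \<open>The exit happens through the boundary of the difference set; this places it where the
  boundary hypothesis applies.\<close>

lemma frontier_Diff_subset: "frontier (D - S) \<subseteq> frontier D \<union> frontier S"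
  unfolding Diff_eq using frontier_Int_subset[of D "- S"] by (simp add: frontier_complement)

theorem theorem1:
  fixes M :: "'a measure"
    and W :: "real \<Rightarrow> 'a \<Rightarrow> real ^ 'k"
    and b :: "real ^ 'n \<Rightarrow> real ^ 'n"
    and \<sigma> :: "real ^ 'n \<Rightarrow> real ^ 'k ^ 'n"
    and X :: "real ^ 'n \<Rightarrow> real \<Rightarrow> 'a \<Rightarrow> real ^ 'n"
    and \<zeta> :: "real ^ 'n \<Rightarrow> 'a \<Rightarrow> ereal"
    and D D\<^sub>s :: "(real ^ 'n) set"
    and T \<alpha> \<beta> :: real
    and v vt :: "real \<Rightarrow> real ^ 'n \<Rightarrow> real"
    and vx :: "real \<Rightarrow> real ^ 'n \<Rightarrow> real ^ 'n"
    and vxx :: "real \<Rightarrow> real ^ 'n \<Rightarrow> real ^ 'n ^ 'n"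
  assumes "local_lipschitz (UNIV :: real set) UNIV (\<lambda>_. b)"
    and "local_lipschitz (UNIV :: real set) UNIV (\<lambda>_. \<sigma>)"
    and "wiener_process M W"
    and "\<And>x\<^sub>0. maximal_local_strong_solution M W b \<sigma> x\<^sub>0 (X x\<^sub>0) (\<zeta> x\<^sub>0)"
    and "open D" and "bounded D"
    and "closed D\<^sub>s" and "D\<^sub>s \<subseteq> D"
    and "0 < T"
    and "C12_on T v vt vx vxx"
    and "\<And>x t. x \<in> D - D\<^sub>s \<Longrightarrow> t \<in> {0..T} \<Longrightarrow> generator b \<sigma> vt vx vxx t x \<le> \<alpha> * v t x + \<beta>"
    and "\<And>x t. x \<in> frontier D \<union> frontier D\<^sub>s \<Longrightarrow> t \<in> {0..T} \<Longrightarrow> vt t x \<le> \<alpha> * v t x + \<beta>"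
    and "\<And>x. x \<in> closure (D - D\<^sub>s) \<Longrightarrow> indicator (frontier D\<^sub>s) x \<le> v T x"
  shows "\<forall>x\<^sub>0 \<in> D - D\<^sub>s. reach_avoid_prob M (X x\<^sub>0) (\<zeta> x\<^sub>0) D D\<^sub>s T \<le>
           (if \<alpha> = 0 then v 0 x\<^sub>0 + \<beta> * T
            else exp (\<alpha> * T) * v 0 x\<^sub>0 + \<beta> / \<alpha> * (exp (\<alpha> * T) - 1))"
proof
  interpret brownian M W by standard (rule assms(3))
  fix x\<^sub>0 assume x0: "x\<^sub>0 \<in> D - D\<^sub>s"
  let ?U = "D - D\<^sub>s"
  let ?d = "\<lambda>t. exp (\<alpha> * (T - t))"
  define V where "V t x = ?d t * v t x + \<beta> * discounted_time \<alpha> (T - t)" for t x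
  define Vt where "Vt t x = ?d t * (vt t x - \<alpha> * v t x - \<beta>)" for t x
  define Vx where "Vx t x = ?d t *\<^sub>R vx t x" for t x
  define Vxx where "Vxx t x = ?d t *\<^sub>R vxx t x" for t x
  have C12: "C12_on T V Vt Vx Vxx"
    unfolding V_def[abs_def] Vt_def[abs_def] Vx_def[abs_def] Vxx_def[abs_def] by (rule C12_on_discount[OF assms(10)])
  have gen: "generator b \<sigma> Vt Vx Vxx t x \<le> 0" if "t \<in> {0..T}" "x \<in> ?U" for t x
    unfolding Vt_def[abs_def] Vx_def[abs_def] Vxx_def[abs_def] generator_discount
    using assms(11)[OF that(2,1)] by (simp add: mult_le_0_iff)
  have bd: "Vt t x \<le> 0" if "t \<in> {0..T}" "x \<in> frontier ?U" for t x
    using assms(12)[of x t] that frontier_Diff_subset[of D D\<^sub>s] by (auto simp: Vt_def mult_le_0_iff)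
  have terminal: "indicator (frontier D\<^sub>s) x \<le> V T x" if "x \<in> closure ?U" for x
    using assms(13)[OF that] by (simp add: V_def discounted_time_def)
  have cU: "compact (closure ?U)"
    using assms(6) by (auto simp: compact_eq_bounded_closed intro: bounded_closure bounded_subset[of D])
  \<comment> \<open>A bound for the time derivative on the closure of the difference set. It limits
    the drift of paths stopped inside and multiplies only the probability of those paths, so its
    size is immaterial in the limit.\<close>
  have "compact ((\<lambda>(t, x). Vt t x) ` ({0..T} \<times> closure ?U))"
    using C12 by (intro compact_continuous_image compact_Times cU) (auto simp: C12_on_def intro: continuous_on_subset)
  from compact_imp_bounded[OF this]
  obtain C where C: "0 < C" "\<forall>y\<in>(\<lambda>(t, x). Vt t x) ` ({0..T} \<times> closure ?U). norm y \<le> C"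
    unfolding bounded_pos by (elim exE conjE) (rule that)
  have VC: "Vt t x \<le> C" if "t \<in> {0..T}" "x \<in> closure ?U" for t x
  proof -
    have "norm (Vt t x) \<le> C" using C(2) that by auto
    then show ?thesis by simp
  qed
  have b_cont: "continuous_on UNIV b" and \<sigma>_cont: "continuous_on UNIV \<sigma>"
    using local_lipschitz_continuous_on[OF assms(1), of 0] local_lipschitz_continuous_on[OF assms(2), of 0] by auto
  note maximal = assms(4)[of x\<^sub>0, unfolded maximal_local_strong_solution_def]
  note explode = maximal[THEN conjunct2]
  note sol = maximal[THEN conjunct1, unfolded local_strong_solution_def]
  note paths = sol[THEN conjunct1] and adapted = sol[THEN conjunct2, THEN conjunct1, rule_format]
  have \<zeta>: "0 < \<zeta> x\<^sub>0 w" and path: "continuous_on {t. 0 \<le> t \<and> ereal t < \<zeta> x\<^sub>0 w} (\<lambda>t. X x\<^sub>0 t w)" if "w \<in> space M" for w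
    using bspec[OF paths that] by (rule conjunct1, rule conjunct2)
  from sol[THEN conjunct2, THEN conjunct2]
  obtain \<theta> :: "nat \<Rightarrow> 'a \<Rightarrow> real" where stop: "\<forall>k. stopping_time F (\<theta> k)"
    and announce: "\<forall>w\<in>space M. incseq (\<lambda>k. \<theta> k w) \<and> (\<forall>k. 0 \<le> \<theta> k w \<and> ereal (\<theta> k w) < \<zeta> x\<^sub>0 w) \<and>
      (\<lambda>k. ereal (\<theta> k w)) \<longlonglongrightarrow> \<zeta> x\<^sub>0 w"
    and ex_I: "\<forall>k. \<exists>I. has_ito_integral M F W (\<lambda>s w. if s \<le> \<theta> k w then \<sigma> (X x\<^sub>0 s w) else 0) I \<and>
      (AE w in M. \<forall>t\<ge>0. X x\<^sub>0 (min t (\<theta> k w)) w =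
        x\<^sub>0 + integral {0..min t (\<theta> k w)} (\<lambda>s. b (X x\<^sub>0 s w)) + I t w)"
    by (elim exE conjE) (rule that)
  have \<theta>: "0 \<le> \<theta> k w \<and> ereal (\<theta> k w) < \<zeta> x\<^sub>0 w" if "w \<in> space M" for k w
    using bspec[OF announce that] by (elim conjE) (erule spec)
  have \<theta>_lim: "(\<lambda>k. ereal (\<theta> k w)) \<longlonglongrightarrow> \<zeta> x\<^sub>0 w" if "w \<in> space M" for w
    using bspec[OF announce that] by (elim conjE)
  have "\<exists>A\<in>events. reach_avoid_prob M (X x\<^sub>0) (\<zeta> x\<^sub>0) D D\<^sub>s T \<le> V 0 x\<^sub>0 + (C * T + 1) * prob A \<and>
    (\<forall>w\<in>A. w \<in> space M \<and> \<theta> k w < T \<and> (\<forall>s. 0 \<le> s \<longrightarrow> s < \<theta> k w \<longrightarrow> X x\<^sub>0 s w \<in> ?U))" for k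
  proof -
    obtain I where "has_ito_integral M F W (\<lambda>s w. if s \<le> \<theta> k w then \<sigma> (X x\<^sub>0 s w) else 0) I"
      "AE w in M. \<forall>t\<ge>0. X x\<^sub>0 (min t (\<theta> k w)) w =
        x\<^sub>0 + integral {0..min t (\<theta> k w)} (\<lambda>s. b (X x\<^sub>0 s w)) + I t w"
      using spec[OF ex_I, of k] by (elim exE conjE) (rule that)
    from local_solution_reach_bound[OF path adapted spec[OF stop] \<theta> this b_cont \<sigma>_cont assms(5,6,7) x0 assms(9) C12
        gen bd terminal less_imp_le[OF C(1)] VC]
    show ?thesis .
  qed
  then obtain A where A: "\<And>k. A k \<in> events"
    "\<And>k. reach_avoid_prob M (X x\<^sub>0) (\<zeta> x\<^sub>0) D D\<^sub>s T \<le> V 0 x\<^sub>0 + (C * T + 1) * prob (A k)"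
    "\<And>k w. w \<in> A k \<Longrightarrow> \<theta> k w < T \<and> (\<forall>s. 0 \<le> s \<longrightarrow> s < \<theta> k w \<longrightarrow> X x\<^sub>0 s w \<in> ?U)"
    by metis
  \<comment> \<open>By maximality almost every path belongs to only finitely many of the
    \<open>A k\<close>; dominated convergence does the rest.\<close>
  have "(\<lambda>k. prob (A k)) \<longlonglongrightarrow> 0"
  proof (rule prob_tendsto_0[OF A(1)])
    show "AE w in M. \<forall>\<^sub>F k in sequentially. w \<notin> A k"
      using explode AE_space
    proof eventually_elim
      case (elim w)
      have "bounded ?U" using assms(6) by (rule bounded_subset) auto
      from announced_eventually_avoided[OF \<theta>_lim[OF elim(2)] \<zeta>[OF elim(2)] elim(1) this]
      show ?case by (rule eventually_mono) (use A(3) in blast)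
    qed
  qed
  from tendsto_add[OF tendsto_const tendsto_mult_left[OF this]]
  have "(\<lambda>k. V 0 x\<^sub>0 + (C * T + 1) * prob (A k)) \<longlonglongrightarrow> V 0 x\<^sub>0 + (C * T + 1) * 0" .
  then have "reach_avoid_prob M (X x\<^sub>0) (\<zeta> x\<^sub>0) D D\<^sub>s T \<le> V 0 x\<^sub>0 + (C * T + 1) * 0"
    by (rule LIMSEQ_le_const) (use A(2) in blast)
  then show "reach_avoid_prob M (X x\<^sub>0) (\<zeta> x\<^sub>0) D D\<^sub>s T \<le>
      (if \<alpha> = 0 then v 0 x\<^sub>0 + \<beta> * T else exp (\<alpha> * T) * v 0 x\<^sub>0 + \<beta> / \<alpha> * (exp (\<alpha> * T) - 1))"
    by (simp add: V_def discounted_time_def split: if_splits)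
qed

end
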